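(* Let $(\beta,B)=(1,0)$, and let $(A_N)$ be a sequence of coupling matrices such that $\limsup_{N\to\infty}N^{1/4}\max_{1\le i\le N}|R_i-1|<\infty$ and $\limsup_{N\to\infty}\frac{\lambda_2(A_N)}{\lambda_1(A_N)}<1$. Let $\boldsymbol\sigma$ be drawn from the Ising model $\mathbb P$ with parameters $(A_N,1,0)$. Suppose further that the quantity $$\frac{\varepsilon_N}{\sqrt N}+\frac{\varepsilon_Nr_N}{N^{1/4}}+\frac{(\log N)^2}{N^{1/4}}\sqrt{\sum_{i=1}^N(R_i-1)^2+N^{-1/2}\Big[\sum_{i=1}^N(R_i-1)\Big]^2}$$ is bounded in $N$. Then the following conclusions hold: (a) $$\log\mathbb P\Big(\max_{1\le i\le N}|m_i(\boldsymbol\sigma)-\overline{\boldsymbol m}(\boldsymbol\sigma)|\ge\lambda\sqrt{\alpha_N(\log N)^3}+\log N\max_{1\le i\le N}|R_i-1|\Big)\lesssim-\lambda^2,\quad\text{for any }\lambda>0.$$ (b) $$\mathbb E\left[\sum_{i=1}^N(R_i-1)\sigma_i\right]^2\lesssim\Big(\sum_{i=1}^N(R_i-1)^2+N^{-1/2}\Big[\sum_{i=1}^N(R_i-1)\Big]^2\Big)(\log N)^4.$$ (c) $N^{3/2}\,\mathbb E(\overline{\boldsymbol\sigma}^6)\lesssim1$.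
   Context: A coupling matrix $A_N$ is a symmetric $N\times N$ matrix with non-negative entries and zeros on the diagonal. The Ising model with parameters $(A_N,\beta,B)$, $\beta>0$, $B\in\mathbb R$, is the probability mass function on $\boldsymbol\sigma=(\sigma_1,\dots,\sigma_N)\in\{-1,1\}^N$ given by $\mathbb P(\boldsymbol\sigma)=\frac1{Z_N(\beta,B)}\exp\big(\frac\beta2\boldsymbol\sigma^\top A_N\boldsymbol\sigma+B\sum_{i=1}^N\sigma_i\big)$, where $Z_N(\beta,B)$ is the normalizing constant; $\mathbb E$ is expectation under it. Put $\overline{\boldsymbol\sigma}=\frac1N\sum_{i=1}^N\sigma_i$, $m_i(\boldsymbol\sigma)=\sum_{j=1}^NA_N(i,j)\sigma_j$, $\overline{\boldsymbol m}(\boldsymbol\sigma)=\frac1N\sum_{i=1}^Nm_i(\boldsymbol\sigma)$, $R_i=\sum_{j=1}^NA_N(i,j)$, $\lambda_1(A_N)\ge\dots\ge\lambda_N(A_N)$ the eigenvalues, $\lVert\cdot\rVert_F$ the Frobenius norm. $\mathbb E[X]^2$ denotes the second moment $\mathbb E[X^2]$. Further, $$\alpha_N=\max_{1\le i\le N}\sum_{j=1}^NA_N(i,j)^2,\qquad r_N=\sqrt{(\log N)^3\alpha_N}+\log N\max_{1\le i\le N}|R_i-1|,$$ $$\varepsilon_N=\lVert A_N\rVert_F^2+\frac1N\Big[\sum_{i=1}^N(R_i-1)\Big]^2+\frac1N\sum_{i=1}^N(R_i-1)^2+\log N.$$ $x_N\lesssim y_N$ means there is a finite constant $C>0$ free of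 $N$ with $x_N\le Cy_N$; in particular $\log\mathbb P(\cdot)\lesssim-\lambda^2$ means $\log\mathbb P(\cdot)\le-C\lambda^2$ for such a constant $C>0$.
   Formalization: In (a) C is free of N and λ, but the bound is claimed, for each λ₀>0, for all λ≥λ₀ and all N large depending on λ₀ (for all N and λ>0 at once it fails, e.g. Curie–Weiss with tiny λ); (b) and (c) are claimed for N≥2, as (b) fails at N=1. *)

theory Defs
  imports "HOL-Probability.Probability" "Jordan_Normal_Form.Char_Poly"
begin

unbundle no inner_syntax and no vec_syntax

text \<open>Rows, columns and spins are indexed by \<open>{..<N}\<close>, where \<open>N\<close> is the dimension of the matrix;
  the index \<open>i\<close> here is the index \<open>i + 1\<close> of the usual notation.\<close>

definition coupling_matrix :: "nat \<Rightarrow> real mat \<Rightarrow> bool" where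
  "coupling_matrix N A \<longleftrightarrow> A \<in> carrier_mat N N \<and> A\<^sup>T = A \<and>
     (\<forall>i<N. \<forall>j<N. A $$ (i, j) \<ge> 0) \<and> (\<forall>i<N. A $$ (i, i) = 0)"


subsection \<open>The Ising model\<close>

definition spins :: "nat \<Rightarrow> real vec set" where
  "spins N = {\<sigma> \<in> carrier_vec N. \<forall>i<N. \<sigma> $ i \<in> {-1, 1}}"

definition ising_weight :: "real mat \<Rightarrow> real \<Rightarrow> real \<Rightarrow> real vec \<Rightarrow> real" where
  "ising_weight A \<beta> B \<sigma> =
     exp (\<beta> / 2 * (\<sigma> \<bullet> (A *\<^sub>v \<sigma>)) + B * (\<Sum>i<dim_row A. \<sigma> $ i))"

definition ising_Z :: "real mat \<Rightarrow> real \<Rightarrow> real \<Rightarrow> real" where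
  "ising_Z A \<beta> B = (\<Sum>\<sigma>\<in>spins (dim_row A). ising_weight A \<beta> B \<sigma>)"

definition ising :: "real mat \<Rightarrow> real \<Rightarrow> real \<Rightarrow> real vec pmf" where
  "ising A \<beta> B = embed_pmf (\<lambda>\<sigma>.
     if \<sigma> \<in> spins (dim_row A) then ising_weight A \<beta> B \<sigma> / ising_Z A \<beta> B else 0)"

lemma finite_spins: "finite (spins N)"
proof -
  have "spins N \<subseteq> vec N ` ({..<N} \<rightarrow>\<^sub>E {-1, 1})"
  proof
    fix \<sigma> :: "real vec" assume s: "\<sigma> \<in> spins N"
    have "\<sigma> = vec N (restrict (\<lambda>i. \<sigma> $ i) {..<N})"
      using s by (intro eq_vecI) (auto simp: spins_def)
    moreover have "restrict (\<lambda>i. \<sigma> $ i) {..<N} \<in> {..<N} \<rightarrow>\<^sub>E {-1, 1}"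
      using s by (auto simp: spins_def)
    ultimately show "\<sigma> \<in> vec N ` ({..<N} \<rightarrow>\<^sub>E {-1, 1})" by blast
  qed
  then show ?thesis
    by (rule finite_subset) (intro finite_imageI finite_PiE; simp)
qed

lemma spins_nonempty: "spins N \<noteq> {}"
proof -
  have "vec N (\<lambda>_. 1) \<in> spins N" by (auto simp: spins_def)
  then show ?thesis by blast
qed

lemma ising_Z_pos: "ising_Z A \<beta> B > 0"
  unfolding ising_Z_def
  by (intro sum_pos finite_spins spins_nonempty) (simp add: ising_weight_def)

lemma pmf_ising:
  "pmf (ising A \<beta> B) \<sigma> =
     (if \<sigma> \<in> spins (dim_row A) then ising_weight A \<beta> B \<sigma> / ising_Z A \<beta> B else 0)"
proof -
  let ?S = "spins (dim_row A)"
  let ?f = "\<lambda>\<sigma>. if \<sigma> \<in> ?S then ising_weight A \<beta> B \<sigma> / ising_Z A \<beta> B else 0"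
  have nn: "0 \<le> ?f x" for x
    using ising_Z_pos[of A \<beta> B] by (simp add: ising_weight_def)
  have "(\<integral>\<^sup>+x. ennreal (?f x) \<partial>count_space UNIV) = (\<Sum>x\<in>?S. ennreal (?f x))"
    by (rule nn_integral_count_space') (auto simp: finite_spins)
  also have "\<dots> = ennreal (\<Sum>x\<in>?S. ?f x)"
    by (rule sum_ennreal) (rule nn)
  also have "(\<Sum>x\<in>?S. ?f x) = (\<Sum>x\<in>?S. ising_weight A \<beta> B x / ising_Z A \<beta> B)"
    by (rule sum.cong) simp_all
  also have "\<dots> = ising_Z A \<beta> B / ising_Z A \<beta> B"
    unfolding sum_divide_distrib[symmetric] by (simp only: ising_Z_def)
  also have "\<dots> = 1"
    using ising_Z_pos[of A \<beta> B] by simp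
  finally show ?thesis
    unfolding ising_def by (subst pmf_embed_pmf) (use nn in simp_all)
qed


subsection \<open>Statistics of a configuration\<close>

definition spin_mean :: "nat \<Rightarrow> real vec \<Rightarrow> real" where
  "spin_mean N \<sigma> = (\<Sum>i<N. \<sigma> $ i) / real N"

definition local_field :: "real mat \<Rightarrow> real vec \<Rightarrow> nat \<Rightarrow> real" where
  "local_field A \<sigma> i = (\<Sum>j<dim_row A. A $$ (i, j) * \<sigma> $ j)"

definition local_field_mean :: "real mat \<Rightarrow> real vec \<Rightarrow> real" where
  "local_field_mean A \<sigma> = (\<Sum>i<dim_row A. local_field A \<sigma> i) / real (dim_row A)"


subsection \<open>Quantities attached to a coupling matrix\<close>

definition row_total :: "real mat \<Rightarrow> nat \<Rightarrow> real" where
  "row_total A i = (\<Sum>j<dim_row A. A $$ (i, j))"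

definition max_row_dev :: "real mat \<Rightarrow> real" where
  "max_row_dev A = (MAX i\<in>{..<dim_row A}. \<bar>row_total A i - 1\<bar>)"

text \<open>The \<open>k\<close>-th largest eigenvalue (\<open>1 \<le> k \<le> dim_row A\<close>), counted with multiplicity. The
  characteristic polynomial of a real symmetric matrix splits over the reals, so for such
  matrices the list below has length \<open>dim_row A\<close>.\<close>

definition eigval_desc :: "real mat \<Rightarrow> nat \<Rightarrow> real" where
  "eigval_desc A k = rev (sorted_list_of_multiset (proots (char_poly A))) ! (k - 1)"

definition frobenius_norm :: "real mat \<Rightarrow> real" where
  "frobenius_norm A = sqrt (\<Sum>i<dim_row A. \<Sum>j<dim_col A. (A $$ (i, j))\<^sup>2)"

definition alpha :: "real mat \<Rightarrow> real" where
  "alpha A = (MAX i\<in>{..<dim_row A}. \<Sum>j<dim_row A. (A $$ (i, j))\<^sup>2)"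

definition r_rate :: "real mat \<Rightarrow> real" where
  "r_rate A = sqrt (ln (real (dim_row A)) ^ 3 * alpha A) + ln (real (dim_row A)) * max_row_dev A"

definition eps_rate :: "real mat \<Rightarrow> real" where
  "eps_rate A = (frobenius_norm A)\<^sup>2
     + (\<Sum>i<dim_row A. row_total A i - 1)\<^sup>2 / real (dim_row A)
     + (\<Sum>i<dim_row A. (row_total A i - 1)\<^sup>2) / real (dim_row A)
     + ln (real (dim_row A))"

definition row_irregularity :: "real mat \<Rightarrow> real" where
  "row_irregularity A = (\<Sum>i<dim_row A. (row_total A i - 1)\<^sup>2)
     + real (dim_row A) powr (-1/2) * (\<Sum>i<dim_row A. row_total A i - 1)\<^sup>2"


subsection \<open>Asymptotic notation\<close>

text \<open>The case \<open>N = 1\<close>, where the logarithm vanishes and there is no second eigenvalue, is left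
  out; all other \<open>N\<close> share the one constant.\<close>

definition lesssim :: "(nat \<Rightarrow> real) \<Rightarrow> (nat \<Rightarrow> real) \<Rightarrow> bool" (infix "\<lesssim>" 50) where
  "x \<lesssim> y \<longleftrightarrow> (\<exists>C>0. \<forall>N\<ge>2. x N \<le> C * y N)"

text \<open>Logarithm of a probability with \<open>log 0 = -\<infinity>\<close>; the library has \<open>ln 0 = 0\<close>.\<close>

definition elog :: "real \<Rightarrow> ereal" where
  "elog p = (if p \<le> 0 then - \<infinity> else ereal (ln p))"

text \<open>\<open>P N t\<close> is the probability of the deviation event with parameter \<open>t\<close>. The constant depends on
  neither \<open>N\<close> nor \<open>t\<close>, and the bound is uniform in \<open>t \<ge> t0\<close> for every \<open>t0 > 0\<close>, from some \<open>N\<close>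
  (depending on \<open>t0\<close>) on. One cannot ask for it at a fixed \<open>N\<close> and all \<open>t > 0\<close> at once: in the
  Curie-Weiss model, with off-diagonal couplings \<open>1 / (N - 1)\<close>, the local fields deviate from their
  mean by at least \<open>1 / (N - 1)\<close> unless all spins agree, so for \<open>t\<close> small depending on \<open>N\<close> the
  probability is exponentially close to \<open>1\<close>, and exceeds \<open>exp (- C * t\<^sup>2)\<close>.\<close>

definition log_tail_lesssim :: "(nat \<Rightarrow> real \<Rightarrow> real) \<Rightarrow> bool" where
  "log_tail_lesssim P \<longleftrightarrow>
     (\<exists>C>0. \<forall>t0>0. \<forall>\<^sub>F N in sequentially. \<forall>t\<ge>t0. elog (P N t) \<le> ereal (- C * t\<^sup>2))"

end

theory Submission
  imports Defs "HOL-Real_Asymp.Real_Asymp"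
begin

text \<open>
  The local fields satisfy \<open>m = a (tanh m) + an\<close>, where \<open>an\<close> is the image under \<open>a\<close> of the
  noise \<open>\<sigma> - tanh m\<close>, and linear forms of this noise are sub-Gaussian by the method of exchangeable
  pairs. Because of the spectral gap the fixed point map contracts modulo constants, so the fields
  deviate from their mean by at most a logarithm times the noise and the row deviations. Averaging
  the same equation gives \<open>\<Sum> (m - tanh m)\<close>, a cubic in the magnetization, as noise plus lower order
  terms; multiplied by the cube of the magnetization it bounds the sixth moment by terms which the
  hypotheses make negligible. Ferromagnetic correlation inequalities control what linear arguments
  cannot: by the Simon-Lieb bound, the second moment of a non-negative linear form is governed by its
  Euclidean norm and the variance of the magnetization, and by GHS it is also sub-Gaussian with that
  variance. Small deviations are treated by linearizing the fixed point equation around the mean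
  field, unless some row is so heavy that already the local fields themselves are small enough.
\<close>

subsection \<open>Inner products and the spectral gap of a coupling matrix\<close>

text \<open>The hypothesis bounds \<open>\<lambda>_2\<close> only, so eigenvalues near -1 may occur
  and the fixed point map by itself need not contract. Even the averaged map contracts in the
  Euclidean norm alone: passing to the supremum norm costs \<open>ln N\<close>, and a maximum of
  \<open>N\<close> sub-Gaussian noises costs \<open>sqrt (ln N)\<close>. Together these are exactly
  the threshold \<open>sqrt (\<alpha> * ln N ^ 3)\<close>, which leaves room for large deviation
  parameters but none for small ones. In the linearized equation the noise enters with Euclidean
  norm of order \<open>sqrt \<alpha>\<close> and without a logarithm; the linearization fails with
  probability of order at most \<open>ln N ^ 4 / sqrt N\<close> if \<open>\<alpha>\<close> is below
  \<open>1 / sqrt N\<close>, and above that value the magnetization adds at most order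
  \<open>\<alpha>\<close> to the variance of a field. The scale \<open>N^(1/4)\<close> is that of
  the magnetization at the critical temperature, where the linear restoring force vanishes.
  Conclusions (b) and (c) depend on each other: the form of the row deviations is bounded through
  the variance of the magnetization, and conversely. The circle closes because the former bound has
  fourth order in the magnetization and is absorbed by the sixth moment.\<close>

definition ip :: "nat \<Rightarrow> (nat \<Rightarrow> real) \<Rightarrow> (nat \<Rightarrow> real) \<Rightarrow> real" where
  "ip n x y = (\<Sum>i<n. x i * y i)"

definition mv :: "nat \<Rightarrow> (nat \<Rightarrow> nat \<Rightarrow> real) \<Rightarrow> (nat \<Rightarrow> real) \<Rightarrow> nat \<Rightarrow> real" where
  "mv n a x i = (\<Sum>j<n. a i j * x j)"

definition nrm :: "nat \<Rightarrow> (nat \<Rightarrow> real) \<Rightarrow> real" where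
  "nrm n x = sqrt (ip n x x)"

lemma ip_commute: "ip n x y = ip n y x"
  by (simp add: ip_def mult.commute)

lemma ip_add_left: "ip n (\<lambda>i. x i + y i) z = ip n x z + ip n y z"
  by (simp add: ip_def sum.distrib algebra_simps)

lemma ip_add_right: "ip n z (\<lambda>i. x i + y i) = ip n z x + ip n z y"
  by (simp add: ip_def sum.distrib algebra_simps)

lemma ip_diff_left: "ip n (\<lambda>i. x i - y i) z = ip n x z - ip n y z"
  by (simp add: ip_def sum_subtractf algebra_simps)

lemma ip_diff_right: "ip n z (\<lambda>i. x i - y i) = ip n z x - ip n z y"
  by (simp add: ip_def sum_subtractf algebra_simps)

lemma ip_scale_left: "ip n (\<lambda>i. c * x i) z = c * ip n x z"
  by (simp add: ip_def sum_distrib_left algebra_simps)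

lemma ip_scale_right: "ip n z (\<lambda>i. c * x i) = c * ip n z x"
  by (simp add: ip_def sum_distrib_left algebra_simps)

lemma ip_uminus_left: "ip n (\<lambda>i. - x i) z = - ip n x z"
  by (simp add: ip_def sum_negf)

lemma ip_uminus_right: "ip n z (\<lambda>i. - x i) = - ip n z x"
  by (simp add: ip_def sum_negf)

lemmas ip_linear = ip_add_left ip_add_right ip_diff_left ip_diff_right ip_scale_left ip_scale_right
  ip_uminus_left ip_uminus_right

lemma ip_nonneg: "0 \<le> ip n x x"
  by (simp add: ip_def sum_nonneg)

lemma ip_zero_iff: "ip n x x = 0 \<longleftrightarrow> (\<forall>i<n. x i = 0)"
  unfolding ip_def by (subst sum_nonneg_eq_0_iff) auto

lemma ip_cong: "(\<And>i. i < n \<Longrightarrow> x i = x' i) \<Longrightarrow> (\<And>i. i < n \<Longrightarrow> y i = y' i) \<Longrightarrow> ip n x y = ip n x' y'"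
  unfolding ip_def by (rule sum.cong) auto

lemma mv_cong: "(\<And>i. i < n \<Longrightarrow> x i = y i) \<Longrightarrow> mv n a x i = mv n a y i"
  unfolding mv_def by (rule sum.cong) auto

lemma mv_add: "mv n a (\<lambda>i. x i + y i) = (\<lambda>i. mv n a x i + mv n a y i)"
  by (rule ext) (simp add: mv_def sum.distrib algebra_simps)

lemma mv_diff: "mv n a (\<lambda>i. x i - y i) = (\<lambda>i. mv n a x i - mv n a y i)"
  by (rule ext) (simp add: mv_def sum_subtractf algebra_simps)

lemma mv_scale: "mv n a (\<lambda>i. c * x i) = (\<lambda>i. c * mv n a x i)"
  by (rule ext) (simp add: mv_def sum_distrib_left algebra_simps)

lemma ip_mv_sym:
  assumes "\<And>i j. i < n \<Longrightarrow> j < n \<Longrightarrow> a i j = a j i"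
  shows "ip n x (mv n a y) = ip n (mv n a x) y"
proof -
  have "ip n x (mv n a y) = (\<Sum>i<n. \<Sum>j<n. x i * (a i j * y j))"
    by (simp add: ip_def mv_def sum_distrib_left)
  also have "\<dots> = (\<Sum>j<n. \<Sum>i<n. x i * (a i j * y j))"
    by (rule sum.swap)
  also have "\<dots> = (\<Sum>j<n. \<Sum>i<n. a j i * x i * y j)"
    by (intro sum.cong refl) (use assms in auto)
  also have "\<dots> = ip n (mv n a x) y"
    by (simp add: ip_def mv_def sum_distrib_right)
  finally show ?thesis .
qed

lemma nrm_nonneg: "0 \<le> nrm n x"
  by (simp add: nrm_def ip_nonneg)

lemma nrm_sq: "(nrm n x)\<^sup>2 = ip n x x"
  by (simp add: nrm_def ip_nonneg)

lemma nrm_eq_L2: "nrm n x = L2_set x {..<n}"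
  by (simp add: nrm_def ip_def L2_set_def power2_eq_square)

lemma nrm_triangle: "nrm n (\<lambda>i. x i + y i) \<le> nrm n x + nrm n y"
  unfolding nrm_eq_L2 by (rule L2_set_triangle_ineq)

lemma nrm_scale: "nrm n (\<lambda>i. c * x i) = \<bar>c\<bar> * nrm n x"
  by (simp add: nrm_def ip_linear real_sqrt_mult real_sqrt_abs2 flip: mult.assoc)

lemma nrm_triangle_diff: "nrm n (\<lambda>i. x i - y i) \<le> nrm n x + nrm n y"
  using nrm_triangle[of n x "\<lambda>i. - y i"] by (simp add: nrm_def ip_linear)

lemma Cauchy_Schwarz_ip: "\<bar>ip n x y\<bar> \<le> nrm n x * nrm n y"
proof -
  have "\<bar>ip n x y\<bar> \<le> (\<Sum>i<n. \<bar>x i\<bar> * \<bar>y i\<bar>)"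
    unfolding ip_def by (rule order_trans[OF sum_abs]) (simp add: abs_mult)
  also have "\<dots> \<le> nrm n x * nrm n y"
    unfolding nrm_eq_L2 by (rule L2_set_mult_ineq)
  finally show ?thesis .
qed

lemma nrm_cong: "(\<And>i. i < n \<Longrightarrow> x i = y i) \<Longrightarrow> nrm n x = nrm n y"
  unfolding nrm_def by (metis ip_cong)

text \<open>Vectors are functions on all of \<open>nat\<close>. Pinning the coordinates from
  \<open>n\<close> on makes the box a product of compact sets, so that Tychonoff's theorem
  applies.\<close>

lemma compact_box:
  fixes n :: nat
  shows "compact {x :: nat \<Rightarrow> real. (\<forall>i<n. \<bar>x i\<bar> \<le> 1) \<and> (\<forall>i\<ge>n. x i = 0)}" (is "compact ?K")
proof -
  have eq: "?K = PiE UNIV (\<lambda>i. if i < n then {-1..1} else {0})"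
    by (auto simp: PiE_def Pi_def abs_le_iff minus_le_iff not_less)
  have "compactin (product_topology (\<lambda>i::nat. euclideanreal) UNIV) (PiE UNIV (\<lambda>i. if i < n then {-1..1} else {0}))"
    by (subst compactin_PiE) auto
  then show ?thesis
    unfolding eq by (simp add: euclidean_product_topology)
qed

lemma continuous_coord: "continuous_on S (\<lambda>x::nat \<Rightarrow> real. x i)"
  using continuous_on_product_coordinates[of i] continuous_on_subset by blast

lemma continuous_ip: "continuous_on S (\<lambda>x. ip n y x)" "continuous_on S (\<lambda>x. ip n x x)"
  "continuous_on S (\<lambda>x. ip n x (mv n a x))"
  unfolding ip_def mv_def by (intro continuous_intros continuous_coord)+

text \<open>The \<open>k < n\<close> vectors are the first rows of a square matrix whose other rows
  are zero. It is singular, and a kernel vector is orthogonal to all of them.\<close>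

lemma exists_orthogonal:
  assumes "k < n"
  obtains x :: "nat \<Rightarrow> real" where "ip n x x \<noteq> 0" "\<And>j. j < k \<Longrightarrow> ip n (e j) x = 0"
proof -
  define M where "M = mat n n (\<lambda>(i, j). if i < k then e i j else 0)"
  have M: "M \<in> carrier_mat n n" by (simp add: M_def)
  have "det M\<^sup>T = 0"
  proof -
    have "M\<^sup>T *\<^sub>v unit_vec n k = 0\<^sub>v n"
      using assms by (auto simp: M_def scalar_prod_def intro!: eq_vecI sum.neutral)
    then show ?thesis
      using det_0_iff_vec_prod_zero[of "M\<^sup>T" n] M assms
      by (metis transpose_carrier_mat unit_vec_carrier unit_vec_nonzero)
  qed
  then have "det M = 0"
    using det_transpose[OF M] by simp
  then obtain v where v: "v \<in> carrier_vec n" "v \<noteq> 0\<^sub>v n" "M *\<^sub>v v = 0\<^sub>v n"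
    using det_0_iff_vec_prod_zero[OF M] by blast
  have "ip n (e j) (\<lambda>i. v $ i) = 0" if "j < k" for j
  proof -
    have "(M *\<^sub>v v) $ j = 0" using v(3) that assms by simp
    then show ?thesis
      using that assms v(1) by (simp add: M_def scalar_prod_def ip_def atLeast0LessThan)
  qed
  moreover have "ip n (\<lambda>i. v $ i) (\<lambda>i. v $ i) \<noteq> 0"
    unfolding ip_zero_iff using v(1,2) by (metis carrier_vecD eq_vecI index_zero_vec(1) index_zero_vec(2))
  ultimately show thesis using that by blast
qed

text \<open>The Rayleigh quotient is maximised over the unit vectors orthogonal to the eigenvectors
  already found. This subspace is invariant, so the residual \<open>r\<close> of the maximiser lies
  in it; criticality makes \<open>r\<close> orthogonal to itself.\<close>

lemma max_eigenvector:
  assumes sym: "\<And>i j. i < n \<Longrightarrow> j < n \<Longrightarrow> a i j = a j i"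
    and eig: "\<And>j i. j < k \<Longrightarrow> i < n \<Longrightarrow> mv n a (e j) i = l j * e j i"
    and "k < n"
  obtains v \<mu> where "ip n v v = 1" "\<And>j. j < k \<Longrightarrow> ip n (e j) v = 0"
    "\<And>i. i < n \<Longrightarrow> mv n a v i = \<mu> * v i"
    "\<And>x. (\<And>j. j < k \<Longrightarrow> ip n (e j) x = 0) \<Longrightarrow> ip n x (mv n a x) \<le> \<mu> * ip n x x"
proof -
  define W where "W = {x. \<forall>j<k. ip n (e j) x = 0}"
  define K where "K = {x::nat \<Rightarrow> real. (\<forall>i<n. \<bar>x i\<bar> \<le> 1) \<and> (\<forall>i\<ge>n. x i = 0)} \<inter> ({x. ip n x x = 1} \<inter> W)"
  have clos: "closed ({x. ip n x x = 1} \<inter> W)"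
  proof -
    have "closed {x. ip n x x = 1}"
      by (intro closed_Collect_eq continuous_ip continuous_on_const)
    moreover have "W = (\<Inter>j\<in>{..<k}. {x. ip n (e j) x = 0})"
      by (auto simp: W_def)
    moreover have "closed (\<Inter>j\<in>{..<k}. {x. ip n (e j) x = 0})"
      by (intro closed_INT ballI closed_Collect_eq continuous_ip continuous_on_const)
    ultimately show ?thesis by auto
  qed
  have "compact K"
    unfolding K_def by (rule compact_Int_closed[OF compact_box clos])
  have norm_in_K: "\<exists>y\<in>K. \<forall>i<n. x i = sqrt (ip n x x) * y i" if x: "x \<in> W" "ip n x x \<noteq> 0" for x
  proof -
    define r where "r = sqrt (ip n x x)"
    have r: "r > 0" "r\<^sup>2 = ip n x x" using x(2) ip_nonneg[of n x] by (auto simp: r_def)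
    define y where "y = (\<lambda>i. if i < n then x i / r else 0)"
    have ipy: "ip n z y = ip n z x / r" for z
      by (simp add: ip_def y_def sum_divide_distrib)
    have yy: "ip n y y = 1"
      using ipy[of y] ipy[of x] r x(2) by (simp add: ip_commute power2_eq_square)
    have "\<bar>y i\<bar> \<le> 1" if "i < n" for i
    proof -
      have "y i * y i \<le> ip n y y"
        unfolding ip_def using that by (intro member_le_sum) auto
      then show ?thesis using yy by (metis abs_square_le_1 power2_eq_square)
    qed
    then have "y \<in> K"
      using yy x(1) by (auto simp: K_def W_def ipy) (auto simp: y_def)
    moreover have "\<forall>i<n. x i = sqrt (ip n x x) * y i"
      using r by (auto simp: y_def r_def)
    ultimately show ?thesis by blast
  qed
  obtain x0 where "ip n x0 x0 \<noteq> 0" "x0 \<in> W"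
    using exists_orthogonal[OF \<open>k < n\<close>, of e] unfolding W_def by auto
  then have "K \<noteq> {}" using norm_in_K by blast
  then obtain v where v: "v \<in> K" "\<And>y. y \<in> K \<Longrightarrow> ip n y (mv n a y) \<le> ip n v (mv n a v)"
    using continuous_attains_sup[OF \<open>compact K\<close> _ continuous_ip(3)[of K n a]] by blast
  define \<mu> where "\<mu> = ip n v (mv n a v)"
  have vv: "ip n v v = 1" and vW: "v \<in> W" using v(1) by (auto simp: K_def)
  have max: "ip n x (mv n a x) \<le> \<mu> * ip n x x" if xW: "x \<in> W" for x
  proof (cases "ip n x x = 0")
    case True
    then have "\<forall>i<n. x i = 0" by (simp add: ip_zero_iff)
    then show ?thesis using True by (simp add: ip_def)
  next
    case False
    define c where "c = sqrt (ip n x x)"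
    obtain y where y: "y \<in> K" "\<forall>i<n. x i = c * y i"
      using norm_in_K[OF xW False] c_def by auto
    have "ip n x (mv n a x) = ip n (\<lambda>i. c * y i) (mv n a (\<lambda>i. c * y i))"
      by (intro ip_cong mv_cong) (use y in \<open>auto intro!: mv_cong\<close>)
    also have "\<dots> = c\<^sup>2 * ip n y (mv n a y)"
      by (simp add: mv_scale ip_linear power2_eq_square)
    also have "\<dots> \<le> c\<^sup>2 * \<mu>"
      using v(2)[OF y(1)] by (intro mult_left_mono) (auto simp: \<mu>_def)
    also have "c\<^sup>2 = ip n x x" by (simp add: c_def ip_nonneg)
    finally show ?thesis by (simp add: mult.commute)
  qed
  have crit: "ip n x (mv n a v) = \<mu> * ip n x v" if x: "x \<in> W" for x
  proof (rule ccontr)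
    define b where "b = ip n x (mv n a v) - \<mu> * ip n x v"
    define c where "c = ip n x (mv n a x) - \<mu> * ip n x x"
    assume "ip n x (mv n a v) \<noteq> \<mu> * ip n x v"
    then have b: "b \<noteq> 0" by (simp add: b_def)
    have vx: "ip n v (mv n a x) = ip n x (mv n a v)"
      by (rule trans[OF ip_mv_sym[OF sym] ip_commute])
    have q: "2 * t * b + t\<^sup>2 * c \<le> 0" for t
    proof -
      have "(\<lambda>i. v i + t * x i) \<in> W"
        using vW x by (auto simp: W_def ip_linear)
      from max[OF this] vv vx show ?thesis
        by (simp add: ip_linear mv_add mv_scale b_def c_def ip_commute[of n v x] power2_eq_square algebra_simps \<mu>_def)
    qed
    \<comment> \<open>At \<open>t = b / s\<close> the linear term wins: the value is a positive
      multiple of \<open>2 * s + c\<close>.\<close>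
    define s where "s = \<bar>c\<bar> + 1"
    have s: "s > 0" "2 * s + c > 0" by (auto simp: s_def)
    have "2 * (b / s) * b + (b / s)\<^sup>2 * c = b\<^sup>2 * (2 * s + c) / s\<^sup>2"
      using s(1) by (simp add: field_simps power2_eq_square)
    moreover have "\<dots> > 0"
      using b s by (intro divide_pos_pos mult_pos_pos) auto
    ultimately show False using q[of "b / s"] by simp
  qed
  define r where "r = (\<lambda>i. mv n a v i - \<mu> * v i)"
  have "ip n (e j) r = 0" if "j < k" for j
  proof -
    have "ip n (e j) (mv n a v) = ip n (mv n a (e j)) v"
      by (rule ip_mv_sym[OF sym])
    also have "\<dots> = ip n (\<lambda>i. l j * e j i) v"
      by (rule ip_cong) (use eig that in auto)
    finally show ?thesis
      using vW that by (simp add: r_def W_def ip_linear)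
  qed
  then have "r \<in> W" by (simp add: W_def)
  then have "ip n r r = 0"
    using crit[of r] by (simp add: r_def ip_linear algebra_simps)
  then have "\<And>i. i < n \<Longrightarrow> mv n a v i = \<mu> * v i"
    by (simp add: ip_zero_iff r_def)
  then show thesis
    using that[of v \<mu>] vv vW max by (auto simp: W_def)
qed

text \<open>The variational bound in the last clause is carried through the induction: it shows that
  the eigenvalues decrease, and its instances 0 and 1 are what the spectral gap is derived
  from.\<close>

lemma orthonormal_eigensystem:
  assumes sym: "\<And>i j. i < n \<Longrightarrow> j < n \<Longrightarrow> a i j = a j i" and "k \<le> n"
  shows "\<exists>e l. (\<forall>j<k. \<forall>h<k. ip n (e j) (e h) = (if j = h then 1 else 0)) \<and>
     (\<forall>j<k. \<forall>i<n. mv n a (e j) i = l j * e j i) \<and>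
     (\<forall>j h. j \<le> h \<longrightarrow> h < k \<longrightarrow> l h \<le> (l j :: real)) \<and>
     (\<forall>j<k. \<forall>x. (\<forall>h<j. ip n (e h) x = 0) \<longrightarrow> ip n x (mv n a x) \<le> l j * ip n x x)"
  using \<open>k \<le> n\<close>
proof (induction k)
  case 0
  then show ?case by simp
next
  case (Suc k)
  then obtain e l where e: "\<forall>j<k. \<forall>h<k. ip n (e j) (e h) = (if j = h then 1 else 0)"
    and eig: "\<forall>j<k. \<forall>i<n. mv n a (e j) i = l j * e j i"
    and dec: "\<forall>j h. j \<le> h \<longrightarrow> h < k \<longrightarrow> l h \<le> (l j :: real)"
    and mx: "\<forall>j<k. \<forall>x. (\<forall>h<j. ip n (e h) x = 0) \<longrightarrow> ip n x (mv n a x) \<le> l j * ip n x x"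
    by auto
  obtain v \<mu> where v: "ip n v v = 1" "\<And>j. j < k \<Longrightarrow> ip n (e j) v = 0"
    "\<And>i. i < n \<Longrightarrow> mv n a v i = \<mu> * v i"
    "\<And>x. (\<And>j. j < k \<Longrightarrow> ip n (e j) x = 0) \<Longrightarrow> ip n x (mv n a x) \<le> \<mu> * ip n x x"
    by (rule max_eigenvector[of n a k e l]) (use sym eig Suc.prems in auto)
  have \<mu>: "\<mu> \<le> l j" if "j < k" for j
  proof -
    have "ip n v (mv n a v) = ip n v (\<lambda>i. \<mu> * v i)"
      by (rule ip_cong) (use v in auto)
    also have "\<dots> = \<mu>" using v(1) by (simp add: ip_linear)
    finally have "ip n v (mv n a v) = \<mu>" .
    moreover have "ip n v (mv n a v) \<le> l j * ip n v v"
      using mx that v(2) by auto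
    ultimately show ?thesis using v(1) by simp
  qed
  show ?case
    by (rule exI[of _ "e(k := v)"], rule exI[of _ "l(k := \<mu>)"])
      (use e eig dec mx v \<mu> in \<open>auto simp: less_Suc_eq ip_commute\<close>)
qed

corollary orthonormal_eigenbasis:
  assumes sym: "\<And>i j. i < n \<Longrightarrow> j < n \<Longrightarrow> a i j = a j i"
  obtains e l where "\<And>j h. j < n \<Longrightarrow> h < n \<Longrightarrow> ip n (e j) (e h) = (if j = h then 1 else 0)"
    and "\<And>j i. j < n \<Longrightarrow> i < n \<Longrightarrow> mv n a (e j) i = l j * e j i"
    and "\<And>j h. j \<le> h \<Longrightarrow> h < n \<Longrightarrow> l h \<le> (l j :: real)"
    and "\<And>j x. j < n \<Longrightarrow> (\<And>h. h < j \<Longrightarrow> ip n (e h) x = 0) \<Longrightarrow> ip n x (mv n a x) \<le> l j * ip n x x"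
proof -
  have "\<exists>e l. (\<forall>j<n. \<forall>h<n. ip n (e j) (e h) = (if j = h then 1 else 0)) \<and>
     (\<forall>j<n. \<forall>i<n. mv n a (e j) i = l j * e j i) \<and>
     (\<forall>j h. j \<le> h \<longrightarrow> h < n \<longrightarrow> l h \<le> (l j :: real)) \<and>
     (\<forall>j<n. \<forall>x. (\<forall>h<j. ip n (e h) x = 0) \<longrightarrow> ip n x (mv n a x) \<le> l j * ip n x x)"
    by (rule orthonormal_eigensystem) (use sym in auto)
  then show thesis
    by (elim exE conjE) (rule that, auto)
qed

lemma orthonormal_complete:
  assumes "\<And>j h. j < n \<Longrightarrow> h < n \<Longrightarrow> ip n (e j) (e h) = (if j = h then 1 else 0)"
    and "i < n" "j < n"
  shows "(\<Sum>k<n. e k i * e k j) = (if i = j then 1 else 0)"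
proof -
  define V where "V = mat n n (\<lambda>(i, j). e j i)"
  have V: "V \<in> carrier_mat n n" by (simp add: V_def)
  have "V\<^sup>T * V = 1\<^sub>m n"
    using assms(1) by (intro eq_matI) (auto simp: V_def scalar_prod_def ip_def atLeast0LessThan)
  then have "V * V\<^sup>T = 1\<^sub>m n"
    using mat_mult_left_right_inverse[of "V\<^sup>T" n V] V by simp
  then have "(V * V\<^sup>T) $$ (i, j) = (if i = j then 1 else 0)"
    using assms by simp
  then show ?thesis
    using assms(2,3) by (simp add: V_def scalar_prod_def atLeast0LessThan)
qed

lemma orthonormal_expansion:
  assumes "\<And>j h. j < n \<Longrightarrow> h < n \<Longrightarrow> ip n (e j) (e h) = (if j = h then 1 else 0)" and "i < n"
  shows "(\<Sum>k<n. ip n (e k) x * e k i) = x i"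
proof -
  have "(\<Sum>k<n. ip n (e k) x * e k i) = (\<Sum>k<n. \<Sum>j<n. x j * (e k i * e k j))"
    unfolding ip_def sum_distrib_right by (intro sum.cong refl) (simp add: mult_ac)
  also have "\<dots> = (\<Sum>j<n. x j * (\<Sum>k<n. e k i * e k j))"
    by (subst sum.swap) (simp add: sum_distrib_left)
  also have "\<dots> = (\<Sum>j<n. x j * (if i = j then 1 else 0))"
    by (intro sum.cong refl arg_cong2[where f="(*)"] orthonormal_complete assms) (use assms in auto)
  also have "\<dots> = x i"
    using assms(2) by (simp add: if_distrib[of "\<lambda>u. _ * u"] cong: if_cong)
  finally show ?thesis .
qed

section \<open>Eigenvalues as roots of the characteristic polynomial\<close>

lemma proots_prod_list_linear: "proots (\<Prod>a\<leftarrow>xs. [:- a, 1:]) = mset (xs :: real list)"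
proof (induction xs)
  case (Cons a xs)
  have "(\<Prod>a\<leftarrow>xs. [:- a, 1:]) \<noteq> (0 :: real poly)"
    by (auto simp: prod_list_zero_iff)
  then show ?case
    using Cons proots_linear_factor[of a] by (simp add: proots_mult del: mult_pCons_left)
qed simp

text \<open>The eigenbasis diagonalises \<open>A\<close>, so the characteristic polynomial is the
  product of the linear factors of the \<open>l j\<close>, and the multiset of roots counts
  eigenvalues as often as the basis does.\<close>

lemma eigval_desc_eq:
  assumes A: "A \<in> carrier_mat n n"
    and on: "\<And>j h. j < n \<Longrightarrow> h < n \<Longrightarrow> ip n (e j) (e h) = (if j = h then 1 else 0)"
    and eig: "\<And>j i. j < n \<Longrightarrow> i < n \<Longrightarrow> mv n (\<lambda>i j. A $$ (i, j)) (e j) i = l j * e j i"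
    and dec: "\<And>j h. j \<le> h \<Longrightarrow> h < n \<Longrightarrow> l h \<le> l j"
    and k: "1 \<le> k" "k \<le> n"
  shows "eigval_desc A k = l (k - 1)"
proof -
  define V where "V = mat n n (\<lambda>(i, j). e j i)"
  define D where "D = mat n n (\<lambda>(i, j). if i = j then l i else 0)"
  have V: "V \<in> carrier_mat n n" and D: "D \<in> carrier_mat n n" by (simp_all add: V_def D_def)
  have VV: "V\<^sup>T * V = 1\<^sub>m n"
    using on by (intro eq_matI) (auto simp: V_def scalar_prod_def ip_def atLeast0LessThan)
  then have VV': "V * V\<^sup>T = 1\<^sub>m n"
    using mat_mult_left_right_inverse[of "V\<^sup>T" n V] V by simp
  have AV: "A * V = V * D"
  proof (intro eq_matI)
    fix i j assume ij: "i < dim_row (V * D)" "j < dim_col (V * D)"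
    then have "i < n" "j < n" using V D by auto
    then have "(A * V) $$ (i, j) = mv n (\<lambda>i j. A $$ (i, j)) (e j) i"
      using A by (simp add: V_def scalar_prod_def mv_def atLeast0LessThan)
    also have "\<dots> = (\<Sum>h<n. e h i * (if h = j then l h else 0))"
      using eig \<open>i < n\<close> \<open>j < n\<close> by (simp add: if_distrib[of "\<lambda>u. _ * u"] cong: if_cong)
    also have "\<dots> = (V * D) $$ (i, j)"
      using \<open>i < n\<close> \<open>j < n\<close> by (simp add: V_def D_def scalar_prod_def atLeast0LessThan)
    finally show "(A * V) $$ (i, j) = (V * D) $$ (i, j)" .
  qed (use A V D in auto)
  have "A = A * (V * V\<^sup>T)" using VV' A by simp
  also have "\<dots> = V * D * V\<^sup>T"
    using A V by (subst assoc_mult_mat[symmetric, of _ n n _ n _ n]) (auto simp: AV)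
  finally have "similar_mat_wit A D V V\<^sup>T"
    using A V D VV VV' by (intro similar_mat_witI[of _ _ n]) auto
  then have "char_poly A = char_poly D"
    by (intro char_poly_similar) (auto simp: similar_mat_def)
  also have "\<dots> = (\<Prod>a\<leftarrow>diag_mat D. [:- a, 1:])"
    by (rule char_poly_upper_triangular[OF D]) (auto simp: D_def)
  also have "diag_mat D = map l [0..<n]"
    by (auto simp: diag_mat_def D_def)
  finally have "proots (char_poly A) = mset (map l [0..<n])"
    using proots_prod_list_linear[of "map l [0..<n]"] by simp
  then have "sorted_list_of_multiset (proots (char_poly A)) = sort (map l [0..<n])"
    by (simp only: sorted_list_of_multiset_mset)
  also have "\<dots> = rev (map l [0..<n])"
    by (intro properties_for_sort) (auto simp: sorted_iff_nth_mono rev_nth intro!: dec)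
  finally show ?thesis
    using k by (simp add: eigval_desc_def)
qed

text \<open>Schur's test: \<open>\<bar>x i\<bar> * \<bar>y j\<bar>\<close> is at most half the sum
  of the squares, and symmetry turns column sums into row sums.\<close>

lemma quadratic_form_le_row_sum:
  assumes sym: "\<And>i j. i < n \<Longrightarrow> j < n \<Longrightarrow> a i j = a j i"
    and nonneg: "\<And>i j. i < n \<Longrightarrow> j < n \<Longrightarrow> 0 \<le> a i j"
    and row: "\<And>i. i < n \<Longrightarrow> (\<Sum>j<n. a i j) \<le> r"
  shows "\<bar>ip n x (mv n a y)\<bar> \<le> r * (ip n x x + ip n y y) / 2"
proof -
  have "\<bar>ip n x (mv n a y)\<bar> \<le> (\<Sum>i<n. \<Sum>j<n. \<bar>x i * (a i j * y j)\<bar>)"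
    unfolding ip_def mv_def sum_distrib_left by (rule order_trans[OF sum_abs sum_mono[OF sum_abs]])
  also have "\<dots> \<le> (\<Sum>i<n. \<Sum>j<n. a i j * (x i)\<^sup>2 / 2 + a i j * (y j)\<^sup>2 / 2)"
  proof (intro sum_mono)
    fix i j assume "i \<in> {..<n}" "j \<in> {..<n}"
    then have a: "0 \<le> a i j" using nonneg by simp
    have "\<bar>x i\<bar> * \<bar>y j\<bar> \<le> ((x i)\<^sup>2 + (y j)\<^sup>2) / 2"
      using sum_squares_bound[of "\<bar>x i\<bar>" "\<bar>y j\<bar>"] by simp
    from mult_left_mono[OF this a] a
    show "\<bar>x i * (a i j * y j)\<bar> \<le> a i j * (x i)\<^sup>2 / 2 + a i j * (y j)\<^sup>2 / 2"
      by (simp add: abs_mult algebra_simps add_divide_distrib)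
  qed
  also have "\<dots> = (\<Sum>i<n. (\<Sum>j<n. a i j) * (x i)\<^sup>2 / 2) + (\<Sum>j<n. (\<Sum>i<n. a i j) * (y j)\<^sup>2 / 2)"
    by (simp add: sum.distrib sum_distrib_right sum_divide_distrib) (rule sum.swap)
  also have "(\<Sum>j<n. (\<Sum>i<n. a i j) * (y j)\<^sup>2 / 2) = (\<Sum>j<n. (\<Sum>i<n. a j i) * (y j)\<^sup>2 / 2)"
    by (intro sum.cong refl arg_cong2[where f="(/)"] arg_cong2[where f="(*)"]) (use sym in auto)
  also have "(\<Sum>i<n. (\<Sum>j<n. a i j) * (x i)\<^sup>2 / 2) + \<dots> \<le> (\<Sum>i<n. r * (x i)\<^sup>2 / 2) + (\<Sum>i<n. r * (y i)\<^sup>2 / 2)"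
    by (intro add_mono sum_mono divide_right_mono mult_right_mono row) auto
  also have "\<dots> = r * (ip n x x + ip n y y) / 2"
    by (simp add: ip_def sum_distrib_left sum_divide_distrib algebra_simps power2_eq_square
        add_divide_distrib sum.distrib)
  finally show ?thesis .
qed

text \<open>The all-ones vector is almost an eigenvector for the top eigenvalue, so that the spectral gap
  passes to its orthogonal complement.\<close>

lemma coupling_gap:
  assumes A: "coupling_matrix n A" and n: "2 \<le> n"
    and dev: "\<And>i. i < n \<Longrightarrow> \<bar>row_total A i - 1\<bar> \<le> D"
  shows "1 - D \<le> eigval_desc A 1" and "eigval_desc A 1 \<le> 1 + D"
    and "ip n x (\<lambda>_. 1) = 0 \<Longrightarrow>
      ip n x (mv n (\<lambda>i j. A $$ (i, j)) x) \<le> (eigval_desc A 2 + 2 * D) * ip n x x"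
proof -
  define a where "a = (\<lambda>i j. A $$ (i, j))"
  have carr: "A \<in> carrier_mat n n" and tr: "A\<^sup>T = A" and nonneg: "\<And>i j. i < n \<Longrightarrow> j < n \<Longrightarrow> 0 \<le> a i j"
    using A by (auto simp: coupling_matrix_def a_def)
  have sym: "a i j = a j i" if "i < n" "j < n" for i j
    using that carr tr by (metis a_def index_transpose_mat(1) carrier_matD)
  have row: "row_total A i = (\<Sum>j<n. a i j)" for i
    using carr by (simp add: row_total_def a_def)
  have D: "row_total A i \<le> 1 + D" "1 - D \<le> row_total A i" if "i < n" for i
    using dev[OF that] by linarith+
  obtain e l where e: "\<And>j h. j < n \<Longrightarrow> h < n \<Longrightarrow> ip n (e j) (e h) = (if j = h then 1 else 0)"
    and eig: "\<And>j i. j < n \<Longrightarrow> i < n \<Longrightarrow> mv n a (e j) i = l j * e j i"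
    and dec: "\<And>j h. j \<le> h \<Longrightarrow> h < n \<Longrightarrow> l h \<le> (l j :: real)"
    and mx: "\<And>j x. j < n \<Longrightarrow> (\<And>h. h < j \<Longrightarrow> ip n (e h) x = 0) \<Longrightarrow> ip n x (mv n a x) \<le> l j * ip n x x"
    by (rule orthonormal_eigenbasis[of n a]) (use sym in auto)
  have l0: "eigval_desc A 1 = l 0" and l1: "eigval_desc A 2 = l 1"
    using eigval_desc_eq[OF carr e, of l] eig dec n by (simp_all add: a_def numeral_2_eq_2)
  define v where "v = e 0"
  have vv: "ip n v v = 1" using e[of 0 0] n by (simp add: v_def)
  have av: "ip n z (mv n a v) = l 0 * ip n v z" for z
  proof -
    have "ip n z (mv n a v) = ip n z (\<lambda>i. l 0 * v i)"
      by (rule ip_cong) (use eig[of 0] n in \<open>auto simp: v_def\<close>)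
    then show ?thesis by (simp add: ip_linear ip_commute)
  qed
  have va: "ip n v (mv n a z) = l 0 * ip n v z" for z
    using ip_mv_sym[OF sym, where x=v and y=z] av by (simp add: ip_commute)
  have split: "ip n z (mv n a z) \<le> l 0 * (ip n v z)\<^sup>2 + l 1 * (ip n z z - (ip n v z)\<^sup>2)" for z
  proof -
    define w where "w = (\<lambda>i. z i - ip n v z * v i)"
    have "ip n v w = 0" by (simp add: w_def ip_linear vv)
    then have "ip n w (mv n a w) \<le> l 1 * ip n w w"
      using mx[of 1 w] n by (simp add: v_def)
    moreover have "ip n w w = ip n z z - (ip n v z)\<^sup>2"
      by (simp add: w_def ip_linear vv ip_commute[of n z v] power2_eq_square)
    moreover have "ip n w (mv n a w) = ip n z (mv n a z) - l 0 * (ip n v z)\<^sup>2"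
      by (simp add: w_def ip_linear vv mv_diff mv_scale av va power2_eq_square)
    ultimately show ?thesis by simp
  qed
  have "ip n v (mv n a v) \<le> (1 + D) * (ip n v v + ip n v v) / 2"
    by (rule order_trans[OF abs_ge_self quadratic_form_le_row_sum[OF sym nonneg]]) (use D(1) row in auto)
  then have up: "l 0 \<le> 1 + D" by (simp add: av vv)
  then show "eigval_desc A 1 \<le> 1 + D" unfolding l0 .
  have one: "ip n (\<lambda>_. 1) (\<lambda>_. 1) = n" by (simp add: ip_def)
  have "ip n (\<lambda>_. 1) (mv n a (\<lambda>_. 1)) = (\<Sum>i<n. row_total A i)"
    by (simp add: ip_def mv_def row)
  also have "\<dots> \<ge> (\<Sum>i<n. 1 - D)" by (intro sum_mono D) simp
  finally have low: "n * (1 - D) \<le> ip n (\<lambda>_. 1) (mv n a (\<lambda>_. 1))" by simp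
  also have "\<dots> \<le> l 0 * n" using mx[of 0 "\<lambda>_. 1"] n by (simp add: one)
  finally show "1 - D \<le> eigval_desc A 1" using n unfolding l0 by (simp add: mult.commute)
  \<comment> \<open>The squared distance of \<open>v\<close> from the constants is
    \<open>1 - s\<^sup>2 / n\<close>. The all-ones vector has Rayleigh quotient at least
    \<open>1 - D\<close>, while the top eigenvalue is at most \<open>1 + D\<close>; so this distance
    times the gap is at most \<open>2 * D\<close>, which is \<open>key\<close>.\<close>
  define s where "s = ip n v (\<lambda>_. 1)"
  have "n * (1 - D) \<le> l 0 * s\<^sup>2 + l 1 * (n - s\<^sup>2)"
    using low split[of "\<lambda>_. 1"] by (simp add: one s_def)
  then have "(l 0 - l 1) * (n - s\<^sup>2) \<le> l 0 * n - n * (1 - D)"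
    by (simp add: algebra_simps)
  also have "\<dots> \<le> (1 + D) * n - n * (1 - D)"
    using up by (intro diff_right_mono mult_right_mono) auto
  also have "\<dots> = 2 * D * n" by (simp add: algebra_simps)
  finally have key: "(l 0 - l 1) * (1 - s\<^sup>2 / n) \<le> 2 * D"
    using n by (simp add: field_simps)
  have l01: "l 1 \<le> l 0" using dec[of 0 1] n by simp
  show "ip n x (mv n (\<lambda>i j. A $$ (i, j)) x) \<le> (eigval_desc A 2 + 2 * D) * ip n x x"
    if x: "ip n x (\<lambda>_. 1) = 0"
  proof -
    \<comment> \<open>Against a vector orthogonal to the constants only the centred part of
      \<open>v\<close> counts, and its norm is what \<open>key\<close> controls.\<close>
    define u where "u = (\<lambda>i. v i - s / n * 1)"
    have "ip n u x = ip n v x"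
      unfolding u_def ip_linear using x by (simp add: ip_commute)
    moreover have "ip n u u = 1 - s\<^sup>2 / n"
      unfolding u_def ip_linear using n
      by (simp add: vv one s_def ip_commute[of n "\<lambda>_. 1" v] power2_eq_square field_simps)
    ultimately have "(ip n v x)\<^sup>2 \<le> (1 - s\<^sup>2 / n) * ip n x x"
      using Cauchy_Schwarz_ip[of n u x] nrm_sq[of n u] nrm_sq[of n x]
      by (metis abs_ge_zero power2_abs power_mono power_mult_distrib)
    then have "(l 0 - l 1) * (ip n v x)\<^sup>2 \<le> (l 0 - l 1) * ((1 - s\<^sup>2 / n) * ip n x x)"
      using l01 by (intro mult_left_mono) auto
    also have "\<dots> \<le> 2 * D * ip n x x"
      unfolding mult.assoc[symmetric] by (intro mult_right_mono key ip_nonneg)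
    finally show ?thesis
      using split[of x] by (simp add: l1 a_def[symmetric] algebra_simps)
  qed
qed

subsection \<open>Spin configurations and the FKG inequality\<close>

definition conf :: "nat \<Rightarrow> (nat \<Rightarrow> real) set" where
  "conf n = {..<n} \<rightarrow>\<^sub>E {-1, 1}"

lemma finite_conf: "finite (conf n)"
  by (simp add: conf_def finite_PiE)

lemma conf_nonempty: "conf n \<noteq> {}"
  by (simp add: conf_def PiE_eq_empty_iff)

lemma conf_value: "\<sigma> \<in> conf n \<Longrightarrow> i < n \<Longrightarrow> \<sigma> i = -1 \<or> \<sigma> i = 1"
  by (auto simp: conf_def PiE_def Pi_def)

lemma conf_sq: "\<sigma> \<in> conf n \<Longrightarrow> i < n \<Longrightarrow> \<sigma> i * \<sigma> i = 1"
  using conf_value[of \<sigma> n i] by auto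

lemma conf_abs: "\<sigma> \<in> conf n \<Longrightarrow> i < n \<Longrightarrow> \<bar>\<sigma> i\<bar> = 1"
  using conf_value[of \<sigma> n i] by auto

lemma sum_conf_Suc:
  "(\<Sum>\<sigma>\<in>conf (Suc n). f \<sigma>) = (\<Sum>\<sigma>\<in>conf n. f (\<sigma>(n := -1)) + f (\<sigma>(n := 1)))"
proof -
  have eq: "conf (Suc n) = (\<lambda>(s, \<sigma>). \<sigma>(n := s)) ` ({-1, 1} \<times> conf n)"
    unfolding conf_def lessThan_Suc by (rule PiE_insert_eq)
  have inj: "inj_on (\<lambda>(s, \<sigma>). \<sigma>(n := s)) ({-1, 1} \<times> conf n)"
    unfolding conf_def by (rule inj_combinator) simp
  have "(\<Sum>\<sigma>\<in>conf (Suc n). f \<sigma>) = (\<Sum>(s, \<sigma>)\<in>{-1, 1} \<times> conf n. f (\<sigma>(n := s)))"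
    unfolding eq by (subst sum.reindex[OF inj]) (simp add: o_def case_prod_unfold)
  also have "\<dots> = (\<Sum>s\<in>{-1, 1}. \<Sum>\<sigma>\<in>conf n. f (\<sigma>(n := s)))"
    by (rule sum.cartesian_product[symmetric])
  finally show ?thesis by (simp add: sum.distrib)
qed

lemma conf_fun_upd: "\<sigma> \<in> conf n \<Longrightarrow> s \<in> {-1, 1} \<Longrightarrow> \<sigma>(n := s) \<in> conf (Suc n)"
  unfolding conf_def lessThan_Suc by (rule PiE_fun_upd) auto

section \<open>The four functions theorem and FKG\<close>

lemma conf_sup: "x \<in> conf n \<Longrightarrow> y \<in> conf n \<Longrightarrow> (\<lambda>i. max (x i) (y i)) \<in> conf n"
  and conf_inf: "x \<in> conf n \<Longrightarrow> y \<in> conf n \<Longrightarrow> (\<lambda>i. min (x i) (y i)) \<in> conf n"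
  unfolding conf_def PiE_def Pi_def extensional_def by (auto simp: max_def min_def)

text \<open>With \<open>P\<close>, \<open>Q\<close> the mixed products on the left and
  \<open>R\<close>, \<open>S\<close> those on the right, \<open>P + Q \<le> R + S\<close> follows
  from \<open>P * Q \<le> R * S\<close> and \<open>P, Q \<le> R\<close>, because
  \<open>(R - P) * (R - Q)\<close> is non-negative.\<close>

lemma four_functions_one_site:
  fixes a0 a1 b0 b1 c0 c1 d0 d1 :: real
  assumes nn: "0 \<le> a0" "0 \<le> a1" "0 \<le> b0" "0 \<le> b1" "0 \<le> c0" "0 \<le> c1" "0 \<le> d0" "0 \<le> d1"
    and h: "a0 * b0 \<le> c0 * d0" "a0 * b1 \<le> c1 * d0" "a1 * b0 \<le> c1 * d0" "a1 * b1 \<le> c1 * d1"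
  shows "(a0 + a1) * (b0 + b1) \<le> (c0 + c1) * (d0 + d1)"
proof -
  define P Q R S where "P = a0 * b1" and "Q = a1 * b0" and "R = c1 * d0" and "S = c0 * d1"
  have nn': "0 \<le> P" "0 \<le> Q" "0 \<le> R" "0 \<le> S" and le: "P \<le> R" "Q \<le> R"
    using nn h by (auto simp: P_def Q_def R_def S_def)
  have "P * Q = (a0 * b0) * (a1 * b1)" by (simp add: P_def Q_def)
  also have "\<dots> \<le> (c0 * d0) * (c1 * d1)" by (rule mult_mono[OF h(1,4)]) (use nn in auto)
  also have "\<dots> = R * S" by (simp add: R_def S_def)
  finally have PQ: "P * Q \<le> R * S" .
  have "P + Q \<le> R + S"
  proof (cases "R = 0")
    case True
    then show ?thesis using nn' le by linarith
  next
    case False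
    have "0 \<le> (R - P) * (R - Q)" using le by simp
    then have "R * (P + Q) \<le> R * (R + S)" using PQ by (simp add: algebra_simps)
    then show ?thesis using False nn' by (simp add: mult_le_cancel_left)
  qed
  then show ?thesis using h(1,4) by (simp add: P_def Q_def R_def S_def algebra_simps)
qed

text \<open>The theorem of Ahlswede and Daykin. Summing out the last spin gives four functions on
  one site fewer, which satisfy the hypothesis again by the one-site case.\<close>

theorem four_functions:
  fixes \<alpha> \<beta> \<gamma> \<delta> :: "(nat \<Rightarrow> real) \<Rightarrow> real"
  assumes "\<And>x. x \<in> conf n \<Longrightarrow> 0 \<le> \<alpha> x" "\<And>x. x \<in> conf n \<Longrightarrow> 0 \<le> \<beta> x"
    "\<And>x. x \<in> conf n \<Longrightarrow> 0 \<le> \<gamma> x" "\<And>x. x \<in> conf n \<Longrightarrow> 0 \<le> \<delta> x"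
    and "\<And>x y. x \<in> conf n \<Longrightarrow> y \<in> conf n \<Longrightarrow>
      \<alpha> x * \<beta> y \<le> \<gamma> (\<lambda>i. max (x i) (y i)) * \<delta> (\<lambda>i. min (x i) (y i))"
  shows "sum \<alpha> (conf n) * sum \<beta> (conf n) \<le> sum \<gamma> (conf n) * sum \<delta> (conf n)"
  using assms
proof (induction n arbitrary: \<alpha> \<beta> \<gamma> \<delta>)
  case 0
  have "conf 0 = {\<lambda>_. undefined}" by (simp add: conf_def)
  then show ?case using 0(5)[of "\<lambda>_. undefined" "\<lambda>_. undefined"] by simp
next
  case (Suc n)
  have up: "x(n := -1) \<in> conf (Suc n)" "x(n := 1) \<in> conf (Suc n)" if "x \<in> conf n" for x
    using conf_fun_upd[OF that] by auto
  have mx: "(\<lambda>i. max (if i = n then s else x i) (if i = n then t else y i)) =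
      (\<lambda>i. if i = n then max s t else max (x i) (y i))"
    and mn: "(\<lambda>i. min (if i = n then s else x i) (if i = n then t else y i)) =
      (\<lambda>i. if i = n then min s t else min (x i) (y i))"
    for x y :: "nat \<Rightarrow> real" and s t
    by auto
  show ?case
    unfolding sum_conf_Suc
  proof (rule Suc.IH)
    fix x y assume xy: "x \<in> conf n" "y \<in> conf n"
    note u = up[OF xy(1)] up[OF xy(2)] up[OF conf_sup[OF xy]] up[OF conf_inf[OF xy]]
    show "(\<alpha> (x(n := - 1)) + \<alpha> (x(n := 1))) * (\<beta> (y(n := - 1)) + \<beta> (y(n := 1)))
       \<le> (\<gamma> ((\<lambda>i. max (x i) (y i))(n := - 1)) + \<gamma> ((\<lambda>i. max (x i) (y i))(n := 1))) *
         (\<delta> ((\<lambda>i. min (x i) (y i))(n := - 1)) + \<delta> ((\<lambda>i. min (x i) (y i))(n := 1)))"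
      using Suc.prems(5)[OF u(1) u(3)] Suc.prems(5)[OF u(1) u(4)]
        Suc.prems(5)[OF u(2) u(3)] Suc.prems(5)[OF u(2) u(4)]
      by (intro four_functions_one_site Suc.prems(1-4) u) (simp_all add: fun_upd_def mx mn)
  qed (intro add_nonneg_nonneg Suc.prems(1-4) up; assumption)+
qed

text \<open>The four functions are \<open>w * f\<close>, \<open>w * g\<close>,
  \<open>w * (f * g)\<close> and \<open>w\<close>. To make them non-negative, \<open>f\<close> and
  \<open>g\<close> are shifted by their values at the minimal configuration, which does not change
  the covariance.\<close>

corollary FKG:
  fixes w f g :: "(nat \<Rightarrow> real) \<Rightarrow> real"
  assumes w: "\<And>x. x \<in> conf n \<Longrightarrow> 0 \<le> w x"
    and lattice: "\<And>x y. x \<in> conf n \<Longrightarrow> y \<in> conf n \<Longrightarrow>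
      w x * w y \<le> w (\<lambda>i. max (x i) (y i)) * w (\<lambda>i. min (x i) (y i))"
    and f: "\<And>x y. x \<in> conf n \<Longrightarrow> y \<in> conf n \<Longrightarrow> (\<And>i. i < n \<Longrightarrow> x i \<le> y i) \<Longrightarrow> f x \<le> f y"
    and g: "\<And>x y. x \<in> conf n \<Longrightarrow> y \<in> conf n \<Longrightarrow> (\<And>i. i < n \<Longrightarrow> x i \<le> y i) \<Longrightarrow> g x \<le> g y"
  shows "(\<Sum>x\<in>conf n. w x * f x) * (\<Sum>x\<in>conf n. w x * g x)
       \<le> (\<Sum>x\<in>conf n. w x * (f x * g x)) * (\<Sum>x\<in>conf n. w x)"
proof -
  have bot: "(\<lambda>i. if i < n then -1 else undefined) \<in> conf n" by (auto simp: conf_def PiE_iff extensional_def)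
  define c d where "c = - f (\<lambda>i. if i < n then -1 else undefined)"
    and "d = - g (\<lambda>i. if i < n then -1 else undefined)"
  have ge: "-1 \<le> x i" if "x \<in> conf n" "i < n" for x i
    using conf_value[OF that] by auto
  have cf: "0 \<le> f x + c" and dg: "0 \<le> g x + d" if "x \<in> conf n" for x
    using f[OF bot that] g[OF bot that] ge[OF that] by (auto simp: c_def d_def)
  have "(\<Sum>x\<in>conf n. w x * (f x + c)) * (\<Sum>x\<in>conf n. w x * (g x + d))
      \<le> (\<Sum>x\<in>conf n. w x * ((f x + c) * (g x + d))) * (\<Sum>x\<in>conf n. w x)"
  proof (rule four_functions)
    fix x y assume xy: "x \<in> conf n" "y \<in> conf n"
    let ?z = "\<lambda>i. max (x i) (y i)"
    have z: "?z \<in> conf n" by (rule conf_sup[OF xy])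
    have "(f x + c) * (g y + d) \<le> (f ?z + c) * (g ?z + d)"
      using f[OF xy(1) z] g[OF xy(2) z] cf[OF xy(1)] dg[OF xy(2)] cf[OF z]
      by (intro mult_mono) auto
    then have "(w x * w y) * ((f x + c) * (g y + d))
        \<le> (w ?z * w (\<lambda>i. min (x i) (y i))) * ((f ?z + c) * (g ?z + d))"
      by (rule mult_mono[OF lattice[OF xy]])
        (use w z conf_inf[OF xy] cf dg xy in \<open>auto intro!: mult_nonneg_nonneg\<close>)
    then show "w x * (f x + c) * (w y * (g y + d))
        \<le> w ?z * ((f ?z + c) * (g ?z + d)) * w (\<lambda>i. min (x i) (y i))"
      by (simp add: mult_ac)
  qed (use w cf dg in \<open>auto intro!: mult_nonneg_nonneg\<close>)
  then show ?thesis
    by (simp add: distrib_left distrib_right sum.distrib sum_distrib_right[symmetric] algebra_simps)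
      (simp add: algebra_simps flip: sum_distrib_left sum_distrib_right)
qed

subsection \<open>The quadruple replica polynomials of the GHS and Lebowitz inequalities\<close>

definition quad_sum :: "'c set \<Rightarrow> ('c \<Rightarrow> 'c \<Rightarrow> 'c \<Rightarrow> 'c \<Rightarrow> real) \<Rightarrow> real" where
  "quad_sum C F = (\<Sum>x\<in>C. \<Sum>y\<in>C. \<Sum>z\<in>C. \<Sum>u\<in>C. F x y z u)"

lemma quad_sum_pairs:
  fixes f g :: "'c \<Rightarrow> 'c \<Rightarrow> real"
  shows "quad_sum C (\<lambda>x y z u. f x y * g z u) = (\<Sum>x\<in>C. \<Sum>y\<in>C. f x y) * (\<Sum>x\<in>C. \<Sum>y\<in>C. g x y)"
  by (simp only: quad_sum_def sum_distrib_left[symmetric] sum_distrib_right[symmetric])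

lemma pair_sum_prod:
  fixes f g :: "'c \<Rightarrow> real"
  shows "(\<Sum>x\<in>C. \<Sum>y\<in>C. f x * g y) = sum f C * sum g C"
  by (simp add: sum_product)

lemma quad_sum_add: "quad_sum C (\<lambda>x y z u. F x y z u + G x y z u) = quad_sum C F + quad_sum C G"
  by (simp add: quad_sum_def sum.distrib)

lemma quad_sum_diff: "quad_sum C (\<lambda>x y z u. F x y z u - G x y z u) = quad_sum C F - quad_sum C G"
  by (simp add: quad_sum_def sum_subtractf)

text \<open>The last two factors in \<open>h\<close> multiply to
  \<open>(F z - F u)\<^sup>2 - (F x - F y)\<^sup>2\<close>. Over four independent copies the whole
  product integrates to -4 times the third cumulant of \<open>F\<close>.\<close>

lemma GHS_expand:
  fixes w F :: "'c \<Rightarrow> real" and C M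
  assumes M: "M = (\<lambda>f. \<Sum>x\<in>C. w x * f x)" and norm: "sum w C = 1"
    and h: "0 \<le> quad_sum C (\<lambda>x y z u. (F x + F y - F z - F u) * (F x - F y + F z - F u)
      * (- F x + F y + F z - F u) * (w x * w y * w z * w u))"
  shows "M (\<lambda>x. F x ^ 3) - 3 * M (\<lambda>x. F x ^ 2) * M F + 2 * M F ^ 3 \<le> 0"
proof -
  define P where "P = (\<lambda>f::'c \<Rightarrow> 'c \<Rightarrow> real. \<Sum>x\<in>C. \<Sum>y\<in>C. w x * w y * f x y)"
  have M1: "M (\<lambda>_. 1) = 1" using norm by (simp add: M)
  have Pprod: "P (\<lambda>x y. f x * g y) = M f * M g" for f g
    using pair_sum_prod[of "\<lambda>x. w x * f x" "\<lambda>x. w x * g x" C]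
    by (simp add: P_def M mult_ac)
  have P1: "P (\<lambda>_ _. 1) = 1"
    using Pprod[of "\<lambda>_. 1" "\<lambda>_. 1"] M1 by simp
  have quad: "quad_sum C (\<lambda>x y z u. f x y * g z u * (w x * w y * w z * w u)) = P f * P g" for f g
    using quad_sum_pairs[of C "\<lambda>x y. w x * w y * f x y" "\<lambda>x y. w x * w y * g x y"]
    by (simp add: P_def mult_ac)
  let ?S = "\<lambda>x y. F x + F y" and ?D = "\<lambda>x y. (F x - F y)\<^sup>2"
  have "quad_sum C (\<lambda>x y z u. (F x + F y - F z - F u) * (F x - F y + F z - F u)
      * (- F x + F y + F z - F u) * (w x * w y * w z * w u))
    = quad_sum C (\<lambda>x y z u. (?S x y * ?D z u * (w x * w y * w z * w u) - (?S x y * ?D x y) * 1 * (w x * w y * w z * w u))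
        - (1 * (?S z u * ?D z u) * (w x * w y * w z * w u) - ?D x y * ?S z u * (w x * w y * w z * w u)))"
    by (rule arg_cong[where f="quad_sum C"]) (auto intro!: ext simp: algebra_simps power2_eq_square)
  also have "\<dots> = 2 * (P ?S * P ?D - P (\<lambda>x y. ?S x y * ?D x y))"
    using quad[of ?S ?D] quad[of "\<lambda>x y. ?S x y * ?D x y" "\<lambda>_ _. 1"] quad[of "\<lambda>_ _. 1" "\<lambda>x y. ?S x y * ?D x y"] quad[of ?D ?S]
    by (simp only: quad_sum_diff P1) (simp add: algebra_simps)
  finally have key: "P (\<lambda>x y. ?S x y * ?D x y) \<le> P ?S * P ?D"
    using h by simp
  have 1: "P ?S = 2 * M F"
  proof -
    have "P ?S = P (\<lambda>x y. F x * 1) + P (\<lambda>x y. 1 * F y)"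
      by (simp add: P_def algebra_simps sum.distrib)
    then show ?thesis by (simp only: Pprod M1)
  qed
  have 2: "P ?D = 2 * (M (\<lambda>x. F x ^ 2) - (M F)\<^sup>2)"
  proof -
    have "P ?D = P (\<lambda>x y. F x ^ 2 * 1) + P (\<lambda>x y. 1 * F y ^ 2) - 2 * P (\<lambda>x y. F x * F y)"
      by (simp add: P_def algebra_simps sum.distrib sum_subtractf power2_eq_square sum_distrib_left)
    then show ?thesis by (simp only: Pprod M1) (simp add: power2_eq_square)
  qed
  have 3: "P (\<lambda>x y. ?S x y * ?D x y) = 2 * (M (\<lambda>x. F x ^ 3) - M (\<lambda>x. F x ^ 2) * M F)"
  proof -
    have "P (\<lambda>x y. ?S x y * ?D x y) = P (\<lambda>x y. F x ^ 3 * 1) + P (\<lambda>x y. 1 * F y ^ 3)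
        - P (\<lambda>x y. F x ^ 2 * F y) - P (\<lambda>x y. F x * F y ^ 2)"
      by (simp add: P_def algebra_simps sum.distrib sum_subtractf power2_eq_square power3_eq_cube)
    then show ?thesis by (simp only: Pprod M1) simp
  qed
  show ?thesis
    using key unfolding 1 2 3 by (simp add: algebra_simps power2_eq_square power3_eq_cube)
qed

text \<open>Over four independent copies the product in \<open>h\<close> integrates to -4 times the
  joint fourth cumulant of \<open>F, F, F, G\<close>; \<open>F0\<close> and \<open>G0\<close> remove
  the terms that contain first moments.\<close>

lemma Lebowitz_expand:
  fixes w F G :: "'c \<Rightarrow> real" and C M
  assumes M: "M = (\<lambda>f. \<Sum>x\<in>C. w x * f x)" and norm: "sum w C = 1"
    and F0: "M F = 0" and G0: "M G = 0"
    and h: "0 \<le> quad_sum C (\<lambda>x y z u. (F x + F y + F z + F u) * (F x + F y - F z - F u) * (F x - F y + F z - F u)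
      * (- G x + G y + G z - G u) * (w x * w y * w z * w u))"
  shows "M (\<lambda>x. F x ^ 3 * G x) \<le> 3 * M (\<lambda>x. F x ^ 2) * M (\<lambda>x. F x * G x)"
proof -
  define P where "P = (\<lambda>f::'c \<Rightarrow> 'c \<Rightarrow> real. \<Sum>x\<in>C. \<Sum>y\<in>C. w x * w y * f x y)"
  have M1: "M (\<lambda>_. 1) = 1" using norm by (simp add: M)
  have Pprod: "P (\<lambda>x y. f x * g y) = M f * M g" for f g
    using pair_sum_prod[of "\<lambda>x. w x * f x" "\<lambda>x. w x * g x" C]
    by (simp add: P_def M mult_ac)
  have P1: "P (\<lambda>_ _. 1) = 1"
    using Pprod[of "\<lambda>_. 1" "\<lambda>_. 1"] M1 by simp
  have quad: "quad_sum C (\<lambda>x y z u. f x y * g z u * (w x * w y * w z * w u)) = P f * P g" for f g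
    using quad_sum_pairs[of C "\<lambda>x y. w x * w y * f x y" "\<lambda>x y. w x * w y * g x y"]
    by (simp add: P_def mult_ac)
  let ?Q = "\<lambda>x y. (F x + F y)\<^sup>2" and ?D = "\<lambda>x y. F x - F y" and ?R = "\<lambda>x y. G x - G y"
  let ?W = "\<lambda>x y z u. w x * w y * w z * w u"
  have D0: "P ?D = 0" "P ?R = 0"
  proof -
    have "P ?D = P (\<lambda>x y. F x * 1) - P (\<lambda>x y. 1 * F y)" "P ?R = P (\<lambda>x y. G x * 1) - P (\<lambda>x y. 1 * G y)"
      by (simp_all add: P_def algebra_simps sum_subtractf)
    then show "P ?D = 0" "P ?R = 0" by (simp_all only: Pprod M1 F0 G0)
  qed
  have "quad_sum C (\<lambda>x y z u. (F x + F y + F z + F u) * (F x + F y - F z - F u) * (F x - F y + F z - F u)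
      * (- G x + G y + G z - G u) * ?W x y z u)
    = quad_sum C (\<lambda>x y z u. (((?Q x y * ?D x y) * ?R z u * ?W x y z u - (?Q x y * ?D x y * ?R x y) * 1 * ?W x y z u)
        + (?Q x y * (?D z u * ?R z u) * ?W x y z u - (?Q x y * ?R x y) * ?D z u * ?W x y z u))
        - ((?D x y * (?Q z u * ?R z u) * ?W x y z u - (?D x y * ?R x y) * ?Q z u * ?W x y z u)
        + (1 * (?Q z u * ?D z u * ?R z u) * ?W x y z u - ?R x y * (?Q z u * ?D z u) * ?W x y z u)))"
  proof (rule arg_cong[where f="quad_sum C"], intro ext)
    fix x y z u
    have "(F x + F y + F z + F u) * (F x + F y - F z - F u) = ?Q x y - ?Q z u"
      by (simp add: algebra_simps power2_eq_square)
    moreover have "F x - F y + F z - F u = ?D x y + ?D z u" "- G x + G y + G z - G u = ?R z u - ?R x y"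
      by simp_all
    ultimately have "(F x + F y + F z + F u) * (F x + F y - F z - F u) * (F x - F y + F z - F u)
      * (- G x + G y + G z - G u) = (?Q x y - ?Q z u) * (?D x y + ?D z u) * (?R z u - ?R x y)"
      by metis
    moreover have "(a - b) * (c + d) * (e - f) * v = (((a * c) * e * v - (a * c * f) * 1 * v)
        + (a * (d * e) * v - (a * f) * d * v))
        - ((c * (b * e) * v - (c * f) * b * v) + (1 * (b * d * e) * v - f * (b * d) * v))" for a b c d e f v :: real
      by (simp add: algebra_simps)
    ultimately show "(F x + F y + F z + F u) * (F x + F y - F z - F u) * (F x - F y + F z - F u)
      * (- G x + G y + G z - G u) * ?W x y z u = (((?Q x y * ?D x y) * ?R z u * ?W x y z u - (?Q x y * ?D x y * ?R x y) * 1 * ?W x y z u)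
        + (?Q x y * (?D z u * ?R z u) * ?W x y z u - (?Q x y * ?R x y) * ?D z u * ?W x y z u))
        - ((?D x y * (?Q z u * ?R z u) * ?W x y z u - (?D x y * ?R x y) * ?Q z u * ?W x y z u)
        + (1 * (?Q z u * ?D z u * ?R z u) * ?W x y z u - ?R x y * (?Q z u * ?D z u) * ?W x y z u))"
      by presburger
  qed
  also have "\<dots> = 2 * (P ?Q * P (\<lambda>x y. ?D x y * ?R x y) - P (\<lambda>x y. ?Q x y * ?D x y * ?R x y))"
    using quad[of "\<lambda>x y. ?Q x y * ?D x y" ?R] quad[of "\<lambda>x y. ?Q x y * ?D x y * ?R x y" "\<lambda>_ _. 1"]
      quad[of ?Q "\<lambda>x y. ?D x y * ?R x y"] quad[of "\<lambda>x y. ?Q x y * ?R x y" ?D]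
      quad[of ?D "\<lambda>x y. ?Q x y * ?R x y"] quad[of "\<lambda>x y. ?D x y * ?R x y" ?Q]
      quad[of "\<lambda>_ _. 1" "\<lambda>x y. ?Q x y * ?D x y * ?R x y"] quad[of ?R "\<lambda>x y. ?Q x y * ?D x y"]
    by (simp only: quad_sum_diff quad_sum_add P1 D0) (simp add: algebra_simps)
  finally have key: "P (\<lambda>x y. ?Q x y * ?D x y * ?R x y) \<le> P ?Q * P (\<lambda>x y. ?D x y * ?R x y)"
    using h by simp
  have 1: "P ?Q = 2 * M (\<lambda>x. F x ^ 2)"
  proof -
    have "P ?Q = P (\<lambda>x y. F x ^ 2 * 1) + P (\<lambda>x y. 1 * F y ^ 2) + 2 * P (\<lambda>x y. F x * F y)"
      by (simp add: P_def algebra_simps sum.distrib power2_eq_square sum_distrib_left)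
    then show ?thesis by (simp only: Pprod M1 F0)
  qed
  have 2: "P (\<lambda>x y. ?D x y * ?R x y) = 2 * M (\<lambda>x. F x * G x)"
  proof -
    have "P (\<lambda>x y. ?D x y * ?R x y) = P (\<lambda>x y. (F x * G x) * 1) + P (\<lambda>x y. 1 * (F y * G y))
        - P (\<lambda>x y. F x * G y) - P (\<lambda>x y. G x * F y)"
      by (simp add: P_def algebra_simps sum.distrib sum_subtractf)
    then show ?thesis by (simp only: Pprod M1 F0)
  qed
  have 3: "P (\<lambda>x y. ?Q x y * ?D x y * ?R x y)
      = 2 * (M (\<lambda>x. F x ^ 3 * G x) - M (\<lambda>x. F x ^ 2) * M (\<lambda>x. F x * G x))"
  proof -
    have "P (\<lambda>x y. ?Q x y * ?D x y * ?R x y) =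
        P (\<lambda>x y. (F x ^ 3 * G x) * 1) + P (\<lambda>x y. 1 * (F y ^ 3 * G y))
        - P (\<lambda>x y. F x ^ 3 * G y) - P (\<lambda>x y. G x * F y ^ 3)
        + P (\<lambda>x y. (F x ^ 2 * G x) * F y) + P (\<lambda>x y. F x * (F y ^ 2 * G y))
        - P (\<lambda>x y. F x ^ 2 * (F y * G y)) - P (\<lambda>x y. (F x * G x) * F y ^ 2)"
      by (simp add: P_def algebra_simps sum.distrib sum_subtractf power2_eq_square power3_eq_cube)
    then show ?thesis by (simp only: Pprod M1 F0 G0) (simp add: algebra_simps)
  qed
  show ?thesis
    using key unfolding 1 2 3 by (simp add: algebra_simps)
qed

subsection \<open>Positivity for four rotated replicas\<close>

text \<open>Four replicas are rotated by half a Hadamard matrix, as in the method of Ellis and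
  Monroe. The sign of \<open>rot3\<close> is such that for three equal spins and an opposite one the
  rotated spins have product 1 and not -1.\<close>

definition rot0 :: "real \<Rightarrow> real \<Rightarrow> real \<Rightarrow> real \<Rightarrow> real" where "rot0 a b c d = (a + b + c + d) / 2"
definition rot1 :: "real \<Rightarrow> real \<Rightarrow> real \<Rightarrow> real \<Rightarrow> real" where "rot1 a b c d = (a + b - c - d) / 2"
definition rot2 :: "real \<Rightarrow> real \<Rightarrow> real \<Rightarrow> real \<Rightarrow> real" where "rot2 a b c d = (a - b + c - d) / 2"
definition rot3 :: "real \<Rightarrow> real \<Rightarrow> real \<Rightarrow> real \<Rightarrow> real" where "rot3 a b c d = (- a + b + c - d) / 2"

lemmas rot_defs = rot0_def rot1_def rot2_def rot3_def

text \<open>The interaction energy of four replicas thus keeps its form, with the same non-negative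
  couplings, in the rotated spins.\<close>

lemma rot_orthogonal:
  "rot0 a b c d * rot0 a' b' c' d' + rot1 a b c d * rot1 a' b' c' d'
    + rot2 a b c d * rot2 a' b' c' d' + rot3 a b c d * rot3 a' b' c' d'
   = a * a' + b * b' + c * c' + d * d'"
  by (simp add: rot_defs field_simps)

definition site_monomial :: "nat \<Rightarrow> nat \<Rightarrow> nat \<Rightarrow> nat \<Rightarrow> real \<Rightarrow> real \<Rightarrow> real \<Rightarrow> real \<Rightarrow> real" where
  "site_monomial p q r s a b c d = rot0 a b c d ^ p * rot1 a b c d ^ q * rot2 a b c d ^ r * rot3 a b c d ^ s"

text \<open>Either exactly one of the four rotated spins is non-zero, or all four are \<open>\<plusminus>1\<close> with product \<open>1\<close>;
  this sign is what makes the rotated monomials positively correlated.\<close>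

lemma site_monomial_sum_nonneg:
  "0 \<le> (\<Sum>a\<in>{-1,1}. \<Sum>b\<in>{-1,1}. \<Sum>c\<in>{-1,1}. \<Sum>d\<in>{-1,1}. site_monomial p q r s a b c d)"
  by (cases "even p"; cases "even q"; cases "even r"; cases "even s")
    (simp_all add: site_monomial_def rot_defs uminus_power_if power_0_left)

definition monomial :: "nat \<Rightarrow> (nat \<Rightarrow> nat) \<Rightarrow> (nat \<Rightarrow> nat) \<Rightarrow> (nat \<Rightarrow> nat) \<Rightarrow> (nat \<Rightarrow> nat) \<Rightarrow>
    (nat \<Rightarrow> real) \<Rightarrow> (nat \<Rightarrow> real) \<Rightarrow> (nat \<Rightarrow> real) \<Rightarrow> (nat \<Rightarrow> real) \<Rightarrow> real" where
  "monomial n p q r s x y z u = (\<Prod>i<n. site_monomial (p i) (q i) (r i) (s i) (x i) (y i) (z i) (u i))"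

lemma sum_conf_prod:
  fixes f :: "nat \<Rightarrow> real \<Rightarrow> real"
  shows "(\<Sum>x\<in>conf n. \<Prod>i<n. f i (x i)) = (\<Prod>i<n. \<Sum>a\<in>{-1,1}. f i a)"
  unfolding conf_def by (rule prod_sum_PiE[symmetric]) auto

lemma quad_sum_monomial_nonneg: "0 \<le> quad_sum (conf n) (monomial n p q r s)"
proof -
  have "quad_sum (conf n) (monomial n p q r s) =
    (\<Prod>i<n. \<Sum>a\<in>{-1,1}. \<Sum>b\<in>{-1,1}. \<Sum>c\<in>{-1,1}. \<Sum>d\<in>{-1,1}. site_monomial (p i) (q i) (r i) (s i) a b c d)"
  proof -
    let ?t = "\<lambda>i. site_monomial (p i) (q i) (r i) (s i)"
    have "(\<Sum>u\<in>conf n. \<Prod>i<n. ?t i (x i) (y i) (z i) (u i)) = (\<Prod>i<n. \<Sum>d\<in>{-1,1}. ?t i (x i) (y i) (z i) d)" for x y z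
      by (rule sum_conf_prod)
    moreover have "(\<Sum>z\<in>conf n. \<Prod>i<n. \<Sum>d\<in>{-1,1}. ?t i (x i) (y i) (z i) d)
        = (\<Prod>i<n. \<Sum>c\<in>{-1,1}. \<Sum>d\<in>{-1,1}. ?t i (x i) (y i) c d)" for x y
      by (rule sum_conf_prod)
    moreover have "(\<Sum>y\<in>conf n. \<Prod>i<n. \<Sum>c\<in>{-1,1}. \<Sum>d\<in>{-1,1}. ?t i (x i) (y i) c d)
        = (\<Prod>i<n. \<Sum>b\<in>{-1,1}. \<Sum>c\<in>{-1,1}. \<Sum>d\<in>{-1,1}. ?t i (x i) b c d)" for x
      by (rule sum_conf_prod)
    moreover have "(\<Sum>x\<in>conf n. \<Prod>i<n. \<Sum>b\<in>{-1,1}. \<Sum>c\<in>{-1,1}. \<Sum>d\<in>{-1,1}. ?t i (x i) b c d)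
        = (\<Prod>i<n. \<Sum>a\<in>{-1,1}. \<Sum>b\<in>{-1,1}. \<Sum>c\<in>{-1,1}. \<Sum>d\<in>{-1,1}. ?t i a b c d)"
      by (rule sum_conf_prod)
    ultimately show ?thesis
      unfolding quad_sum_def monomial_def by simp
  qed
  also have "\<dots> \<ge> 0"
    by (intro prod_nonneg site_monomial_sum_nonneg)
  finally show ?thesis .
qed

text \<open>Elements are multipliers that preserve non-negativity of the sums against all monomials.
  With this encoding closure under products is composition, and no function has to be expanded in
  monomials.\<close>

definition cone :: "nat \<Rightarrow> ((nat \<Rightarrow> real) \<Rightarrow> (nat \<Rightarrow> real) \<Rightarrow> (nat \<Rightarrow> real) \<Rightarrow> (nat \<Rightarrow> real) \<Rightarrow> real) \<Rightarrow> bool" where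
  "cone n G \<longleftrightarrow> (\<forall>F. (\<forall>p q r s. 0 \<le> quad_sum (conf n) (\<lambda>x y z u. F x y z u * monomial n p q r s x y z u)) \<longrightarrow>
     (\<forall>p q r s. 0 \<le> quad_sum (conf n) (\<lambda>x y z u. G x y z u * F x y z u * monomial n p q r s x y z u)))"

lemma cone_nonneg:
  assumes "cone n G"
  shows "0 \<le> quad_sum (conf n) G"
proof -
  have "0 \<le> quad_sum (conf n) (\<lambda>x y z u. G x y z u * 1 * monomial n p q r s x y z u)" for p q r s
    by (rule assms[unfolded cone_def, rule_format]) (simp add: quad_sum_monomial_nonneg)
  from this[of "\<lambda>_. 0" "\<lambda>_. 0" "\<lambda>_. 0" "\<lambda>_. 0"] show ?thesis
    by (simp add: monomial_def site_monomial_def)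
qed

lemma cone_add: "cone n G \<Longrightarrow> cone n H \<Longrightarrow> cone n (\<lambda>x y z u. G x y z u + H x y z u)"
  unfolding cone_def by (simp add: distrib_right quad_sum_add)

lemma cone_mult: "cone n G \<Longrightarrow> cone n H \<Longrightarrow> cone n (\<lambda>x y z u. G x y z u * H x y z u)"
  unfolding cone_def
proof (intro allI impI)
  fix F p q r s
  assume G: "\<forall>F. (\<forall>p q r s. 0 \<le> quad_sum (conf n) (\<lambda>x y z u. F x y z u * monomial n p q r s x y z u)) \<longrightarrow>
     (\<forall>p q r s. 0 \<le> quad_sum (conf n) (\<lambda>x y z u. G x y z u * F x y z u * monomial n p q r s x y z u))"
   and H: "\<forall>F. (\<forall>p q r s. 0 \<le> quad_sum (conf n) (\<lambda>x y z u. F x y z u * monomial n p q r s x y z u)) \<longrightarrow>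
     (\<forall>p q r s. 0 \<le> quad_sum (conf n) (\<lambda>x y z u. H x y z u * F x y z u * monomial n p q r s x y z u))"
   and F: "\<forall>p q r s. 0 \<le> quad_sum (conf n) (\<lambda>x y z u. F x y z u * monomial n p q r s x y z u)"
  from G[rule_format, of "\<lambda>x y z u. H x y z u * F x y z u", OF H[rule_format, OF F[rule_format]]]
  show "0 \<le> quad_sum (conf n) (\<lambda>x y z u. G x y z u * H x y z u * F x y z u * monomial n p q r s x y z u)"
    by (simp add: mult.assoc)
qed

lemma cone_const: "0 \<le> c \<Longrightarrow> cone n (\<lambda>_ _ _ _. c)"
  unfolding cone_def quad_sum_def by (simp add: mult.assoc flip: sum_distrib_left)

lemma cone_sum:
  "(\<And>k. k \<in> K \<Longrightarrow> cone n (G k)) \<Longrightarrow> cone n (\<lambda>x y z u. \<Sum>k\<in>K. G k x y z u)"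
  by (induction K rule: infinite_finite_induct) (auto intro!: cone_add cone_const)

lemma cone_power: "cone n G \<Longrightarrow> cone n (\<lambda>x y z u. G x y z u ^ k)"
  by (induction k) (auto intro!: cone_mult cone_const)

text \<open>The sums over configurations are finite and commute with the exponential series, whose
  coefficients are non-negative.\<close>

lemma cone_exp:
  assumes "cone n G"
  shows "cone n (\<lambda>x y z u. exp (G x y z u))"
  unfolding cone_def
proof (intro allI impI)
  fix F p q r s
  assume F: "\<forall>p q r s. 0 \<le> quad_sum (conf n) (\<lambda>x y z u. F x y z u * monomial n p q r s x y z u)"
  let ?m = "monomial n p q r s"
  have "(\<lambda>k. quad_sum (conf n) (\<lambda>x y z u. inverse (fact k) * G x y z u ^ k * F x y z u * ?m x y z u))
      sums quad_sum (conf n) (\<lambda>x y z u. exp (G x y z u) * F x y z u * ?m x y z u)"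
    unfolding quad_sum_def
    by (intro sums_sum sums_mult2) (use exp_converges[where 'a = real] in \<open>simp add: field_simps\<close>)
  moreover have "0 \<le> quad_sum (conf n) (\<lambda>x y z u. inverse (fact k) * G x y z u ^ k * F x y z u * ?m x y z u)" for k
  proof -
    have "cone n (\<lambda>x y z u. inverse (fact k) * G x y z u ^ k)"
      by (intro cone_mult cone_const cone_power assms) simp
    then show ?thesis using F unfolding cone_def by blast
  qed
  ultimately show "0 \<le> quad_sum (conf n) (\<lambda>x y z u. exp (G x y z u) * F x y z u * ?m x y z u)"
    by (rule sums_le[OF _ sums_zero, rotated])
qed

lemma monomial_Suc:
  assumes "i < n"
  shows "monomial n (p(i := Suc (p i))) q r s x y z u = rot0 (x i) (y i) (z i) (u i) * monomial n p q r s x y z u"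
    "monomial n p (q(i := Suc (q i))) r s x y z u = rot1 (x i) (y i) (z i) (u i) * monomial n p q r s x y z u"
    "monomial n p q (r(i := Suc (r i))) s x y z u = rot2 (x i) (y i) (z i) (u i) * monomial n p q r s x y z u"
    "monomial n p q r (s(i := Suc (s i))) x y z u = rot3 (x i) (y i) (z i) (u i) * monomial n p q r s x y z u"
  using assms unfolding monomial_def
  by (simp_all add: prod.remove[of "{..<n}" i] site_monomial_def)

text \<open>Multiplication by a rotated spin raises one exponent of the monomial, and
  \<open>cone\<close> quantifies over all exponents.\<close>

lemma cone_rot:
  assumes "i < n"
  shows "cone n (\<lambda>x y z u. rot0 (x i) (y i) (z i) (u i))" "cone n (\<lambda>x y z u. rot1 (x i) (y i) (z i) (u i))"
    "cone n (\<lambda>x y z u. rot2 (x i) (y i) (z i) (u i))" "cone n (\<lambda>x y z u. rot3 (x i) (y i) (z i) (u i))"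
proof -
  show "cone n (\<lambda>x y z u. rot0 (x i) (y i) (z i) (u i))"
    unfolding cone_def
  proof (intro allI impI)
    fix F p q r s assume "\<forall>p q r s. 0 \<le> quad_sum (conf n) (\<lambda>x y z u. F x y z u * monomial n p q r s x y z u)"
    from this[rule_format, of "p(i := Suc (p i))" q r s] show "0 \<le> quad_sum (conf n)
      (\<lambda>x y z u. rot0 (x i) (y i) (z i) (u i) * F x y z u * monomial n p q r s x y z u)"
      by (simp add: monomial_Suc[OF assms] mult_ac)
  qed
  show "cone n (\<lambda>x y z u. rot1 (x i) (y i) (z i) (u i))"
    unfolding cone_def
  proof (intro allI impI)
    fix F p q r s assume "\<forall>p q r s. 0 \<le> quad_sum (conf n) (\<lambda>x y z u. F x y z u * monomial n p q r s x y z u)"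
    from this[rule_format, of p "q(i := Suc (q i))" r s] show "0 \<le> quad_sum (conf n)
      (\<lambda>x y z u. rot1 (x i) (y i) (z i) (u i) * F x y z u * monomial n p q r s x y z u)"
      by (simp add: monomial_Suc[OF assms] mult_ac)
  qed
  show "cone n (\<lambda>x y z u. rot2 (x i) (y i) (z i) (u i))"
    unfolding cone_def
  proof (intro allI impI)
    fix F p q r s assume "\<forall>p q r s. 0 \<le> quad_sum (conf n) (\<lambda>x y z u. F x y z u * monomial n p q r s x y z u)"
    from this[rule_format, of p q "r(i := Suc (r i))" s] show "0 \<le> quad_sum (conf n)
      (\<lambda>x y z u. rot2 (x i) (y i) (z i) (u i) * F x y z u * monomial n p q r s x y z u)"
      by (simp add: monomial_Suc[OF assms] mult_ac)
  qed
  show "cone n (\<lambda>x y z u. rot3 (x i) (y i) (z i) (u i))"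
    unfolding cone_def
  proof (intro allI impI)
    fix F p q r s assume "\<forall>p q r s. 0 \<le> quad_sum (conf n) (\<lambda>x y z u. F x y z u * monomial n p q r s x y z u)"
    from this[rule_format, of p q r "s(i := Suc (s i))"] show "0 \<le> quad_sum (conf n)
      (\<lambda>x y z u. rot3 (x i) (y i) (z i) (u i) * F x y z u * monomial n p q r s x y z u)"
      by (simp add: monomial_Suc[OF assms] mult_ac)
  qed
qed

definition gibbs :: "nat \<Rightarrow> (nat \<Rightarrow> nat \<Rightarrow> real) \<Rightarrow> (nat \<Rightarrow> real) \<Rightarrow> (nat \<Rightarrow> real) \<Rightarrow> real" where
  "gibbs n a h \<sigma> = exp (ip n \<sigma> (mv n a \<sigma>) / 2 + ip n h \<sigma>)"

text \<open>In the rotated spins the exponent has the coefficients \<open>a i j / 2\<close> and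
  \<open>2 * h i\<close>: a field that is equal in all four replicas couples to \<open>rot0\<close>
  only. No coefficient is negative.\<close>

lemma cone_gibbs:
  assumes a: "\<And>i j. i < n \<Longrightarrow> j < n \<Longrightarrow> 0 \<le> a i j" and h: "\<And>i. i < n \<Longrightarrow> 0 \<le> h i"
  shows "cone n (\<lambda>x y z u. gibbs n a h x * gibbs n a h y * gibbs n a h z * gibbs n a h u)"
proof -
  have quadr: "ip n x (mv n a x) / 2 + ip n y (mv n a y) / 2 + ip n z (mv n a z) / 2 + ip n u (mv n a u) / 2
    = (\<Sum>i<n. \<Sum>j<n. a i j / 2 *
       (rot0 (x i) (y i) (z i) (u i) * rot0 (x j) (y j) (z j) (u j) + rot1 (x i) (y i) (z i) (u i) * rot1 (x j) (y j) (z j) (u j)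
      + rot2 (x i) (y i) (z i) (u i) * rot2 (x j) (y j) (z j) (u j) + rot3 (x i) (y i) (z i) (u i) * rot3 (x j) (y j) (z j) (u j)))"
    for x y z u
    unfolding rot_orthogonal ip_def mv_def
    by (simp add: sum_distrib_left sum_divide_distrib sum.distrib algebra_simps add_divide_distrib)
  have lin: "ip n h x + ip n h y + ip n h z + ip n h u = (\<Sum>i<n. (2 * h i) * rot0 (x i) (y i) (z i) (u i))" for x y z u
    unfolding ip_def rot0_def sum.distrib[symmetric] by (intro sum.cong refl) (simp add: field_simps)
  have "gibbs n a h x * gibbs n a h y * gibbs n a h z * gibbs n a h u =
     exp ((\<Sum>i<n. \<Sum>j<n. a i j / 2 *
       (rot0 (x i) (y i) (z i) (u i) * rot0 (x j) (y j) (z j) (u j) + rot1 (x i) (y i) (z i) (u i) * rot1 (x j) (y j) (z j) (u j)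
      + rot2 (x i) (y i) (z i) (u i) * rot2 (x j) (y j) (z j) (u j) + rot3 (x i) (y i) (z i) (u i) * rot3 (x j) (y j) (z j) (u j)))
      + (\<Sum>i<n. (2 * h i) * rot0 (x i) (y i) (z i) (u i)))" for x y z u
    unfolding quadr[symmetric] lin[symmetric] gibbs_def by (simp add: exp_add[symmetric] algebra_simps)
  moreover have "cone n (\<lambda>x y z u. exp ((\<Sum>i<n. \<Sum>j<n. a i j / 2 *
       (rot0 (x i) (y i) (z i) (u i) * rot0 (x j) (y j) (z j) (u j) + rot1 (x i) (y i) (z i) (u i) * rot1 (x j) (y j) (z j) (u j)
      + rot2 (x i) (y i) (z i) (u i) * rot2 (x j) (y j) (z j) (u j) + rot3 (x i) (y i) (z i) (u i) * rot3 (x j) (y j) (z j) (u j)))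
      + (\<Sum>i<n. (2 * h i) * rot0 (x i) (y i) (z i) (u i))))"
    by (intro cone_exp cone_add cone_sum cone_mult cone_const cone_rot) (use a h in auto)
  ultimately show ?thesis by simp
qed

subsection \<open>Expectations in the Ising model\<close>

locale ising_model =
  fixes n :: nat and a :: "nat \<Rightarrow> nat \<Rightarrow> real"
  assumes sym: "i < n \<Longrightarrow> j < n \<Longrightarrow> a i j = a j i"
    and nonneg: "i < n \<Longrightarrow> j < n \<Longrightarrow> 0 \<le> a i j"
    and diag: "i < n \<Longrightarrow> a i i = 0"
begin

definition W :: "(nat \<Rightarrow> real) \<Rightarrow> real" where "W \<sigma> = exp (ip n \<sigma> (mv n a \<sigma>) / 2)"

definition Z :: real where "Z = (\<Sum>\<sigma>\<in>conf n. W \<sigma>)"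

definition E :: "((nat \<Rightarrow> real) \<Rightarrow> real) \<Rightarrow> real" where
  "E f = (\<Sum>\<sigma>\<in>conf n. W \<sigma> / Z * f \<sigma>)"

abbreviation m :: "(nat \<Rightarrow> real) \<Rightarrow> nat \<Rightarrow> real" where "m \<equiv> mv n a"

lemma W_pos: "0 < W \<sigma>" by (simp add: W_def)

lemma Z_pos: "0 < Z"
  unfolding Z_def by (intro sum_pos finite_conf conf_nonempty W_pos)

lemma weight_nonneg: "0 \<le> W \<sigma> / Z"
  using W_pos[of \<sigma>] Z_pos by simp

lemma weight_sum: "(\<Sum>\<sigma>\<in>conf n. W \<sigma> / Z) = 1"
  using Z_pos by (simp add: sum_divide_distrib[symmetric] Z_def)

lemma E_const [simp]: "E (\<lambda>_. c) = c"
  by (simp only: E_def sum_distrib_right[symmetric] weight_sum mult_1)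

lemma E_add: "E (\<lambda>\<sigma>. f \<sigma> + g \<sigma>) = E f + E g"
  by (simp add: E_def distrib_left sum.distrib)

lemma E_diff: "E (\<lambda>\<sigma>. f \<sigma> - g \<sigma>) = E f - E g"
  by (simp add: E_def right_diff_distrib sum_subtractf)

lemma E_uminus: "E (\<lambda>\<sigma>. - f \<sigma>) = - E f"
  by (simp add: E_def sum_negf)

lemma E_cmult: "E (\<lambda>\<sigma>. c * f \<sigma>) = c * E f"
  by (simp add: E_def sum_distrib_left mult_ac)

lemma E_divide: "E (\<lambda>\<sigma>. f \<sigma> / c) = E f / c"
  by (simp add: E_def sum_divide_distrib)

lemma E_sum: "E (\<lambda>\<sigma>. \<Sum>k\<in>K. f k \<sigma>) = (\<Sum>k\<in>K. E (f k))"
  unfolding E_def sum_distrib_left by (rule sum.swap)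

lemma E_mono: "(\<And>\<sigma>. \<sigma> \<in> conf n \<Longrightarrow> f \<sigma> \<le> g \<sigma>) \<Longrightarrow> E f \<le> E g"
  unfolding E_def by (intro sum_mono mult_left_mono weight_nonneg) auto

lemma E_nonneg: "(\<And>\<sigma>. \<sigma> \<in> conf n \<Longrightarrow> 0 \<le> f \<sigma>) \<Longrightarrow> 0 \<le> E f"
  unfolding E_def by (intro sum_nonneg mult_nonneg_nonneg weight_nonneg) auto

lemma E_cong: "(\<And>\<sigma>. \<sigma> \<in> conf n \<Longrightarrow> f \<sigma> = g \<sigma>) \<Longrightarrow> E f = E g"
  unfolding E_def by (intro sum.cong) auto

lemma E_Cauchy_Schwarz: "(E (\<lambda>\<sigma>. f \<sigma> * g \<sigma>))\<^sup>2 \<le> E (\<lambda>\<sigma>. (f \<sigma>)\<^sup>2) * E (\<lambda>\<sigma>. (g \<sigma>)\<^sup>2)"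
proof -
  define F G where "F = (\<lambda>\<sigma>. sqrt (W \<sigma> / Z) * f \<sigma>)" and "G = (\<lambda>\<sigma>. sqrt (W \<sigma> / Z) * g \<sigma>)"
  have FG: "F \<sigma> * G \<sigma> = W \<sigma> / Z * (f \<sigma> * g \<sigma>)" for \<sigma>
  proof -
    have "F \<sigma> * G \<sigma> = (sqrt (W \<sigma> / Z) * sqrt (W \<sigma> / Z)) * (f \<sigma> * g \<sigma>)"
      by (simp only: F_def G_def mult_ac)
    also have "sqrt (W \<sigma> / Z) * sqrt (W \<sigma> / Z) = W \<sigma> / Z"
      by (rule real_sqrt_mult_self[THEN trans]) (rule abs_of_nonneg[OF weight_nonneg])
    finally show ?thesis .
  qed
  have FF: "(F \<sigma>)\<^sup>2 = W \<sigma> / Z * (f \<sigma>)\<^sup>2" and GG: "(G \<sigma>)\<^sup>2 = W \<sigma> / Z * (g \<sigma>)\<^sup>2" for \<sigma>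
    unfolding F_def G_def power_mult_distrib by (simp_all only: real_sqrt_pow2[OF weight_nonneg])
  have "(\<Sum>\<sigma>\<in>conf n. F \<sigma> * G \<sigma>)\<^sup>2 \<le> (\<Sum>\<sigma>\<in>conf n. (F \<sigma>)\<^sup>2) * (\<Sum>\<sigma>\<in>conf n. (G \<sigma>)\<^sup>2)"
    by (rule Cauchy_Schwarz_ineq_sum)
  then show ?thesis unfolding FG FF GG E_def .
qed

lemma E_Cauchy_Schwarz_sqrt: "\<bar>E (\<lambda>\<sigma>. f \<sigma> * g \<sigma>)\<bar> \<le> sqrt (E (\<lambda>\<sigma>. (f \<sigma>)\<^sup>2)) * sqrt (E (\<lambda>\<sigma>. (g \<sigma>)\<^sup>2))"
  using real_sqrt_le_mono[OF E_Cauchy_Schwarz[of f g]] by (simp add: real_sqrt_mult)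

lemma E_square_le: "(E f)\<^sup>2 \<le> E (\<lambda>\<sigma>. (f \<sigma>)\<^sup>2)"
  using E_Cauchy_Schwarz[of f "\<lambda>_. 1"] by simp

text \<open>Configurations are extensional functions. Values at indices from \<open>n\<close> on are
  kept, since negating \<open>undefined\<close> could leave \<open>conf n\<close>.\<close>

definition flip_all :: "(nat \<Rightarrow> real) \<Rightarrow> nat \<Rightarrow> real" where
  "flip_all \<sigma> = (\<lambda>i. if i < n then - \<sigma> i else \<sigma> i)"

lemma flip_all_apply: "i < n \<Longrightarrow> flip_all \<sigma> i = - \<sigma> i"
  by (simp add: flip_all_def)

lemma flip_all_conf: "\<sigma> \<in> conf n \<Longrightarrow> flip_all \<sigma> \<in> conf n"
  unfolding conf_def
proof (rule PiE_I)
  fix i assume "\<sigma> \<in> {..<n} \<rightarrow>\<^sub>E {- 1, 1}" "i \<in> {..<n}"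
  then have "\<sigma> i = -1 \<or> \<sigma> i = 1" "i < n" using conf_value[of \<sigma> n i] by (auto simp: conf_def)
  then show "flip_all \<sigma> i \<in> {- 1, 1}" by (auto simp: flip_all_apply)
qed (auto simp: flip_all_def)

lemma flip_all_flip_all: "flip_all (flip_all \<sigma>) = \<sigma>"
  by (rule ext) (simp add: flip_all_def)

lemma flip_all_bij: "bij_betw flip_all (conf n) (conf n)"
  by (rule bij_betw_byWitness[where f' = flip_all]) (simp_all add: flip_all_flip_all flip_all_conf image_subset_iff)

lemma m_flip_all: "m (flip_all \<sigma>) i = - m \<sigma> i"
  by (simp add: mv_def flip_all_apply sum_negf)

lemma W_flip_all: "W (flip_all \<sigma>) = W \<sigma>"
  unfolding W_def ip_def by (simp add: m_flip_all flip_all_apply)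

lemma E_flip_all: "E (\<lambda>\<sigma>. f (flip_all \<sigma>)) = E f"
proof -
  have "E f = (\<Sum>\<sigma>\<in>conf n. W (flip_all \<sigma>) / Z * f (flip_all \<sigma>))"
    unfolding E_def by (rule sum.reindex_bij_betw[OF flip_all_bij, symmetric])
  then show ?thesis by (simp add: E_def W_flip_all)
qed

lemma E_odd:
  assumes "\<And>\<sigma>. \<sigma> \<in> conf n \<Longrightarrow> f (flip_all \<sigma>) = - f \<sigma>"
  shows "E f = 0"
proof -
  have "E (\<lambda>\<sigma>. f (flip_all \<sigma>)) = E (\<lambda>\<sigma>. - f \<sigma>)"
    by (rule E_cong) (rule assms)
  then show ?thesis using E_flip_all[of f] E_uminus[of f] by linarith
qed

text \<open>The lattice condition for the weight holds because \<open>s * t\<close> is supermodular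
  and the couplings are non-negative.\<close>

lemma FKG_E:
  assumes f: "\<And>x y. x \<in> conf n \<Longrightarrow> y \<in> conf n \<Longrightarrow> (\<And>i. i < n \<Longrightarrow> x i \<le> y i) \<Longrightarrow> f x \<le> f y"
    and g: "\<And>x y. x \<in> conf n \<Longrightarrow> y \<in> conf n \<Longrightarrow> (\<And>i. i < n \<Longrightarrow> x i \<le> y i) \<Longrightarrow> g x \<le> g y"
  shows "E f * E g \<le> E (\<lambda>\<sigma>. f \<sigma> * g \<sigma>)"
proof -
  have "(\<Sum>x\<in>conf n. W x / Z * f x) * (\<Sum>x\<in>conf n. W x / Z * g x)
       \<le> (\<Sum>x\<in>conf n. W x / Z * (f x * g x)) * (\<Sum>x\<in>conf n. W x / Z)"
  proof (rule FKG)
    show "0 \<le> W x / Z" for x by (rule weight_nonneg)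
    show "f x \<le> f y" if "x \<in> conf n" "y \<in> conf n" "\<And>i. i < n \<Longrightarrow> x i \<le> y i" for x y
      using that by (rule f)
    show "g x \<le> g y" if "x \<in> conf n" "y \<in> conf n" "\<And>i. i < n \<Longrightarrow> x i \<le> y i" for x y
      using that by (rule g)
    fix x y :: "nat \<Rightarrow> real" assume xy: "x \<in> conf n" "y \<in> conf n"
    let ?z = "\<lambda>i. max (x i) (y i)" and ?u = "\<lambda>i. min (x i) (y i)"
    have super: "s * t + s' * t' \<le> max s s' * max t t' + min s s' * min t t'" for s t s' t' :: real
    proof -
      have "s * t + s' * t' \<le> s' * t + s * t'" if "(s' - s) * (t' - t) \<le> 0"
        using that by (simp add: algebra_simps)
      then show ?thesis
        by (cases "s \<le> s'"; cases "t \<le> t'") (simp_all add: max_def min_def mult_le_0_iff)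
    qed
    have "ip n x (m x) + ip n y (m y) = (\<Sum>i<n. \<Sum>j<n. a i j * (x i * x j + y i * y j))"
      by (simp add: ip_def mv_def sum_distrib_left sum.distrib algebra_simps)
    also have "\<dots> \<le> (\<Sum>i<n. \<Sum>j<n. a i j * (?z i * ?z j + ?u i * ?u j))"
      by (intro sum_mono mult_left_mono super nonneg) auto
    also have "\<dots> = ip n ?z (m ?z) + ip n ?u (m ?u)"
      by (simp add: ip_def mv_def sum_distrib_left sum.distrib algebra_simps)
    finally have "W x * W y \<le> W ?z * W ?u"
      by (simp add: W_def exp_add[symmetric])
    then show "W x / Z * (W y / Z) \<le> W ?z / Z * (W ?u / Z)"
      using Z_pos by (simp add: divide_simps)
  qed
  then show ?thesis by (simp add: E_def weight_sum)
qed

text \<open>Oddness gives mean zero, so positive correlation becomes a non-negative mixed moment,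
  the form in which FKG is applied below.\<close>

corollary FKG_odd:
  assumes f: "\<And>x y. x \<in> conf n \<Longrightarrow> y \<in> conf n \<Longrightarrow> (\<And>i. i < n \<Longrightarrow> x i \<le> y i) \<Longrightarrow> f x \<le> f y"
    and g: "\<And>x y. x \<in> conf n \<Longrightarrow> y \<in> conf n \<Longrightarrow> (\<And>i. i < n \<Longrightarrow> x i \<le> y i) \<Longrightarrow> g x \<le> g y"
    and odd: "\<And>\<sigma>. \<sigma> \<in> conf n \<Longrightarrow> f (flip_all \<sigma>) = - f \<sigma>"
  shows "0 \<le> E (\<lambda>\<sigma>. f \<sigma> * g \<sigma>)"
proof -
  have "E f = 0" by (rule E_odd) (rule odd)
  moreover have "E f * E g \<le> E (\<lambda>\<sigma>. f \<sigma> * g \<sigma>)"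
    by (rule FKG_E) (rule f g; assumption)+
  ultimately show ?thesis by simp
qed

lemma m_mono: "i < n \<Longrightarrow> (\<And>i. i < n \<Longrightarrow> x i \<le> y i) \<Longrightarrow> m x i \<le> m y i"
  unfolding mv_def by (intro sum_mono mult_left_mono nonneg) auto

lemma Lebowitz:
  assumes c: "\<And>i. i < n \<Longrightarrow> 0 \<le> c i" and e: "\<And>i. i < n \<Longrightarrow> 0 \<le> e i"
  shows "E (\<lambda>\<sigma>. ip n c \<sigma> ^ 3 * ip n e \<sigma>) \<le> 3 * E (\<lambda>\<sigma>. (ip n c \<sigma>)\<^sup>2) * E (\<lambda>\<sigma>. ip n c \<sigma> * ip n e \<sigma>)"
proof -
  have WG: "W = gibbs n a (\<lambda>_. 0)"
    by (auto simp: W_def gibbs_def ip_def)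
  have odd: "E (ip n v) = 0" for v
    by (rule E_odd) (simp add: ip_def flip_all_apply sum_negf)
  have lin: "(\<Sum>i<n. v i * rot0 (x i) (y i) (z i) (u i)) = (ip n v x + ip n v y + ip n v z + ip n v u) / 2"
    "(\<Sum>i<n. v i * rot1 (x i) (y i) (z i) (u i)) = (ip n v x + ip n v y - ip n v z - ip n v u) / 2"
    "(\<Sum>i<n. v i * rot2 (x i) (y i) (z i) (u i)) = (ip n v x - ip n v y + ip n v z - ip n v u) / 2"
    "(\<Sum>i<n. v i * rot3 (x i) (y i) (z i) (u i)) = (- ip n v x + ip n v y + ip n v z - ip n v u) / 2"
    for v x y z u
    unfolding ip_def rot_defs
    by (simp_all only: times_divide_eq_right sum_divide_distrib[symmetric])
      (simp_all add: sum.distrib sum_subtractf sum_negf distrib_left right_diff_distrib)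
  \<comment> \<open>The factor 16 undoes the four halves in the rotations, and \<open>Z ^ 4\<close>
    normalises the four replicas.\<close>
  have "cone n (\<lambda>x y z u. 16 / Z ^ 4 * ((\<Sum>i<n. c i * rot0 (x i) (y i) (z i) (u i)) * (\<Sum>i<n. c i * rot1 (x i) (y i) (z i) (u i))
      * (\<Sum>i<n. c i * rot2 (x i) (y i) (z i) (u i)) * (\<Sum>i<n. e i * rot3 (x i) (y i) (z i) (u i))
      * (W x * W y * W z * W u)))"
    unfolding WG by (intro cone_mult cone_sum cone_const cone_rot cone_gibbs) (use c e nonneg Z_pos in auto)
  moreover have "16 / Z ^ 4 * (A / 2 * (B / 2) * (C / 2) * (D / 2) * (s * t * p * q))
      = A * B * C * D * (s / Z * (t / Z) * (p / Z) * (q / Z))" for A B C D s t p q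
    by (simp add: power4_eq_xxxx)
  ultimately have "cone n (\<lambda>x y z u. (ip n c x + ip n c y + ip n c z + ip n c u)
     * (ip n c x + ip n c y - ip n c z - ip n c u) * (ip n c x - ip n c y + ip n c z - ip n c u)
     * (- ip n e x + ip n e y + ip n e z - ip n e u) * (W x / Z * (W y / Z) * (W z / Z) * (W u / Z)))"
    unfolding lin by (simp only:)
  from cone_nonneg[OF this]
  have "0 \<le> quad_sum (conf n) (\<lambda>x y z u. (ip n c x + ip n c y + ip n c z + ip n c u)
     * (ip n c x + ip n c y - ip n c z - ip n c u) * (ip n c x - ip n c y + ip n c z - ip n c u)
     * (- ip n e x + ip n e y + ip n e z - ip n e u) * (W x / Z * (W y / Z) * (W z / Z) * (W u / Z)))" .
  from Lebowitz_expand[OF _ weight_sum _ _ this, of E] odd show ?thesis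
    by (simp add: E_def[abs_def])
qed

end

subsection \<open>Conditional expectations and concentration of the spin noise\<close>

lemma tanh_deriv: "(tanh has_real_derivative (1 - (tanh x)\<^sup>2)) (at x)" for x :: real
proof -
  have "cosh x \<noteq> 0" using cosh_real_pos[of x] by simp
  from has_field_derivative_tanh[OF this DERIV_ident] show ?thesis by simp
qed

text \<open>The excess of a field over the mean spin it induces. At the critical temperature the
  linear parts cancel, and this function, close to \<open>x ^ 3 / 3\<close> near 0, is the restoring
  force of the magnetization.\<close>

definition tgap :: "real \<Rightarrow> real" where "tgap x = x - tanh x"

lemma tgap_deriv: "(tgap has_real_derivative (tanh x)\<^sup>2) (at x)"
  unfolding tgap_def[abs_def] by (auto intro!: derivative_eq_intros tanh_deriv)

lemma tgap_mono:
  assumes "x \<le> y"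
  shows "tgap x \<le> tgap y"
proof (rule DERIV_nonneg_imp_nondecreasing[OF assms, where f = tgap])
  fix t :: real
  show "\<exists>d. (tgap has_real_derivative d) (at t) \<and> 0 \<le> d"
    by (rule exI[of _ "(tanh t)\<^sup>2"]) (simp add: tgap_deriv)
qed

lemma tanh_diff_le: "x \<le> y \<Longrightarrow> tanh y - tanh x \<le> y - x" for x y :: real
  using tgap_mono[of x y] by (simp add: tgap_def)

lemma tanh_Lipschitz: "\<bar>tanh x - tanh y\<bar> \<le> \<bar>x - y\<bar>" for x y :: real
  using tanh_diff_le[of x y] tanh_diff_le[of y x] tanh_real_le_iff[of x y] by linarith

lemma tgap_Lipschitz: "\<bar>tgap x - tgap y\<bar> \<le> \<bar>x - y\<bar>"
  using tgap_mono[of x y] tgap_mono[of y x] tanh_real_le_iff[of x y] unfolding tgap_def by linarith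

lemma tgap_minus: "tgap (- x) = - tgap x"
  by (simp add: tgap_def)

lemma tgap_0 [simp]: "tgap 0 = 0"
  by (simp add: tgap_def)

lemma tgap_nonneg: "0 \<le> x \<Longrightarrow> 0 \<le> tgap x"
  using tgap_mono[of 0 x] by simp

lemma tanh_abs_le: "\<bar>tanh x\<bar> \<le> \<bar>x\<bar>" for x :: real
  using tanh_Lipschitz[of x 0] by simp

text \<open>The derivative is \<open>t\<^sup>2 - (tanh t)\<^sup>2\<close>. Monotonicity, and not
  only the sign, is recorded because FKG is applied to this difference.\<close>

lemma cube_minus_tgap_mono:
  assumes "x \<le> y"
  shows "x ^ 3 / 3 - tgap x \<le> y ^ 3 / 3 - tgap y"
proof (rule DERIV_nonneg_imp_nondecreasing[OF assms, where f = "\<lambda>x. x ^ 3 / 3 - tgap x"])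
  fix t :: real
  have "((\<lambda>x. x ^ 3 / 3 - tgap x) has_real_derivative t\<^sup>2 - (tanh t)\<^sup>2) (at t)"
    by (auto intro!: derivative_eq_intros tgap_deriv)
  moreover have "(tanh t)\<^sup>2 \<le> t\<^sup>2" using tanh_abs_le by (simp add: abs_le_square_iff)
  ultimately show "\<exists>d. ((\<lambda>x. x ^ 3 / 3 - tgap x) has_real_derivative d) (at t) \<and> 0 \<le> d" by auto
qed

lemma exp_diff_le: "\<bar>exp x - exp y\<bar> \<le> \<bar>x - y\<bar> * (exp x + exp y)" for x y :: real
proof -
  have *: "exp x - exp y \<le> \<bar>x - y\<bar> * (exp x + exp y)" for x y :: real
  proof -
    have "1 + (y - x) \<le> exp (y - x)" by (rule exp_ge_add_one_self)
    then have "exp x * (1 + (y - x)) \<le> exp x * exp (y - x)" by (intro mult_left_mono) auto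
    then have "exp x - exp y \<le> (x - y) * exp x" by (simp add: exp_diff algebra_simps)
    also have "\<dots> \<le> \<bar>x - y\<bar> * (exp x + exp y)" by (intro mult_mono) auto
    finally show ?thesis .
  qed
  show ?thesis using *[of x y] *[of y x] by (simp add: abs_le_iff abs_minus_commute add.commute)
qed

section \<open>Single spin flips and the heat bath\<close>

context ising_model
begin

definition flip :: "nat \<Rightarrow> (nat \<Rightarrow> real) \<Rightarrow> nat \<Rightarrow> real" where
  "flip j \<sigma> = \<sigma>(j := - \<sigma> j)"

lemma flip_conf: "j < n \<Longrightarrow> \<sigma> \<in> conf n \<Longrightarrow> flip j \<sigma> \<in> conf n"
  unfolding conf_def flip_def
proof (rule PiE_I)
  fix i assume *: "j < n" "\<sigma> \<in> {..<n} \<rightarrow>\<^sub>E {- 1, 1}" "i \<in> {..<n}"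
  then have "\<sigma> k = -1 \<or> \<sigma> k = 1" if "k < n" for k using conf_value[of \<sigma> n k] that by (simp add: conf_def)
  from this[of i] this[of j] * show "(\<sigma>(j := - \<sigma> j)) i \<in> {- 1, 1}" by auto
qed auto

lemma flip_flip: "flip j (flip j \<sigma>) = \<sigma>"
  by (simp add: flip_def)

lemma flip_bij: "j < n \<Longrightarrow> bij_betw (flip j) (conf n) (conf n)"
  by (rule bij_betw_byWitness[where f' = "flip j"]) (simp_all add: flip_flip flip_conf image_subset_iff)

lemma sum_flip:
  assumes "j < n"
  shows "(\<Sum>i<n. f i * flip j \<sigma> i) = (\<Sum>i<n. f i * \<sigma> i) - 2 * f j * \<sigma> j"
proof -
  have "(\<Sum>i<n. f i * flip j \<sigma> i) = (\<Sum>i<n. f i * \<sigma> i - (if i = j then 2 * f i * \<sigma> i else 0))"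
    by (intro sum.cong) (auto simp: flip_def)
  then show ?thesis using assms by (simp add: sum_subtractf)
qed

lemma m_flip: "j < n \<Longrightarrow> m (flip j \<sigma>) i = m \<sigma> i - 2 * a i j * \<sigma> j"
  unfolding mv_def by (rule sum_flip)

lemma W_flip:
  assumes "j < n"
  shows "W (flip j \<sigma>) = W \<sigma> * exp (- 2 * \<sigma> j * m \<sigma> j)"
proof -
  have "ip n (flip j \<sigma>) (m (flip j \<sigma>)) = (\<Sum>i<n. (m \<sigma> i - 2 * a i j * \<sigma> j) * flip j \<sigma> i)"
    by (simp add: ip_def m_flip[OF assms] mult.commute)
  also have "\<dots> = (\<Sum>i<n. (m \<sigma> i - 2 * a i j * \<sigma> j) * \<sigma> i) - 2 * (m \<sigma> j - 2 * a j j * \<sigma> j) * \<sigma> j"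
    by (rule sum_flip[OF assms])
  also have "(\<Sum>i<n. (m \<sigma> i - 2 * a i j * \<sigma> j) * \<sigma> i) = ip n \<sigma> (m \<sigma>) - 2 * \<sigma> j * (\<Sum>i<n. a i j * \<sigma> i)"
    unfolding ip_def sum_distrib_left sum_subtractf[symmetric] by (intro sum.cong) (simp_all add: algebra_simps)
  also have "(\<Sum>i<n. a i j * \<sigma> i) = m \<sigma> j"
    unfolding mv_def by (intro sum.cong) (use sym assms in auto)
  finally have "ip n (flip j \<sigma>) (m (flip j \<sigma>)) = ip n \<sigma> (m \<sigma>) - 4 * \<sigma> j * m \<sigma> j"
    using diag[OF assms] by (simp add: algebra_simps)
  then show ?thesis by (simp add: W_def exp_add[symmetric] diff_divide_distrib)
qed

text \<open>The spin minus its conditional expectation given the other spins; as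
  \<open>a j j = 0\<close>, the field at \<open>j\<close> is a function of the others.\<close>

definition nz :: "(nat \<Rightarrow> real) \<Rightarrow> nat \<Rightarrow> real" where "nz \<sigma> j = \<sigma> j - tanh (m \<sigma> j)"

text \<open>Twice the probability that a heat bath update at \<open>j\<close> reverses the
  spin.\<close>

definition kap :: "(nat \<Rightarrow> real) \<Rightarrow> nat \<Rightarrow> real" where "kap \<sigma> j = 1 - \<sigma> j * tanh (m \<sigma> j)"

lemma nz_eq_kap: "\<sigma> \<in> conf n \<Longrightarrow> j < n \<Longrightarrow> nz \<sigma> j = \<sigma> j * kap \<sigma> j"
  using conf_sq[of \<sigma> n j] by (simp add: nz_def kap_def right_diff_distrib flip: mult.assoc)

lemma kap_bounds: "\<sigma> \<in> conf n \<Longrightarrow> j < n \<Longrightarrow> 0 \<le> kap \<sigma> j" "\<sigma> \<in> conf n \<Longrightarrow> j < n \<Longrightarrow> kap \<sigma> j \<le> 2"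
  using conf_value[of \<sigma> n j] tanh_real_lt_1[of "m \<sigma> j"] tanh_real_gt_neg1[of "m \<sigma> j"]
  by (auto simp: kap_def)

lemma nz_abs: "\<sigma> \<in> conf n \<Longrightarrow> j < n \<Longrightarrow> \<bar>nz \<sigma> j\<bar> = kap \<sigma> j"
  using nz_eq_kap[of \<sigma> j] kap_bounds[of \<sigma> j] conf_abs[of \<sigma> n j] by (simp add: abs_mult)

lemma detailed_balance:
  assumes "j < n" "\<sigma> \<in> conf n"
  shows "W (flip j \<sigma>) * kap (flip j \<sigma>) j = W \<sigma> * kap \<sigma> j"
proof -
  have mj: "m (flip j \<sigma>) j = m \<sigma> j"
    using m_flip[OF assms(1), of \<sigma> j] diag[OF assms(1)] by simp
  have t: "exp (- 2 * u) * (1 + tanh u) = 1 - tanh u" for u :: real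
  proof -
    have "exp u + exp (- u) \<noteq> 0" by (metis add_pos_pos exp_gt_zero less_irrefl)
    then show ?thesis
      by (simp add: tanh_def sinh_def cosh_def field_simps exp_add[symmetric] flip: exp_add)
  qed
  have flipj: "flip j \<sigma> j = - \<sigma> j" by (simp add: flip_def)
  consider "\<sigma> j = 1" | "\<sigma> j = -1" using conf_value[OF assms(2,1)] by auto
  then show ?thesis
  proof cases
    case 1
    then show ?thesis
      using t[of "m \<sigma> j"] flipj by (simp add: W_flip[OF assms(1)] kap_def mj mult.assoc)
  next
    case 2
    then show ?thesis
      using t[of "- m \<sigma> j"] flipj by (simp add: W_flip[OF assms(1)] kap_def mj mult.assoc)
  qed
qed

lemma E_kap_flip:
  assumes "j < n"
  shows "E (\<lambda>\<sigma>. kap \<sigma> j * f (flip j \<sigma>)) = E (\<lambda>\<sigma>. kap \<sigma> j * f \<sigma>)"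
proof -
  have "E (\<lambda>\<sigma>. kap \<sigma> j * f \<sigma>) = (\<Sum>\<sigma>\<in>conf n. W (flip j \<sigma>) * kap (flip j \<sigma>) j / Z * f (flip j \<sigma>))"
    unfolding E_def by (subst sum.reindex_bij_betw[OF flip_bij[OF assms], symmetric]) (simp add: mult_ac)
  also have "\<dots> = (\<Sum>\<sigma>\<in>conf n. W \<sigma> * kap \<sigma> j / Z * f (flip j \<sigma>))"
    by (intro sum.cong refl) (simp add: detailed_balance[OF assms])
  finally show ?thesis by (simp add: E_def mult.assoc)
qed

text \<open>Under the weight \<open>kap \<sigma> j\<close> the flip of spin \<open>j\<close> is
  reversible, and \<open>nz \<sigma> j\<close> is this weight times the odd function
  \<open>\<sigma> j\<close>. So only the part of \<open>f\<close> that is antisymmetric under the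
  flip contributes.\<close>

lemma E_nz:
  assumes "j < n"
  shows "E (\<lambda>\<sigma>. nz \<sigma> j * f \<sigma>) = E (\<lambda>\<sigma>. nz \<sigma> j * (f \<sigma> - f (flip j \<sigma>))) / 2"
proof -
  have "E (\<lambda>\<sigma>. nz \<sigma> j * f (flip j \<sigma>)) = E (\<lambda>\<sigma>. kap \<sigma> j * (- (flip j \<sigma> j) * f (flip j \<sigma>)))"
    by (rule E_cong) (simp add: nz_eq_kap assms flip_def)
  also have "\<dots> = E (\<lambda>\<sigma>. kap \<sigma> j * (- \<sigma> j * f \<sigma>))"
    by (rule E_kap_flip[OF assms])
  also have "\<dots> = E (\<lambda>\<sigma>. - (nz \<sigma> j * f \<sigma>))"
    by (rule E_cong) (simp add: nz_eq_kap assms)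
  finally show ?thesis by (simp add: right_diff_distrib E_diff E_uminus)
qed

lemma E_exp_deriv:
  "((\<lambda>\<theta>. E (\<lambda>\<sigma>. F \<sigma> ^ k * exp (\<theta> * F \<sigma>))) has_real_derivative
    E (\<lambda>\<sigma>. F \<sigma> ^ Suc k * exp (\<theta> * F \<sigma>))) (at \<theta>)"
  unfolding E_def by (auto intro!: derivative_eq_intros sum.cong simp: mult_ac Z_pos[THEN less_imp_neq, symmetric])

lemma E_pos: "(\<And>\<sigma>. 0 < f \<sigma>) \<Longrightarrow> 0 < E f"
  unfolding E_def by (intro sum_pos finite_conf conf_nonempty mult_pos_pos divide_pos_pos W_pos Z_pos)

text \<open>Chatterjee's method of exchangeable pairs.\<close>

lemma nz_exp_moment:
  assumes row: "\<And>i. i < n \<Longrightarrow> (\<Sum>j<n. a i j) \<le> 3 / 2"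
  shows "E (\<lambda>\<sigma>. exp (ip n c (nz \<sigma>))) \<le> exp (5 * ip n c c)"
proof -
  define f where "f = (\<lambda>\<sigma>. ip n c (nz \<sigma>))"
  \<comment> \<open>Flipping \<open>j\<close> changes \<open>f\<close> directly by at most
    \<open>2 * \<bar>c j\<bar>\<close>; the second term bounds the change through
    \<open>tanh\<close> of the other fields.\<close>
  define \<Delta> where "\<Delta> = (\<lambda>j. 2 * \<bar>c j\<bar> + 2 * mv n a (\<lambda>i. \<bar>c i\<bar>) j)"
  have \<Delta>0: "0 \<le> \<Delta> j" if "j < n" for j
    unfolding \<Delta>_def mv_def using nonneg that by (auto intro!: add_nonneg_nonneg sum_nonneg mult_nonneg_nonneg)
  have ff: "\<bar>f \<sigma> - f (flip j \<sigma>)\<bar> \<le> \<Delta> j" if j: "j < n" and \<sigma>: "\<sigma> \<in> conf n" for j \<sigma>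
  proof -
    have "f \<sigma> - f (flip j \<sigma>) = (\<Sum>i<n. c i * \<sigma> i) - (\<Sum>i<n. c i * flip j \<sigma> i)
        - (\<Sum>i<n. c i * (tanh (m \<sigma> i) - tanh (m (flip j \<sigma>) i)))"
      by (simp add: f_def ip_def nz_def sum_subtractf right_diff_distrib)
    also have "\<dots> = 2 * c j * \<sigma> j - (\<Sum>i<n. c i * (tanh (m \<sigma> i) - tanh (m (flip j \<sigma>) i)))"
      by (simp add: sum_flip[OF j])
    finally have "\<bar>f \<sigma> - f (flip j \<sigma>)\<bar> = \<bar>2 * c j * \<sigma> j - (\<Sum>i<n. c i * (tanh (m \<sigma> i) - tanh (m (flip j \<sigma>) i)))\<bar>"
      by simp
    also have "\<dots> \<le> \<bar>2 * c j * \<sigma> j\<bar> + (\<Sum>i<n. \<bar>c i * (tanh (m \<sigma> i) - tanh (m (flip j \<sigma>) i))\<bar>)"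
      by (rule order_trans[OF abs_triangle_ineq4 add_left_mono[OF sum_abs]])
    also have "\<dots> \<le> 2 * \<bar>c j\<bar> + (\<Sum>i<n. \<bar>c i\<bar> * (2 * a j i))"
    proof (rule add_mono[OF _ sum_mono])
      show "\<bar>2 * c j * \<sigma> j\<bar> \<le> 2 * \<bar>c j\<bar>" by (simp add: abs_mult conf_abs[OF \<sigma> j])
      fix i assume "i \<in> {..<n}"
      then have i: "i < n" by simp
      have "\<bar>tanh (m \<sigma> i) - tanh (m (flip j \<sigma>) i)\<bar> \<le> \<bar>m \<sigma> i - m (flip j \<sigma>) i\<bar>"
        by (rule tanh_Lipschitz)
      also have "\<dots> = 2 * a j i"
        using nonneg[OF j i] conf_abs[OF \<sigma> j] unfolding m_flip[OF j] sym[OF i j] by (simp add: abs_mult)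
      finally show "\<bar>c i * (tanh (m \<sigma> i) - tanh (m (flip j \<sigma>) i))\<bar> \<le> \<bar>c i\<bar> * (2 * a j i)"
        unfolding abs_mult by (rule mult_left_mono) simp
    qed
    also have "\<dots> = \<Delta> j" by (simp add: \<Delta>_def mv_def sum_distrib_left mult_ac)
    finally show ?thesis .
  qed
  \<comment> \<open>Here \<open>5 = 2 + 2 * (3 / 2)\<close>, with row sums at most
    \<open>3 / 2\<close>.\<close>
  have c\<Delta>: "(\<Sum>j<n. \<bar>c j\<bar> * \<Delta> j) \<le> 5 * ip n c c"
  proof -
    have "(\<Sum>j<n. \<bar>c j\<bar> * \<Delta> j) = 2 * ip n c c + 2 * ip n (\<lambda>i. \<bar>c i\<bar>) (mv n a (\<lambda>i. \<bar>c i\<bar>))"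
    proof -
      have "(\<Sum>j<n. \<bar>c j\<bar> * \<Delta> j) = (\<Sum>j<n. 2 * (\<bar>c j\<bar> * \<bar>c j\<bar>) + 2 * (\<bar>c j\<bar> * mv n a (\<lambda>i. \<bar>c i\<bar>) j))"
        by (intro sum.cong refl) (simp only: \<Delta>_def algebra_simps)
      then show ?thesis
        by (simp add: ip_def sum.distrib flip: sum_distrib_left)
    qed
    also have "ip n (\<lambda>i. \<bar>c i\<bar>) (mv n a (\<lambda>i. \<bar>c i\<bar>)) \<le> 3 / 2 * (ip n c c + ip n c c) / 2"
      using quadratic_form_le_row_sum[OF sym nonneg row, of "\<lambda>i. \<bar>c i\<bar>" "\<lambda>i. \<bar>c i\<bar>"]
      by (simp add: ip_def flip: abs_mult)
    finally show ?thesis by simp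
  qed
  define M where "M = (\<lambda>\<theta>. E (\<lambda>\<sigma>. exp (\<theta> * f \<sigma>)))"
  define M' where "M' = (\<lambda>\<theta>. E (\<lambda>\<sigma>. f \<sigma> * exp (\<theta> * f \<sigma>)))"
  have der: "(M has_real_derivative M' \<theta>) (at \<theta>)" for \<theta>
    using E_exp_deriv[of f 0 \<theta>] by (simp add: M_def M'_def)
  have M': "M' \<theta> \<le> 10 * \<theta> * ip n c c * M \<theta>" if \<theta>: "0 \<le> \<theta>" for \<theta>
  proof -
    have "M' \<theta> = (\<Sum>j<n. E (\<lambda>\<sigma>. nz \<sigma> j * (c j * exp (\<theta> * f \<sigma>))))"
      unfolding M'_def E_sum[symmetric]
      by (rule E_cong) (simp add: f_def ip_def sum_distrib_right mult_ac)
    also have "\<dots> = (\<Sum>j<n. E (\<lambda>\<sigma>. nz \<sigma> j * (c j * exp (\<theta> * f \<sigma>) - c j * exp (\<theta> * f (flip j \<sigma>)))) / 2)"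
      by (intro sum.cong refl E_nz) auto
    also have "\<dots> \<le> (\<Sum>j<n. E (\<lambda>\<sigma>. kap \<sigma> j * (\<bar>c j\<bar> * (\<theta> * \<Delta> j) * (exp (\<theta> * f \<sigma>) + exp (\<theta> * f (flip j \<sigma>))))) / 2)"
    proof (intro sum_mono divide_right_mono E_mono)
      fix j \<sigma> assume "j \<in> {..<n}" and \<sigma>: "\<sigma> \<in> conf n"
      then have j: "j < n" by simp
      have "\<bar>exp (\<theta> * f \<sigma>) - exp (\<theta> * f (flip j \<sigma>))\<bar>
          \<le> \<bar>\<theta> * f \<sigma> - \<theta> * f (flip j \<sigma>)\<bar> * (exp (\<theta> * f \<sigma>) + exp (\<theta> * f (flip j \<sigma>)))"
        by (rule exp_diff_le)
      also have "\<bar>\<theta> * f \<sigma> - \<theta> * f (flip j \<sigma>)\<bar> \<le> \<theta> * \<Delta> j"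
        using ff[OF j \<sigma>] \<theta> by (simp add: abs_mult mult_left_mono flip: right_diff_distrib)
      finally have *: "\<bar>exp (\<theta> * f \<sigma>) - exp (\<theta> * f (flip j \<sigma>))\<bar>
          \<le> \<theta> * \<Delta> j * (exp (\<theta> * f \<sigma>) + exp (\<theta> * f (flip j \<sigma>)))"
        by (simp add: mult_right_mono add_nonneg_nonneg)
      have "nz \<sigma> j * (c j * exp (\<theta> * f \<sigma>) - c j * exp (\<theta> * f (flip j \<sigma>)))
         \<le> \<bar>nz \<sigma> j * (c j * exp (\<theta> * f \<sigma>) - c j * exp (\<theta> * f (flip j \<sigma>)))\<bar>"
        by (rule abs_ge_self)
      also have "\<dots> = kap \<sigma> j * (\<bar>c j\<bar> * \<bar>exp (\<theta> * f \<sigma>) - exp (\<theta> * f (flip j \<sigma>))\<bar>)"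
        by (simp add: abs_mult nz_abs[OF \<sigma> j] flip: right_diff_distrib)
      also have "\<dots> \<le> kap \<sigma> j * (\<bar>c j\<bar> * (\<theta> * \<Delta> j * (exp (\<theta> * f \<sigma>) + exp (\<theta> * f (flip j \<sigma>)))))"
        by (intro mult_left_mono * kap_bounds \<sigma> j) auto
      finally show "nz \<sigma> j * (c j * exp (\<theta> * f \<sigma>) - c j * exp (\<theta> * f (flip j \<sigma>)))
         \<le> kap \<sigma> j * (\<bar>c j\<bar> * (\<theta> * \<Delta> j) * (exp (\<theta> * f \<sigma>) + exp (\<theta> * f (flip j \<sigma>))))"
        by (simp add: mult.assoc)
    qed auto
    also have "\<dots> = (\<Sum>j<n. \<bar>c j\<bar> * (\<theta> * \<Delta> j) * E (\<lambda>\<sigma>. kap \<sigma> j * exp (\<theta> * f \<sigma>)))"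
    proof (intro sum.cong refl)
      fix j assume "j \<in> {..<n}"
      then have j: "j < n" by simp
      have "E (\<lambda>\<sigma>. kap \<sigma> j * (\<bar>c j\<bar> * (\<theta> * \<Delta> j) * (exp (\<theta> * f \<sigma>) + exp (\<theta> * f (flip j \<sigma>)))))
        = \<bar>c j\<bar> * (\<theta> * \<Delta> j) * (E (\<lambda>\<sigma>. kap \<sigma> j * exp (\<theta> * f \<sigma>)) + E (\<lambda>\<sigma>. kap \<sigma> j * exp (\<theta> * f (flip j \<sigma>))))"
        unfolding E_add[symmetric] E_cmult[symmetric] by (rule E_cong) (simp add: algebra_simps)
      also have "E (\<lambda>\<sigma>. kap \<sigma> j * exp (\<theta> * f (flip j \<sigma>))) = E (\<lambda>\<sigma>. kap \<sigma> j * exp (\<theta> * f \<sigma>))"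
        by (rule E_kap_flip[OF j])
      finally show "E (\<lambda>\<sigma>. kap \<sigma> j * (\<bar>c j\<bar> * (\<theta> * \<Delta> j) * (exp (\<theta> * f \<sigma>) + exp (\<theta> * f (flip j \<sigma>))))) / 2
        = \<bar>c j\<bar> * (\<theta> * \<Delta> j) * E (\<lambda>\<sigma>. kap \<sigma> j * exp (\<theta> * f \<sigma>))"
        by simp
    qed
    also have "\<dots> \<le> (\<Sum>j<n. \<bar>c j\<bar> * (\<theta> * \<Delta> j) * (2 * M \<theta>))"
      unfolding M_def E_cmult[symmetric]
      by (intro sum_mono mult_left_mono E_mono mult_right_mono kap_bounds mult_nonneg_nonneg \<Delta>0 \<theta>) auto
    also have "\<dots> = 2 * \<theta> * M \<theta> * (\<Sum>j<n. \<bar>c j\<bar> * \<Delta> j)"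
      by (simp add: sum_distrib_left mult_ac)
    also have "\<dots> \<le> 2 * \<theta> * M \<theta> * (5 * ip n c c)"
      using \<theta> by (intro mult_left_mono c\<Delta> mult_nonneg_nonneg) (auto simp: M_def intro!: E_nonneg)
    finally show ?thesis by (simp add: mult_ac)
  qed
  \<comment> \<open>The differential inequality
    \<open>M' \<theta> \<le> 10 * \<theta> * ip n c c * M \<theta>\<close> is integrated from 0 to
    1.\<close>
  have "M 1 * exp (- (5 * ip n c c * 1\<^sup>2)) \<le> M 0 * exp (- (5 * ip n c c * 0\<^sup>2))"
  proof (rule DERIV_nonpos_imp_nonincreasing[where f = "\<lambda>\<theta>. M \<theta> * exp (- (5 * ip n c c * \<theta>\<^sup>2))"])
    fix \<theta> :: real assume "0 \<le> \<theta>"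
    have "((\<lambda>\<theta>. M \<theta> * exp (- (5 * ip n c c * \<theta>\<^sup>2))) has_real_derivative
        (M' \<theta> - 10 * \<theta> * ip n c c * M \<theta>) * exp (- (5 * ip n c c * \<theta>\<^sup>2))) (at \<theta>)"
      by (auto intro!: derivative_eq_intros der simp: algebra_simps)
    moreover have "(M' \<theta> - 10 * \<theta> * ip n c c * M \<theta>) * exp (- (5 * ip n c c * \<theta>\<^sup>2)) \<le> 0"
      using M'[OF \<open>0 \<le> \<theta>\<close>] by (intro mult_nonpos_nonneg) auto
    ultimately show "\<exists>y. ((\<lambda>\<theta>. M \<theta> * exp (- (5 * ip n c c * \<theta>\<^sup>2))) has_real_derivative y) (at \<theta>) \<and> y \<le> 0"
      by blast
  qed simp
  then show ?thesis by (simp add: M_def f_def exp_minus field_simps)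
qed

subsection \<open>Correlation inequalities\<close>

lemma correlation_nonneg:
  assumes "i < n" "j < n"
  shows "0 \<le> E (\<lambda>\<sigma>. \<sigma> i * \<sigma> j)"
  by (rule FKG_odd) (use assms in \<open>auto simp: flip_all_apply\<close>)

lemma E_tgap_spin_nonneg:
  assumes "i < n" "j < n"
  shows "0 \<le> E (\<lambda>\<sigma>. tgap (m \<sigma> i) * \<sigma> j)"
  by (rule FKG_odd) (use assms m_mono in \<open>auto simp: m_flip_all tgap_minus intro!: tgap_mono\<close>)

lemma E_spin_tanh:
  assumes "i < n" "j < n" "i \<noteq> j"
  shows "E (\<lambda>\<sigma>. \<sigma> i * \<sigma> j) = E (\<lambda>\<sigma>. tanh (m \<sigma> i) * \<sigma> j)"
proof -
  have "E (\<lambda>\<sigma>. nz \<sigma> i * \<sigma> j) = 0"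
    using E_nz[OF assms(1), of "\<lambda>\<sigma>. \<sigma> j"] assms(3) by (simp add: flip_def)
  then show ?thesis by (simp add: nz_def left_diff_distrib E_diff)
qed

lemma E_m_spin: "E (\<lambda>\<sigma>. m \<sigma> i * \<sigma> j) = mv n a (\<lambda>k. E (\<lambda>\<sigma>. \<sigma> k * \<sigma> j)) i"
  by (simp add: mv_def sum_distrib_right E_sum E_cmult mult.assoc)

text \<open>A Simon--Lieb type inequality.\<close>

lemma correlation_subsolution:
  assumes "i < n" "j < n"
  shows "E (\<lambda>\<sigma>. \<sigma> i * \<sigma> j) \<le> (if i = j then 1 else 0) + mv n a (\<lambda>k. E (\<lambda>\<sigma>. \<sigma> k * \<sigma> j)) i"
proof (cases "i = j")
  case True
  have "E (\<lambda>\<sigma>. \<sigma> i * \<sigma> j) = E (\<lambda>_. 1)"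
    by (rule E_cong) (use True assms conf_sq in auto)
  moreover have "0 \<le> mv n a (\<lambda>k. E (\<lambda>\<sigma>. \<sigma> k * \<sigma> j)) i"
    unfolding mv_def using assms by (intro sum_nonneg mult_nonneg_nonneg nonneg correlation_nonneg) auto
  ultimately show ?thesis using True by simp
next
  case False
  have "E (\<lambda>\<sigma>. \<sigma> i * \<sigma> j) \<le> E (\<lambda>\<sigma>. m \<sigma> i * \<sigma> j)"
    using E_tgap_spin_nonneg[OF assms] E_spin_tanh[OF assms False]
    by (simp add: tgap_def left_diff_distrib E_diff)
  then show ?thesis using False by (simp add: E_m_spin)
qed

text \<open>The two-point bounds are summed against \<open>z\<close>, whose sign preserves them. The
  covariances form a subsolution of \<open>x = z + a x\<close> and can later be tested against
  themselves because they are non-negative.\<close>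

lemma cov_subsolution:
  assumes z: "\<And>i. i < n \<Longrightarrow> 0 \<le> z i" and "i < n"
  shows "0 \<le> E (\<lambda>\<sigma>. \<sigma> i * ip n z \<sigma>)"
    and "E (\<lambda>\<sigma>. \<sigma> i * ip n z \<sigma>) \<le> z i + mv n a (\<lambda>k. E (\<lambda>\<sigma>. \<sigma> k * ip n z \<sigma>)) i"
proof -
  have eq: "E (\<lambda>\<sigma>. \<sigma> k * ip n z \<sigma>) = (\<Sum>j<n. z j * E (\<lambda>\<sigma>. \<sigma> k * \<sigma> j))" for k
    by (simp add: ip_def sum_distrib_left E_sum E_cmult[symmetric] mult_ac)
  show "0 \<le> E (\<lambda>\<sigma>. \<sigma> i * ip n z \<sigma>)"
    unfolding eq using z assms(2) by (intro sum_nonneg mult_nonneg_nonneg correlation_nonneg) auto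
  have "E (\<lambda>\<sigma>. \<sigma> i * ip n z \<sigma>) \<le> (\<Sum>j<n. z j * ((if i = j then 1 else 0) + mv n a (\<lambda>k. E (\<lambda>\<sigma>. \<sigma> k * \<sigma> j)) i))"
    unfolding eq using z assms(2) by (intro sum_mono mult_left_mono correlation_subsolution) auto
  also have "\<dots> = (\<Sum>j<n. (if i = j then z j else 0)) + (\<Sum>j<n. \<Sum>k<n. a i k * (z j * E (\<lambda>\<sigma>. \<sigma> k * \<sigma> j)))"
    unfolding sum.distrib[symmetric] mv_def by (intro sum.cong refl) (simp add: distrib_left sum_distrib_left mult_ac)
  also have "\<dots> = z i + mv n a (\<lambda>k. E (\<lambda>\<sigma>. \<sigma> k * ip n z \<sigma>)) i"
    using assms(2) by (simp add: eq mv_def sum_distrib_left) (rule sum.swap)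
  finally show "E (\<lambda>\<sigma>. \<sigma> i * ip n z \<sigma>) \<le> z i + mv n a (\<lambda>k. E (\<lambda>\<sigma>. \<sigma> k * ip n z \<sigma>)) i" .
qed

lemma m_eq_ip: "m \<sigma> i = ip n (a i) \<sigma>"
  by (simp add: mv_def ip_def)

text \<open>For the upper bound, FKG replaces \<open>tgap (m \<sigma> i)\<close> by
  \<open>m \<sigma> i ^ 3 / 3\<close> and then \<open>tgap (m \<sigma> j)\<close> by
  \<open>m \<sigma> j\<close>, as the differences are increasing and odd. The remaining fourth
  moment is bounded by the Lebowitz inequality, whose factor 3 cancels.\<close>

lemma E_tgap_tgap:
  assumes i: "i < n" and j: "j < n"
  shows "0 \<le> E (\<lambda>\<sigma>. tgap (m \<sigma> i) * tgap (m \<sigma> j))"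
    and "E (\<lambda>\<sigma>. tgap (m \<sigma> i) * tgap (m \<sigma> j)) \<le> E (\<lambda>\<sigma>. (m \<sigma> i)\<^sup>2) * E (\<lambda>\<sigma>. m \<sigma> i * m \<sigma> j)"
proof -
  show "0 \<le> E (\<lambda>\<sigma>. tgap (m \<sigma> i) * tgap (m \<sigma> j))"
    by (rule FKG_odd) (use assms m_mono in \<open>auto simp: m_flip_all tgap_minus intro!: tgap_mono\<close>)
  have "0 \<le> E (\<lambda>\<sigma>. (m \<sigma> i ^ 3 / 3 - tgap (m \<sigma> i)) * tgap (m \<sigma> j))"
    by (rule FKG_odd) (use assms m_mono in \<open>auto simp: m_flip_all tgap_minus intro!: tgap_mono cube_minus_tgap_mono\<close>)
  moreover have "0 \<le> E (\<lambda>\<sigma>. tanh (m \<sigma> j) * m \<sigma> i ^ 3)"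
  proof (rule FKG_odd)
    fix x y :: "nat \<Rightarrow> real" assume "\<And>i. i < n \<Longrightarrow> x i \<le> y i"
    then show "tanh (m x j) \<le> tanh (m y j)" "m x i ^ 3 \<le> m y i ^ 3"
      using m_mono assms by (auto intro!: power_mono_odd)
  qed (simp add: m_flip_all)
  moreover have "E (\<lambda>\<sigma>. m \<sigma> i ^ 3 * m \<sigma> j) \<le> 3 * E (\<lambda>\<sigma>. (m \<sigma> i)\<^sup>2) * E (\<lambda>\<sigma>. m \<sigma> i * m \<sigma> j)"
    unfolding m_eq_ip by (rule Lebowitz) (use nonneg assms in auto)
  moreover have "E (\<lambda>\<sigma>. (m \<sigma> i ^ 3 / 3 - tgap (m \<sigma> i)) * tgap (m \<sigma> j))
      = E (\<lambda>\<sigma>. m \<sigma> i ^ 3 * m \<sigma> j) / 3 - E (\<lambda>\<sigma>. tanh (m \<sigma> j) * m \<sigma> i ^ 3) / 3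
        - E (\<lambda>\<sigma>. tgap (m \<sigma> i) * tgap (m \<sigma> j))"
    unfolding E_divide[symmetric] E_diff[symmetric]
    by (rule E_cong) (simp add: tgap_def algebra_simps add_divide_distrib diff_divide_distrib)
  ultimately show "E (\<lambda>\<sigma>. tgap (m \<sigma> i) * tgap (m \<sigma> j)) \<le> E (\<lambda>\<sigma>. (m \<sigma> i)\<^sup>2) * E (\<lambda>\<sigma>. m \<sigma> i * m \<sigma> j)"
    by linarith
qed

text \<open>GHS for the model in the external field \<open>\<theta> * c\<close>: its non-negativity
  keeps the tilted weight in the cone.\<close>

lemma third_cumulant_nonpos:
  assumes c: "\<And>i. i < n \<Longrightarrow> 0 \<le> c i" and \<theta>: "0 \<le> \<theta>"
  defines "M \<equiv> \<lambda>k. E (\<lambda>\<sigma>. ip n c \<sigma> ^ k * exp (\<theta> * ip n c \<sigma>)) / E (\<lambda>\<sigma>. exp (\<theta> * ip n c \<sigma>))"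
  shows "M 3 - 3 * M 2 * M 1 + 2 * M 1 ^ 3 \<le> 0"
proof -
  define h where "h = (\<lambda>i. \<theta> * c i)"
  define Q where "Q = Z * E (\<lambda>\<sigma>. exp (\<theta> * ip n c \<sigma>))"
  have Q: "Q > 0" unfolding Q_def using Z_pos by (intro mult_pos_pos E_pos) auto
  have G: "gibbs n a h \<sigma> = W \<sigma> * exp (\<theta> * ip n c \<sigma>)" for \<sigma>
    by (simp add: gibbs_def W_def exp_add h_def ip_linear)
  define w where "w = (\<lambda>\<sigma>. gibbs n a h \<sigma> / Q)"
  have MM: "(\<Sum>\<sigma>\<in>conf n. w \<sigma> * f \<sigma>) = E (\<lambda>\<sigma>. f \<sigma> * exp (\<theta> * ip n c \<sigma>)) / E (\<lambda>\<sigma>. exp (\<theta> * ip n c \<sigma>))" for f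
    using Z_pos by (simp add: w_def G Q_def E_def sum_divide_distrib mult_ac)
  have norm: "sum w (conf n) = 1"
  proof -
    have "E (\<lambda>\<sigma>. exp (\<theta> * ip n c \<sigma>)) \<noteq> 0" using Q by (auto simp: Q_def)
    then show ?thesis using MM[of "\<lambda>_. 1"] by simp
  qed
  have lin: "(\<Sum>i<n. v i * rot1 (x i) (y i) (z i) (u i)) = (ip n v x + ip n v y - ip n v z - ip n v u) / 2"
    "(\<Sum>i<n. v i * rot2 (x i) (y i) (z i) (u i)) = (ip n v x - ip n v y + ip n v z - ip n v u) / 2"
    "(\<Sum>i<n. v i * rot3 (x i) (y i) (z i) (u i)) = (- ip n v x + ip n v y + ip n v z - ip n v u) / 2"
    for v x y z u
    unfolding ip_def rot_defs
    by (simp_all only: times_divide_eq_right sum_divide_distrib[symmetric])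
      (simp_all add: sum.distrib sum_subtractf sum_negf distrib_left right_diff_distrib)
  let ?F = "ip n c"
  have "cone n (\<lambda>x y z u. 8 / Q ^ 4 * ((\<Sum>i<n. c i * rot1 (x i) (y i) (z i) (u i))
      * (\<Sum>i<n. c i * rot2 (x i) (y i) (z i) (u i)) * (\<Sum>i<n. c i * rot3 (x i) (y i) (z i) (u i))
      * (gibbs n a h x * gibbs n a h y * gibbs n a h z * gibbs n a h u)))"
    by (intro cone_mult cone_sum cone_const cone_rot cone_gibbs) (use c nonneg \<theta> Q in \<open>auto simp: h_def\<close>)
  moreover have "8 / Q ^ 4 * (B / 2 * (C / 2) * (D / 2) * (s * t * p * q))
      = B * C * D * (s / Q * (t / Q) * (p / Q) * (q / Q))" for B C D s t p q
    by (simp add: power4_eq_xxxx)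
  ultimately have "cone n (\<lambda>x y z u. (?F x + ?F y - ?F z - ?F u) * (?F x - ?F y + ?F z - ?F u)
      * (- ?F x + ?F y + ?F z - ?F u) * (w x * w y * w z * w u))"
    unfolding lin w_def by (simp only:)
  from cone_nonneg[OF this]
  have h: "0 \<le> quad_sum (conf n) (\<lambda>x y z u. (?F x + ?F y - ?F z - ?F u) * (?F x - ?F y + ?F z - ?F u)
      * (- ?F x + ?F y + ?F z - ?F u) * (w x * w y * w z * w u))" .
  from GHS_expand[OF refl norm h] show ?thesis
    unfolding MM M_def by simp
qed

text \<open>By the GHS inequality the second derivative of the cumulant generating function is decreasing,
  hence bounded by its value at \<open>0\<close>.\<close>

lemma sub_Gaussian:
  assumes c: "\<And>i. i < n \<Longrightarrow> 0 \<le> c i" and \<theta>: "0 \<le> \<theta>"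
  shows "E (\<lambda>\<sigma>. exp (\<theta> * ip n c \<sigma>)) \<le> exp (\<theta>\<^sup>2 / 2 * E (\<lambda>\<sigma>. (ip n c \<sigma>)\<^sup>2))"
proof -
  define p where "p = E (\<lambda>\<sigma>. (ip n c \<sigma>)\<^sup>2)"
  define N where "N = (\<lambda>k t. E (\<lambda>\<sigma>. ip n c \<sigma> ^ k * exp (t * ip n c \<sigma>)))"
  have N0: "0 < N 0 t" for t unfolding N_def by (rule E_pos) simp
  have N0': "N 0 t \<noteq> 0" for t using N0[of t] by simp
  have dN: "(N k has_real_derivative N (Suc k) t) (at t)" for k t
    unfolding N_def by (rule E_exp_deriv)
  have N1: "N 1 0 = 0"
    unfolding N_def by (simp, rule E_odd) (simp add: ip_def flip_all_apply sum_negf)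
  define k where "k = (\<lambda>t. N 2 t / N 0 t - (N 1 t / N 0 t)\<^sup>2)"
  define g where "g = (\<lambda>t. N 1 t / N 0 t)"
  have dg: "(g has_real_derivative k t) (at t)" for t
    unfolding g_def k_def
    by (auto intro!: derivative_eq_intros dN simp: N0' field_simps power2_eq_square numeral_2_eq_2)
  have dk: "(k has_real_derivative (N 3 t / N 0 t - 3 * (N 2 t / N 0 t) * (N 1 t / N 0 t) + 2 * (N 1 t / N 0 t) ^ 3)) (at t)" for t
    unfolding k_def
    by (auto intro!: derivative_eq_intros dN simp: N0' field_simps power2_eq_square power3_eq_cube numeral_2_eq_2 numeral_3_eq_3)
  have k3: "N 3 t / N 0 t - 3 * (N 2 t / N 0 t) * (N 1 t / N 0 t) + 2 * (N 1 t / N 0 t) ^ 3 \<le> 0" if "0 \<le> t" for t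
    using third_cumulant_nonpos[of c t, OF c that] by (simp add: N_def)
  have kp: "k t \<le> p" if "0 \<le> t" for t
  proof -
    have "k t \<le> k 0"
      by (rule DERIV_nonpos_imp_nonincreasing[OF that, where f = k]) (use dk k3 in blast)
    also have "k 0 = p" using N1 by (simp add: k_def) (simp add: N_def p_def)
    finally show ?thesis .
  qed
  have gp: "g t \<le> t * p" if "0 \<le> t" for t
  proof -
    have "g t - t * p \<le> g 0 - 0 * p"
    proof (rule DERIV_nonpos_imp_nonincreasing[OF that, where f = "\<lambda>t. g t - t * p"])
      fix s :: real assume "0 \<le> s"
      have "((\<lambda>t. g t - t * p) has_real_derivative k s - p) (at s)"
        by (auto intro!: derivative_eq_intros dg)
      then show "\<exists>y. ((\<lambda>t. g t - t * p) has_real_derivative y) (at s) \<and> y \<le> 0"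
        using kp[OF \<open>0 \<le> s\<close>] by auto
    qed
    then show ?thesis using N1 by (simp add: g_def)
  qed
  have "ln (N 0 \<theta>) - \<theta>\<^sup>2 / 2 * p \<le> ln (N 0 0) - 0\<^sup>2 / 2 * p"
  proof (rule DERIV_nonpos_imp_nonincreasing[OF \<theta>, where f = "\<lambda>t. ln (N 0 t) - t\<^sup>2 / 2 * p"])
    fix s :: real assume "0 \<le> s"
    have "((\<lambda>t. ln (N 0 t) - t\<^sup>2 / 2 * p) has_real_derivative g s - s * p) (at s)"
      by (auto intro!: derivative_eq_intros dN simp: N0 g_def)
    then show "\<exists>y. ((\<lambda>t. ln (N 0 t) - t\<^sup>2 / 2 * p) has_real_derivative y) (at s) \<and> y \<le> 0"
      using gp[OF \<open>0 \<le> s\<close>] by auto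
  qed
  then have "ln (N 0 \<theta>) \<le> \<theta>\<^sup>2 / 2 * p" by (simp add: N_def)
  then have "exp (ln (N 0 \<theta>)) \<le> exp (\<theta>\<^sup>2 / 2 * p)" by simp
  then show ?thesis unfolding exp_ln[OF N0] by (simp add: N_def p_def)
qed

end

subsection \<open>Contraction of the fixed point map\<close>

definition avg :: "nat \<Rightarrow> (nat \<Rightarrow> real) \<Rightarrow> real" where
  "avg n x = (\<Sum>i<n. x i) / real n"

definition ctr :: "nat \<Rightarrow> (nat \<Rightarrow> real) \<Rightarrow> nat \<Rightarrow> real" where
  "ctr n x = (\<lambda>i. x i - avg n x)"

lemma avg_add: "avg n (\<lambda>i. x i + y i) = avg n x + avg n y"
  by (simp add: avg_def sum.distrib add_divide_distrib)

lemma avg_diff: "avg n (\<lambda>i. x i - y i) = avg n x - avg n y"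
  by (simp add: avg_def sum_subtractf diff_divide_distrib)

lemma avg_cmult: "avg n (\<lambda>i. c * x i) = c * avg n x"
  by (simp add: avg_def sum_distrib_left)

lemma avg_const: "0 < n \<Longrightarrow> avg n (\<lambda>_. c) = c"
  by (simp add: avg_def)

lemma avg_cong: "(\<And>i. i < n \<Longrightarrow> x i = y i) \<Longrightarrow> avg n x = avg n y"
  unfolding avg_def by (metis (no_types, lifting) lessThan_iff sum.cong)

lemma sum_eq_avg: "0 < n \<Longrightarrow> (\<Sum>i<n. x i) = real n * avg n x"
  by (simp add: avg_def)

lemma ip_one: "ip n x (\<lambda>_. 1) = (\<Sum>i<n. x i)" "ip n (\<lambda>_. 1) x = (\<Sum>i<n. x i)"
  by (simp_all add: ip_def)

lemma ip_const: "ip n x (\<lambda>_. c) = c * (\<Sum>i<n. x i)" "ip n (\<lambda>_. c) x = c * (\<Sum>i<n. x i)"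
  by (simp_all add: ip_def sum_distrib_left mult.commute)

lemma avg_abs_le:
  assumes "\<And>i. i < n \<Longrightarrow> \<bar>x i\<bar> \<le> B" "0 < n"
  shows "\<bar>avg n x\<bar> \<le> B"
proof -
  have "\<bar>\<Sum>i<n. x i\<bar> \<le> (\<Sum>i<n. \<bar>x i\<bar>)" by (rule sum_abs)
  also have "\<dots> \<le> (\<Sum>i<n. B)" by (intro sum_mono) (use assms in auto)
  finally show ?thesis using assms(2) by (simp add: avg_def abs_divide field_simps)
qed

lemma avg_ctr: "0 < n \<Longrightarrow> avg n (ctr n x) = 0"
  by (simp add: ctr_def avg_diff avg_const)

lemma sum_ctr: "0 < n \<Longrightarrow> (\<Sum>i<n. ctr n x i) = 0"
  by (simp add: sum_eq_avg avg_ctr)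

lemma ctr_add: "ctr n (\<lambda>i. x i + y i) = (\<lambda>i. ctr n x i + ctr n y i)"
  by (simp add: ctr_def avg_add fun_eq_iff)

lemma ctr_diff: "ctr n (\<lambda>i. x i - y i) = (\<lambda>i. ctr n x i - ctr n y i)"
  by (simp add: ctr_def avg_diff fun_eq_iff)

lemma ctr_cmult: "ctr n (\<lambda>i. c * x i) = (\<lambda>i. c * ctr n x i)"
  by (simp add: ctr_def avg_cmult fun_eq_iff right_diff_distrib)

lemma ctr_const: "0 < n \<Longrightarrow> ctr n (\<lambda>_. c) = (\<lambda>_. 0)"
  by (simp add: ctr_def avg_const)

lemma ctr_ctr: "0 < n \<Longrightarrow> ctr n (ctr n x) = ctr n x"
  using avg_ctr[of n x] by (simp add: ctr_def[of n "ctr n x"])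

lemma ip_ctr_left: "0 < n \<Longrightarrow> ip n (ctr n x) (ctr n y) = ip n (ctr n x) y"
  by (subst (2) ctr_def) (simp add: ip_diff_right ip_const sum_ctr)

lemma ip_ctr_right: "0 < n \<Longrightarrow> ip n (ctr n x) (ctr n y) = ip n x (ctr n y)"
  using ip_ctr_left[of n y x] by (simp add: ip_commute)

lemma ip_split: "0 < n \<Longrightarrow> ip n x y = ip n (ctr n x) (ctr n y) + real n * avg n x * avg n y"
  unfolding ctr_def by (simp add: ip_diff_left ip_diff_right ip_const sum_eq_avg)

lemma ip_ctr_le: "0 < n \<Longrightarrow> ip n (ctr n x) (ctr n x) \<le> ip n x x"
  using ip_split[of n x x] by (simp add: mult.assoc flip: power2_eq_square)

lemma nrm_ctr_le: "0 < n \<Longrightarrow> nrm n (ctr n x) \<le> nrm n x"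
  unfolding nrm_def by (intro real_sqrt_le_mono ip_ctr_le)

lemma avg_sq_le: "0 < n \<Longrightarrow> real n * (avg n x)\<^sup>2 \<le> ip n x x"
  using ip_split[of n x x] ip_nonneg[of n "ctr n x"] by (simp add: mult.assoc flip: power2_eq_square)

lemma abs_le_nrm: "i < n \<Longrightarrow> \<bar>x i\<bar> \<le> nrm n x"
  unfolding nrm_eq_L2 using member_le_L2_set[of "{..<n}" i "\<lambda>i. \<bar>x i\<bar>"] by (simp add: L2_set_def)

lemma nrm_le_sup:
  assumes "\<And>i. i < n \<Longrightarrow> \<bar>x i\<bar> \<le> B" "0 \<le> B"
  shows "nrm n x \<le> sqrt (real n) * B"
proof -
  have "ip n x x \<le> (\<Sum>i<n. B * B)"
    unfolding ip_def
  proof (intro sum_mono)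
    fix i assume "i \<in> {..<n}"
    then have "\<bar>x i\<bar> * \<bar>x i\<bar> \<le> B * B" by (intro mult_mono assms) auto
    then show "x i * x i \<le> B * B" by simp
  qed
  then have "sqrt (ip n x x) \<le> sqrt (n * (B * B))" by simp
  then show ?thesis using assms(2) by (simp add: nrm_def real_sqrt_mult)
qed

text \<open>\<open>gap\<close> is one-sided, so eigenvalues near -1 remain possible.
  \<open>D\<delta>\<close> makes the row deviations negligible against the loss of order
  \<open>\<delta>\<^sup>2\<close> in the contraction estimate.\<close>

locale near_regular = ising_model +
  fixes D \<delta> :: real
  assumes n2: "2 \<le> n"
    and dev: "i < n \<Longrightarrow> \<bar>(\<Sum>j<n. a i j) - 1\<bar> \<le> D"
    and D0: "0 \<le> D" and D\<delta>: "D \<le> \<delta>\<^sup>2 / 80"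
    and \<delta>0: "0 < \<delta>" and \<delta>1: "\<delta> \<le> 1"
    and gap: "ip n x (\<lambda>_. 1) = 0 \<Longrightarrow> ip n x (mv n a x) \<le> (1 - \<delta>) * ip n x x"
begin

definition d :: "nat \<Rightarrow> real" where "d i = (\<Sum>j<n. a i j) - 1"

lemma n0: "0 < n" using n2 by simp

lemma D1: "D \<le> 1 / 80"
proof -
  have "\<delta>\<^sup>2 \<le> 1" using \<delta>0 \<delta>1 by (simp add: power_le_one)
  then show ?thesis using D\<delta> by simp
qed

lemma d_le: "i < n \<Longrightarrow> \<bar>d i\<bar> \<le> D"
  using dev by (simp add: d_def)

lemma row_eq: "(\<Sum>j<n. a i j) = 1 + d i"
  by (simp add: d_def)

lemma row_le: "i < n \<Longrightarrow> (\<Sum>j<n. a i j) \<le> 1 + D"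
  using d_le[of i] by (simp add: row_eq)

lemma row_le': "i < n \<Longrightarrow> (\<Sum>j<n. a i j) \<le> 3 / 2"
  using row_le[of i] D1 by simp

lemma m_const: "m (\<lambda>_. c) i = c * (1 + d i)"
  by (simp add: mv_def row_eq[symmetric] sum_distrib_left mult.commute)

lemma ip_m_sym: "ip n x (m y) = ip n (m x) y"
  by (rule ip_mv_sym[OF sym])

lemma sum_m: "(\<Sum>i<n. m x i) = (\<Sum>i<n. x i) + ip n d x"
proof -
  have "(\<Sum>i<n. m x i) = ip n (m (\<lambda>_. 1)) x"
    using ip_m_sym[of "\<lambda>_. 1" x] by (simp add: ip_one)
  then show ?thesis by (simp add: m_const ip_def sum.distrib distrib_right)
qed

lemma m_sup:
  assumes "\<And>j. j < n \<Longrightarrow> \<bar>x j\<bar> \<le> B" "i < n"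
  shows "\<bar>m x i\<bar> \<le> (1 + D) * B"
proof -
  have B: "0 \<le> B" using assms(1)[of i] assms(2) by linarith
  have "\<bar>m x i\<bar> \<le> (\<Sum>j<n. a i j * B)"
    unfolding mv_def
    by (rule order_trans[OF sum_abs]) (use assms nonneg in \<open>auto intro!: sum_mono mult_left_mono simp: abs_mult\<close>)
  also have "\<dots> = (\<Sum>j<n. a i j) * B" by (simp add: sum_distrib_right)
  also have "\<dots> \<le> (1 + D) * B" by (intro mult_right_mono row_le assms B)
  finally show ?thesis .
qed

lemma ip_m_m: "ip n (m x) (m x) \<le> (1 + D)\<^sup>2 * ip n x x"
proof -
  let ?r = "1 + D"
  have "\<bar>ip n (m x) (m (\<lambda>i. ?r * x i))\<bar> \<le> ?r * (ip n (m x) (m x) + ip n (\<lambda>i. ?r * x i) (\<lambda>i. ?r * x i)) / 2"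
    by (rule quadratic_form_le_row_sum[OF sym nonneg row_le])
  then have "?r * ip n (m x) (m x) \<le> ?r * (ip n (m x) (m x) + ?r\<^sup>2 * ip n x x) / 2"
    using abs_ge_self[of "ip n (m x) (m (\<lambda>i. ?r * x i))"]
    by (simp add: mv_scale ip_linear power2_eq_square mult.assoc)
  then have "ip n (m x) (m x) \<le> (ip n (m x) (m x) + ?r\<^sup>2 * ip n x x) / 2"
    using D0 by (simp add: mult_le_cancel_left_pos flip: times_divide_eq_right)
  then show ?thesis by simp
qed

lemma nrm_m: "nrm n (m x) \<le> (1 + D) * nrm n x"
  using real_sqrt_le_mono[OF ip_m_m[of x]] D0 by (simp add: nrm_def real_sqrt_mult)

text \<open>Averaging with the identity removes the influence of eigenvalues near \<open>-1\<close>; subtracting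
  \<open>\<phi> (avg n x) * d i\<close> makes constant vectors exact.\<close>

definition Psi :: "(real \<Rightarrow> real) \<Rightarrow> (nat \<Rightarrow> real) \<Rightarrow> nat \<Rightarrow> real" where
  "Psi \<phi> x i = (x i + m (\<lambda>j. \<phi> (x j)) i - \<phi> (avg n x) * d i) / 2"

text \<open>Half of the loss \<open>\<delta>\<^sup>2 / 64\<close> that is proved for the squared
  norm.\<close>

definition rate :: real where "rate = \<delta>\<^sup>2 / 128"

lemma rate_pos: "0 < rate" and rate_le: "rate \<le> 1 / 128"
proof -
  have "\<delta>\<^sup>2 \<le> 1" using \<delta>0 \<delta>1 by (simp add: power_le_one)
  then show "0 < rate" "rate \<le> 1 / 128" using \<delta>0 by (auto simp: rate_def)
qed

text \<open>As \<open>\<phi>\<close> is increasing and 1-Lipschitz, \<open>z i\<close> lies between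
  0 and \<open>y i\<close>, whence \<open>U + V \<le> Y\<close>. If \<open>V\<close> is small,
  \<open>z\<close> is close to \<open>y\<close> and the gap gives the loss; if \<open>V\<close> is
  large, \<open>z\<close> is shorter than \<open>y\<close>. Both \<open>tanh\<close> and the
  identity will be inserted for \<open>\<phi>\<close>.\<close>

lemma Psi_contract_L2:
  assumes \<phi>: "\<And>s t. s \<le> t \<Longrightarrow> 0 \<le> \<phi> t - \<phi> s \<and> \<phi> t - \<phi> s \<le> t - s"
  shows "nrm n (ctr n (Psi \<phi> x)) \<le> (1 - rate) * nrm n (ctr n x)"
proof -
  define y where "y = ctr n x"
  define z where "z = (\<lambda>i. \<phi> (x i) - \<phi> (avg n x))"
  have "Psi \<phi> x i = (x i + m z i + \<phi> (avg n x)) / 2" for i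
  proof -
    have "m (\<lambda>j. \<phi> (x j)) i = m z i + \<phi> (avg n x) * (1 + d i)"
      unfolding z_def mv_diff m_const by simp
    then show ?thesis by (simp add: Psi_def algebra_simps)
  qed
  then have "Psi \<phi> x = (\<lambda>i. (1 / 2) * ((x i + m z i) + \<phi> (avg n x)))" by (simp add: fun_eq_iff)
  then have PPsi: "ctr n (Psi \<phi> x) = (\<lambda>i. (1 / 2) * (y i + ctr n (m z) i))"
    by (simp only: ctr_cmult ctr_add ctr_const[OF n0] y_def) simp
  define Y where "Y = ip n y y"
  define U where "U = ip n z z"
  define V where "V = ip n (\<lambda>i. y i - z i) (\<lambda>i. y i - z i)"
  have yy: "ctr n y = y" by (simp add: y_def ctr_ctr[OF n0])
  have nn: "0 \<le> Y" "0 \<le> U" "0 \<le> V" by (simp_all add: Y_def U_def V_def ip_nonneg)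
  have "0 \<le> z i * (y i - z i)" for i
  proof (cases "avg n x \<le> x i")
    case True
    with \<phi>[OF True] show ?thesis by (simp add: z_def y_def ctr_def)
  next
    case False
    with \<phi>[of "x i" "avg n x"] have "z i \<le> 0" "y i - z i \<le> 0" by (simp_all add: z_def y_def ctr_def)
    then show ?thesis by (simp add: mult_nonpos_nonpos)
  qed
  then have "0 \<le> ip n z (\<lambda>i. y i - z i)" unfolding ip_def by (intro sum_nonneg) auto
  then have UV: "U + V \<le> Y"
    by (simp add: U_def V_def Y_def ip_linear ip_commute[of n z y])
  have full: "ip n (\<lambda>i. y i + ctr n (m z) i) (\<lambda>i. y i + ctr n (m z) i) \<le> Y + 2 * ip n y (m z) + (1 + D)\<^sup>2 * U"
  proof -
    have "ip n y (ctr n (m z)) = ip n y (m z)" using ip_ctr_left[OF n0, of y "m z"] by (simp add: yy)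
    moreover have "ip n (ctr n (m z)) (ctr n (m z)) \<le> (1 + D)\<^sup>2 * U"
      using ip_ctr_le[OF n0, of "m z"] ip_m_m[of z] by (simp add: U_def)
    ultimately show ?thesis by (simp add: ip_linear Y_def ip_commute[of n "ctr n (m z)" y])
  qed
  have D80: "80 * D \<le> \<delta>\<^sup>2" and Ds: "D\<^sup>2 \<le> D" and d2: "\<delta>\<^sup>2 \<le> \<delta>"
    using D\<delta> D0 D1 \<delta>0 \<delta>1 by (auto simp: power2_eq_square mult_left_le mult_left_le_one_le)
  have "ip n (\<lambda>i. y i + ctr n (m z) i) (\<lambda>i. y i + ctr n (m z) i) \<le> (4 - \<delta>\<^sup>2 / 16) * Y"
  \<comment> \<open>In the first case replacing \<open>z\<close> by \<open>y\<close> costs about a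
    quarter of the gap. In the second \<open>U\<close> has lost the fraction
    \<open>\<delta>\<^sup>2 / 16\<close>, which is why the rate is quadratic in
    \<open>\<delta>\<close>.\<close>
  proof (cases "V \<le> (\<delta> / 4)\<^sup>2 * Y")
    case True
    have "ip n y (m z) = ip n y (m y) - ip n y (m (\<lambda>i. y i - z i))"
      by (simp add: mv_diff ip_linear)
    moreover have "ip n y (m y) \<le> (1 - \<delta>) * Y"
      unfolding Y_def by (rule gap) (simp add: y_def ip_one sum_ctr[OF n0])
    moreover have "\<bar>ip n y (m (\<lambda>i. y i - z i))\<bar> \<le> (1 + D) * (\<delta> / 4) * Y"
    proof -
      have "\<bar>ip n y (m (\<lambda>i. y i - z i))\<bar> \<le> nrm n y * nrm n (m (\<lambda>i. y i - z i))"
        by (rule Cauchy_Schwarz_ip)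
      also have "\<dots> \<le> nrm n y * ((1 + D) * nrm n (\<lambda>i. y i - z i))"
        by (intro mult_left_mono nrm_m nrm_nonneg)
      also have "\<dots> \<le> nrm n y * ((1 + D) * ((\<delta> / 4) * nrm n y))"
      proof (intro mult_left_mono nrm_nonneg)
        show "nrm n (\<lambda>i. y i - z i) \<le> (\<delta> / 4) * nrm n y"
          using real_sqrt_le_mono[OF True] \<delta>0 by (simp add: nrm_def V_def Y_def real_sqrt_mult real_sqrt_divide)
      qed (use D0 in auto)
      also have "\<dots> = (1 + D) * (\<delta> / 4) * Y"
        using nrm_sq[of n y] by (simp add: Y_def power2_eq_square mult_ac)
      finally show ?thesis .
    qed
    ultimately have "ip n y (m z) \<le> (1 - \<delta>) * Y + (1 + D) * (\<delta> / 4) * Y" by linarith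
    then have 1: "ip n y (m z) \<le> (1 - \<delta> + (1 + D) * (\<delta> / 4)) * Y" by (simp only: distrib_right)
    have 2: "(1 + D)\<^sup>2 * U \<le> (1 + D)\<^sup>2 * Y" using UV nn by (intro mult_left_mono) auto
    have "ip n (\<lambda>i. y i + ctr n (m z) i) (\<lambda>i. y i + ctr n (m z) i)
       \<le> (1 + 2 * (1 - \<delta> + (1 + D) * (\<delta> / 4)) + (1 + D)\<^sup>2) * Y"
    proof -
      have comb: "L \<le> (1 + 2 * A + B) * Y" if "L \<le> Y + 2 * J + V'" "J \<le> A * Y" "V' \<le> B * Y" for A B J V' L
      proof -
        have "(1 + 2 * A + B) * Y = Y + 2 * (A * Y) + B * Y" by (simp add: algebra_simps)
        then show ?thesis using that by linarith
      qed
      show ?thesis by (rule comb[OF full 1 2])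
    qed
    also have "\<dots> \<le> (4 - \<delta>\<^sup>2 / 16) * Y"
    proof (rule mult_right_mono[OF _ nn(1)])
      have "D * \<delta> \<le> \<delta>" using D1 \<delta>0 by (simp add: mult_left_le_one_le D0)
      moreover have e: "(1 + D)\<^sup>2 = 1 + 2 * D + D\<^sup>2" "(1 + D) * (\<delta> / 4) = \<delta> / 4 + D * \<delta> / 4"
        by (simp_all add: power2_sum algebra_simps)
      ultimately show "1 + 2 * (1 - \<delta> + (1 + D) * (\<delta> / 4)) + (1 + D)\<^sup>2 \<le> 4 - \<delta>\<^sup>2 / 16"
        unfolding e using D80 Ds d2 \<delta>0 D0 by argo
    qed
    finally show ?thesis .
  next
    case False
    then have U: "U \<le> (1 - \<delta>\<^sup>2 / 16) * Y" using UV by (simp add: power_divide algebra_simps)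
    have "2 * ip n y (m z) \<le> (1 + D) * (Y + U)"
      using quadratic_form_le_row_sum[OF sym nonneg row_le, of y z] by (simp add: Y_def U_def)
    then have "ip n (\<lambda>i. y i + ctr n (m z) i) (\<lambda>i. y i + ctr n (m z) i) \<le> Y + (1 + D) * (Y + U) + (1 + D)\<^sup>2 * U"
      using full by linarith
    also have "\<dots> = (2 + D) * Y + ((1 + D) + (1 + D)\<^sup>2) * U" by (simp add: algebra_simps)
    also have "\<dots> \<le> (2 + D) * Y + ((1 + D) + (1 + D)\<^sup>2) * ((1 - \<delta>\<^sup>2 / 16) * Y)"
      using U D0 by (intro add_left_mono mult_left_mono) auto
    also have "\<dots> = ((2 + D) + ((1 + D) + (1 + D)\<^sup>2) * (1 - \<delta>\<^sup>2 / 16)) * Y" by (simp add: algebra_simps)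
    also have "\<dots> \<le> (4 - \<delta>\<^sup>2 / 16) * Y"
    proof (rule mult_right_mono[OF _ nn(1)])
      have p: "0 \<le> 3 * (D * \<delta>\<^sup>2) + D\<^sup>2 * \<delta>\<^sup>2" using D0 by (intro add_nonneg_nonneg) auto
      have e: "(2 + D) + ((1 + D) + (1 + D)\<^sup>2) * (1 - \<delta>\<^sup>2 / 16)
          = 4 - \<delta>\<^sup>2 / 8 + 4 * D + D\<^sup>2 - (3 * (D * \<delta>\<^sup>2) + D\<^sup>2 * \<delta>\<^sup>2) / 16"
        by (simp add: power2_eq_square algebra_simps add_divide_distrib)
      show "(2 + D) + ((1 + D) + (1 + D)\<^sup>2) * (1 - \<delta>\<^sup>2 / 16) \<le> 4 - \<delta>\<^sup>2 / 16"
        unfolding e using D80 Ds D0 p by argo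
    qed
    finally show ?thesis .
  qed
  moreover have "(4 - \<delta>\<^sup>2 / 16) * Y = (1 - \<delta>\<^sup>2 / 64) * Y * 4" by (simp add: algebra_simps)
  ultimately have "ip n (ctr n (Psi \<phi> x)) (ctr n (Psi \<phi> x)) \<le> (1 - \<delta>\<^sup>2 / 64) * Y"
    unfolding PPsi ip_scale_left ip_scale_right by simp
  also have "1 - \<delta>\<^sup>2 / 64 = 1 - 2 * rate" by (simp add: rate_def)
  finally have "ip n (ctr n (Psi \<phi> x)) (ctr n (Psi \<phi> x)) \<le> (1 - 2 * rate) * Y" .
  also have "\<dots> \<le> (1 - rate)\<^sup>2 * Y"
    using nn by (intro mult_right_mono) (simp_all add: power2_diff)
  finally have "ip n (ctr n (Psi \<phi> x)) (ctr n (Psi \<phi> x)) \<le> (1 - rate)\<^sup>2 * Y" .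
  from real_sqrt_le_mono[OF this] show ?thesis
    using rate_le by (simp add: nrm_def real_sqrt_mult Y_def y_def)
qed

lemma L2_bound:
  assumes \<phi>: "\<And>s t. s \<le> t \<Longrightarrow> 0 \<le> \<phi> t - \<phi> s \<and> \<phi> t - \<phi> s \<le> t - s"
  shows "rate * nrm n (ctr n x) \<le> nrm n (ctr n (\<lambda>i. x i - Psi \<phi> x i))"
proof -
  have "nrm n (ctr n x) = nrm n (\<lambda>i. ctr n (\<lambda>i. x i - Psi \<phi> x i) i + ctr n (Psi \<phi> x) i)"
    by (rule nrm_cong) (simp add: ctr_diff)
  also have "\<dots> \<le> nrm n (ctr n (\<lambda>i. x i - Psi \<phi> x i)) + nrm n (ctr n (Psi \<phi> x))"
    by (rule nrm_triangle)
  also have "nrm n (ctr n (Psi \<phi> x)) \<le> (1 - rate) * nrm n (ctr n x)"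
    by (rule Psi_contract_L2[OF \<phi>])
  finally show ?thesis by (simp add: algebra_simps)
qed

lemma Psi_Lipschitz:
  assumes \<phi>: "\<And>s t. s \<le> t \<Longrightarrow> 0 \<le> \<phi> t - \<phi> s \<and> \<phi> t - \<phi> s \<le> t - s"
    and x: "\<And>j. j < n \<Longrightarrow> \<bar>x j - x' j\<bar> \<le> B" and i: "i < n"
  shows "\<bar>Psi \<phi> x i - Psi \<phi> x' i\<bar> \<le> (1 + D) * B"
proof -
  have B: "0 \<le> B" using x[OF i] by linarith
  have lip: "\<bar>\<phi> s - \<phi> t\<bar> \<le> \<bar>s - t\<bar>" for s t
    using \<phi>[of s t] \<phi>[of t s] by (cases "s \<le> t") auto
  have "\<bar>m (\<lambda>j. \<phi> (x j) - \<phi> (x' j)) i\<bar> \<le> (1 + D) * B"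
    by (rule m_sup[OF order_trans[OF lip x] i])
  moreover have "\<bar>(\<phi> (avg n x) - \<phi> (avg n x')) * d i\<bar> \<le> B * D"
    unfolding abs_mult
  proof (intro mult_mono d_le i)
    have "\<bar>avg n (\<lambda>i. x i - x' i)\<bar> \<le> B" by (rule avg_abs_le[OF x n0])
    then show "\<bar>\<phi> (avg n x) - \<phi> (avg n x')\<bar> \<le> B"
      using lip[of "avg n x" "avg n x'"] by (simp add: avg_diff)
  qed (use B in auto)
  moreover have "Psi \<phi> x i - Psi \<phi> x' i = ((x i - x' i) + m (\<lambda>j. \<phi> (x j) - \<phi> (x' j)) i
      - (\<phi> (avg n x) - \<phi> (avg n x')) * d i) / 2"
    by (simp add: Psi_def mv_diff algebra_simps diff_divide_distrib add_divide_distrib)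
  ultimately show ?thesis using x[OF i] by (simp add: algebra_simps abs_le_iff)
qed

text \<open>After \<open>k\<close> steps, of the order of \<open>ln n\<close>, the contraction in the Euclidean norm beats the factor
  \<open>sqrt n\<close> lost in passing from the Euclidean to the supremum norm.\<close>

lemma sup_bound:
  assumes \<phi>: "\<And>s t. s \<le> t \<Longrightarrow> 0 \<le> \<phi> t - \<phi> s \<and> \<phi> t - \<phi> s \<le> t - s"
    and x: "\<And>i. i < n \<Longrightarrow> \<bar>x i - Psi \<phi> x i\<bar> \<le> r"
    and k: "real k * D \<le> 1" "(1 - rate) ^ k * sqrt n \<le> 1 / 2" and i: "i < n"
  shows "\<bar>ctr n x i\<bar> \<le> 12 * k * r"
proof -
  have r: "0 \<le> r" using x[OF i] by linarith
  have one_step: "\<bar>(Psi \<phi> ^^ j) x i - (Psi \<phi> ^^ Suc j) x i\<bar> \<le> (1 + D) ^ j * r" if "i < n" for i j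
    using that
  proof (induction j arbitrary: i)
    case 0
    then show ?case using x by simp
  next
    case (Suc j)
    have "\<bar>Psi \<phi> ((Psi \<phi> ^^ j) x) i - Psi \<phi> ((Psi \<phi> ^^ Suc j) x) i\<bar> \<le> (1 + D) * ((1 + D) ^ j * r)"
      by (rule Psi_Lipschitz[OF \<phi> Suc.IH Suc.prems])
    then show ?case by (simp add: mult.assoc)
  qed
  \<comment> \<open>Growth over \<open>k\<close> steps stays bounded because
    \<open>k * D \<le> 1\<close>; 3 bounds \<open>exp 1\<close>.\<close>
  have pow: "(1 + D) ^ j \<le> 3" if "j \<le> k" for j
  proof -
    have "(1 + D) ^ j \<le> exp D ^ j" using D0 by (intro power_mono exp_ge_add_one_self) auto
    also have "\<dots> = exp (j * D)" by (simp add: exp_of_nat_mult)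
    also have "\<dots> \<le> exp 1" using that k(1) D0 by (auto intro: order_trans[OF mult_right_mono k(1)])
    also have "\<dots> \<le> 3" by (rule exp_le)
    finally show ?thesis .
  qed
  have steps: "\<bar>x i - (Psi \<phi> ^^ j) x i\<bar> \<le> real j * (3 * r)" if "j \<le> k" "i < n" for i j
    using that
  proof (induction j)
    case (Suc j)
    have "(1 + D) ^ j * r \<le> 3 * r" using Suc.prems by (intro mult_right_mono pow r) auto
    then show ?case using Suc one_step[of i j] by (simp add: algebra_simps)
  qed simp
  have contr: "nrm n (ctr n ((Psi \<phi> ^^ j) x)) \<le> (1 - rate) ^ j * nrm n (ctr n x)" for j
  proof (induction j)
    case (Suc j)
    have "nrm n (ctr n ((Psi \<phi> ^^ Suc j) x)) \<le> (1 - rate) * nrm n (ctr n ((Psi \<phi> ^^ j) x))"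
      using Psi_contract_L2[OF \<phi>, of "(Psi \<phi> ^^ j) x"] by simp
    also have "\<dots> \<le> (1 - rate) * ((1 - rate) ^ j * nrm n (ctr n x))"
      using rate_le by (intro mult_left_mono Suc) auto
    finally show ?case by (simp add: mult.assoc)
  qed simp
  \<comment> \<open>The largest entry will be at most \<open>6 * k * r\<close> plus half of itself;
    absorbing the half gives the factor 12.\<close>
  define B where "B = (MAX i\<in>{..<n}. \<bar>ctr n x i\<bar>)"
  have fin: "finite ((\<lambda>i. \<bar>ctr n x i\<bar>) ` {..<n})" "(\<lambda>i. \<bar>ctr n x i\<bar>) ` {..<n} \<noteq> {}" using n0 by auto
  have B: "\<bar>ctr n x j\<bar> \<le> B" if "j < n" for j
    unfolding B_def using fin that by (intro Max_ge) auto
  have B0: "0 \<le> B" using B[OF i] by linarith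
  obtain j where j: "j < n" "B = \<bar>ctr n x j\<bar>"
    using Max_in[OF fin] unfolding B_def by auto
  have "ctr n x j = ctr n (\<lambda>i. x i - (Psi \<phi> ^^ k) x i) j + ctr n ((Psi \<phi> ^^ k) x) j"
    by (simp add: ctr_diff)
  moreover have "\<bar>ctr n (\<lambda>i. x i - (Psi \<phi> ^^ k) x i) j\<bar> \<le> 2 * (real k * (3 * r))"
    using steps[of k j] j avg_abs_le[of n "\<lambda>i. x i - (Psi \<phi> ^^ k) x i" "real k * (3 * r)"] steps[of k] n0
    unfolding ctr_def by fastforce
  moreover have "\<bar>ctr n ((Psi \<phi> ^^ k) x) j\<bar> \<le> B / 2"
  proof -
    have "\<bar>ctr n ((Psi \<phi> ^^ k) x) j\<bar> \<le> (1 - rate) ^ k * nrm n (ctr n x)"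
      by (rule order_trans[OF abs_le_nrm[OF j(1)] contr])
    also have "\<dots> \<le> (1 - rate) ^ k * (sqrt n * B)"
      using rate_le B0 B by (intro mult_left_mono nrm_le_sup) auto
    also have "\<dots> \<le> 1 / 2 * B"
      unfolding mult.assoc[symmetric] by (intro mult_right_mono k B0)
    finally show ?thesis by simp
  qed
  ultimately have "B \<le> 2 * (real k * (3 * r)) + B / 2" using j(2) by linarith
  then show ?thesis using B[OF i] by simp
qed

end

subsection \<open>Local fields\<close>

lemma power_le_fact_exp:
  assumes "0 \<le> (x :: real)"
  shows "x ^ k \<le> fact k * exp x"
proof -
  have "(\<lambda>j. x ^ j /\<^sub>R fact j) sums exp x" by (rule exp_converges)
  then have "x ^ k /\<^sub>R fact k \<le> exp x"
    using sum_le_suminf[of "\<lambda>j. x ^ j /\<^sub>R fact j" "{k}"] assms by (simp add: sums_iff)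
  then show ?thesis by (simp add: field_simps)
qed

lemma exp_abs_le: "exp \<bar>x\<bar> \<le> exp x + exp (- x)" for x :: real
  by (cases "0 \<le> x") auto

context near_regular
begin

lemma nz_exp_bound: "E (\<lambda>\<sigma>. exp (ip n c (nz \<sigma>))) \<le> exp (5 * ip n c c)"
  by (rule nz_exp_moment[OF row_le'])

lemma nz_exp_abs: "E (\<lambda>\<sigma>. exp \<bar>ip n c (nz \<sigma>)\<bar>) \<le> 2 * exp (5 * ip n c c)"
proof -
  have "E (\<lambda>\<sigma>. exp \<bar>ip n c (nz \<sigma>)\<bar>) \<le> E (\<lambda>\<sigma>. exp (ip n c (nz \<sigma>)) + exp (ip n (\<lambda>i. - c i) (nz \<sigma>)))"
    by (rule E_mono) (simp add: ip_linear exp_abs_le)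
  also have "\<dots> \<le> exp (5 * ip n c c) + exp (5 * ip n (\<lambda>i. - c i) (\<lambda>i. - c i))"
    unfolding E_add by (intro add_mono nz_exp_bound)
  finally show ?thesis by (simp add: ip_linear)
qed

text \<open>Comes from \<open>x ^ p \<le> fact p * exp x\<close> and the exponential moment bound
  for a unit vector.\<close>

definition Kmom :: "nat \<Rightarrow> real" where "Kmom p = fact p * (2 * exp 5)"

lemma nz_moment: "E (\<lambda>\<sigma>. \<bar>ip n c (nz \<sigma>)\<bar> ^ p) \<le> Kmom p * nrm n c ^ p"
proof (cases "nrm n c = 0")
  case True
  then have "\<forall>i<n. c i = 0" by (simp add: nrm_def ip_zero_iff)
  then have "ip n c (nz \<sigma>) = 0" for \<sigma> by (simp add: ip_def)
  moreover have "1 \<le> exp (5 :: real)" by simp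
  then have "1 \<le> 2 * exp (5 :: real)" by linarith
  ultimately show ?thesis using True by (cases p) (simp_all add: Kmom_def)
next
  case False
  define s where "s = nrm n c"
  have s: "s > 0" using False nrm_nonneg[of n c] by (simp add: s_def)
  define e where "e = (\<lambda>i. 1 / s * c i)"
  have ee: "ip n e e = 1"
    using s nrm_sq[of n c] unfolding e_def ip_scale_left ip_scale_right by (auto simp: s_def power2_eq_square)
  have ipe: "ip n e v = ip n c v / s" for v
    unfolding e_def ip_scale_left by simp
  have "E (\<lambda>\<sigma>. \<bar>ip n c (nz \<sigma>)\<bar> ^ p) = E (\<lambda>\<sigma>. s ^ p * \<bar>ip n e (nz \<sigma>)\<bar> ^ p)"
    using s by (intro E_cong) (simp add: ipe abs_divide power_divide)
  also have "\<dots> \<le> E (\<lambda>\<sigma>. s ^ p * (fact p * exp \<bar>ip n e (nz \<sigma>)\<bar>))"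
    using s by (intro E_mono mult_left_mono power_le_fact_exp) auto
  also have "\<dots> = s ^ p * (fact p * E (\<lambda>\<sigma>. exp \<bar>ip n e (nz \<sigma>)\<bar>))"
    by (simp add: E_cmult)
  also have "\<dots> \<le> s ^ p * (fact p * (2 * exp (5 * ip n e e)))"
    using s by (intro mult_left_mono nz_exp_abs) auto
  finally show ?thesis by (simp add: ee Kmom_def s_def mult_ac)
qed

definition an :: "(nat \<Rightarrow> real) \<Rightarrow> nat \<Rightarrow> real" where "an \<sigma> = m (nz \<sigma>)"

lemma an_eq: "an \<sigma> i = ip n (a i) (nz \<sigma>)"
  by (simp add: an_def m_eq_ip)

definition y :: "(nat \<Rightarrow> real) \<Rightarrow> nat \<Rightarrow> real" where "y \<sigma> = ctr n (m \<sigma>)"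
definition mb :: "(nat \<Rightarrow> real) \<Rightarrow> real" where "mb \<sigma> = avg n (m \<sigma>)"
definition sb :: "(nat \<Rightarrow> real) \<Rightarrow> real" where "sb \<sigma> = avg n \<sigma>"
definition u :: "(nat \<Rightarrow> real) \<Rightarrow> real" where "u \<sigma> = ip n d \<sigma>"
definition om :: "(nat \<Rightarrow> real) \<Rightarrow> real" where "om \<sigma> = (MAX i\<in>{..<n}. \<bar>an \<sigma> i\<bar>)"
definition Ym :: "(nat \<Rightarrow> real) \<Rightarrow> real" where "Ym \<sigma> = (MAX i\<in>{..<n}. \<bar>y \<sigma> i\<bar>)"
text \<open>\<open>fr\<close> and \<open>al\<close> are the squared Frobenius norm and
  \<open>\<alpha>_N\<close> of the coupling matrix.\<close>

definition fr :: real where "fr = (\<Sum>i<n. ip n (a i) (a i))"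
definition al :: real where "al = (MAX i\<in>{..<n}. ip n (a i) (a i))"

lemma m_eq_y: "m \<sigma> i = mb \<sigma> + y \<sigma> i"
  by (simp add: y_def mb_def ctr_def)

lemma Max_upper: "i < n \<Longrightarrow> (f i :: real) \<le> (MAX i\<in>{..<n}. f i)"
  by (intro Max_ge) auto

lemma Max_attained: "\<exists>i<n. (MAX i\<in>{..<n}. f i) = (f i :: real)"
proof -
  have "(MAX i\<in>{..<n}. f i) \<in> f ` {..<n}" using n0 by (intro Max_in) auto
  then show ?thesis by auto
qed

lemma om_upper: "i < n \<Longrightarrow> \<bar>an \<sigma> i\<bar> \<le> om \<sigma>"
  unfolding om_def by (rule Max_upper)

lemma Ym_upper: "i < n \<Longrightarrow> \<bar>y \<sigma> i\<bar> \<le> Ym \<sigma>"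
  unfolding Ym_def by (rule Max_upper)

lemma om_nonneg: "0 \<le> om \<sigma>"
  using om_upper[OF n0, of \<sigma>] by linarith

lemma Ym_nonneg: "0 \<le> Ym \<sigma>"
  using Ym_upper[OF n0, of \<sigma>] by linarith

lemma al_upper: "i < n \<Longrightarrow> ip n (a i) (a i) \<le> al"
  unfolding al_def by (rule Max_upper)

lemma al_nonneg: "0 \<le> al"
  using al_upper[OF n0] ip_nonneg[of n "a 0"] by linarith

text \<open>Cauchy-Schwarz for one row, whose sum is near 1. Errors of order
  \<open>1 / sqrt n\<close> are therefore at most of order \<open>sqrt al\<close>.\<close>

lemma al_lower: "1 / 2 \<le> real n * al"
proof -
  have "(1 / 2 :: real) \<le> (79 / 80)\<^sup>2" by (simp add: power2_eq_square)
  also have "\<dots> \<le> (\<Sum>j<n. a 0 j)\<^sup>2"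
    using d_le[OF n0] D1 unfolding row_eq by (intro power_mono) auto
  also have "\<dots> = (real n * avg n (a 0))\<^sup>2" by (simp add: sum_eq_avg n0)
  also have "\<dots> = real n * (real n * (avg n (a 0))\<^sup>2)" by (simp add: power2_eq_square)
  also have "\<dots> \<le> real n * ip n (a 0) (a 0)" by (intro mult_left_mono avg_sq_le n0) auto
  also have "\<dots> \<le> real n * al" by (intro mult_left_mono al_upper n0) auto
  finally show ?thesis .
qed

lemma al_pos: "0 < al"
  using al_lower al_nonneg by (cases "al = 0") auto

lemma fr_nonneg: "0 \<le> fr"
  unfolding fr_def by (intro sum_nonneg ip_nonneg)

lemma m_bound: "\<sigma> \<in> conf n \<Longrightarrow> i < n \<Longrightarrow> \<bar>m \<sigma> i\<bar> \<le> 1 + D"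
  using m_sup[of \<sigma> 1 i] conf_abs[of \<sigma> n] by simp

lemma mb_bound: "\<sigma> \<in> conf n \<Longrightarrow> \<bar>mb \<sigma>\<bar> \<le> 1 + D"
  unfolding mb_def by (rule avg_abs_le[OF m_bound n0])

lemma sb_bound: "\<sigma> \<in> conf n \<Longrightarrow> \<bar>sb \<sigma>\<bar> \<le> 1"
  unfolding sb_def by (rule avg_abs_le[OF _ n0]) (simp add: conf_abs)

lemma y_bound: "\<sigma> \<in> conf n \<Longrightarrow> i < n \<Longrightarrow> \<bar>y \<sigma> i\<bar> \<le> 3"
  using m_bound[of \<sigma> i] mb_bound[of \<sigma>] D1 m_eq_y[of \<sigma> i] by linarith

lemma Ym_le_3: "\<sigma> \<in> conf n \<Longrightarrow> Ym \<sigma> \<le> 3"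
  unfolding Ym_def using Max_attained[of "\<lambda>i. \<bar>y \<sigma> i\<bar>"] y_bound[of \<sigma>] by auto

lemma mb_eq: "real n * mb \<sigma> = real n * sb \<sigma> + u \<sigma>"
  using sum_m[of \<sigma>] by (simp add: mb_def sb_def u_def sum_eq_avg[OF n0])

lemma m_fixed_point: "m \<sigma> i = m (\<lambda>j. tanh (m \<sigma> j)) i + an \<sigma> i"
  unfolding an_def nz_def mv_diff by simp

lemma Psi_residual: "m \<sigma> i - Psi tanh (m \<sigma>) i = (an \<sigma> i + tanh (mb \<sigma>) * d i) / 2"
  using m_fixed_point[of \<sigma> i] by (simp add: Psi_def mb_def field_simps)

lemma tanh_step: "s \<le> t \<Longrightarrow> 0 \<le> tanh t - tanh s \<and> tanh t - tanh s \<le> t - s" for s t :: real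
  using tanh_diff_le[of s t] by simp

text \<open>Constants are eigenvectors up to \<open>d\<close>, so in the sum over all sites the
  linear parts of the fixed point equation cancel and only the cubic \<open>tgap\<close> is left.
  This is where the critical temperature enters.\<close>

lemma sum_tgap: "(\<Sum>i<n. tgap (m \<sigma> i)) = (\<Sum>i<n. d i * tanh (m \<sigma> i)) + (\<Sum>i<n. an \<sigma> i)"
proof -
  have "(\<Sum>i<n. m \<sigma> i) = (\<Sum>i<n. m (\<lambda>j. tanh (m \<sigma> j)) i) + (\<Sum>i<n. an \<sigma> i)"
    unfolding sum.distrib[symmetric] by (intro sum.cong refl m_fixed_point)
  then show ?thesis by (simp add: sum_m tgap_def sum_subtractf ip_def)
qed

text \<open>Stability of a contraction: the deviation from the constants is at most the defect
  divided by \<open>rate\<close>. In the Euclidean norm no logarithm appears.\<close>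

lemma y_nrm: "2 * rate * nrm n (y \<sigma>) \<le> nrm n (an \<sigma>) + \<bar>mb \<sigma>\<bar> * nrm n d"
proof -
  have "rate * nrm n (y \<sigma>) \<le> nrm n (ctr n (\<lambda>i. m \<sigma> i - Psi tanh (m \<sigma>) i))"
    unfolding y_def by (rule L2_bound) (rule tanh_step)
  also have "\<dots> \<le> nrm n (\<lambda>i. m \<sigma> i - Psi tanh (m \<sigma>) i)"
    by (rule nrm_ctr_le[OF n0])
  also have "\<dots> = nrm n (\<lambda>i. (1 / 2) * (an \<sigma> i + tanh (mb \<sigma>) * d i))"
    by (rule nrm_cong) (simp add: Psi_residual)
  also have "\<dots> = (1 / 2) * nrm n (\<lambda>i. an \<sigma> i + tanh (mb \<sigma>) * d i)"
    unfolding nrm_scale by simp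
  also have "nrm n (\<lambda>i. an \<sigma> i + tanh (mb \<sigma>) * d i) \<le> nrm n (an \<sigma>) + \<bar>tanh (mb \<sigma>)\<bar> * nrm n d"
    using nrm_triangle[of n "an \<sigma>" "\<lambda>i. tanh (mb \<sigma>) * d i"] by (simp add: nrm_scale)
  also have "\<bar>tanh (mb \<sigma>)\<bar> * nrm n d \<le> \<bar>mb \<sigma>\<bar> * nrm n d"
    by (intro mult_right_mono tanh_abs_le nrm_nonneg)
  finally show ?thesis by simp
qed

lemma y_ip: "ip n (y \<sigma>) (y \<sigma>) \<le> (ip n (an \<sigma>) (an \<sigma>) + (mb \<sigma>)\<^sup>2 * ip n d d) / rate\<^sup>2"
proof -
  have "(2 * rate * nrm n (y \<sigma>))\<^sup>2 \<le> (nrm n (an \<sigma>) + \<bar>mb \<sigma>\<bar> * nrm n d)\<^sup>2"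
    using rate_pos by (intro power_mono y_nrm mult_nonneg_nonneg nrm_nonneg) auto
  also have "\<dots> \<le> 2 * (nrm n (an \<sigma>))\<^sup>2 + 2 * (\<bar>mb \<sigma>\<bar> * nrm n d)\<^sup>2"
    using sum_squares_bound[of "nrm n (an \<sigma>)" "\<bar>mb \<sigma>\<bar> * nrm n d"] by (simp add: power2_sum)
  finally have "4 * rate\<^sup>2 * ip n (y \<sigma>) (y \<sigma>) \<le> 2 * (ip n (an \<sigma>) (an \<sigma>) + (mb \<sigma>)\<^sup>2 * ip n d d)"
    by (simp add: power_mult_distrib nrm_sq)
  moreover have "0 \<le> ip n (an \<sigma>) (an \<sigma>) + (mb \<sigma>)\<^sup>2 * ip n d d"
    by (intro add_nonneg_nonneg mult_nonneg_nonneg ip_nonneg) auto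
  ultimately show ?thesis using rate_pos by (simp add: field_simps)
qed

lemma Ym_le:
  assumes "real k * D \<le> 1" "(1 - rate) ^ k * sqrt n \<le> 1 / 2"
  shows "Ym \<sigma> \<le> 6 * k * (om \<sigma> + \<bar>mb \<sigma>\<bar> * D)"
proof -
  obtain i where i: "i < n" "Ym \<sigma> = \<bar>y \<sigma> i\<bar>"
    unfolding Ym_def using Max_attained[of "\<lambda>i. \<bar>y \<sigma> i\<bar>"] by auto
  have "\<bar>ctr n (m \<sigma>) i\<bar> \<le> 12 * real k * ((om \<sigma> + \<bar>mb \<sigma>\<bar> * D) / 2)"
  proof (rule sup_bound[OF tanh_step _ assms i(1)])
    fix i assume i: "i < n"
    have "\<bar>an \<sigma> i + tanh (mb \<sigma>) * d i\<bar> \<le> \<bar>an \<sigma> i\<bar> + \<bar>tanh (mb \<sigma>)\<bar> * \<bar>d i\<bar>"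
      by (simp add: abs_triangle_ineq order_trans[OF abs_triangle_ineq] flip: abs_mult)
    also have "\<dots> \<le> om \<sigma> + \<bar>mb \<sigma>\<bar> * D"
      by (intro add_mono om_upper mult_mono tanh_abs_le d_le i) auto
    finally show "\<bar>m \<sigma> i - Psi tanh (m \<sigma>) i\<bar> \<le> (om \<sigma> + \<bar>mb \<sigma>\<bar> * D) / 2"
      by (simp add: Psi_residual)
  qed
  then show ?thesis by (simp add: i y_def)
qed

lemma max_nz_exp:
  assumes "0 \<le> \<theta>" and c: "\<And>i. i < n \<Longrightarrow> ip n (c i) (c i) \<le> v"
  shows "E (\<lambda>\<sigma>. exp (\<theta> * (MAX i\<in>{..<n}. \<bar>ip n (c i) (nz \<sigma>)\<bar>))) \<le> 2 * n * exp (5 * \<theta>\<^sup>2 * v)"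
proof -
  have "E (\<lambda>\<sigma>. exp (\<theta> * (MAX i\<in>{..<n}. \<bar>ip n (c i) (nz \<sigma>)\<bar>))) \<le> E (\<lambda>\<sigma>. \<Sum>i<n. exp \<bar>ip n (\<lambda>j. \<theta> * c i j) (nz \<sigma>)\<bar>)"
  proof (rule E_mono)
    fix \<sigma>
    obtain i where i: "i < n" "(MAX i\<in>{..<n}. \<bar>ip n (c i) (nz \<sigma>)\<bar>) = \<bar>ip n (c i) (nz \<sigma>)\<bar>"
      using Max_attained[of "\<lambda>i. \<bar>ip n (c i) (nz \<sigma>)\<bar>"] by auto
    have "exp (\<theta> * (MAX i\<in>{..<n}. \<bar>ip n (c i) (nz \<sigma>)\<bar>)) = exp \<bar>ip n (\<lambda>j. \<theta> * c i j) (nz \<sigma>)\<bar>"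
      using assms by (simp add: i ip_scale_left abs_mult)
    also have "\<dots> \<le> (\<Sum>i<n. exp \<bar>ip n (\<lambda>j. \<theta> * c i j) (nz \<sigma>)\<bar>)"
      by (rule member_le_sum[of i]) (use i in auto)
    finally show "exp (\<theta> * (MAX i\<in>{..<n}. \<bar>ip n (c i) (nz \<sigma>)\<bar>)) \<le> (\<Sum>i<n. exp \<bar>ip n (\<lambda>j. \<theta> * c i j) (nz \<sigma>)\<bar>)" .
  qed
  also have "\<dots> \<le> (\<Sum>i<n. 2 * exp (5 * \<theta>\<^sup>2 * v))"
    unfolding E_sum
  proof (intro sum_mono order_trans[OF nz_exp_abs] mult_left_mono)
    fix i assume "i \<in> {..<n}"
    then have "\<theta>\<^sup>2 * ip n (c i) (c i) \<le> \<theta>\<^sup>2 * v" by (intro mult_left_mono c) auto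
    then show "exp (5 * ip n (\<lambda>j. \<theta> * c i j) (\<lambda>j. \<theta> * c i j)) \<le> exp (5 * \<theta>\<^sup>2 * v)"
      by (simp add: ip_scale_left ip_scale_right power2_eq_square mult_ac)
  qed auto
  finally show ?thesis by simp
qed

lemma om_exp:
  assumes "0 \<le> \<theta>"
  shows "E (\<lambda>\<sigma>. exp (\<theta> * om \<sigma>)) \<le> 2 * n * exp (5 * \<theta>\<^sup>2 * al)"
  using max_nz_exp[OF assms al_upper] by (simp add: om_def an_eq)

end

subsection \<open>Second moments of linear forms\<close>

lemma le_weighted_sum:
  fixes x a b \<eta> :: real
  assumes "x\<^sup>2 \<le> a * b" "0 \<le> a" "0 \<le> b" "0 < \<eta>"
  shows "x \<le> \<eta> * a + b / (4 * \<eta>)"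
proof -
  define s where "s = \<eta> * a + b / (4 * \<eta>)"
  have s: "0 \<le> s" using assms by (simp add: s_def)
  have "s\<^sup>2 - a * b = (\<eta> * a - b / (4 * \<eta>))\<^sup>2"
    using assms(4) by (simp add: s_def power2_eq_square field_simps)
  then have "a * b \<le> s\<^sup>2" by (metis diff_ge_0_iff_ge zero_le_power2)
  then have "x\<^sup>2 \<le> s\<^sup>2" using assms(1) by linarith
  then show ?thesis using s by (metis power2_le_imp_le s_def)
qed

lemma ip_young: "0 < \<eta> \<Longrightarrow> ip n x y \<le> \<eta> * ip n x x + ip n y y / (4 * \<eta>)"
proof (rule le_weighted_sum)
  have "(ip n x y)\<^sup>2 \<le> (nrm n x * nrm n y)\<^sup>2"
    using Cauchy_Schwarz_ip[of n x y] by (metis abs_ge_zero power2_abs power_mono)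
  then show "(ip n x y)\<^sup>2 \<le> ip n x x * ip n y y" by (simp add: power_mult_distrib nrm_sq)
qed (auto simp: ip_nonneg)

context near_regular
begin

definition \<tau> :: real where "\<tau> = E (\<lambda>\<sigma>. (sb \<sigma>)\<^sup>2)"
definition sd :: real where "sd = (\<Sum>i<n. d i)"
text \<open>The price of the constant component of a covariance vector, which the spectral gap does
  not see. It will be bounded, because \<open>\<tau>\<close> has order at most
  \<open>1 / sqrt n\<close> while \<open>ip n d d\<close> and \<open>sd\<close> have order at most
  \<open>sqrt n\<close>.\<close>

definition \<Theta> :: real where "\<Theta> = 1 + \<tau> * (ip n d d + \<bar>sd\<bar>)"

lemma \<tau>_nonneg: "0 \<le> \<tau>" unfolding \<tau>_def by (intro E_nonneg) simp

lemma \<Theta>_ge_1: "1 \<le> \<Theta>"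
  unfolding \<Theta>_def by (simp add: \<tau>_nonneg ip_nonneg)

text \<open>The second moment \<open>q\<close> equals \<open>ip n \<xi> z\<close> for the
  covariances \<open>\<xi>\<close> of the spins with the form. The gap controls the centred part of
  \<open>\<xi>\<close>; the mean \<open>xb\<close>, invisible to the gap, obeys
  \<open>xb\<^sup>2 \<le> \<tau> * q\<close>. Young's inequality returns both to fractions of
  \<open>q\<close>.\<close>

lemma second_moment_nonneg_vector:
  assumes z: "\<And>i. i < n \<Longrightarrow> 0 \<le> z i"
  shows "E (\<lambda>\<sigma>. (ip n z \<sigma>)\<^sup>2) \<le> 17 * \<Theta> / \<delta>\<^sup>2 * ip n z z + 4 * \<tau> * (\<Sum>i<n. z i)\<^sup>2"
proof -
  define S where "S = (\<Sum>i<n. z i)"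
  define q where "q = E (\<lambda>\<sigma>. (ip n z \<sigma>)\<^sup>2)"
  define \<xi> where "\<xi> = (\<lambda>i. E (\<lambda>\<sigma>. \<sigma> i * ip n z \<sigma>))"
  define xb where "xb = avg n \<xi>"
  define X where "X = ip n (ctr n \<xi>) (ctr n \<xi>)"
  have q0: "0 \<le> q" unfolding q_def by (intro E_nonneg) simp
  have S0: "0 \<le> S" unfolding S_def using z by (intro sum_nonneg) auto
  have X0: "0 \<le> X" by (simp add: X_def ip_nonneg)
  have \<xi>0: "0 \<le> \<xi> i" and \<xi>sub: "\<xi> i \<le> z i + m \<xi> i" if "i < n" for i
    unfolding \<xi>_def by (rule cov_subsolution[OF z that]; assumption)+
  have xb0: "0 \<le> xb" unfolding xb_def avg_def using \<xi>0 by (intro divide_nonneg_nonneg sum_nonneg) auto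
  have xb: "xb = E (\<lambda>\<sigma>. sb \<sigma> * ip n z \<sigma>)"
    by (simp add: xb_def \<xi>_def avg_def sb_def E_divide E_sum sum_distrib_right[symmetric] flip: E_sum)
  have xb2: "xb\<^sup>2 \<le> \<tau> * q"
    unfolding xb \<tau>_def q_def by (rule E_Cauchy_Schwarz)
  have q_eq: "q = ip n \<xi> z"
  proof -
    have "q = E (\<lambda>\<sigma>. \<Sum>i<n. z i * (\<sigma> i * ip n z \<sigma>))"
      unfolding q_def by (rule E_cong) (simp add: power2_eq_square ip_def sum_distrib_right mult_ac)
    then show ?thesis by (simp add: E_sum E_cmult ip_def \<xi>_def mult.commute)
  qed
  \<comment> \<open>The subsolution is tested against itself, which \<open>\<xi> i \<ge> 0\<close>
    permits.\<close>
  have "ip n \<xi> \<xi> - ip n \<xi> (m \<xi>) \<le> ip n \<xi> z"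
    unfolding ip_def sum_subtractf[symmetric]
  proof (intro sum_mono)
    fix i assume "i \<in> {..<n}"
    then have "\<xi> i * (\<xi> i - m \<xi> i) \<le> \<xi> i * z i" using \<xi>sub[of i] \<xi>0[of i] by (intro mult_left_mono) auto
    then show "\<xi> i * \<xi> i - \<xi> i * m \<xi> i \<le> \<xi> i * z i" by (simp add: right_diff_distrib)
  qed
  moreover have "ip n \<xi> \<xi> = X + n * xb\<^sup>2"
    using ip_split[OF n0, of \<xi> \<xi>] by (simp add: X_def xb_def power2_eq_square)
  \<comment> \<open>Its term \<open>n * xb\<^sup>2\<close> cancels against that of
    \<open>ip n \<xi> \<xi>\<close>; what the mean leaves behind are terms with
    \<open>d\<close>.\<close>
  moreover have "ip n \<xi> (m \<xi>) = ip n (ctr n \<xi>) (m (ctr n \<xi>)) + 2 * xb * ip n d (ctr n \<xi>) + xb\<^sup>2 * (n + sd)"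
  proof -
    have \<xi>eq: "\<xi> = (\<lambda>i. ctr n \<xi> i + xb)" by (simp add: ctr_def xb_def)
    have mx: "m \<xi> = (\<lambda>i. m (ctr n \<xi>) i + xb * (1 + d i))"
      by (subst \<xi>eq) (simp add: mv_add m_const)
    have "ip n \<xi> (m \<xi>) = ip n (ctr n \<xi>) (m (ctr n \<xi>)) + ip n (ctr n \<xi>) (\<lambda>i. xb * (1 + d i))
      + ip n (\<lambda>_. xb) (m (ctr n \<xi>)) + ip n (\<lambda>_. xb) (\<lambda>i. xb * (1 + d i))"
      unfolding mx by (subst \<xi>eq) (simp only: ip_add_left ip_add_right)
    moreover have "ip n (ctr n \<xi>) (\<lambda>i. xb * (1 + d i)) = xb * ip n d (ctr n \<xi>)"
      by (simp add: ip_scale_right ip_add_right ip_const sum_ctr[OF n0] ip_commute)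
    moreover have "ip n (\<lambda>_. xb) (m (ctr n \<xi>)) = xb * ip n d (ctr n \<xi>)"
      by (simp add: ip_const sum_m sum_ctr[OF n0])
    moreover have "ip n (\<lambda>_. xb) (\<lambda>i. xb * (1 + d i)) = xb\<^sup>2 * (n + sd)"
      by (simp add: ip_const sum.distrib sd_def power2_eq_square flip: sum_distrib_left)
    ultimately show ?thesis by simp
  qed
  moreover have "ip n (ctr n \<xi>) (m (ctr n \<xi>)) \<le> (1 - \<delta>) * X"
    unfolding X_def by (rule gap) (simp add: ip_one sum_ctr[OF n0])
  moreover have \<xi>z: "ip n \<xi> z = ip n (ctr n \<xi>) z + xb * S"
    using ip_split[OF n0, of \<xi> z] ip_ctr_left[OF n0, of \<xi> z] sum_eq_avg[OF n0, of z] by (simp add: xb_def S_def)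
  ultimately have "\<delta> * X \<le> ip n (ctr n \<xi>) z + xb * S + 2 * (xb * ip n d (ctr n \<xi>)) + xb\<^sup>2 * sd"
    by (simp add: algebra_simps)
  moreover have "ip n (ctr n \<xi>) z \<le> \<delta> / 4 * X + ip n z z / \<delta>"
    using ip_young[of "\<delta> / 4" n "ctr n \<xi>" z] \<delta>0 by (simp add: X_def)
  moreover have "2 * (xb * ip n d (ctr n \<xi>)) \<le> \<delta> / 4 * X + 4 * (xb\<^sup>2 * ip n d d) / \<delta>"
    using ip_young[of "\<delta> / 4" n "ctr n \<xi>" "\<lambda>i. (2 * xb) * d i"] \<delta>0
    unfolding ip_scale_right ip_scale_left by (simp add: X_def power2_eq_square ip_commute mult_ac)
  moreover have "xb\<^sup>2 * sd \<le> xb\<^sup>2 * \<bar>sd\<bar>" by (intro mult_left_mono) auto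
  ultimately have "\<delta> / 2 * X \<le> ip n z z / \<delta> + 4 * (xb\<^sup>2 * ip n d d) / \<delta> + xb * S + xb\<^sup>2 * \<bar>sd\<bar>"
    by (simp add: algebra_simps)
  also have "\<dots> \<le> 4 / \<delta> * (ip n z z + xb\<^sup>2 * (ip n d d + \<bar>sd\<bar>) + xb * S)"
  proof -
    have le: "t \<le> 4 / \<delta> * t" if "0 \<le> t" for t
    proof -
      have "\<delta> * t \<le> 1 * t" using that \<delta>1 by (intro mult_right_mono) auto
      then show ?thesis using that \<delta>0 by (simp add: field_simps)
    qed
    have "xb * S \<le> 4 / \<delta> * (xb * S)" "xb\<^sup>2 * \<bar>sd\<bar> \<le> 4 / \<delta> * (xb\<^sup>2 * \<bar>sd\<bar>)"
      by (intro le mult_nonneg_nonneg xb0 S0; simp)+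
    moreover have "ip n z z / \<delta> \<le> 4 / \<delta> * ip n z z"
      using \<delta>0 ip_nonneg[of n z] by (simp add: divide_right_mono)
    ultimately show ?thesis by (simp add: distrib_left)
  qed
  finally have Xle: "X \<le> 8 / \<delta>\<^sup>2 * (ip n z z + xb\<^sup>2 * (ip n d d + \<bar>sd\<bar>) + xb * S)"
    using \<delta>0 by (simp add: field_simps power2_eq_square)
  have xbq: "xb\<^sup>2 * (ip n d d + \<bar>sd\<bar>) \<le> \<Theta> * q"
  proof -
    have "xb\<^sup>2 * (ip n d d + \<bar>sd\<bar>) \<le> \<tau> * q * (ip n d d + \<bar>sd\<bar>)"
      by (intro mult_right_mono xb2 add_nonneg_nonneg ip_nonneg) auto
    also have "\<dots> \<le> \<Theta> * q" using q0 by (simp add: \<Theta>_def algebra_simps)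
    finally show ?thesis .
  qed
  \<comment> \<open>The weight is chosen so that the part \<open>\<Theta> * q\<close> of the bound
    on \<open>X\<close> returns only \<open>q / 4\<close>.\<close>
  have "q \<le> \<delta>\<^sup>2 / (32 * \<Theta>) * X + 8 * \<Theta> / \<delta>\<^sup>2 * ip n z z + xb * S"
    using ip_young[of "\<delta>\<^sup>2 / (32 * \<Theta>)" n "ctr n \<xi>" z] \<delta>0 \<Theta>_ge_1
    by (simp add: q_eq \<xi>z X_def field_simps)
  also have "\<delta>\<^sup>2 / (32 * \<Theta>) * X \<le> \<delta>\<^sup>2 / (32 * \<Theta>) * (8 / \<delta>\<^sup>2 * (ip n z z + \<Theta> * q + xb * S))"
  proof (intro mult_left_mono order_trans[OF Xle])
    show "ip n z z + xb\<^sup>2 * (ip n d d + \<bar>sd\<bar>) + xb * S \<le> ip n z z + \<Theta> * q + xb * S"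
      using xbq by simp
  qed (use \<Theta>_ge_1 in auto)
  also have "\<dots> = (ip n z z + xb * S) / (4 * \<Theta>) + q / 4"
    using \<delta>0 \<Theta>_ge_1 by (simp add: field_simps)
  also have "(ip n z z + xb * S) / (4 * \<Theta>) \<le> (ip n z z + xb * S) / 4"
    using \<Theta>_ge_1 xb0 S0 ip_nonneg[of n z] by (intro divide_left_mono add_nonneg_nonneg mult_nonneg_nonneg) auto
  finally have "q \<le> (ip n z z + xb * S) / 4 + q / 4 + 8 * \<Theta> / \<delta>\<^sup>2 * ip n z z + xb * S" by simp
  \<comment> \<open>With the weight \<open>1 / 5\<close>, the total \<open>5 / 4 * (xb * S)\<close>
    returns another \<open>q / 4\<close>, so that half of \<open>q\<close> survives.\<close>
  moreover have "xb * S \<le> 1 / 5 * q + (\<tau> * S\<^sup>2) / (4 * (1 / 5))"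
  proof (rule le_weighted_sum)
    have "(xb * S)\<^sup>2 \<le> (\<tau> * q) * S\<^sup>2"
      unfolding power_mult_distrib by (intro mult_right_mono xb2) auto
    then show "(xb * S)\<^sup>2 \<le> q * (\<tau> * S\<^sup>2)" by (simp add: mult_ac)
  qed (use q0 \<tau>_nonneg in auto)
  ultimately have "q / 2 \<le> ip n z z / 4 + 8 * \<Theta> / \<delta>\<^sup>2 * ip n z z + 25 / 16 * (\<tau> * S\<^sup>2)"
    by argo
  moreover have "ip n z z / 4 \<le> 1 / 4 * \<Theta> / \<delta>\<^sup>2 * ip n z z"
  proof -
    have "\<delta>\<^sup>2 \<le> 1" using \<delta>0 \<delta>1 by (simp add: power_le_one)
    then have "1 \<le> \<Theta> / \<delta>\<^sup>2" using \<Theta>_ge_1 \<delta>0 by (simp add: field_simps)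
    then have "1 * ip n z z \<le> \<Theta> / \<delta>\<^sup>2 * ip n z z" by (intro mult_right_mono ip_nonneg)
    then show ?thesis by simp
  qed
  ultimately have "q \<le> 2 * (1 / 4 * \<Theta> / \<delta>\<^sup>2 * ip n z z + 8 * \<Theta> / \<delta>\<^sup>2 * ip n z z) + 25 / 8 * (\<tau> * S\<^sup>2)"
    by argo
  also have "2 * (1 / 4 * \<Theta> / \<delta>\<^sup>2 * ip n z z + 8 * \<Theta> / \<delta>\<^sup>2 * ip n z z) \<le> 17 * \<Theta> / \<delta>\<^sup>2 * ip n z z"
  proof -
    have "0 \<le> \<Theta> / \<delta>\<^sup>2 * ip n z z" using \<Theta>_ge_1 by (intro mult_nonneg_nonneg ip_nonneg) auto
    then show ?thesis by simp
  qed
  also have "25 / 8 * (\<tau> * S\<^sup>2) \<le> 4 * \<tau> * S\<^sup>2" using \<tau>_nonneg by simp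
  finally show ?thesis by (simp add: q_def S_def)
qed

text \<open>The centred coupling operator has eigenvalues at most \<open>1 - \<delta>\<close>, so
  identity minus this operator is inverted in an eigenbasis, with norm at most
  \<open>1 / \<delta>\<close> on centred vectors. Negative eigenvalues do no harm here.\<close>

lemma resolvent_exists:
  assumes v: "(\<Sum>i<n. v i) = 0"
  obtains w where "(\<Sum>i<n. w i) = 0" "\<And>i. i < n \<Longrightarrow> w i - ctr n (m w) i = v i" "\<delta> * nrm n w \<le> nrm n v"
proof -
  \<comment> \<open>The matrix \<open>P a P\<close> for the projection \<open>P\<close> that
    subtracts the mean, written out by entries so that its symmetry is visible.\<close>
  define b where "b = (\<lambda>i j. a i j - (1 + d i) / n - (1 + d j) / n + avg n (\<lambda>i. 1 + d i) / n)"
  have bsym: "b i j = b j i" if "i < n" "j < n" for i j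
    using sym[OF that] by (simp add: b_def)
  have b: "mv n b x i = ctr n (m (ctr n x)) i" if "i < n" for x i
  proof -
    have mc: "m (ctr n x) i = m x i - avg n x * (1 + d i)" for i
      unfolding ctr_def mv_diff m_const by simp
    have "avg n (m (ctr n x)) = ip n d (ctr n x) / n"
      by (simp add: avg_def sum_m sum_ctr[OF n0])
    also have "ip n d (ctr n x) = ip n (\<lambda>i. 1 + d i) x - avg n x * (\<Sum>i<n. 1 + d i)"
      by (simp add: ctr_def ip_diff_right ip_add_left ip_const sum_eq_avg[OF n0, of x] sum.distrib) (simp add: ip_one sum_eq_avg[OF n0, of x] algebra_simps)
    finally have 1: "ctr n (m (ctr n x)) i = m x i - avg n x * (1 + d i)
        - (ip n (\<lambda>i. 1 + d i) x - avg n x * (\<Sum>i<n. 1 + d i)) / n"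
      unfolding ctr_def[of n "m (ctr n x)"] mc by simp
    have "mv n b x i = m x i - (1 + d i) / n * (\<Sum>j<n. x j) - ip n (\<lambda>i. 1 + d i) x / n + avg n (\<lambda>i. 1 + d i) / n * (\<Sum>j<n. x j)"
      unfolding mv_def ip_def b_def sum_divide_distrib sum_distrib_left sum_subtractf[symmetric] sum.distrib[symmetric]
      by (intro sum.cong refl) (simp add: algebra_simps add_divide_distrib)
    then show ?thesis
      unfolding 1 avg_def by (simp add: diff_divide_distrib add_divide_distrib algebra_simps)
  qed
  obtain e l where e: "\<And>j h. j < n \<Longrightarrow> h < n \<Longrightarrow> ip n (e j) (e h) = (if j = h then 1 else 0)"
    and eig: "\<And>j i. j < n \<Longrightarrow> i < n \<Longrightarrow> mv n b (e j) i = l j * e j i"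
    by (rule orthonormal_eigenbasis[of n b]) (use bsym in auto)
  have l: "l k \<le> 1 - \<delta>" if k: "k < n" for k
  proof -
    have "l k = ip n (e k) (\<lambda>i. l k * e k i)" using e[OF k k] by (simp add: ip_scale_right)
    also have "\<dots> = ip n (e k) (ctr n (m (ctr n (e k))))"
      by (rule ip_cong) (use eig[OF k] b in auto)
    also have "\<dots> = ip n (ctr n (e k)) (m (ctr n (e k)))"
      using ip_ctr_left[OF n0] ip_ctr_right[OF n0] by metis
    also have "\<dots> \<le> (1 - \<delta>) * ip n (ctr n (e k)) (ctr n (e k))"
      by (rule gap) (simp add: ip_one sum_ctr[OF n0])
    also have "\<dots> \<le> (1 - \<delta>) * 1"
      using ip_ctr_le[OF n0, of "e k"] e[OF k k] \<delta>1 by (intro mult_left_mono) auto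
    finally show ?thesis by simp
  qed
  define c where "c = (\<lambda>k. ip n (e k) v / (1 - l k))"
  define w where "w = (\<lambda>i. \<Sum>k<n. c k * e k i)"
  have mvb: "mv n b w i = (\<Sum>k<n. c k * (l k * e k i))" if "i < n" for i
  proof -
    have "mv n b w i = (\<Sum>k<n. c k * mv n b (e k) i)"
      unfolding mv_def w_def sum_distrib_left by (subst sum.swap) (simp add: mult_ac)
    also have "\<dots> = (\<Sum>k<n. c k * (l k * e k i))"
      by (intro sum.cong refl) (simp add: eig that)
    finally show ?thesis .
  qed
  have w: "w i - ctr n (m (ctr n w)) i = v i" if "i < n" for i
  proof -
    have "w i - ctr n (m (ctr n w)) i = (\<Sum>k<n. c k * e k i - c k * (l k * e k i))"
      unfolding b[OF that, symmetric] mvb[OF that] by (simp add: w_def sum_subtractf)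
    also have "\<dots> = (\<Sum>k<n. ip n (e k) v * e k i)"
    proof (intro sum.cong refl)
      fix k assume "k \<in> {..<n}"
      then have "1 - l k \<noteq> 0" using l[of k] \<delta>0 by auto
      moreover have "c k * e k i - c k * (l k * e k i) = c k * (1 - l k) * e k i" by (simp add: algebra_simps)
      ultimately show "c k * e k i - c k * (l k * e k i) = ip n (e k) v * e k i" by (simp add: c_def)
    qed
    also have "\<dots> = v i" by (rule orthonormal_expansion[OF e that])
    finally show ?thesis .
  qed
  have sw: "(\<Sum>i<n. w i) = 0"
  proof -
    have "(\<Sum>i<n. w i - ctr n (m (ctr n w)) i) = (\<Sum>i<n. v i)" by (intro sum.cong refl w) auto
    then show ?thesis using v by (simp add: sum_subtractf sum_ctr[OF n0])
  qed
  then have cw: "ctr n w = w" by (simp add: ctr_def avg_def)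
  have "\<delta> * (nrm n w)\<^sup>2 \<le> ip n w w - ip n w (m w)"
    using gap[of w] sw by (simp add: ip_one nrm_sq algebra_simps)
  also have "ip n w (m w) = ip n w (ctr n (m w))"
    using ip_ctr_left[OF n0, of w "m w"] by (simp add: cw)
  also have "ip n w w - ip n w (ctr n (m w)) = ip n w v"
    unfolding ip_diff_right[symmetric] by (rule ip_cong) (use w cw in auto)
  also have "\<dots> \<le> nrm n w * nrm n v" using Cauchy_Schwarz_ip[of n w v] by linarith
  finally have "\<delta> * nrm n w * nrm n w \<le> nrm n v * nrm n w" by (simp add: power2_eq_square mult_ac)
  then have "\<delta> * nrm n w \<le> nrm n v"
    using nrm_nonneg[of n w] nrm_nonneg[of n v] by (cases "nrm n w = 0") (auto simp: mult_le_cancel_right)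
  then show thesis using that[of w] sw w cw by simp
qed

subsection \<open>The linear form of the row deviations\<close>

definition p :: "nat \<Rightarrow> real" where "p i = E (\<lambda>\<sigma>. (m \<sigma> i)\<^sup>2)"

lemma p_nonneg: "0 \<le> p i" unfolding p_def by (intro E_nonneg) simp

lemma p_le_2: "i < n \<Longrightarrow> p i \<le> 2"
proof -
  assume i: "i < n"
  have "p i \<le> E (\<lambda>_. 2)"
    unfolding p_def
  proof (rule E_mono)
    fix \<sigma> assume "\<sigma> \<in> conf n"
    from m_bound[OF this i] D1 have "\<bar>m \<sigma> i\<bar> \<le> 81 / 80" by simp
    then have "\<bar>m \<sigma> i\<bar>\<^sup>2 \<le> (81 / 80)\<^sup>2" by (intro power_mono) auto
    then show "(m \<sigma> i)\<^sup>2 \<le> 2" by (simp add: power2_eq_square)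
  qed
  then show ?thesis by simp
qed

lemma p_le: 
  assumes i: "i < n"
  shows "p i \<le> 17 * \<Theta> / \<delta>\<^sup>2 * al + 16 * \<tau>"
proof -
  have "p i \<le> 17 * \<Theta> / \<delta>\<^sup>2 * ip n (a i) (a i) + 4 * \<tau> * (\<Sum>j<n. a i j)\<^sup>2"
    unfolding p_def m_eq_ip by (rule second_moment_nonneg_vector) (use nonneg i in auto)
  also have "17 * \<Theta> / \<delta>\<^sup>2 * ip n (a i) (a i) \<le> 17 * \<Theta> / \<delta>\<^sup>2 * al"
    using \<Theta>_ge_1 by (intro mult_left_mono al_upper i) auto
  also have "4 * \<tau> * (\<Sum>j<n. a i j)\<^sup>2 \<le> 4 * \<tau> * 2\<^sup>2"
    using row_le[OF i] D1 \<tau>_nonneg nonneg i by (intro mult_left_mono power_mono sum_nonneg) auto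
  finally show ?thesis by simp
qed

lemma u_sq_le: "\<sigma> \<in> conf n \<Longrightarrow> (u \<sigma>)\<^sup>2 \<le> real n * ip n d d"
proof -
  assume \<sigma>: "\<sigma> \<in> conf n"
  have "(u \<sigma>)\<^sup>2 \<le> (nrm n d * nrm n \<sigma>)\<^sup>2"
    unfolding u_def using Cauchy_Schwarz_ip[of n d \<sigma>] by (metis abs_ge_zero power2_abs power_mono)
  moreover have "ip n \<sigma> \<sigma> = real n"
    using conf_sq[OF \<sigma>] by (simp add: ip_def)
  ultimately show ?thesis by (simp add: power_mult_distrib nrm_sq mult.commute)
qed

lemma mb_sq_le: "real n * (mb \<sigma>)\<^sup>2 \<le> 2 * real n * (sb \<sigma>)\<^sup>2 + 2 * (u \<sigma>)\<^sup>2 / real n"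
proof -
  have "mb \<sigma> = sb \<sigma> + u \<sigma> / n"
    using mb_eq[of \<sigma>] n0 by (simp add: field_simps)
  moreover have "(sb \<sigma> + u \<sigma> / n)\<^sup>2 \<le> 2 * (sb \<sigma>)\<^sup>2 + 2 * (u \<sigma> / n)\<^sup>2"
    using sum_squares_bound[of "sb \<sigma>" "u \<sigma> / n"] by (simp add: power2_sum)
  ultimately have "real n * (mb \<sigma>)\<^sup>2 \<le> real n * (2 * (sb \<sigma>)\<^sup>2 + 2 * (u \<sigma> / n)\<^sup>2)"
    by (intro mult_left_mono) auto
  also have "\<dots> = 2 * real n * (sb \<sigma>)\<^sup>2 + 2 * (u \<sigma>)\<^sup>2 / real n"
    using n0 by (simp add: field_simps power2_eq_square)
  finally show ?thesis .
qed

lemma E_an_sq: "E (\<lambda>\<sigma>. ip n (an \<sigma>) (an \<sigma>)) \<le> Kmom 2 * fr"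
proof -
  have "E (\<lambda>\<sigma>. ip n (an \<sigma>) (an \<sigma>)) = (\<Sum>i<n. E (\<lambda>\<sigma>. \<bar>ip n (a i) (nz \<sigma>)\<bar> ^ 2))"
    unfolding E_sum[symmetric] by (rule E_cong) (simp add: ip_def[of n "an _"] an_eq power2_eq_square)
  also have "\<dots> \<le> (\<Sum>i<n. Kmom 2 * nrm n (a i) ^ 2)"
    by (intro sum_mono nz_moment)
  finally show ?thesis by (simp add: nrm_sq fr_def sum_distrib_left)
qed

definition \<Pi>m :: real where
  "\<Pi>m = 2 * real n * \<tau> + 2 * ip n d d + (Kmom 2 * fr + 4 * ip n d d) / rate\<^sup>2"

lemma sum_p: "(\<Sum>i<n. p i) \<le> \<Pi>m"
proof -
  have "(\<Sum>i<n. p i) = E (\<lambda>\<sigma>. ip n (y \<sigma>) (y \<sigma>) + real n * (mb \<sigma>)\<^sup>2)"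
    unfolding p_def E_sum[symmetric]
  proof (rule E_cong)
    fix \<sigma>
    have "(\<Sum>i<n. (m \<sigma> i)\<^sup>2) = ip n (m \<sigma>) (m \<sigma>)" by (simp add: ip_def power2_eq_square)
    also have "\<dots> = ip n (y \<sigma>) (y \<sigma>) + real n * (mb \<sigma>)\<^sup>2"
      using ip_split[OF n0, of "m \<sigma>" "m \<sigma>"] by (simp add: y_def mb_def power2_eq_square mult.assoc)
    finally show "(\<Sum>i<n. (m \<sigma> i)\<^sup>2) = ip n (y \<sigma>) (y \<sigma>) + real n * (mb \<sigma>)\<^sup>2" .
  qed
  also have "\<dots> \<le> E (\<lambda>\<sigma>. (ip n (an \<sigma>) (an \<sigma>) + 4 * ip n d d) / rate\<^sup>2 + (2 * real n * (sb \<sigma>)\<^sup>2 + 2 * ip n d d))"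
  proof (intro E_mono add_mono)
    fix \<sigma> assume \<sigma>: "\<sigma> \<in> conf n"
    have "\<bar>mb \<sigma>\<bar>\<^sup>2 \<le> 2\<^sup>2" using mb_bound[OF \<sigma>] D1 by (intro power_mono) auto
    then have "(mb \<sigma>)\<^sup>2 * ip n d d \<le> 4 * ip n d d" by (intro mult_right_mono ip_nonneg) auto
    then show "ip n (y \<sigma>) (y \<sigma>) \<le> (ip n (an \<sigma>) (an \<sigma>) + 4 * ip n d d) / rate\<^sup>2"
      by (intro order_trans[OF y_ip] divide_right_mono add_left_mono) auto
    have "2 * (u \<sigma>)\<^sup>2 / real n \<le> 2 * ip n d d"
      using u_sq_le[OF \<sigma>] n0 by (simp add: field_simps)
    then show "real n * (mb \<sigma>)\<^sup>2 \<le> 2 * real n * (sb \<sigma>)\<^sup>2 + 2 * ip n d d"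
      using mb_sq_le[of \<sigma>] by linarith
  qed
  also have "\<dots> = (E (\<lambda>\<sigma>. ip n (an \<sigma>) (an \<sigma>)) + 4 * ip n d d) / rate\<^sup>2 + (2 * real n * \<tau> + 2 * ip n d d)"
    by (simp add: E_add E_divide E_cmult \<tau>_def)
  also have "\<dots> \<le> (Kmom 2 * fr + 4 * ip n d d) / rate\<^sup>2 + (2 * real n * \<tau> + 2 * ip n d d)"
    by (intro add_right_mono divide_right_mono E_an_sq) auto
  finally show ?thesis by (simp add: \<Pi>m_def)
qed

lemma \<Pi>m_nonneg: "0 \<le> \<Pi>m"
  by (rule order_trans[OF sum_nonneg sum_p]) (rule p_nonneg)

lemma E_m_m_nonneg: "i < n \<Longrightarrow> j < n \<Longrightarrow> 0 \<le> E (\<lambda>\<sigma>. m \<sigma> i * m \<sigma> j)"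
  by (rule FKG_odd) (use m_mono in \<open>auto simp: m_flip_all\<close>)

text \<open>The correlation of two \<open>tgap\<close> terms is at most \<open>p i\<close>, and by
  symmetry \<open>p j\<close>, times that of the fields, hence at most the geometric mean. The signs
  of \<open>w\<close> can then be dropped, and the non-negative form with coefficients
  \<open>sqrt (p i) * \<bar>w i\<bar>\<close> in the fields falls under
  \<open>second_moment_nonneg_vector\<close>. Its coefficient sum costs \<open>\<Pi>m\<close> by
  Cauchy-Schwarz.\<close>

lemma tgap_second_moment:
  "E (\<lambda>\<sigma>. (\<Sum>i<n. w i * tgap (m \<sigma> i))\<^sup>2) \<le> (68 * \<Theta> / \<delta>\<^sup>2 + 8 * \<tau> * \<Pi>m) * ip n w w"
proof -
  define z where "z = (\<lambda>i. sqrt (p i) * \<bar>w i\<bar>)"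
  have z0: "0 \<le> z i" for i by (simp add: z_def p_nonneg)
  have K: "w i * w j * E (\<lambda>\<sigma>. tgap (m \<sigma> i) * tgap (m \<sigma> j)) \<le> z i * z j * E (\<lambda>\<sigma>. m \<sigma> i * m \<sigma> j)"
    if ij: "i < n" "j < n" for i j
  proof -
    define K where "K = E (\<lambda>\<sigma>. tgap (m \<sigma> i) * tgap (m \<sigma> j))"
    define M where "M = E (\<lambda>\<sigma>. m \<sigma> i * m \<sigma> j)"
    have M: "0 \<le> M" unfolding M_def by (rule E_m_m_nonneg[OF ij])
    have K0: "0 \<le> K" unfolding K_def by (rule E_tgap_tgap(1)[OF ij])
    have Ki: "K \<le> p i * M" unfolding K_def M_def p_def by (rule E_tgap_tgap(2)[OF ij])
    have Kj: "K \<le> p j * M"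
      using E_tgap_tgap(2)[OF ij(2,1)] unfolding K_def M_def p_def by (simp add: mult.commute)
    have "K * K \<le> (p i * M) * (p j * M)"
      using Ki Kj K0 M p_nonneg by (intro mult_mono) auto
    also have "\<dots> = (sqrt (p i) * sqrt (p j) * M)\<^sup>2"
      by (simp add: power2_eq_square power_mult_distrib p_nonneg mult_ac flip: real_sqrt_mult)
    finally have "K\<^sup>2 \<le> (sqrt (p i) * sqrt (p j) * M)\<^sup>2"
      unfolding power2_eq_square[of K] .
    then have KM: "K \<le> sqrt (p i) * sqrt (p j) * M"
      by (rule power2_le_imp_le) (intro mult_nonneg_nonneg real_sqrt_ge_zero p_nonneg M)
    have "w i * w j \<le> \<bar>w i\<bar> * \<bar>w j\<bar>"
      using abs_ge_self[of "w i * w j"] by (simp only: abs_mult)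
    then have "w i * w j * K \<le> \<bar>w i\<bar> * \<bar>w j\<bar> * K"
      using K0 by (rule mult_right_mono)
    also have "\<dots> \<le> \<bar>w i\<bar> * \<bar>w j\<bar> * (sqrt (p i) * sqrt (p j) * M)"
      by (intro mult_left_mono KM) simp
    finally show ?thesis by (simp add: K_def M_def z_def mult_ac)
  qed
  have "E (\<lambda>\<sigma>. (\<Sum>i<n. w i * tgap (m \<sigma> i))\<^sup>2) = (\<Sum>i<n. \<Sum>j<n. w i * w j * E (\<lambda>\<sigma>. tgap (m \<sigma> i) * tgap (m \<sigma> j)))"
    unfolding E_cmult[symmetric] E_sum[symmetric] power2_eq_square sum_product
    by (rule E_cong) (simp add: mult_ac)
  also have "\<dots> \<le> (\<Sum>i<n. \<Sum>j<n. z i * z j * E (\<lambda>\<sigma>. m \<sigma> i * m \<sigma> j))"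
    by (intro sum_mono K) auto
  also have "\<dots> = E (\<lambda>\<sigma>. (ip n z (m \<sigma>))\<^sup>2)"
    unfolding E_cmult[symmetric] E_sum[symmetric] power2_eq_square ip_def sum_product
    by (rule E_cong) (simp add: mult_ac)
  also have "\<dots> = E (\<lambda>\<sigma>. (ip n (m z) \<sigma>)\<^sup>2)"
    by (simp add: ip_m_sym)
  also have "\<dots> \<le> 17 * \<Theta> / \<delta>\<^sup>2 * ip n (m z) (m z) + 4 * \<tau> * (\<Sum>i<n. m z i)\<^sup>2"
    by (rule second_moment_nonneg_vector) (unfold mv_def, intro sum_nonneg mult_nonneg_nonneg nonneg z0, auto)
  also have "17 * \<Theta> / \<delta>\<^sup>2 * ip n (m z) (m z) \<le> 17 * \<Theta> / \<delta>\<^sup>2 * (4 * ip n w w)"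
  proof (rule mult_left_mono)
    have "ip n z z \<le> 2 * ip n w w"
      unfolding ip_def sum_distrib_left
    proof (intro sum_mono)
      fix i assume "i \<in> {..<n}"
      then have "p i * (w i * w i) \<le> 2 * (w i * w i)" using p_le_2 by (intro mult_right_mono) auto
      moreover have "z i * z i = p i * (w i * w i)"
        using p_nonneg[of i] by (simp add: z_def mult_ac)
      ultimately show "z i * z i \<le> 2 * (w i * w i)" by simp
    qed
    moreover have "(1 + D)\<^sup>2 \<le> 2"
    proof -
      have "(1 + D)\<^sup>2 \<le> (81 / 80)\<^sup>2" using D0 D1 by (intro power_mono) auto
      then show ?thesis by (simp add: power2_eq_square)
    qed
    ultimately have "(1 + D)\<^sup>2 * ip n z z \<le> 2 * (2 * ip n w w)" by (intro mult_mono ip_nonneg) auto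
    then show "ip n (m z) (m z) \<le> 4 * ip n w w" using ip_m_m[of z] by simp
  qed (use \<Theta>_ge_1 in auto)
  also have "4 * \<tau> * (\<Sum>i<n. m z i)\<^sup>2 \<le> 4 * \<tau> * (2 * (\<Pi>m * ip n w w))"
  proof (rule mult_left_mono)
    have "0 \<le> (\<Sum>i<n. m z i)" unfolding mv_def by (intro sum_nonneg mult_nonneg_nonneg nonneg z0) auto
    moreover have "(\<Sum>i<n. m z i) \<le> (1 + D) * (\<Sum>i<n. z i)"
    proof -
      have "ip n d z \<le> (\<Sum>i<n. D * z i)"
        unfolding ip_def by (intro sum_mono mult_right_mono z0) (use d_le abs_le_D1 in auto)
      then show ?thesis by (simp add: sum_m distrib_right sum_distrib_left sum.distrib)
    qed
    ultimately have "(\<Sum>i<n. m z i)\<^sup>2 \<le> ((1 + D) * (\<Sum>i<n. z i))\<^sup>2" by (rule power_mono[rotated])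
    also have "\<dots> = (1 + D)\<^sup>2 * (\<Sum>i<n. z i)\<^sup>2" by (rule power_mult_distrib)
    also have "\<dots> \<le> 2 * (\<Pi>m * ip n w w)"
    proof (rule mult_mono)
      have "(1 + D)\<^sup>2 \<le> (81 / 80)\<^sup>2" using D0 D1 by (intro power_mono) auto
      then show "(1 + D)\<^sup>2 \<le> 2" by (simp add: power2_eq_square)
      have "(\<Sum>i<n. z i)\<^sup>2 \<le> (\<Sum>i<n. (sqrt (p i))\<^sup>2) * (\<Sum>i<n. \<bar>w i\<bar>\<^sup>2)"
        unfolding z_def by (rule Cauchy_Schwarz_ineq_sum)
      also have "\<dots> = (\<Sum>i<n. p i) * ip n w w"
        by (simp add: p_nonneg ip_def power2_eq_square)
      also have "\<dots> \<le> \<Pi>m * ip n w w" by (intro mult_right_mono sum_p ip_nonneg)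
      finally show "(\<Sum>i<n. z i)\<^sup>2 \<le> \<Pi>m * ip n w w" .
    qed auto
    finally show "(\<Sum>i<n. m z i)\<^sup>2 \<le> 2 * (\<Pi>m * ip n w w)" .
  qed (use \<tau>_nonneg in auto)
  finally show ?thesis by (simp add: algebra_simps)
qed

text \<open>The coefficients \<open>d\<close> have both signs, and absolute values would replace
  \<open>sd\<close> by a sum without cancellation. Instead the resolvent \<open>w\<close> of the
  centred \<open>d\<close> is used: as
  \<open>\<sigma> - m \<sigma> = nz \<sigma> - tgap (m \<sigma>)\<close> sitewise, \<open>u\<close>
  becomes a noise form, a \<open>tgap\<close> form and multiples of \<open>sb\<close>.\<close>

theorem u_second_moment:
  "E (\<lambda>\<sigma>. (u \<sigma>)\<^sup>2) \<le> 4 * (sd\<^sup>2 * \<tau> + (ip n d d)\<^sup>2 / \<delta>\<^sup>2 * \<tau>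
     + ip n d d / \<delta>\<^sup>2 * (Kmom 2 + 68 * \<Theta> / \<delta>\<^sup>2 + 8 * \<tau> * \<Pi>m))"
proof -
  define v where "v = ctr n d"
  obtain w where w: "(\<Sum>i<n. w i) = 0" "\<And>i. i < n \<Longrightarrow> w i - ctr n (m w) i = v i" "\<delta> * nrm n w \<le> nrm n v"
    by (rule resolvent_exists[of v]) (use sum_ctr[OF n0, of d] in \<open>auto simp: v_def\<close>)
  have vd: "nrm n v \<le> nrm n d" unfolding v_def by (rule nrm_ctr_le[OF n0])
  have wd: "nrm n w \<le> nrm n d / \<delta>" using w(3) vd \<delta>0 by (simp add: field_simps)
  have ww: "ip n w w \<le> ip n d d / \<delta>\<^sup>2"
  proof -
    have "(nrm n w)\<^sup>2 \<le> (nrm n d / \<delta>)\<^sup>2" by (intro power_mono wd nrm_nonneg)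
    then show ?thesis by (simp add: nrm_sq power_divide)
  qed
  have dw: "(ip n d w)\<^sup>2 \<le> (ip n d d)\<^sup>2 / \<delta>\<^sup>2"
  proof -
    have "(ip n d w)\<^sup>2 \<le> (nrm n d * nrm n w)\<^sup>2"
      using Cauchy_Schwarz_ip[of n d w] by (metis abs_ge_zero power2_abs power_mono)
    also have "\<dots> = ip n d d * ip n w w" by (simp add: power_mult_distrib nrm_sq)
    also have "\<dots> \<le> ip n d d * (ip n d d / \<delta>\<^sup>2)" by (intro mult_left_mono ww ip_nonneg)
    finally show ?thesis by (simp add: power2_eq_square)
  qed
  have u_eq: "u \<sigma> = sd * sb \<sigma> + ip n d w * sb \<sigma> + ip n w (nz \<sigma>) - (\<Sum>i<n. w i * tgap (m \<sigma> i))" for \<sigma>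
  proof -
    have "u \<sigma> = ip n v \<sigma> + sd * sb \<sigma>"
      using ip_split[OF n0, of d \<sigma>] ip_ctr_left[OF n0, of d \<sigma>] sum_eq_avg[OF n0, of d]
      by (simp add: u_def v_def sd_def sb_def)
    moreover have "ip n v \<sigma> = ip n w \<sigma> - ip n (ctr n (m w)) \<sigma>"
      unfolding ip_diff_left[symmetric] by (rule ip_cong) (use w(2) in auto)
    moreover have "ip n (ctr n (m w)) \<sigma> = ip n w (m \<sigma>) - ip n d w * sb \<sigma>"
    proof -
      have "ip n (ctr n (m w)) \<sigma> = ip n (m w) \<sigma> - (\<Sum>i<n. m w i) * sb \<sigma>"
        using ip_split[OF n0, of "m w" \<sigma>] ip_ctr_left[OF n0, of "m w" \<sigma>] sum_eq_avg[OF n0, of "m w"]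
        by (simp add: sb_def)
      then show ?thesis by (simp add: sum_m w(1) ip_m_sym)
    qed
    moreover have "ip n w \<sigma> - ip n w (m \<sigma>) = ip n w (nz \<sigma>) - (\<Sum>i<n. w i * tgap (m \<sigma> i))"
      by (simp add: ip_def nz_def tgap_def algebra_simps sum_subtractf sum.distrib)
    ultimately show ?thesis by linarith
  qed
  have four: "(a + b + c - e)\<^sup>2 \<le> 4 * (a\<^sup>2 + b\<^sup>2 + c\<^sup>2 + e\<^sup>2)" for a b c e :: real
  proof -
    have "4 * (a\<^sup>2 + b\<^sup>2 + c\<^sup>2 + e\<^sup>2) - (a + b + c - e)\<^sup>2
      = (a - b)\<^sup>2 + (a - c)\<^sup>2 + (a + e)\<^sup>2 + (b - c)\<^sup>2 + (b + e)\<^sup>2 + (c + e)\<^sup>2"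
      by (simp add: power2_eq_square algebra_simps)
    also have "\<dots> \<ge> 0" by (intro add_nonneg_nonneg) auto
    finally show ?thesis by simp
  qed
  have "E (\<lambda>\<sigma>. (u \<sigma>)\<^sup>2) \<le> E (\<lambda>\<sigma>. 4 * ((sd * sb \<sigma>)\<^sup>2 + (ip n d w * sb \<sigma>)\<^sup>2 + (ip n w (nz \<sigma>))\<^sup>2
      + (\<Sum>i<n. w i * tgap (m \<sigma> i))\<^sup>2))"
    by (rule E_mono) (unfold u_eq, rule four)
  also have "\<dots> = 4 * (sd\<^sup>2 * \<tau> + (ip n d w)\<^sup>2 * \<tau> + E (\<lambda>\<sigma>. (ip n w (nz \<sigma>))\<^sup>2) + E (\<lambda>\<sigma>. (\<Sum>i<n. w i * tgap (m \<sigma> i))\<^sup>2))"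
    by (simp add: E_cmult E_add power_mult_distrib \<tau>_def)
  also have "\<dots> \<le> 4 * (sd\<^sup>2 * \<tau> + (ip n d d)\<^sup>2 / \<delta>\<^sup>2 * \<tau> + Kmom 2 * (ip n d d / \<delta>\<^sup>2)
     + (68 * \<Theta> / \<delta>\<^sup>2 + 8 * \<tau> * \<Pi>m) * (ip n d d / \<delta>\<^sup>2))"
  proof (intro mult_left_mono add_mono mult_right_mono dw \<tau>_nonneg order_refl)
    have "E (\<lambda>\<sigma>. \<bar>ip n w (nz \<sigma>)\<bar> ^ 2) \<le> Kmom 2 * nrm n w ^ 2" by (rule nz_moment)
    also have "\<dots> \<le> Kmom 2 * (ip n d d / \<delta>\<^sup>2)"
      unfolding nrm_sq by (intro mult_left_mono ww) (simp add: Kmom_def)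
    finally show "E (\<lambda>\<sigma>. (ip n w (nz \<sigma>))\<^sup>2) \<le> Kmom 2 * (ip n d d / \<delta>\<^sup>2)" by simp
    show "E (\<lambda>\<sigma>. (\<Sum>i<n. w i * tgap (m \<sigma> i))\<^sup>2) \<le> (68 * \<Theta> / \<delta>\<^sup>2 + 8 * \<tau> * \<Pi>m) * (ip n d d / \<delta>\<^sup>2)"
      using \<Theta>_ge_1 \<tau>_nonneg \<Pi>m_nonneg
      by (intro order_trans[OF tgap_second_moment] mult_left_mono ww add_nonneg_nonneg) auto
  qed auto
  finally show ?thesis by (simp add: algebra_simps)
qed

end

subsection \<open>The sixth moment of the magnetization\<close>

lemma tgap_le_cube: "0 \<le> x \<Longrightarrow> tgap x \<le> x ^ 3 / 3"
  using cube_minus_tgap_mono[of 0 x] by simp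

lemma tgap_abs_le_cube: "\<bar>tgap x\<bar> \<le> \<bar>x\<bar> ^ 3 / 3"
proof (cases "0 \<le> x")
  case True
  then show ?thesis using tgap_le_cube[of x] tgap_nonneg[of x] by simp
next
  case False
  then show ?thesis using tgap_le_cube[of "- x"] tgap_nonneg[of "- x"] by (simp add: tgap_minus)
qed

text \<open>On this interval \<open>tanh t \<ge> 11 / 12 * t\<close>, so the derivative of
  \<open>tgap\<close> exceeds \<open>3 / 5 * t\<^sup>2\<close>.\<close>

lemma tgap_ge_cube:
  assumes "0 \<le> x" "x \<le> 1 / 2"
  shows "x ^ 3 / 5 \<le> tgap x"
proof -
  have "tgap 0 - 0 ^ 3 / 5 \<le> tgap x - x ^ 3 / 5"
  proof (rule DERIV_nonneg_imp_nondecreasing[OF assms(1), where f = "\<lambda>x. tgap x - x ^ 3 / 5"])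
    fix t :: real assume t: "0 \<le> t" "t \<le> x"
    have "t * t \<le> (1 / 2) * (1 / 2)" using t assms by (intro mult_mono) auto
    then have "t * (11 / 12) \<le> t * (1 - t\<^sup>2 / 3)" using t by (intro mult_left_mono) (auto simp: power2_eq_square)
    also have "\<dots> = t - t ^ 3 / 3" by (simp add: algebra_simps power3_eq_cube power2_eq_square)
    also have "\<dots> \<le> tanh t" using tgap_le_cube[OF t(1)] by (simp add: tgap_def)
    finally have "(t * (11 / 12))\<^sup>2 \<le> (tanh t)\<^sup>2" using t by (intro power_mono) auto
    moreover have "3 / 5 * t\<^sup>2 \<le> (t * (11 / 12))\<^sup>2" by (simp add: power_mult_distrib power2_eq_square)
    ultimately have "0 \<le> (tanh t)\<^sup>2 - 3 / 5 * t\<^sup>2" by simp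
    moreover have "((\<lambda>x. tgap x - x ^ 3 / 5) has_real_derivative (tanh t)\<^sup>2 - 3 / 5 * t\<^sup>2) (at t)"
      by (auto intro!: derivative_eq_intros tgap_deriv)
    ultimately show "\<exists>d. ((\<lambda>x. tgap x - x ^ 3 / 5) has_real_derivative d) (at t) \<and> 0 \<le> d" by blast
  qed
  then show ?thesis by simp
qed

text \<open>If \<open>\<bar>\<eta>\<bar> \<le> x / 2\<close>, the argument is at least
  \<open>x / 2\<close>, and \<open>40 = 5 * 2 ^ 3\<close>. Otherwise \<open>x\<close> is at most
  \<open>2 * \<bar>\<eta>\<bar>\<close> and all terms are multiples of the cube of
  \<open>\<eta>\<close>.\<close>

lemma tgap_perturb_nonneg:
  assumes x: "0 \<le> x" "x \<le> 1"
  shows "x ^ 3 / 40 - 10 * \<bar>\<eta>\<bar> ^ 3 \<le> tgap (x + \<eta>)"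
proof (cases "\<bar>\<eta>\<bar> \<le> x / 2")
  case True
  have "x ^ 3 / 40 = (x / 2) ^ 3 / 5" by (simp add: power_divide)
  also have "\<dots> \<le> tgap (x / 2)" using x by (intro tgap_ge_cube) auto
  also have "\<dots> \<le> tgap (x + \<eta>)" using True by (intro tgap_mono) linarith
  finally show ?thesis using zero_le_power_abs[of \<eta> 3] by linarith
next
  case False
  have "x ^ 3 \<le> (2 * \<bar>\<eta>\<bar>) ^ 3" using False x by (intro power_mono) auto
  then have 1: "x ^ 3 \<le> 8 * \<bar>\<eta>\<bar> ^ 3" by (simp add: power_mult_distrib)
  have "\<bar>x + \<eta>\<bar> ^ 3 \<le> (3 * \<bar>\<eta>\<bar>) ^ 3" using False x by (intro power_mono) auto
  then have 2: "\<bar>x + \<eta>\<bar> ^ 3 \<le> 27 * \<bar>\<eta>\<bar> ^ 3" by (simp add: power_mult_distrib)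
  show ?thesis using tgap_abs_le_cube[of "x + \<eta>"] 1 2 zero_le_power_abs[of \<eta> 3] by linarith
qed

lemma tgap_perturb:
  assumes x: "\<bar>x\<bar> \<le> 1"
  shows "x ^ 6 / 40 - 10 * \<bar>x\<bar> ^ 3 * \<bar>\<eta>\<bar> ^ 3 \<le> x ^ 3 * tgap (x + \<eta>)"
proof (cases "0 \<le> x")
  case True
  have "x ^ 3 * (x ^ 3 / 40 - 10 * \<bar>\<eta>\<bar> ^ 3) \<le> x ^ 3 * tgap (x + \<eta>)"
    using True x by (intro mult_left_mono tgap_perturb_nonneg) auto
  moreover have "x ^ 3 * x ^ 3 = x ^ 6" by (simp flip: power_add)
  ultimately show ?thesis using True by (simp add: right_diff_distrib)
next
  case False
  have "(- x) ^ 3 * ((- x) ^ 3 / 40 - 10 * \<bar>- \<eta>\<bar> ^ 3) \<le> (- x) ^ 3 * tgap (- x + - \<eta>)"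
    using False x by (intro mult_left_mono tgap_perturb_nonneg zero_le_power) auto
  moreover have "tgap (- x + - \<eta>) = - tgap (x + \<eta>)" using tgap_minus[of "x + \<eta>"] by simp
  moreover have "x ^ 3 * x ^ 3 = x ^ 6" by (simp flip: power_add)
  ultimately show ?thesis using False by (simp add: right_diff_distrib)
qed

lemma cube_add_le: "\<bar>a + b\<bar> ^ 3 \<le> 4 * (\<bar>a\<bar> ^ 3 + \<bar>b\<bar> ^ 3)" for a b :: real
proof -
  have "\<bar>a + b\<bar> ^ 3 \<le> (\<bar>a\<bar> + \<bar>b\<bar>) ^ 3" by (intro power_mono abs_triangle_ineq) auto
  also have "\<dots> \<le> 4 * (\<bar>a\<bar> ^ 3 + \<bar>b\<bar> ^ 3)"
  proof -
    have "0 \<le> 3 * ((\<bar>a\<bar> + \<bar>b\<bar>) * (\<bar>a\<bar> - \<bar>b\<bar>)\<^sup>2)" by simp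
    also have "\<dots> = 4 * (\<bar>a\<bar> ^ 3 + \<bar>b\<bar> ^ 3) - (\<bar>a\<bar> + \<bar>b\<bar>) ^ 3"
      by (simp add: power2_eq_square power3_eq_cube algebra_simps)
    finally show ?thesis by simp
  qed
  finally show ?thesis .
qed

context near_regular
begin

lemma sb_flip: "j < n \<Longrightarrow> sb (flip j \<sigma>) = sb \<sigma> - 2 * \<sigma> j / n"
  using sum_flip[of j "\<lambda>_. 1" \<sigma>] by (simp add: sb_def avg_def diff_divide_distrib)

lemma cube_diff_flip:
  assumes "\<sigma> \<in> conf n" "j < n"
  shows "\<bar>sb \<sigma> ^ 3 - sb (flip j \<sigma>) ^ 3\<bar> \<le> 3 / n * (3 * (sb \<sigma>)\<^sup>2 + 8 / (real n)\<^sup>2)"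
proof -
  define x h where "x = sb \<sigma>" and "h = 2 * \<sigma> j / n"
  have h: "\<bar>h\<bar> = 2 / n" using conf_abs[OF assms] by (simp add: h_def abs_mult)
  then have h2: "h\<^sup>2 = 4 / (real n)\<^sup>2" by (metis power2_abs power_divide four_x_squared mult_2 numeral_Bit0 power2_eq_square)
  have "x ^ 3 - (x - h) ^ 3 = h * (x\<^sup>2 + x * (x - h) + (x - h)\<^sup>2)"
    by (simp add: power2_eq_square power3_eq_cube algebra_simps)
  then have "\<bar>x ^ 3 - (x - h) ^ 3\<bar> = 2 / n * \<bar>x\<^sup>2 + x * (x - h) + (x - h)\<^sup>2\<bar>"
    by (simp add: abs_mult h)
  also have "\<bar>x\<^sup>2 + x * (x - h) + (x - h)\<^sup>2\<bar> \<le> 3 / 2 * (3 * x\<^sup>2 + 2 * h\<^sup>2)"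
  proof -
    have "x\<^sup>2 + x * (x - h) + (x - h)\<^sup>2 \<le> 3 / 2 * (x\<^sup>2 + (x - h)\<^sup>2)"
      using sum_squares_bound[of x "x - h"] by simp
    also have "(x - h)\<^sup>2 \<le> 2 * x\<^sup>2 + 2 * h\<^sup>2"
      using sum_squares_bound[of x "- h"] by (simp add: power2_diff)
    finally have "x\<^sup>2 + x * (x - h) + (x - h)\<^sup>2 \<le> 3 / 2 * (3 * x\<^sup>2 + 2 * h\<^sup>2)" by simp
    moreover have "0 \<le> x\<^sup>2 + x * (x - h) + (x - h)\<^sup>2"
    proof -
      have "s\<^sup>2 + s * t + t\<^sup>2 = (s + t / 2)\<^sup>2 + 3 / 4 * t\<^sup>2" for s t :: real
        by (simp add: power2_eq_square field_simps)
      then show ?thesis by simp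
    qed
    ultimately show ?thesis by simp
  qed
  finally have "\<bar>x ^ 3 - (x - h) ^ 3\<bar> \<le> 2 / n * (3 / 2 * (3 * x\<^sup>2 + 2 * h\<^sup>2))"
    by (simp add: divide_right_mono)
  then show ?thesis
    unfolding sb_flip[OF assms(2)] x_def[symmetric] h_def[symmetric] h2 using n0 by (simp add: field_simps)
qed

lemma sum_nz: "(\<Sum>j<n. nz \<sigma> j) = (\<Sum>j<n. tgap (m \<sigma> j)) - u \<sigma>"
  using sum_m[of \<sigma>] by (simp add: nz_def tgap_def sum_subtractf u_def)

text \<open>By \<open>E_nz\<close> only the change of \<open>sb \<sigma> ^ 3\<close> under a flip
  counts, of order \<open>sb\<^sup>2 / n\<close>; the noise of all \<open>n\<close> sites thus costs
  only \<open>\<tau>\<close> and a term of order \<open>1 / n\<^sup>2\<close>. The sum of the noise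
  is that of \<open>tgap\<close> minus \<open>u\<close>.\<close>

lemma cubic_identity: "E (\<lambda>\<sigma>. sb \<sigma> ^ 3 * (\<Sum>j<n. tgap (m \<sigma> j))) \<le> 9 * \<tau> + 24 / (real n)\<^sup>2 + E (\<lambda>\<sigma>. \<bar>sb \<sigma>\<bar> ^ 3 * \<bar>u \<sigma>\<bar>)"
proof -
  have "E (\<lambda>\<sigma>. sb \<sigma> ^ 3 * (\<Sum>j<n. nz \<sigma> j)) = (\<Sum>j<n. E (\<lambda>\<sigma>. nz \<sigma> j * sb \<sigma> ^ 3))"
    unfolding E_sum[symmetric] by (rule E_cong) (simp add: sum_distrib_right mult.commute)
  also have "\<dots> = (\<Sum>j<n. E (\<lambda>\<sigma>. nz \<sigma> j * (sb \<sigma> ^ 3 - sb (flip j \<sigma>) ^ 3)) / 2)"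
    by (intro sum.cong refl E_nz) auto
  also have "\<dots> \<le> (\<Sum>j<n. E (\<lambda>\<sigma>. 2 * (3 / n * (3 * (sb \<sigma>)\<^sup>2 + 8 / (real n)\<^sup>2))) / 2)"
  proof (intro sum_mono divide_right_mono E_mono)
    fix j \<sigma> assume "j \<in> {..<n}" and \<sigma>: "\<sigma> \<in> conf n"
    then have j: "j < n" by simp
    have "nz \<sigma> j * (sb \<sigma> ^ 3 - sb (flip j \<sigma>) ^ 3) \<le> \<bar>nz \<sigma> j\<bar> * \<bar>sb \<sigma> ^ 3 - sb (flip j \<sigma>) ^ 3\<bar>"
      by (metis abs_ge_self abs_mult)
    also have "\<dots> \<le> 2 * (3 / n * (3 * (sb \<sigma>)\<^sup>2 + 8 / (real n)\<^sup>2))"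
      by (intro mult_mono cube_diff_flip \<sigma> j) (use nz_abs[OF \<sigma> j] kap_bounds[OF \<sigma> j] in auto)
    finally show "nz \<sigma> j * (sb \<sigma> ^ 3 - sb (flip j \<sigma>) ^ 3) \<le> 2 * (3 / n * (3 * (sb \<sigma>)\<^sup>2 + 8 / (real n)\<^sup>2))" .
  qed auto
  also have "\<dots> = 9 * \<tau> + 24 / (real n)\<^sup>2"
    using n0 by (simp add: E_cmult E_add E_divide \<tau>_def field_simps)
  finally have "E (\<lambda>\<sigma>. sb \<sigma> ^ 3 * (\<Sum>j<n. nz \<sigma> j)) \<le> 9 * \<tau> + 24 / (real n)\<^sup>2" .
  moreover have "E (\<lambda>\<sigma>. sb \<sigma> ^ 3 * (\<Sum>j<n. nz \<sigma> j))
      = E (\<lambda>\<sigma>. sb \<sigma> ^ 3 * (\<Sum>j<n. tgap (m \<sigma> j))) - E (\<lambda>\<sigma>. sb \<sigma> ^ 3 * u \<sigma>)"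
    by (simp add: sum_nz right_diff_distrib E_diff)
  moreover have "E (\<lambda>\<sigma>. sb \<sigma> ^ 3 * u \<sigma>) \<le> E (\<lambda>\<sigma>. \<bar>sb \<sigma>\<bar> ^ 3 * \<bar>u \<sigma>\<bar>)"
    by (rule E_mono) (metis abs_ge_self abs_mult power_abs)
  ultimately show ?thesis by linarith
qed

lemma u_abs_le: "\<sigma> \<in> conf n \<Longrightarrow> \<bar>u \<sigma>\<bar> \<le> n * D"
proof -
  assume \<sigma>: "\<sigma> \<in> conf n"
  have "\<bar>u \<sigma>\<bar> \<le> (\<Sum>i<n. \<bar>d i * \<sigma> i\<bar>)" unfolding u_def ip_def by (rule sum_abs)
  also have "\<dots> \<le> (\<Sum>i<n. D)" by (intro sum_mono) (use d_le conf_abs[OF \<sigma>] in \<open>auto simp: abs_mult\<close>)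
  finally show ?thesis by simp
qed

lemma dd_le: "ip n d d \<le> n * D\<^sup>2"
proof -
  have "ip n d d \<le> (\<Sum>i<n. D\<^sup>2)"
    unfolding ip_def
  proof (intro sum_mono)
    fix i assume "i \<in> {..<n}"
    then have "\<bar>d i\<bar>\<^sup>2 \<le> D\<^sup>2" by (intro power_mono d_le) auto
    then show "d i * d i \<le> D\<^sup>2" by (simp add: power2_eq_square)
  qed
  then show ?thesis by simp
qed

abbreviation A :: "(nat \<Rightarrow> real) \<Rightarrow> real" where "A \<sigma> \<equiv> ip n (an \<sigma>) (an \<sigma>)"

text \<open>Each field is \<open>sb \<sigma>\<close> perturbed by
  \<open>y \<sigma> j + u \<sigma> / n\<close>, so a site yields the sixth power up to cubes of the
  perturbation. The cubes of \<open>y\<close> are bounded by \<open>Ym\<close> times the squared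
  Euclidean norm, where \<open>y_ip\<close> loses no logarithm.\<close>

lemma sixth_pointwise:
  assumes \<sigma>: "\<sigma> \<in> conf n"
  shows "real n * sb \<sigma> ^ 6 / 40 \<le> sb \<sigma> ^ 3 * (\<Sum>j<n. tgap (m \<sigma> j))
     + (40 + 40 / rate\<^sup>2) * (\<bar>sb \<sigma>\<bar> ^ 3 * \<bar>u \<sigma>\<bar>)
     + 40 / rate\<^sup>2 * (\<bar>sb \<sigma>\<bar> ^ 3 * (Ym \<sigma> * A \<sigma>))
     + 80 * ip n d d / rate\<^sup>2 * (\<bar>sb \<sigma>\<bar> ^ 5 * Ym \<sigma>)"
proof -
  have m_eq: "m \<sigma> j = sb \<sigma> + (y \<sigma> j + u \<sigma> / n)" for j
    using m_eq_y[of \<sigma> j] mb_eq[of \<sigma>] n0 by (simp add: field_simps)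
  have un: "\<bar>u \<sigma> / n\<bar> \<le> D" using u_abs_le[OF \<sigma>] n0 by (simp add: abs_divide field_simps)
  have "(\<Sum>j<n. sb \<sigma> ^ 6 / 40 - 10 * \<bar>sb \<sigma>\<bar> ^ 3 * (4 * (\<bar>y \<sigma> j\<bar> ^ 3 + \<bar>u \<sigma> / n\<bar> ^ 3)))
     \<le> (\<Sum>j<n. sb \<sigma> ^ 3 * tgap (m \<sigma> j))"
  proof (intro sum_mono)
    fix j
    have "sb \<sigma> ^ 6 / 40 - 10 * \<bar>sb \<sigma>\<bar> ^ 3 * (4 * (\<bar>y \<sigma> j\<bar> ^ 3 + \<bar>u \<sigma> / n\<bar> ^ 3))
        \<le> sb \<sigma> ^ 6 / 40 - 10 * \<bar>sb \<sigma>\<bar> ^ 3 * \<bar>y \<sigma> j + u \<sigma> / n\<bar> ^ 3"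
      by (intro diff_left_mono mult_left_mono cube_add_le) auto
    also have "\<dots> \<le> sb \<sigma> ^ 3 * tgap (m \<sigma> j)"
      unfolding m_eq by (rule tgap_perturb[OF sb_bound[OF \<sigma>]])
    finally show "sb \<sigma> ^ 6 / 40 - 10 * \<bar>sb \<sigma>\<bar> ^ 3 * (4 * (\<bar>y \<sigma> j\<bar> ^ 3 + \<bar>u \<sigma> / n\<bar> ^ 3)) \<le> sb \<sigma> ^ 3 * tgap (m \<sigma> j)" .
  qed
  moreover have "(\<Sum>j<n. sb \<sigma> ^ 6 / 40 - 10 * \<bar>sb \<sigma>\<bar> ^ 3 * (4 * (\<bar>y \<sigma> j\<bar> ^ 3 + \<bar>u \<sigma> / n\<bar> ^ 3)))
     = real n * sb \<sigma> ^ 6 / 40 - 40 * \<bar>sb \<sigma>\<bar> ^ 3 * ((\<Sum>j<n. \<bar>y \<sigma> j\<bar> ^ 3) + n * \<bar>u \<sigma> / n\<bar> ^ 3)"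
    by (simp add: sum_subtractf sum.distrib distrib_left sum_distrib_left mult_ac)
  moreover have "(\<Sum>j<n. \<bar>y \<sigma> j\<bar> ^ 3) \<le> (Ym \<sigma> * A \<sigma> + 2 * ip n d d * ((sb \<sigma>)\<^sup>2 * Ym \<sigma>) + \<bar>u \<sigma>\<bar>) / rate\<^sup>2"
  proof -
    have "(\<Sum>j<n. \<bar>y \<sigma> j\<bar> ^ 3) \<le> (\<Sum>j<n. Ym \<sigma> * (y \<sigma> j * y \<sigma> j))"
    proof (intro sum_mono)
      fix j assume "j \<in> {..<n}"
      then have "\<bar>y \<sigma> j\<bar> * (\<bar>y \<sigma> j\<bar> * \<bar>y \<sigma> j\<bar>) \<le> Ym \<sigma> * (\<bar>y \<sigma> j\<bar> * \<bar>y \<sigma> j\<bar>)"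
        by (intro mult_right_mono Ym_upper) auto
      then show "\<bar>y \<sigma> j\<bar> ^ 3 \<le> Ym \<sigma> * (y \<sigma> j * y \<sigma> j)" by (simp add: power3_eq_cube mult.assoc)
    qed
    also have "\<dots> = Ym \<sigma> * ip n (y \<sigma>) (y \<sigma>)" by (simp add: ip_def sum_distrib_left)
    also have "\<dots> \<le> Ym \<sigma> * ((A \<sigma> + (mb \<sigma>)\<^sup>2 * ip n d d) / rate\<^sup>2)"
      by (intro mult_left_mono y_ip Ym_nonneg)
    also have "\<dots> = (Ym \<sigma> * A \<sigma> + Ym \<sigma> * (mb \<sigma>)\<^sup>2 * ip n d d) / rate\<^sup>2" by (simp add: algebra_simps)
    also have "\<dots> \<le> (Ym \<sigma> * A \<sigma> + 2 * ip n d d * ((sb \<sigma>)\<^sup>2 * Ym \<sigma>) + \<bar>u \<sigma>\<bar>) / rate\<^sup>2"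
    proof (intro divide_right_mono)
      have mb: "(mb \<sigma>)\<^sup>2 \<le> 2 * (sb \<sigma>)\<^sup>2 + 2 * (u \<sigma> / n)\<^sup>2"
      proof -
        have "mb \<sigma> = sb \<sigma> + u \<sigma> / n" using mb_eq[of \<sigma>] n0 by (simp add: field_simps)
        then show ?thesis using sum_squares_bound[of "sb \<sigma>" "u \<sigma> / n"] by (simp add: power2_sum)
      qed
      have "Ym \<sigma> * (mb \<sigma>)\<^sup>2 * ip n d d \<le> Ym \<sigma> * (2 * (sb \<sigma>)\<^sup>2 + 2 * (u \<sigma> / n)\<^sup>2) * ip n d d"
        by (intro mult_right_mono mult_left_mono mb Ym_nonneg ip_nonneg)
      also have "\<dots> = 2 * ip n d d * ((sb \<sigma>)\<^sup>2 * Ym \<sigma>) + 2 * Ym \<sigma> * (u \<sigma> / n)\<^sup>2 * ip n d d"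
        by (simp add: algebra_simps)
      \<comment> \<open>For the part of \<open>mb\<close> that stems from \<open>u\<close>, crude
        bounds suffice: the resulting factor \<open>6 * D ^ 3\<close> is at most 1.\<close>
      also have "2 * Ym \<sigma> * (u \<sigma> / n)\<^sup>2 * ip n d d \<le> 2 * 3 * (\<bar>u \<sigma> / n\<bar> * D) * (n * D\<^sup>2)"
      proof (intro mult_mono dd_le)
        show "(u \<sigma> / n)\<^sup>2 \<le> \<bar>u \<sigma> / n\<bar> * D"
          using mult_left_mono[OF un, of "\<bar>u \<sigma> / n\<bar>"] by (simp add: power2_eq_square)
      qed (use Ym_le_3[OF \<sigma>] Ym_nonneg[of \<sigma>] D0 ip_nonneg in auto)
      also have "\<dots> = 6 * D ^ 3 * \<bar>u \<sigma>\<bar>"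
        using n0 by (simp add: abs_divide power2_eq_square power3_eq_cube)
      also have "\<dots> \<le> 1 * \<bar>u \<sigma>\<bar>"
      proof (rule mult_right_mono)
        have "D ^ 3 \<le> (1 / 80) ^ 3" using D0 D1 by (intro power_mono) auto
        then show "6 * D ^ 3 \<le> 1" by (simp add: power3_eq_cube)
      qed simp
      finally show "Ym \<sigma> * A \<sigma> + Ym \<sigma> * (mb \<sigma>)\<^sup>2 * ip n d d
          \<le> Ym \<sigma> * A \<sigma> + 2 * ip n d d * ((sb \<sigma>)\<^sup>2 * Ym \<sigma>) + \<bar>u \<sigma>\<bar>" by simp
    qed simp
    finally show ?thesis .
  qed
  moreover have "n * \<bar>u \<sigma> / n\<bar> ^ 3 \<le> \<bar>u \<sigma>\<bar>"
  proof -
    have "\<bar>u \<sigma> / n\<bar> * \<bar>u \<sigma> / n\<bar> \<le> 1 * 1" using un D1 by (intro mult_mono) auto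
    then have "n * (\<bar>u \<sigma> / n\<bar> * (\<bar>u \<sigma> / n\<bar> * \<bar>u \<sigma> / n\<bar>)) \<le> n * (\<bar>u \<sigma> / n\<bar> * 1)"
      by (intro mult_left_mono) auto
    then show ?thesis using n0 by (simp add: power3_eq_cube abs_divide mult.assoc)
  qed
  ultimately have "real n * sb \<sigma> ^ 6 / 40 \<le> sb \<sigma> ^ 3 * (\<Sum>j<n. tgap (m \<sigma> j))
     + 40 * \<bar>sb \<sigma>\<bar> ^ 3 * ((Ym \<sigma> * A \<sigma> + 2 * ip n d d * ((sb \<sigma>)\<^sup>2 * Ym \<sigma>) + \<bar>u \<sigma>\<bar>) / rate\<^sup>2 + \<bar>u \<sigma>\<bar>)"
  proof -
    assume h: "(\<Sum>j<n. sb \<sigma> ^ 6 / 40 - 10 * \<bar>sb \<sigma>\<bar> ^ 3 * (4 * (\<bar>y \<sigma> j\<bar> ^ 3 + \<bar>u \<sigma> / n\<bar> ^ 3)))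
        \<le> (\<Sum>j<n. sb \<sigma> ^ 3 * tgap (m \<sigma> j))"
      "(\<Sum>j<n. sb \<sigma> ^ 6 / 40 - 10 * \<bar>sb \<sigma>\<bar> ^ 3 * (4 * (\<bar>y \<sigma> j\<bar> ^ 3 + \<bar>u \<sigma> / n\<bar> ^ 3)))
        = real n * sb \<sigma> ^ 6 / 40 - 40 * \<bar>sb \<sigma>\<bar> ^ 3 * ((\<Sum>j<n. \<bar>y \<sigma> j\<bar> ^ 3) + n * \<bar>u \<sigma> / n\<bar> ^ 3)"
      "(\<Sum>j<n. \<bar>y \<sigma> j\<bar> ^ 3) \<le> (Ym \<sigma> * A \<sigma> + 2 * ip n d d * ((sb \<sigma>)\<^sup>2 * Ym \<sigma>) + \<bar>u \<sigma>\<bar>) / rate\<^sup>2"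
      "n * \<bar>u \<sigma> / n\<bar> ^ 3 \<le> \<bar>u \<sigma>\<bar>"
    have "40 * \<bar>sb \<sigma>\<bar> ^ 3 * ((\<Sum>j<n. \<bar>y \<sigma> j\<bar> ^ 3) + n * \<bar>u \<sigma> / n\<bar> ^ 3)
       \<le> 40 * \<bar>sb \<sigma>\<bar> ^ 3 * ((Ym \<sigma> * A \<sigma> + 2 * ip n d d * ((sb \<sigma>)\<^sup>2 * Ym \<sigma>) + \<bar>u \<sigma>\<bar>) / rate\<^sup>2 + \<bar>u \<sigma>\<bar>)"
      by (intro mult_left_mono add_mono h) auto
    then show ?thesis using h(1,2) by (simp add: sum_distrib_left)
  qed
  also have "40 * \<bar>sb \<sigma>\<bar> ^ 3 * ((Ym \<sigma> * A \<sigma> + 2 * ip n d d * ((sb \<sigma>)\<^sup>2 * Ym \<sigma>) + \<bar>u \<sigma>\<bar>) / rate\<^sup>2 + \<bar>u \<sigma>\<bar>)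
    = (40 + 40 / rate\<^sup>2) * (\<bar>sb \<sigma>\<bar> ^ 3 * \<bar>u \<sigma>\<bar>) + 40 / rate\<^sup>2 * (\<bar>sb \<sigma>\<bar> ^ 3 * (Ym \<sigma> * A \<sigma>))
      + 80 * ip n d d / rate\<^sup>2 * (\<bar>sb \<sigma>\<bar> ^ 5 * Ym \<sigma>)"
  proof -
    have "(sb \<sigma>)\<^sup>2 = \<bar>sb \<sigma>\<bar>\<^sup>2" "\<bar>sb \<sigma>\<bar> ^ 5 = \<bar>sb \<sigma>\<bar> ^ 3 * \<bar>sb \<sigma>\<bar>\<^sup>2"
      using power_add[of "\<bar>sb \<sigma>\<bar>" 3 2] by simp_all
    then show ?thesis by (simp add: distrib_left distrib_right add_divide_distrib mult_ac)
  qed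
  finally show ?thesis by simp
qed

lemma sixth_moment:
  "real n * E (\<lambda>\<sigma>. sb \<sigma> ^ 6) / 40 \<le> 9 * \<tau> + 24 / (real n)\<^sup>2
     + (41 + 40 / rate\<^sup>2) * E (\<lambda>\<sigma>. \<bar>sb \<sigma>\<bar> ^ 3 * \<bar>u \<sigma>\<bar>)
     + 40 / rate\<^sup>2 * E (\<lambda>\<sigma>. \<bar>sb \<sigma>\<bar> ^ 3 * (Ym \<sigma> * A \<sigma>))
     + 80 * ip n d d / rate\<^sup>2 * E (\<lambda>\<sigma>. \<bar>sb \<sigma>\<bar> ^ 5 * Ym \<sigma>)"
proof -
  have "real n * E (\<lambda>\<sigma>. sb \<sigma> ^ 6) / 40 = E (\<lambda>\<sigma>. real n * sb \<sigma> ^ 6 / 40)"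
    by (simp add: E_cmult E_divide)
  also have "\<dots> \<le> E (\<lambda>\<sigma>. sb \<sigma> ^ 3 * (\<Sum>j<n. tgap (m \<sigma> j))
     + (40 + 40 / rate\<^sup>2) * (\<bar>sb \<sigma>\<bar> ^ 3 * \<bar>u \<sigma>\<bar>)
     + 40 / rate\<^sup>2 * (\<bar>sb \<sigma>\<bar> ^ 3 * (Ym \<sigma> * A \<sigma>))
     + 80 * ip n d d / rate\<^sup>2 * (\<bar>sb \<sigma>\<bar> ^ 5 * Ym \<sigma>))"
    by (rule E_mono) (rule sixth_pointwise)
  also have "\<dots> = E (\<lambda>\<sigma>. sb \<sigma> ^ 3 * (\<Sum>j<n. tgap (m \<sigma> j)))
     + (40 + 40 / rate\<^sup>2) * E (\<lambda>\<sigma>. \<bar>sb \<sigma>\<bar> ^ 3 * \<bar>u \<sigma>\<bar>)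
     + 40 / rate\<^sup>2 * E (\<lambda>\<sigma>. \<bar>sb \<sigma>\<bar> ^ 3 * (Ym \<sigma> * A \<sigma>))
     + 80 * ip n d d / rate\<^sup>2 * E (\<lambda>\<sigma>. \<bar>sb \<sigma>\<bar> ^ 5 * Ym \<sigma>)"
    unfolding E_add E_cmult ..
  finally show ?thesis using cubic_identity by (simp add: distrib_right)
qed

end

subsection \<open>Absorbing the lower order terms\<close>

text \<open>What remains after absorption with the weights \<open>1 / (8 * B)\<close> and
  \<open>1 / (24 * B ^ 3)\<close>; \<open>8 / 3\<close> is the inverse of the fraction of
  \<open>S\<close> that is left.\<close>

definition closing_bound :: "real \<Rightarrow> real" where
  "closing_bound B = 8 / 3 * (3 * B ^ 3 * (1 + 24 * B ^ 3 + 576 * B ^ 6) + 2 * B ^ 3 + B\<^sup>2 * (8 * B) ^ 5)"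

text \<open>All terms on the right of the moment inequality are of lower order in the sixth moment \<open>S\<close>,
  so that they can be absorbed.\<close>

lemma closing:
  fixes B S t t2 Q2 Q3 Q5 :: real
  assumes B: "1 \<le> B" and S0: "0 \<le> S" and t0: "0 \<le> t" "0 \<le> t2"
    and main: "S \<le> B * (1 + t + Q2 + Q3 + Q5)"
    and Q2: "\<And>\<eta>. 0 < \<eta> \<Longrightarrow> \<eta> \<le> 1 \<Longrightarrow> Q2 \<le> \<eta> * S + B * (1 + t + t2) / (4 * \<eta>)"
    and Q3: "\<And>\<eta>. 0 < \<eta> \<Longrightarrow> \<eta> \<le> 1 \<Longrightarrow> Q3 \<le> \<eta> * S + B / (4 * \<eta>)"
    and Q5: "\<And>\<eta>. 0 < \<eta> \<Longrightarrow> \<eta> \<le> 1 \<Longrightarrow> Q5 \<le> \<eta> * S + B / \<eta> ^ 5"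
    and t: "\<And>\<eta>. 0 < \<eta> \<Longrightarrow> \<eta> \<le> 1 \<Longrightarrow> t \<le> \<eta> * S + 1 / \<eta>"
    and t2: "\<And>\<eta>. 0 < \<eta> \<Longrightarrow> \<eta> \<le> 1 \<Longrightarrow> t2 \<le> \<eta> * S + 1 / \<eta>\<^sup>2"
  shows "S \<le> closing_bound B"
proof -
  have B0: "0 < B" using B by simp
  have BB: "1 \<le> B ^ 3" "B \<le> B ^ 3"
    using B power_increasing[of 1 3 B] by (simp_all add: one_le_power)
  \<comment> \<open>Three terms with weight \<open>e1\<close> cost \<open>S / 8\<close> each, and
    \<open>t\<close>, \<open>t2\<close> with weight \<open>e2\<close> cost \<open>S / 4\<close>
    together, so that \<open>3 / 8 * S\<close> survives.\<close>
  define e1 e2 where "e1 = 1 / (8 * B)" and "e2 = 1 / (24 * B ^ 3)"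
  have e1: "0 < e1" "e1 \<le> 1" and e2: "0 < e2" "e2 \<le> 1"
    using B0 B BB by (simp_all add: e1_def e2_def)
  have "B * Q2 \<le> B * (e1 * S + B * (1 + t + t2) / (4 * e1))"
    using B0 by (intro mult_left_mono Q2 e1) auto
  also have "\<dots> = S / 8 + 2 * B ^ 3 * (1 + t + t2)"
    using B0 by (simp add: e1_def field_simps power3_eq_cube)
  finally have 2: "B * Q2 \<le> S / 8 + 2 * B ^ 3 * (1 + t + t2)" .
  have "B * Q3 \<le> B * (e1 * S + B / (4 * e1))"
    using B0 by (intro mult_left_mono Q3 e1) auto
  also have "\<dots> = S / 8 + 2 * B ^ 3"
    using B0 by (simp add: e1_def field_simps power3_eq_cube)
  finally have 3: "B * Q3 \<le> S / 8 + 2 * B ^ 3" .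
  have "B * Q5 \<le> B * (e1 * S + B / e1 ^ 5)"
    using B0 by (intro mult_left_mono Q5 e1) auto
  also have "\<dots> = S / 8 + B\<^sup>2 * (8 * B) ^ 5"
    using B0 by (simp add: e1_def distrib_left power_divide power2_eq_square)
  finally have 5: "B * Q5 \<le> S / 8 + B\<^sup>2 * (8 * B) ^ 5" .
  have "S \<le> B * (1 + t) + B * Q2 + B * Q3 + B * Q5"
    using main by (simp add: distrib_left)
  also have "\<dots> \<le> B ^ 3 * (1 + t + t2) + (S / 8 + 2 * B ^ 3 * (1 + t + t2)) + (S / 8 + 2 * B ^ 3) + (S / 8 + B\<^sup>2 * (8 * B) ^ 5)"
  proof -
    have "B * (1 + t) \<le> B ^ 3 * (1 + t + t2)" using BB t0 B0 by (intro mult_mono) auto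
    then show ?thesis using 2 3 5 by linarith
  qed
  finally have "5 / 8 * S \<le> 3 * B ^ 3 * (1 + t + t2) + 2 * B ^ 3 + B\<^sup>2 * (8 * B) ^ 5"
    by (simp add: algebra_simps)
  also have "3 * B ^ 3 * (1 + t + t2) \<le> 3 * B ^ 3 * (1 + (e2 * S + 1 / e2) + (e2 * S + 1 / e2\<^sup>2))"
    using B0 by (intro mult_left_mono add_mono t t2 e2) auto
  also have "\<dots> = S / 4 + 3 * B ^ 3 * (1 + 24 * B ^ 3 + 576 * B ^ 6)"
    using B0 by (simp add: e2_def field_simps power2_eq_square flip: power_add)
  finally show ?thesis by (simp add: closing_bound_def)
qed

section \<open>Young inequalities with a free weight\<close>

lemma young_cube:
  fixes s v \<eta> :: real
  assumes "0 < \<eta>"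
  shows "\<bar>s\<bar> ^ 3 * v \<le> \<eta> * s ^ 6 + v\<^sup>2 / (4 * \<eta>)"
proof (rule le_weighted_sum[OF _ _ _ assms])
  have "(\<bar>s\<bar> ^ 3)\<^sup>2 = \<bar>s\<bar> ^ 6" by (simp flip: power_mult)
  then show "(\<bar>s\<bar> ^ 3 * v)\<^sup>2 \<le> s ^ 6 * v\<^sup>2" by (simp add: power_mult_distrib power_even_abs)
qed (auto simp: zero_le_even_power)

lemma young_fifth:
  fixes s v \<eta> :: real
  assumes "0 < \<eta>" "0 \<le> v"
  shows "\<bar>s\<bar> ^ 5 * v \<le> \<eta> * s ^ 6 + v ^ 6 / \<eta> ^ 5"
proof (cases "v \<le> \<eta> * \<bar>s\<bar>")
  case True
  have "\<bar>s\<bar> ^ 5 * v \<le> \<bar>s\<bar> ^ 5 * (\<eta> * \<bar>s\<bar>)" using True by (intro mult_left_mono) auto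
  also have "\<dots> = \<eta> * \<bar>s\<bar> ^ 6" by (simp add: eval_nat_numeral)
  also have "\<dots> = \<eta> * s ^ 6" by (simp add: power_even_abs)
  finally show ?thesis using assms by (simp add: add_increasing2)
next
  case False
  then have "\<bar>s\<bar> ^ 5 \<le> (v / \<eta>) ^ 5" using assms by (intro power_mono) (auto simp: field_simps)
  then have "\<bar>s\<bar> ^ 5 * v \<le> (v / \<eta>) ^ 5 * v" using assms by (intro mult_right_mono) auto
  also have "\<dots> = v ^ 6 / \<eta> ^ 5" by (simp add: power_divide eval_nat_numeral)
  finally show ?thesis using assms by (simp add: add_increasing zero_le_even_power)
qed

lemma young_square:
  fixes s \<eta> :: real
  assumes "0 < \<eta>" "\<eta> \<le> 1"
  shows "s\<^sup>2 \<le> \<eta> * s ^ 6 + 1 / \<eta>" "s ^ 4 \<le> \<eta> * s ^ 6 + 1 / \<eta>\<^sup>2"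
proof -
  define w where "w = s\<^sup>2"
  have w: "0 \<le> w" "s ^ 6 = w ^ 3" "s ^ 4 = w\<^sup>2" by (simp_all add: w_def flip: power_mult)
  have "w \<le> \<eta> * w ^ 3 + 1 / \<eta> \<and> w\<^sup>2 \<le> \<eta> * w ^ 3 + 1 / \<eta>\<^sup>2"
  proof (cases "w \<le> 1 / \<eta>")
    case True
    then have "w\<^sup>2 \<le> (1 / \<eta>)\<^sup>2" using w by (intro power_mono) auto
    moreover have "0 \<le> \<eta> * w ^ 3" using w assms by simp
    ultimately show ?thesis using True by (simp add: power_divide)
  next
    case False
    then have "1 \<le> \<eta> * w" using assms by (simp add: field_simps)
    then have 2: "1 * w\<^sup>2 \<le> (\<eta> * w) * w\<^sup>2" by (intro mult_right_mono) auto
    have "\<eta> * w \<le> 1 * w" using assms w by (intro mult_right_mono) auto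
    then have "1 \<le> w" using \<open>1 \<le> \<eta> * w\<close> by simp
    then have 1: "w * 1 \<le> w * w" using w by (intro mult_left_mono) auto
    have "(\<eta> * w) * w\<^sup>2 = \<eta> * w ^ 3" by (simp add: power2_eq_square power3_eq_cube)
    with 2 have 3: "w\<^sup>2 \<le> \<eta> * w ^ 3" "w \<le> w\<^sup>2" using 1 by (simp, simp add: power2_eq_square)
    have 4: "0 \<le> 1 / \<eta>" "0 \<le> 1 / \<eta>\<^sup>2" using assms by simp_all
    show ?thesis using 3 4 by linarith
  qed
  then show "s\<^sup>2 \<le> \<eta> * s ^ 6 + 1 / \<eta>" "s ^ 4 \<le> \<eta> * s ^ 6 + 1 / \<eta>\<^sup>2" by (simp_all add: w flip: w_def)
qed

context near_regular
begin

text \<open>This and the constants built from it depend on the locale only through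
  \<open>\<delta>\<close>, not through \<open>n\<close> or \<open>a\<close>; hence they serve all
  \<open>N\<close> at once.\<close>

definition Ubound :: "real \<Rightarrow> real" where
  "Ubound \<kappa> = 4 * (1 + \<kappa> / \<delta>\<^sup>2 + 1 / \<delta>\<^sup>2 * (Kmom 2 + 68 * (1 + 2 * \<kappa>) / \<delta>\<^sup>2
     + 8 * (2 + 2 * \<kappa> + \<kappa> * (Kmom 2 + 4) / rate\<^sup>2)))"

definition Bbound :: "real \<Rightarrow> real" where
  "Bbound \<kappa> = \<kappa> * Ubound \<kappa> + 40 * (33 + (41 + 40 / rate\<^sup>2) + 40 / rate\<^sup>2 + 80 * \<kappa> / rate\<^sup>2) + \<kappa>"

lemma Kmom_nonneg: "0 \<le> Kmom k"
  by (simp add: Kmom_def)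

lemma Ubound_nonneg: "1 \<le> \<kappa> \<Longrightarrow> 0 \<le> Ubound \<kappa>"
  unfolding Ubound_def using Kmom_nonneg[of 2] by (intro mult_nonneg_nonneg add_nonneg_nonneg divide_nonneg_nonneg) auto

lemma Bbound_ge_1: "1 \<le> \<kappa> \<Longrightarrow> 1 \<le> Bbound \<kappa>"
proof -
  assume \<kappa>: "1 \<le> \<kappa>"
  have "0 \<le> \<kappa> * Ubound \<kappa>" using Ubound_nonneg[OF \<kappa>] \<kappa> by simp
  moreover have "0 \<le> 40 * (33 + (41 + 40 / rate\<^sup>2) + 40 / rate\<^sup>2 + 80 * \<kappa> / rate\<^sup>2)"
    using \<kappa> by (intro mult_nonneg_nonneg add_nonneg_nonneg) auto
  ultimately show ?thesis using \<kappa> unfolding Bbound_def by linarith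
qed

text \<open>\<open>q\<close> is the fourth root of \<open>n\<close>, and
  \<open>q\<^sup>2 * \<tau>\<close> the rescaled variance of the magnetization, not yet known to be
  bounded. The bound is quadratic in it, hence of fourth order in the magnetization and below the
  sixth moment.\<close>

lemma u_moment_bound:
  assumes q: "0 < q" "q ^ 4 = real n" and \<kappa>: "1 \<le> \<kappa>" and r: "0 \<le> r" "r \<le> \<kappa> * q\<^sup>2"
    and dd: "ip n d d \<le> r" and sd2: "sd\<^sup>2 \<le> r * q\<^sup>2" and fr: "fr \<le> \<kappa> * q\<^sup>2"
  shows "E (\<lambda>\<sigma>. (u \<sigma>)\<^sup>2) \<le> r * (Ubound \<kappa> * (1 + q\<^sup>2 * \<tau> + (q\<^sup>2 * \<tau>)\<^sup>2))"
proof -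
  define t where "t = q\<^sup>2 * \<tau>"
  have t0: "0 \<le> t" using \<tau>_nonneg by (simp add: t_def)
  define K where "K = Kmom 2"
  have K: "0 \<le> K" by (simp add: K_def Kmom_nonneg)
  have nq: "real n = q\<^sup>2 * q\<^sup>2" using q by (simp flip: power_add)
  have dd': "ip n d d \<le> \<kappa> * q\<^sup>2" using dd r by linarith
  have sd: "\<bar>sd\<bar> \<le> \<kappa> * q\<^sup>2"
  proof -
    have "sd\<^sup>2 \<le> (\<kappa> * q\<^sup>2) * q\<^sup>2" using sd2 r by (meson mult_right_mono order_trans zero_le_power2)
    also have "\<dots> = 1 * (\<kappa> * q\<^sup>2 * q\<^sup>2)" by simp
    also have "\<dots> \<le> \<kappa> * (\<kappa> * q\<^sup>2 * q\<^sup>2)" using \<kappa> by (intro mult_right_mono) auto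
    also have "\<dots> = (\<kappa> * q\<^sup>2)\<^sup>2" by (simp add: power2_eq_square)
    finally have "\<bar>sd\<bar>\<^sup>2 \<le> (\<kappa> * q\<^sup>2)\<^sup>2" by simp
    then show ?thesis by (rule power2_le_imp_le) (use \<kappa> in auto)
  qed
  have \<Theta>: "\<Theta> \<le> (1 + 2 * \<kappa>) * (1 + t)"
  proof -
    have "\<Theta> \<le> 1 + \<tau> * (\<kappa> * q\<^sup>2 + \<kappa> * q\<^sup>2)"
      unfolding \<Theta>_def by (intro add_left_mono mult_left_mono add_mono dd' sd \<tau>_nonneg)
    also have "\<dots> = 1 + 2 * \<kappa> * t" by (simp add: t_def algebra_simps)
    also have "\<dots> \<le> (1 + 2 * \<kappa>) * (1 + t)" using \<kappa> t0 by (simp add: algebra_simps)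
    finally show ?thesis .
  qed
  have \<Pi>: "\<tau> * \<Pi>m \<le> (2 + 2 * \<kappa> + \<kappa> * (K + 4) / rate\<^sup>2) * (t + t\<^sup>2)"
  proof -
    have "\<Pi>m \<le> 2 * real n * \<tau> + 2 * (\<kappa> * q\<^sup>2) + (K * (\<kappa> * q\<^sup>2) + 4 * (\<kappa> * q\<^sup>2)) / rate\<^sup>2"
      unfolding \<Pi>m_def K_def[symmetric]
      by (intro add_mono divide_right_mono mult_left_mono dd' fr order_refl) (use K in auto)
    then have "\<tau> * \<Pi>m \<le> \<tau> * (2 * real n * \<tau> + 2 * (\<kappa> * q\<^sup>2) + (K * (\<kappa> * q\<^sup>2) + 4 * (\<kappa> * q\<^sup>2)) / rate\<^sup>2)"
      by (intro mult_left_mono \<tau>_nonneg)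
    also have "\<dots> = 2 * t\<^sup>2 + (2 * \<kappa> + \<kappa> * (K + 4) / rate\<^sup>2) * t"
      by (simp add: t_def nq power2_eq_square algebra_simps add_divide_distrib)
    also have "\<dots> \<le> (2 + 2 * \<kappa> + \<kappa> * (K + 4) / rate\<^sup>2) * t\<^sup>2 + (2 + 2 * \<kappa> + \<kappa> * (K + 4) / rate\<^sup>2) * t"
      using \<kappa> K t0 by (intro add_mono mult_right_mono) auto
    finally show ?thesis by (simp add: distrib_left)
  qed
  let ?T = "1 + t + t\<^sup>2"
  have T: "t \<le> ?T" "1 \<le> ?T" "1 + t \<le> ?T" "t + t\<^sup>2 \<le> ?T" "0 \<le> ?T" using t0 by auto
  have "E (\<lambda>\<sigma>. (u \<sigma>)\<^sup>2) \<le> 4 * (sd\<^sup>2 * \<tau> + (ip n d d)\<^sup>2 / \<delta>\<^sup>2 * \<tau>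
     + ip n d d / \<delta>\<^sup>2 * (K + 68 * \<Theta> / \<delta>\<^sup>2 + 8 * (\<tau> * \<Pi>m)))"
    using u_second_moment by (simp add: K_def mult.assoc)
  also have "\<dots> \<le> 4 * (r * ?T + r * (\<kappa> / \<delta>\<^sup>2) * ?T + r / \<delta>\<^sup>2 * (K * ?T + 68 * ((1 + 2 * \<kappa>) * ?T) / \<delta>\<^sup>2
      + 8 * ((2 + 2 * \<kappa> + \<kappa> * (K + 4) / rate\<^sup>2) * ?T)))"
  proof (rule mult_left_mono[OF add_mono[OF add_mono]])
    have "sd\<^sup>2 * \<tau> \<le> (r * q\<^sup>2) * \<tau>" by (intro mult_right_mono sd2 \<tau>_nonneg)
    also have "\<dots> = r * t" by (simp add: t_def)
    also have "\<dots> \<le> r * ?T" by (intro mult_left_mono T r)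
    finally show "sd\<^sup>2 * \<tau> \<le> r * ?T" .
    have "(ip n d d)\<^sup>2 / \<delta>\<^sup>2 * \<tau> \<le> (r * (\<kappa> * q\<^sup>2)) / \<delta>\<^sup>2 * \<tau>"
      unfolding power2_eq_square[of "ip n d d"]
      by (intro mult_right_mono divide_right_mono mult_mono dd dd' \<tau>_nonneg r ip_nonneg) auto
    also have "\<dots> = r * (\<kappa> / \<delta>\<^sup>2) * t" by (simp add: t_def)
    also have "\<dots> \<le> r * (\<kappa> / \<delta>\<^sup>2) * ?T" using \<kappa> by (intro mult_left_mono T mult_nonneg_nonneg r) auto
    finally show "(ip n d d)\<^sup>2 / \<delta>\<^sup>2 * \<tau> \<le> r * (\<kappa> / \<delta>\<^sup>2) * ?T" .
    have "68 * \<Theta> / \<delta>\<^sup>2 \<le> 68 * ((1 + 2 * \<kappa>) * ?T) / \<delta>\<^sup>2"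
    proof (intro divide_right_mono mult_left_mono)
      show "\<Theta> \<le> (1 + 2 * \<kappa>) * ?T" using \<kappa> by (intro order_trans[OF \<Theta>] mult_left_mono T) auto
    qed auto
    moreover have "8 * (\<tau> * \<Pi>m) \<le> 8 * ((2 + 2 * \<kappa> + \<kappa> * (K + 4) / rate\<^sup>2) * ?T)"
    proof (intro mult_left_mono)
      show "\<tau> * \<Pi>m \<le> (2 + 2 * \<kappa> + \<kappa> * (K + 4) / rate\<^sup>2) * ?T"
        using \<kappa> K by (intro order_trans[OF \<Pi>] mult_left_mono T add_nonneg_nonneg divide_nonneg_nonneg mult_nonneg_nonneg) auto
    qed auto
    moreover have "K \<le> K * ?T" using K T(2) by (simp add: mult_le_cancel_left1)
    ultimately have "K + 68 * \<Theta> / \<delta>\<^sup>2 + 8 * (\<tau> * \<Pi>m)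
        \<le> K * ?T + 68 * ((1 + 2 * \<kappa>) * ?T) / \<delta>\<^sup>2 + 8 * ((2 + 2 * \<kappa> + \<kappa> * (K + 4) / rate\<^sup>2) * ?T)"
      by (intro add_mono)
    moreover have "ip n d d / \<delta>\<^sup>2 \<le> r / \<delta>\<^sup>2" by (intro divide_right_mono dd) auto
    moreover have "0 \<le> K + 68 * \<Theta> / \<delta>\<^sup>2 + 8 * (\<tau> * \<Pi>m)"
      using \<Theta>_ge_1 \<tau>_nonneg \<Pi>m_nonneg K by (intro add_nonneg_nonneg divide_nonneg_nonneg mult_nonneg_nonneg) auto
    moreover have "0 \<le> r / \<delta>\<^sup>2" using r by simp
    ultimately show "ip n d d / \<delta>\<^sup>2 * (K + 68 * \<Theta> / \<delta>\<^sup>2 + 8 * (\<tau> * \<Pi>m))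
        \<le> r / \<delta>\<^sup>2 * (K * ?T + 68 * ((1 + 2 * \<kappa>) * ?T) / \<delta>\<^sup>2 + 8 * ((2 + 2 * \<kappa> + \<kappa> * (K + 4) / rate\<^sup>2) * ?T))"
      by (intro mult_mono)
  qed auto
  also have "\<dots> = r * (Ubound \<kappa> * ?T)"
    by (simp add: Ubound_def K_def[symmetric] algebra_simps add_divide_distrib)
  finally show ?thesis by (simp add: t_def)
qed

text \<open>Rescaling the magnetization by \<open>q\<close> brings all terms of
  \<open>sixth_moment\<close> to order one. Young's inequality bounds each by a small multiple of
  the rescaled sixth moment plus data, and \<open>closing\<close> absorbs them.\<close>

lemma sixth_moment_bound:
  assumes q: "0 < q" "q ^ 4 = real n" and \<kappa>: "1 \<le> \<kappa>" and r: "0 \<le> r" "r \<le> \<kappa> * q\<^sup>2"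
    and dd: "ip n d d \<le> r" and sd2: "sd\<^sup>2 \<le> r * q\<^sup>2" and fr: "fr \<le> \<kappa> * q\<^sup>2"
    and Y6: "E (\<lambda>\<sigma>. Ym \<sigma> ^ 6) \<le> \<kappa> * q ^ 6" and YA: "E (\<lambda>\<sigma>. (Ym \<sigma> * A \<sigma>)\<^sup>2) \<le> \<kappa> * q\<^sup>2"
  shows "q ^ 6 * E (\<lambda>\<sigma>. sb \<sigma> ^ 6) \<le> closing_bound (Bbound \<kappa>)"
    and "q\<^sup>2 * \<tau> \<le> closing_bound (Bbound \<kappa>) + 1"
proof -
  define s where "s = (\<lambda>\<sigma>. q * sb \<sigma>)"
  define S where "S = E (\<lambda>\<sigma>. s \<sigma> ^ 6)"
  define t where "t = q\<^sup>2 * \<tau>"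
  have t_eq: "t = E (\<lambda>\<sigma>. (s \<sigma>)\<^sup>2)" by (simp add: t_def \<tau>_def s_def power_mult_distrib E_cmult)
  have S_eq: "S = q ^ 6 * E (\<lambda>\<sigma>. sb \<sigma> ^ 6)" by (simp add: S_def s_def power_mult_distrib E_cmult)
  define Q2 where "Q2 = E (\<lambda>\<sigma>. \<bar>s \<sigma>\<bar> ^ 3 * (\<bar>u \<sigma>\<bar> / q))"
  define Q3 where "Q3 = E (\<lambda>\<sigma>. \<bar>s \<sigma>\<bar> ^ 3 * (Ym \<sigma> * A \<sigma> / q))"
  define Q5 where "Q5 = E (\<lambda>\<sigma>. \<bar>s \<sigma>\<bar> ^ 5 * (Ym \<sigma> / q))"
  have S0: "0 \<le> S" unfolding S_def by (rule E_nonneg) (simp add: zero_le_even_power)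
  have t0: "0 \<le> t" using \<tau>_nonneg by (simp add: t_def)
  have nq: "real n = q ^ 4" by (simp add: q)
  have q1: "1 \<le> q"
  proof (rule ccontr)
    assume "\<not> 1 \<le> q"
    then have "q ^ 4 \<le> 1" using q by (intro power_le_one) auto
    then show False using n2 q by simp
  qed
  have B: "1 \<le> Bbound \<kappa>" by (rule Bbound_ge_1[OF \<kappa>])
  have t_le: "t \<le> \<eta> * S + 1 / \<eta>" if "0 < \<eta>" "\<eta> \<le> 1" for \<eta>
  proof -
    have "t \<le> E (\<lambda>\<sigma>. \<eta> * s \<sigma> ^ 6 + 1 / \<eta>)" unfolding t_eq by (rule E_mono) (rule young_square[OF that])
    then show ?thesis by (simp add: E_add E_cmult S_def)
  qed
  have t2_le: "t\<^sup>2 \<le> \<eta> * S + 1 / \<eta>\<^sup>2" if "0 < \<eta>" "\<eta> \<le> 1" for \<eta>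
  proof -
    have "t\<^sup>2 \<le> E (\<lambda>\<sigma>. ((s \<sigma>)\<^sup>2)\<^sup>2)" unfolding t_eq by (rule E_square_le)
    also have "\<dots> \<le> E (\<lambda>\<sigma>. \<eta> * s \<sigma> ^ 6 + 1 / \<eta>\<^sup>2)"
      by (rule E_mono) (use young_square(2)[OF that] in \<open>simp flip: power_mult\<close>)
    finally show ?thesis by (simp add: E_add E_cmult S_def)
  qed
  have Q2_le: "Q2 \<le> \<eta> * S + Bbound \<kappa> * (1 + t + t\<^sup>2) / (4 * \<eta>)" if \<eta>: "0 < \<eta>" "\<eta> \<le> 1" for \<eta>
  proof -
    have "Q2 \<le> E (\<lambda>\<sigma>. \<eta> * s \<sigma> ^ 6 + (\<bar>u \<sigma>\<bar> / q)\<^sup>2 / (4 * \<eta>))"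
      unfolding Q2_def by (rule E_mono) (rule young_cube[OF \<eta>(1)])
    also have "\<dots> = \<eta> * S + E (\<lambda>\<sigma>. (u \<sigma>)\<^sup>2) / q\<^sup>2 / (4 * \<eta>)"
      by (simp add: E_add E_cmult E_divide S_def power_divide)
    also have "E (\<lambda>\<sigma>. (u \<sigma>)\<^sup>2) / q\<^sup>2 \<le> Bbound \<kappa> * (1 + t + t\<^sup>2)"
    proof -
      have "E (\<lambda>\<sigma>. (u \<sigma>)\<^sup>2) \<le> r * (Ubound \<kappa> * (1 + t + t\<^sup>2))"
        unfolding t_def by (rule u_moment_bound[OF q \<kappa> r dd sd2 fr])
      also have "\<dots> \<le> (\<kappa> * q\<^sup>2) * (Ubound \<kappa> * (1 + t + t\<^sup>2))"
        using Ubound_nonneg[OF \<kappa>] t0 by (intro mult_right_mono r) auto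
      finally have "E (\<lambda>\<sigma>. (u \<sigma>)\<^sup>2) / q\<^sup>2 \<le> \<kappa> * Ubound \<kappa> * (1 + t + t\<^sup>2)"
        using q by (simp add: field_simps)
      also have "\<dots> \<le> Bbound \<kappa> * (1 + t + t\<^sup>2)"
        using t0 \<kappa> unfolding Bbound_def by (intro mult_right_mono) auto
      finally show ?thesis .
    qed
    finally show ?thesis using \<eta> by (simp add: divide_right_mono)
  qed
  have \<kappa>B: "\<kappa> \<le> Bbound \<kappa>"
    using Ubound_nonneg[OF \<kappa>] \<kappa> by (auto simp: Bbound_def intro!: add_nonneg_nonneg mult_nonneg_nonneg)
  have Q3_le: "Q3 \<le> \<eta> * S + Bbound \<kappa> / (4 * \<eta>)" if \<eta>: "0 < \<eta>" "\<eta> \<le> 1" for \<eta>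
  proof -
    have "Q3 \<le> E (\<lambda>\<sigma>. \<eta> * s \<sigma> ^ 6 + (Ym \<sigma> * A \<sigma> / q)\<^sup>2 / (4 * \<eta>))"
      unfolding Q3_def by (rule E_mono) (rule young_cube[OF \<eta>(1)])
    also have "\<dots> = \<eta> * S + E (\<lambda>\<sigma>. (Ym \<sigma> * A \<sigma>)\<^sup>2) / q\<^sup>2 / (4 * \<eta>)"
      by (simp add: E_add E_cmult E_divide S_def power_divide)
    also have "E (\<lambda>\<sigma>. (Ym \<sigma> * A \<sigma>)\<^sup>2) / q\<^sup>2 \<le> Bbound \<kappa>"
      using YA q \<kappa>B by (auto simp: field_simps intro: order_trans)
    finally show ?thesis using \<eta> by (simp add: divide_right_mono)
  qed
  have Q5_le: "Q5 \<le> \<eta> * S + Bbound \<kappa> / \<eta> ^ 5" if \<eta>: "0 < \<eta>" "\<eta> \<le> 1" for \<eta>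
  proof -
    have "Q5 \<le> E (\<lambda>\<sigma>. \<eta> * s \<sigma> ^ 6 + (Ym \<sigma> / q) ^ 6 / \<eta> ^ 5)"
      unfolding Q5_def by (rule E_mono) (rule young_fifth[OF \<eta>(1)], use Ym_nonneg q in auto)
    also have "\<dots> = \<eta> * S + E (\<lambda>\<sigma>. Ym \<sigma> ^ 6) / q ^ 6 / \<eta> ^ 5"
      by (simp add: E_add E_cmult E_divide S_def power_divide)
    also have "E (\<lambda>\<sigma>. Ym \<sigma> ^ 6) / q ^ 6 \<le> Bbound \<kappa>"
    proof -
      have "E (\<lambda>\<sigma>. Ym \<sigma> ^ 6) / q ^ 6 \<le> \<kappa>" using Y6 q by (simp add: field_simps)
      then show ?thesis using \<kappa>B by linarith
    qed
    finally show ?thesis using \<eta> by (simp add: divide_right_mono)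
  qed
  have "S \<le> Bbound \<kappa> * (1 + t + Q2 + Q3 + Q5)"
  proof -
    have Q0: "0 \<le> Q2" "0 \<le> Q3" "0 \<le> Q5"
      unfolding Q2_def Q3_def Q5_def using q
      by (auto intro!: E_nonneg mult_nonneg_nonneg divide_nonneg_nonneg Ym_nonneg ip_nonneg)
    define x2 x3 x5 where "x2 = E (\<lambda>\<sigma>. \<bar>sb \<sigma>\<bar> ^ 3 * \<bar>u \<sigma>\<bar>)"
      and "x3 = E (\<lambda>\<sigma>. \<bar>sb \<sigma>\<bar> ^ 3 * (Ym \<sigma> * A \<sigma>))" and "x5 = E (\<lambda>\<sigma>. \<bar>sb \<sigma>\<bar> ^ 5 * Ym \<sigma>)"
    have x: "q\<^sup>2 * x2 = Q2" "q\<^sup>2 * x3 = Q3" "q ^ 4 * x5 = Q5"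
    proof -
      have "q\<^sup>2 * (X * Y) = q ^ 3 * X * (Y / q)" "q ^ 4 * (X * Y) = q ^ 5 * X * (Y / q)" for X Y
        using q(1) by (simp_all add: eval_nat_numeral)
      moreover have "\<bar>q\<bar> = q" using q(1) by simp
      ultimately show "q\<^sup>2 * x2 = Q2" "q\<^sup>2 * x3 = Q3" "q ^ 4 * x5 = Q5"
        unfolding x2_def x3_def x5_def Q2_def Q3_def Q5_def E_cmult[symmetric] s_def abs_mult power_mult_distrib
        by simp_all
    qed
    \<comment> \<open>The moment inequality is to be multiplied by \<open>40 * q\<^sup>2\<close>: as
      \<open>n = q ^ 4\<close>, its left side becomes the sixth moment of
      \<open>q * sb\<close>.\<close>
    have S_n: "40 * q\<^sup>2 * (real n * E (\<lambda>\<sigma>. sb \<sigma> ^ 6) / 40) = S"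
      by (simp add: S_eq nq flip: power_add mult.assoc)
    have x50: "0 \<le> x5" unfolding x5_def by (intro E_nonneg mult_nonneg_nonneg Ym_nonneg) auto
    have "80 * ip n d d / rate\<^sup>2 * x5 \<le> 80 * (\<kappa> * q\<^sup>2) / rate\<^sup>2 * x5"
      using dd r by (intro mult_right_mono divide_right_mono mult_left_mono x50) auto
    then have "real n * E (\<lambda>\<sigma>. sb \<sigma> ^ 6) / 40 \<le> 9 * \<tau> + 24 / (real n)\<^sup>2 + (41 + 40 / rate\<^sup>2) * x2 + 40 / rate\<^sup>2 * x3
        + 80 * (\<kappa> * q\<^sup>2) / rate\<^sup>2 * x5"
      using sixth_moment unfolding x2_def x3_def x5_def by linarith
    then have "S \<le> 40 * q\<^sup>2 * (9 * \<tau> + 24 / (real n)\<^sup>2 + (41 + 40 / rate\<^sup>2) * x2 + 40 / rate\<^sup>2 * x3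
        + 80 * (\<kappa> * q\<^sup>2) / rate\<^sup>2 * x5)"
      unfolding S_n[symmetric] by (intro mult_left_mono) auto
    also have "\<dots> = 40 * (9 * (q\<^sup>2 * \<tau>) + 24 * (q\<^sup>2 / (real n)\<^sup>2) + (41 + 40 / rate\<^sup>2) * (q\<^sup>2 * x2) + 40 / rate\<^sup>2 * (q\<^sup>2 * x3)
        + 80 * \<kappa> / rate\<^sup>2 * (q ^ 4 * x5))"
      by (simp add: algebra_simps eval_nat_numeral)
    also have "\<dots> = 40 * (9 * t + 24 * (q\<^sup>2 / (real n)\<^sup>2) + (41 + 40 / rate\<^sup>2) * Q2 + 40 / rate\<^sup>2 * Q3 + 80 * \<kappa> / rate\<^sup>2 * Q5)"
      by (simp only: x t_def)
    also have "\<dots> \<le> 40 * (9 * t + 24 * 1 + (41 + 40 / rate\<^sup>2) * Q2 + 40 / rate\<^sup>2 * Q3 + 80 * \<kappa> / rate\<^sup>2 * Q5)"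
    proof -
      have "q\<^sup>2 * 1 \<le> q\<^sup>2 * q ^ 6" using q1 by (intro mult_left_mono one_le_power) auto
      also have "\<dots> = (real n)\<^sup>2" by (simp add: nq flip: power_mult power_add)
      finally have "q\<^sup>2 / (real n)\<^sup>2 \<le> 1" using n0 by (simp add: field_simps)
      then show ?thesis by simp
    qed
    also have "\<dots> \<le> Bbound \<kappa> * (1 + t + Q2 + Q3 + Q5)"
    proof -
      define R where "R = 1 / rate\<^sup>2"
      have R0: "0 \<le> R" by (simp add: R_def)
      have "40 * (33 + (41 + 40 * R) + 40 * R + 80 * \<kappa> * R) \<le> Bbound \<kappa>"
        using Ubound_nonneg[OF \<kappa>] \<kappa> by (simp add: Bbound_def R_def)
      then have "40 * (33 + (41 + 40 * R) + 40 * R + 80 * \<kappa> * R) * (1 + t + Q2 + Q3 + Q5) \<le> Bbound \<kappa> * (1 + t + Q2 + Q3 + Q5)"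
        using t0 Q0 by (intro mult_right_mono) auto
      moreover have "40 * (9 * t + 24 * 1 + (41 + 40 * R) * Q2 + 40 * R * Q3 + 80 * \<kappa> * R * Q5)
         \<le> 40 * (33 + (41 + 40 * R) + 40 * R + 80 * \<kappa> * R) * (1 + t + Q2 + Q3 + Q5)"
      proof -
        define c where "c = 33 + (41 + 40 * R) + 40 * R + 80 * \<kappa> * R"
        have \<kappa>R: "0 \<le> \<kappa> * R" using \<kappa> R0 by simp
        have c: "9 \<le> c" "24 \<le> c" "41 + 40 * R \<le> c" "40 * R \<le> c" "80 * \<kappa> * R \<le> c"
          using \<kappa>R R0 by (auto simp: c_def)
        have "9 * t + 24 * 1 + (41 + 40 * R) * Q2 + 40 * R * Q3 + 80 * \<kappa> * R * Q5 \<le> c * t + c * 1 + c * Q2 + c * Q3 + c * Q5"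
          using t0 Q0 by (intro add_mono mult_right_mono c) auto
        then show ?thesis unfolding c_def[symmetric] by (simp add: algebra_simps)
      qed
      ultimately show ?thesis by (simp add: R_def)
    qed
    finally show ?thesis .
  qed
  from closing[OF B S0 t0 zero_le_power2 this Q2_le Q3_le Q5_le t_le t2_le]
  have "S \<le> closing_bound (Bbound \<kappa>)" by simp
  then show "q ^ 6 * E (\<lambda>\<sigma>. sb \<sigma> ^ 6) \<le> closing_bound (Bbound \<kappa>)" "q\<^sup>2 * \<tau> \<le> closing_bound (Bbound \<kappa>) + 1"
    using t_le[of 1] by (simp_all add: S_eq t_def)
qed

end

subsection \<open>Moments of the deviation of the local fields\<close>

lemma power_add_le:
  fixes x y :: real
  assumes "0 \<le> x" "0 \<le> y"
  shows "(x + y) ^ p \<le> 2 ^ p * (x ^ p + y ^ p)"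
proof -
  have "(x + y) ^ p \<le> (2 * max x y) ^ p" using assms by (intro power_mono) auto
  also have "\<dots> = 2 ^ p * max x y ^ p" by (rule power_mult_distrib)
  also have "max x y ^ p \<le> x ^ p + y ^ p" using assms by (auto simp: max_def)
  finally show ?thesis by simp
qed

context near_regular
begin

lemma ln_n_ge_1: "3 \<le> n \<Longrightarrow> 1 \<le> ln (real n)"
proof -
  assume "3 \<le> n"
  then have "ln 3 \<le> ln (real n)" by simp
  then show ?thesis using ln3_gt_1 by linarith
qed

lemma sup_steps:
  assumes n3: "3 \<le> n" and D: "3 * ln n / rate * D \<le> 1"
  obtains k :: nat where "real k \<le> 3 * ln n / rate" "real k * D \<le> 1" "(1 - rate) ^ k * sqrt n \<le> 1 / 2"
proof
  \<comment> \<open>In units of \<open>1 / rate\<close>, \<open>ln n / 2\<close> steps compensate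
    \<open>sqrt n\<close>, and one more leaves the factor \<open>1 / exp 1\<close>, below
    \<open>1 / 2\<close>.\<close>
  define k where "k = nat \<lceil>(ln n / 2 + 1) / rate\<rceil>"
  have L: "1 \<le> ln (real n)" by (rule ln_n_ge_1[OF n3])
  have 0: "0 \<le> (ln n / 2 + 1) / rate" using L rate_pos by (intro divide_nonneg_pos) auto
  have "real k \<le> (ln n / 2 + 1) / rate + 1" unfolding k_def using 0 by linarith
  also have "\<dots> \<le> (ln n / 2 + 1) / rate + ln n / rate"
    using rate_pos rate_le L by (intro add_left_mono) (simp add: field_simps)
  also have "\<dots> = (3 / 2 * ln n + 1) / rate" by (simp add: add_divide_distrib)
  also have "\<dots> \<le> 3 * ln n / rate" using L rate_pos by (intro divide_right_mono) auto
  finally show k: "real k \<le> 3 * ln n / rate" .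
  show "real k * D \<le> 1" using mult_right_mono[OF k D0] D by linarith
  have "(ln n / 2 + 1) / rate \<le> real k" unfolding k_def using 0 by linarith
  then have kr: "ln n / 2 + 1 \<le> real k * rate" using rate_pos by (simp add: field_simps)
  have "(1 - rate) ^ k \<le> exp (- rate) ^ k"
    using exp_ge_add_one_self[of "- rate"] rate_le by (intro power_mono) auto
  also have "\<dots> = exp (- (real k * rate))" by (simp flip: exp_of_nat_mult)
  also have "\<dots> \<le> exp (- (ln n / 2 + 1))" using kr by simp
  also have "\<dots> = 1 / (sqrt n * exp 1)"
  proof -
    have "exp (ln n / 2) = sqrt n" using n0 by (simp add: ln_sqrt[symmetric])
    then show ?thesis by (simp only: exp_minus exp_add) (simp add: field_simps)
  qed
  finally have "(1 - rate) ^ k * sqrt n \<le> 1 / (sqrt n * exp 1) * sqrt n"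
    using n0 by (intro mult_right_mono) auto
  also have "\<dots> = 1 / exp 1" using n0 by simp
  also have "\<dots> \<le> 1 / 2" using exp_ge_add_one_self[of 1] by (intro divide_left_mono) auto
  finally show "(1 - rate) ^ k * sqrt n \<le> 1 / 2" .
qed

text \<open>\<open>18 = 6 * 3\<close>: the factor 6 of \<open>Ym_le\<close> times the number
  \<open>3 * ln n / rate\<close> of steps.\<close>

definition H :: real where "H = 18 / rate"

lemma H_pos: "0 < H" using rate_pos by (simp add: H_def)

lemma Ym_log:
  assumes "3 \<le> n" "3 * ln n / rate * D \<le> 1"
  shows "Ym \<sigma> \<le> H * ln n * (om \<sigma> + \<bar>mb \<sigma>\<bar> * D)"
proof -
  from sup_steps[OF assms] obtain k where k: "real k \<le> 3 * ln n / rate" and kk: "real k * D \<le> 1" "(1 - rate) ^ k * sqrt n \<le> 1 / 2" .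
  have "Ym \<sigma> \<le> 6 * real k * (om \<sigma> + \<bar>mb \<sigma>\<bar> * D)" using Ym_le[OF kk, of \<sigma>] by simp
  also have "\<dots> \<le> H * ln n * (om \<sigma> + \<bar>mb \<sigma>\<bar> * D)"
    using k om_nonneg D0 by (intro mult_right_mono add_nonneg_nonneg mult_nonneg_nonneg) (auto simp: H_def)
  finally show ?thesis .
qed

definition Omom :: "nat \<Rightarrow> real" where "Omom k = 2 ^ k * (6 ^ k + 2 * fact k)"

text \<open>Let \<open>w\<close> be the noise in units of \<open>sqrt (al * ln n)\<close>. With the
  tilt \<open>L / s\<close> the bound of \<open>om_exp\<close> is \<open>2 * n ^ 6\<close>, and
  \<open>exp (- (6 * L\<^sup>2))\<close> cancels all but the 2. Values of \<open>w\<close> above 12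
  are dominated by the tilted exponential, since then \<open>w \<le> 2 * (w - 6)\<close>.\<close>

lemma om_moment:
  assumes n3: "3 \<le> n"
  shows "E (\<lambda>\<sigma>. om \<sigma> ^ k) \<le> Omom k * sqrt (al * ln n) ^ k"
proof -
  define L where "L = sqrt (ln n)"
  define s where "s = sqrt al"
  have L: "1 \<le> L" using ln_n_ge_1[OF n3] by (simp add: L_def)
  have L2: "L\<^sup>2 = ln n" using ln_n_ge_1[OF n3] by (simp add: L_def)
  have s: "0 < s" "s\<^sup>2 = al" using al_pos by (auto simp: s_def)
  have sL: "sqrt (al * ln n) = s * L" by (simp add: s_def L_def real_sqrt_mult)
  have pointwise: "om \<sigma> ^ k \<le> (s * L) ^ k * 2 ^ k * (6 ^ k + fact k * exp (- (6 * L\<^sup>2)) * exp (L / s * om \<sigma>))" for \<sigma>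
  proof -
    define w where "w = om \<sigma> / (s * L)"
    have w0: "0 \<le> w" using om_nonneg s L by (simp add: w_def)
    have om: "om \<sigma> = s * L * w" using s L by (simp add: w_def)
    have e: "exp (- (6 * L\<^sup>2)) * exp (L / s * om \<sigma>) = exp (L\<^sup>2 * (w - 6))"
      using s by (simp add: om power2_eq_square algebra_simps flip: exp_add)
    have "w ^ k \<le> 2 ^ k * (6 ^ k + fact k * exp (L\<^sup>2 * (w - 6)))"
    proof (cases "w \<le> 12")
      case True
      then have "w ^ k \<le> 12 ^ k" using w0 by (intro power_mono)
      also have "\<dots> = 2 ^ k * 6 ^ k" by (simp flip: power_mult_distrib)
      finally show ?thesis by (simp add: distrib_left add_increasing2)
    next
      case False
      then have "w ^ k \<le> (2 * (w - 6)) ^ k" using w0 by (intro power_mono) auto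
      also have "\<dots> \<le> 2 ^ k * (fact k * exp (w - 6))"
        unfolding power_mult_distrib using False by (intro mult_left_mono power_le_fact_exp) auto
      also have "\<dots> \<le> 2 ^ k * (fact k * exp (L\<^sup>2 * (w - 6)))"
      proof -
        have "1 * (w - 6) \<le> L\<^sup>2 * (w - 6)" using False L by (intro mult_right_mono) (auto simp: one_le_power)
        then show ?thesis by (intro mult_left_mono) auto
      qed
      finally show ?thesis by (simp add: distrib_left add_increasing)
    qed
    then have "(s * L) ^ k * w ^ k \<le> (s * L) ^ k * (2 ^ k * (6 ^ k + fact k * exp (L\<^sup>2 * (w - 6))))"
      using s L by (intro mult_left_mono) auto
    moreover have "(s * L) ^ k * w ^ k = om \<sigma> ^ k" by (simp add: om power_mult_distrib)
    ultimately show ?thesis by (simp only: e[symmetric] mult.assoc)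
  qed
  have "E (\<lambda>\<sigma>. om \<sigma> ^ k) \<le> E (\<lambda>\<sigma>. (s * L) ^ k * 2 ^ k * (6 ^ k + fact k * exp (- (6 * L\<^sup>2)) * exp (L / s * om \<sigma>)))"
    by (intro E_mono pointwise)
  also have "\<dots> = (s * L) ^ k * 2 ^ k * (6 ^ k + fact k * exp (- (6 * L\<^sup>2)) * E (\<lambda>\<sigma>. exp (L / s * om \<sigma>)))"
    by (simp add: E_cmult E_add)
  also have "\<dots> \<le> (s * L) ^ k * 2 ^ k * (6 ^ k + fact k * exp (- (6 * L\<^sup>2)) * (2 * n * exp (5 * (L / s)\<^sup>2 * al)))"
    using s L by (intro mult_left_mono add_left_mono om_exp mult_nonneg_nonneg) auto
  finally have le: "E (\<lambda>\<sigma>. om \<sigma> ^ k) \<le> (s * L) ^ k * 2 ^ k * (6 ^ k + fact k * exp (- (6 * L\<^sup>2)) * (2 * n * exp (5 * (L / s)\<^sup>2 * al)))" .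
  have "exp (- (6 * L\<^sup>2)) * (2 * n * exp (5 * (L / s)\<^sup>2 * al)) = 2"
  proof -
    have "(L / s)\<^sup>2 * al = ln n" using s al_pos by (simp add: power_divide L2)
    then have 1: "5 * (L / s)\<^sup>2 * al = 5 * ln n" by (simp only: mult.assoc)
    have "exp (ln n) * exp (- (6 * ln n)) * exp (5 * ln n) = 1" by (simp flip: exp_add)
    then have "n * exp (- (6 * ln n)) * exp (5 * ln n) = 1" using n0 by simp
    then show ?thesis by (simp only: 1 L2) (simp add: mult_ac)
  qed
  with le show ?thesis by (simp only: mult.assoc sL Omom_def) (simp add: mult_ac)
qed

definition rr :: real where "rr = sqrt (ln n ^ 3 * al) + ln n * D"

definition Ymom :: "nat \<Rightarrow> real" where "Ymom k = (2 * H) ^ k * (Omom k + 2 ^ k)"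

lemma Ymom_nonneg: "0 \<le> Ymom k"
  unfolding Ymom_def Omom_def using H_pos by simp

lemma rr_nonneg: "3 \<le> n \<Longrightarrow> 0 \<le> rr"
  unfolding rr_def using ln_n_ge_1 D0 al_pos by (intro add_nonneg_nonneg mult_nonneg_nonneg) auto

text \<open>Uses \<open>Ym_log\<close> with the crude bound 2 for \<open>mb\<close>. Logarithm times
  noise and logarithm times row deviation are the two summands of \<open>rr\<close>.\<close>

lemma Ym_moment:
  assumes n3: "3 \<le> n" and D: "3 * ln n / rate * D \<le> 1"
  shows "E (\<lambda>\<sigma>. Ym \<sigma> ^ k) \<le> Ymom k * rr ^ k"
proof -
  have L: "1 \<le> ln (real n)" by (rule ln_n_ge_1[OF n3])
  define HL where "HL = H * ln n"
  have HL: "0 \<le> HL" using L H_pos by (simp add: HL_def)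
  have "E (\<lambda>\<sigma>. Ym \<sigma> ^ k) \<le> E (\<lambda>\<sigma>. HL ^ k * (2 ^ k * (om \<sigma> ^ k + (2 * D) ^ k)))"
  proof (rule E_mono)
    fix \<sigma> assume \<sigma>: "\<sigma> \<in> conf n"
    have "\<bar>mb \<sigma>\<bar> * D \<le> 2 * D" using mb_bound[OF \<sigma>] D1 D0 by (intro mult_right_mono) auto
    then have "HL * (om \<sigma> + \<bar>mb \<sigma>\<bar> * D) \<le> HL * (om \<sigma> + 2 * D)" using HL by (intro mult_left_mono) auto
    then have "Ym \<sigma> \<le> HL * (om \<sigma> + 2 * D)"
      using Ym_log[OF n3 D, of \<sigma>] unfolding HL_def by linarith
    then have "Ym \<sigma> ^ k \<le> (HL * (om \<sigma> + 2 * D)) ^ k" using Ym_nonneg by (intro power_mono)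
    also have "\<dots> \<le> HL ^ k * (2 ^ k * (om \<sigma> ^ k + (2 * D) ^ k))"
      unfolding power_mult_distrib[of HL] using HL om_nonneg D0 by (intro mult_left_mono power_add_le) auto
    finally show "Ym \<sigma> ^ k \<le> HL ^ k * (2 ^ k * (om \<sigma> ^ k + (2 * D) ^ k))" .
  qed
  also have "\<dots> = HL ^ k * (2 ^ k * (E (\<lambda>\<sigma>. om \<sigma> ^ k) + (2 * D) ^ k))"
    by (simp add: E_cmult E_add)
  also have "\<dots> \<le> HL ^ k * (2 ^ k * (Omom k * sqrt (al * ln n) ^ k + (2 * D) ^ k))"
    using HL by (intro mult_left_mono add_right_mono om_moment n3) auto
  also have "\<dots> = (2 * H) ^ k * (Omom k * (ln n * sqrt (al * ln n)) ^ k + 2 ^ k * (ln n * D) ^ k)"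
    by (simp add: HL_def power_mult_distrib algebra_simps)
  also have "\<dots> \<le> (2 * H) ^ k * (Omom k * rr ^ k + 2 ^ k * rr ^ k)"
  proof -
    have "ln n * sqrt (al * ln n) = sqrt (ln n ^ 3 * al)"
      using L by (simp add: power3_eq_cube real_sqrt_mult mult_ac)
    then have 1: "ln n * sqrt (al * ln n) \<le> rr" using L D0 by (simp add: rr_def)
    have "0 \<le> sqrt (ln n ^ 3 * al)" using L al_pos by simp
    then have 2: "ln n * D \<le> rr" by (simp add: rr_def)
    have "0 \<le> Omom k" by (simp add: Omom_def)
    then show ?thesis using 1 2 H_pos L D0 al_pos
      by (intro mult_left_mono add_mono power_mono) auto
  qed
  finally show ?thesis by (simp add: Ymom_def algebra_simps)
qed

text \<open>Jensen's inequality for the fourth power, with the squared row norms as weights: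
  \<open>A\<close> is a weighted sum of normalised squares, whose moments \<open>nz_moment\<close>
  bounds uniformly.\<close>

lemma A_moment: "E (\<lambda>\<sigma>. A \<sigma> ^ 4) \<le> Kmom 8 * fr ^ 4"
proof (cases "fr = 0")
  case True
  have "\<forall>i<n. ip n (a i) (a i) = 0"
    using True unfolding fr_def by (subst (asm) sum_nonneg_eq_0_iff) (auto simp: ip_nonneg)
  then have "an \<sigma> i = 0" if "i < n" for \<sigma> i
    using that by (auto simp: an_eq ip_zero_iff) (simp add: ip_def)
  then have "A \<sigma> = 0" for \<sigma> by (simp add: ip_def)
  then show ?thesis using True by simp
next
  case False
  then have fr: "0 < fr" using fr_nonneg by simp
  define w where "w = (\<lambda>i. ip n (a i) (a i))"
  have w0: "0 \<le> w i" for i by (simp add: w_def ip_nonneg)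
  have fr_w: "fr = (\<Sum>i<n. w i)" by (simp add: fr_def w_def)
  \<comment> \<open>Where \<open>w i = 0\<close> the row vanishes and with it
    \<open>an \<sigma> i\<close>, so the value 0 of the quotient is the right one.\<close>
  define X where "X = (\<lambda>\<sigma> i. (an \<sigma> i)\<^sup>2 / w i)"
  have wX: "w i * X \<sigma> i = (an \<sigma> i)\<^sup>2" for \<sigma> i
  proof (cases "w i = 0")
    case True
    then have "\<forall>j<n. a i j = 0" by (simp add: w_def ip_zero_iff)
    then have "an \<sigma> i = 0" by (simp add: an_eq) (simp add: ip_def)
    then show ?thesis using True by simp
  qed (simp add: X_def)
  have A: "A \<sigma> = (\<Sum>i<n. w i * X \<sigma> i)" for \<sigma> by (simp add: wX ip_def power2_eq_square)
  have "A \<sigma> ^ 4 \<le> fr ^ 3 * (\<Sum>i<n. w i * X \<sigma> i ^ 4)" for \<sigma>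
  proof -
    \<comment> \<open>The weighted mean of the \<open>X \<sigma> i\<close>. The fourth power lies
      above its tangent at \<open>c\<close>, and the linear part of the tangent sums to
      zero.\<close>
    define c where "c = A \<sigma> / fr"
    have "w i * (c ^ 4 + 4 * c ^ 3 * (X \<sigma> i - c)) \<le> w i * X \<sigma> i ^ 4" for i
    proof (rule mult_left_mono[OF _ w0])
      define x where "x = X \<sigma> i"
      have "0 \<le> (x - c)\<^sup>2 * ((x + c)\<^sup>2 + 2 * c\<^sup>2)" by simp
      also have "\<dots> = x ^ 4 - (c ^ 4 + 4 * c ^ 3 * (x - c))"
        by (simp add: algebra_simps eval_nat_numeral)
      finally show "c ^ 4 + 4 * c ^ 3 * (X \<sigma> i - c) \<le> X \<sigma> i ^ 4" by (simp add: x_def)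
    qed
    then have "(\<Sum>i<n. w i * (c ^ 4 + 4 * c ^ 3 * (X \<sigma> i - c))) \<le> (\<Sum>i<n. w i * X \<sigma> i ^ 4)"
      by (intro sum_mono) auto
    moreover have "(\<Sum>i<n. w i * (c ^ 4 + 4 * c ^ 3 * (X \<sigma> i - c))) = (c ^ 4 - 4 * c ^ 3 * c) * fr + 4 * c ^ 3 * A \<sigma>"
      by (simp add: fr_w A sum_distrib_left sum_distrib_right sum.distrib[symmetric] sum_subtractf[symmetric] algebra_simps)
    moreover have "A \<sigma> = c * fr" using fr by (simp add: c_def)
    ultimately have "c ^ 4 * fr \<le> (\<Sum>i<n. w i * X \<sigma> i ^ 4)"
      by (simp add: algebra_simps eval_nat_numeral)
    then have "fr ^ 3 * (c ^ 4 * fr) \<le> fr ^ 3 * (\<Sum>i<n. w i * X \<sigma> i ^ 4)"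
      using fr by (intro mult_left_mono) auto
    then show ?thesis using \<open>A \<sigma> = c * fr\<close> by (simp add: power_mult_distrib eval_nat_numeral mult_ac)
  qed
  then have "E (\<lambda>\<sigma>. A \<sigma> ^ 4) \<le> E (\<lambda>\<sigma>. fr ^ 3 * (\<Sum>i<n. w i * X \<sigma> i ^ 4))"
    by (intro E_mono)
  also have "\<dots> = fr ^ 3 * (\<Sum>i<n. w i * E (\<lambda>\<sigma>. X \<sigma> i ^ 4))"
    by (simp add: E_cmult E_sum)
  also have "\<dots> \<le> fr ^ 3 * (\<Sum>i<n. w i * Kmom 8)"
  proof (intro mult_left_mono sum_mono w0)
    fix i
    have "E (\<lambda>\<sigma>. X \<sigma> i ^ 4) = E (\<lambda>\<sigma>. \<bar>an \<sigma> i\<bar> ^ 8) / w i ^ 4"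
      by (simp add: X_def power_divide E_divide power_even_abs flip: power_mult)
    also have "\<dots> \<le> Kmom 8 * w i ^ 4 / w i ^ 4"
    proof (rule divide_right_mono)
      have "nrm n (a i) ^ 8 = ((nrm n (a i))\<^sup>2) ^ 4" by (simp flip: power_mult)
      then show "E (\<lambda>\<sigma>. \<bar>an \<sigma> i\<bar> ^ 8) \<le> Kmom 8 * w i ^ 4"
        using nz_moment[of "a i" 8] by (simp add: an_eq nrm_sq w_def)
    qed (simp add: w0)
    also have "\<dots> \<le> Kmom 8" using Kmom_nonneg by simp
    finally show "E (\<lambda>\<sigma>. X \<sigma> i ^ 4) \<le> Kmom 8" .
  qed (use fr in auto)
  also have "\<dots> = Kmom 8 * fr ^ 4" by (simp add: fr_w[symmetric] eval_nat_numeral flip: sum_distrib_right)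
  finally show ?thesis .
qed

lemma Ym_A_moment:
  assumes n3: "3 \<le> n" and D: "3 * ln n / rate * D \<le> 1"
  shows "E (\<lambda>\<sigma>. (Ym \<sigma> * A \<sigma>)\<^sup>2) \<le> sqrt (Ymom 4 * Kmom 8) * (rr * fr)\<^sup>2"
proof -
  have "E (\<lambda>\<sigma>. (Ym \<sigma> * A \<sigma>)\<^sup>2) = E (\<lambda>\<sigma>. (Ym \<sigma>)\<^sup>2 * (A \<sigma>)\<^sup>2)" by (simp add: power_mult_distrib)
  also have "\<dots> \<le> sqrt (E (\<lambda>\<sigma>. Ym \<sigma> ^ 4) * E (\<lambda>\<sigma>. A \<sigma> ^ 4))"
    using E_Cauchy_Schwarz_sqrt[of "\<lambda>\<sigma>. (Ym \<sigma>)\<^sup>2" "\<lambda>\<sigma>. (A \<sigma>)\<^sup>2"]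
    by (simp add: real_sqrt_mult flip: power_mult)
  also have "\<dots> \<le> sqrt ((Ymom 4 * rr ^ 4) * (Kmom 8 * fr ^ 4))"
    by (intro real_sqrt_le_mono mult_mono Ym_moment n3 D A_moment mult_nonneg_nonneg Ymom_nonneg E_nonneg) auto
  also have "\<dots> = sqrt (Ymom 4 * Kmom 8) * sqrt ((rr * fr) ^ 4)"
    by (simp add: power_mult_distrib mult_ac flip: real_sqrt_mult)
  also have "sqrt ((rr * fr) ^ 4) = (rr * fr)\<^sup>2"
  proof -
    have "(rr * fr) ^ 4 = ((rr * fr)\<^sup>2)\<^sup>2" by (simp flip: power_mult)
    then show ?thesis by (metis real_sqrt_abs abs_power2)
  qed
  finally show ?thesis .
qed

definition \<kappa>0 :: "real \<Rightarrow> real" where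
  "\<kappa>0 K = K + K\<^sup>2 + Ymom 6 * K ^ 6 + sqrt (Ymom 4 * Kmom 8) * K\<^sup>2"

definition tbound :: "real \<Rightarrow> real" where
  "tbound K = closing_bound (Bbound (\<kappa>0 K)) + 1"

text \<open>\<open>e\<close> and \<open>r\<close> stand for \<open>\<epsilon>_N\<close> and the row
  irregularity, \<open>K\<close> for the bound in the hypothesis. Since
  \<open>e \<ge> ln n \<ge> 1\<close>, the bound on \<open>e * rr\<close> also bounds
  \<open>rr\<close>; likewise \<open>(ln n)\<^sup>2 \<ge> 1\<close> makes \<open>r\<close> at most
  of order \<open>q\<^sup>2\<close>.\<close>

lemma moment_bounds:
  assumes n3: "3 \<le> n" and D: "3 * ln n / rate * D \<le> 1" and q: "0 < q" "q ^ 4 = real n" and K: "1 \<le> K"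
    and e: "fr \<le> e" "ln n \<le> e" "e \<le> K * q\<^sup>2" "e * rr \<le> K * q"
    and r: "ip n d d \<le> r" "sd\<^sup>2 \<le> r * q\<^sup>2" "(ln n)\<^sup>2 * sqrt r \<le> K * q"
  shows "q ^ 6 * E (\<lambda>\<sigma>. sb \<sigma> ^ 6) \<le> tbound K"
    and "q\<^sup>2 * \<tau> \<le> tbound K"
    and "E (\<lambda>\<sigma>. (u \<sigma>)\<^sup>2) \<le> r * (Ubound (\<kappa>0 K) * (1 + tbound K + (tbound K)\<^sup>2))"
proof -
  have L: "1 \<le> ln (real n)" by (rule ln_n_ge_1[OF n3])
  have rr: "0 \<le> rr" by (rule rr_nonneg[OF n3])
  have Y6: "0 \<le> Ymom 6 * K ^ 6" "0 \<le> sqrt (Ymom 4 * Kmom 8) * K\<^sup>2"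
    using Ymom_nonneg Kmom_nonneg K by simp_all
  have K2: "0 \<le> K\<^sup>2" by simp
  have \<kappa>: "K \<le> \<kappa>0 K" "K\<^sup>2 \<le> \<kappa>0 K" "Ymom 6 * K ^ 6 \<le> \<kappa>0 K" "sqrt (Ymom 4 * Kmom 8) * K\<^sup>2 \<le> \<kappa>0 K"
    using Y6 K K2 unfolding \<kappa>0_def by linarith+
  have \<kappa>1: "1 \<le> \<kappa>0 K" using \<kappa> K by linarith
  have r0: "0 \<le> r" using r(1) ip_nonneg[of n d] by linarith
  have "1 * sqrt r \<le> (ln n)\<^sup>2 * sqrt r" using L r0 by (intro mult_right_mono) (auto simp: one_le_power)
  then have "sqrt r \<le> K * q" using r by linarith
  then have "(sqrt r)\<^sup>2 \<le> (K * q)\<^sup>2" using r0 by (intro power_mono) auto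
  then have "r \<le> K\<^sup>2 * q\<^sup>2" using r0 by (simp add: power_mult_distrib)
  also have "\<dots> \<le> \<kappa>0 K * q\<^sup>2" by (intro mult_right_mono \<kappa>) auto
  finally have rq: "r \<le> \<kappa>0 K * q\<^sup>2" .
  have "e \<le> \<kappa>0 K * q\<^sup>2" using e(3) mult_right_mono[OF \<kappa>(1), of "q\<^sup>2"] by simp
  then have frq: "fr \<le> \<kappa>0 K * q\<^sup>2" using e by linarith
  have "1 * rr \<le> e * rr" using e L rr by (intro mult_right_mono) auto
  then have rrq: "rr \<le> K * q" using e by linarith
  have Y: "E (\<lambda>\<sigma>. Ym \<sigma> ^ 6) \<le> \<kappa>0 K * q ^ 6"
  proof -
    have "E (\<lambda>\<sigma>. Ym \<sigma> ^ 6) \<le> Ymom 6 * rr ^ 6" by (rule Ym_moment[OF n3 D])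
    also have "\<dots> \<le> Ymom 6 * (K * q) ^ 6" by (intro mult_left_mono power_mono rrq rr Ymom_nonneg)
    also have "\<dots> = Ymom 6 * K ^ 6 * q ^ 6" by (simp add: power_mult_distrib)
    also have "\<dots> \<le> \<kappa>0 K * q ^ 6" using q by (intro mult_right_mono \<kappa>) auto
    finally show ?thesis .
  qed
  have YA: "E (\<lambda>\<sigma>. (Ym \<sigma> * A \<sigma>)\<^sup>2) \<le> \<kappa>0 K * q\<^sup>2"
  proof -
    have "rr * fr \<le> e * rr" using e(1) rr by (subst mult.commute) (rule mult_right_mono)
    then have "rr * fr \<le> K * q" using e by linarith
    then have "(rr * fr)\<^sup>2 \<le> (K * q)\<^sup>2" using rr fr_nonneg by (intro power_mono) auto
    have "E (\<lambda>\<sigma>. (Ym \<sigma> * A \<sigma>)\<^sup>2) \<le> sqrt (Ymom 4 * Kmom 8) * (rr * fr)\<^sup>2" by (rule Ym_A_moment[OF n3 D])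
    also have "\<dots> \<le> sqrt (Ymom 4 * Kmom 8) * (K * q)\<^sup>2"
      using \<open>(rr * fr)\<^sup>2 \<le> (K * q)\<^sup>2\<close> Ymom_nonneg Kmom_nonneg by (intro mult_left_mono) auto
    also have "\<dots> = sqrt (Ymom 4 * Kmom 8) * K\<^sup>2 * q\<^sup>2" by (simp add: power_mult_distrib)
    also have "\<dots> \<le> \<kappa>0 K * q\<^sup>2" by (intro mult_right_mono \<kappa>) auto
    finally show ?thesis .
  qed
  note S = sixth_moment_bound[OF q \<kappa>1 r0 rq r(1,2) frq Y YA]
  show "q ^ 6 * E (\<lambda>\<sigma>. sb \<sigma> ^ 6) \<le> tbound K" "q\<^sup>2 * \<tau> \<le> tbound K"
    using S by (simp_all add: tbound_def)
  have "1 + q\<^sup>2 * \<tau> + (q\<^sup>2 * \<tau>)\<^sup>2 \<le> 1 + tbound K + (tbound K)\<^sup>2"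
    using \<open>q\<^sup>2 * \<tau> \<le> tbound K\<close> \<tau>_nonneg by (intro add_mono power_mono) auto
  then have "r * (Ubound (\<kappa>0 K) * (1 + q\<^sup>2 * \<tau> + (q\<^sup>2 * \<tau>)\<^sup>2)) \<le> r * (Ubound (\<kappa>0 K) * (1 + tbound K + (tbound K)\<^sup>2))"
    using r0 Ubound_nonneg[OF \<kappa>1] by (intro mult_left_mono)
  then show "E (\<lambda>\<sigma>. (u \<sigma>)\<^sup>2) \<le> r * (Ubound (\<kappa>0 K) * (1 + tbound K + (tbound K)\<^sup>2))"
    using u_moment_bound[OF q \<kappa>1 r0 rq r(1,2) frq] by linarith
qed

end

subsection \<open>Large deviations\<close>

context ising_model
begin

definition pr :: "((nat \<Rightarrow> real) \<Rightarrow> bool) \<Rightarrow> real" where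
  "pr Q = E (\<lambda>\<sigma>. of_bool (Q \<sigma>))"

lemma pr_mono: "(\<And>\<sigma>. \<sigma> \<in> conf n \<Longrightarrow> Q \<sigma> \<Longrightarrow> R \<sigma>) \<Longrightarrow> pr Q \<le> pr R"
  unfolding pr_def by (intro E_mono) (auto simp: of_bool_def)

lemma pr_disj: "pr (\<lambda>\<sigma>. Q \<sigma> \<or> R \<sigma>) \<le> pr Q + pr R"
  unfolding pr_def E_add[symmetric] by (intro E_mono) (auto simp: of_bool_def)

lemma pr_Markov:
  assumes "\<And>\<sigma>. \<sigma> \<in> conf n \<Longrightarrow> 0 \<le> f \<sigma>" "\<And>\<sigma>. \<sigma> \<in> conf n \<Longrightarrow> Q \<sigma> \<Longrightarrow> 1 \<le> f \<sigma>"
  shows "pr Q \<le> E f"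
  unfolding pr_def by (intro E_mono) (use assms in \<open>auto simp: of_bool_def\<close>)

lemma pr_Chernoff:
  assumes v: "0 < v" and x: "0 \<le> x" and f: "\<And>\<theta>. 0 \<le> \<theta> \<Longrightarrow> E (\<lambda>\<sigma>. exp (\<theta> * f \<sigma>)) \<le> C * exp (\<theta>\<^sup>2 * v)"
  shows "pr (\<lambda>\<sigma>. x \<le> f \<sigma>) \<le> C * exp (- (x\<^sup>2 / (4 * v)))"
proof -
  define \<theta> where "\<theta> = x / (2 * v)"
  have \<theta>: "0 \<le> \<theta>" using x v by (simp add: \<theta>_def)
  have "pr (\<lambda>\<sigma>. x \<le> f \<sigma>) \<le> E (\<lambda>\<sigma>. exp (- (\<theta> * x)) * exp (\<theta> * f \<sigma>))"
  proof (rule pr_Markov)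
    fix \<sigma> assume "x \<le> f \<sigma>"
    then have "\<theta> * x \<le> \<theta> * f \<sigma>" using \<theta> by (rule mult_left_mono)
    then show "1 \<le> exp (- (\<theta> * x)) * exp (\<theta> * f \<sigma>)" by (simp flip: exp_add)
  qed simp
  also have "\<dots> = exp (- (\<theta> * x)) * E (\<lambda>\<sigma>. exp (\<theta> * f \<sigma>))" by (rule E_cmult)
  also have "\<dots> \<le> exp (- (\<theta> * x)) * (C * exp (\<theta>\<^sup>2 * v))" by (intro mult_left_mono f \<theta>) auto
  also have "\<dots> = C * exp (\<theta>\<^sup>2 * v - \<theta> * x)" by (simp add: exp_diff exp_minus field_simps)
  also have "\<theta>\<^sup>2 * v - \<theta> * x = - (x\<^sup>2 / (4 * v))"
    using v by (simp add: \<theta>_def power2_eq_square field_simps)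
  finally show ?thesis .
qed

end

context near_regular
begin

lemma om_tail: "0 \<le> x \<Longrightarrow> pr (\<lambda>\<sigma>. x \<le> om \<sigma>) \<le> 2 * n * exp (- (x\<^sup>2 / (20 * al)))"
  using pr_Chernoff[of "5 * al" x om "2 * real n"] om_exp al_pos by (simp add: mult_ac)

text \<open>Chosen so that \<open>(1 + 1 / rate) * (2 * s0) = tgap (1 / H)\<close>, which yields the
  contradiction in \<open>mb_small\<close>.\<close>

definition s0 :: real where "s0 = tgap (1 / H) / (2 * (1 + 1 / rate))"

lemma tgap_pos: "0 < x \<Longrightarrow> 0 < tgap x"
proof -
  assume x: "0 < x"
  have "0 < min x 1 ^ 3 / 40" using x by simp
  also have "\<dots> \<le> tgap (min x 1)" using tgap_perturb_nonneg[of "min x 1" 0] x by simp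
  also have "\<dots> \<le> tgap x" by (intro tgap_mono) simp
  finally show ?thesis .
qed

lemma s0_pos: "0 < s0"
  unfolding s0_def using H_pos rate_pos by (intro divide_pos_pos tgap_pos add_pos_pos mult_pos_pos) auto

text \<open>A macroscopic magnetization would violate the averaged fixed point equation, since the
  averages of \<open>m\<close> and of \<open>tanh m\<close> differ by about \<open>tgap\<close> of the magnetization.\<close>

lemma mb_small:
  assumes \<sigma>: "\<sigma> \<in> conf n" and D: "D \<le> s0" and om: "om \<sigma> < s0"
  shows "\<bar>mb \<sigma>\<bar> \<le> 1 / H"
proof (rule ccontr)
  assume "\<not> ?thesis"
  then have mb: "1 / H < \<bar>mb \<sigma>\<bar>" by simp
  have "tgap (1 / H) \<le> tgap \<bar>mb \<sigma>\<bar>" using tgap_mono[of "1 / H" "\<bar>mb \<sigma>\<bar>"] mb by simp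
  also have "\<dots> \<le> \<bar>tgap (mb \<sigma>)\<bar>" by (simp add: abs_if tgap_minus)
  also have "\<dots> \<le> \<bar>avg n (\<lambda>i. tgap (m \<sigma> i))\<bar> + \<bar>avg n (\<lambda>i. tgap (m \<sigma> i) - tgap (mb \<sigma>))\<bar>"
    by (simp add: avg_diff avg_const[OF n0])
  also have "\<bar>avg n (\<lambda>i. tgap (m \<sigma> i))\<bar> \<le> D + om \<sigma>"
  proof -
    have "avg n (\<lambda>i. tgap (m \<sigma> i)) = avg n (\<lambda>i. d i * tanh (m \<sigma> i) + an \<sigma> i)"
      using sum_tgap[of \<sigma>] by (simp add: avg_def sum.distrib)
    moreover have "\<bar>d i * tanh (m \<sigma> i) + an \<sigma> i\<bar> \<le> D + om \<sigma>" if "i < n" for i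
    proof -
      have "\<bar>d i\<bar> * \<bar>tanh (m \<sigma> i)\<bar> \<le> D * 1"
        using d_le[OF that] D0 tanh_real_bounds[of "m \<sigma> i"] by (intro mult_mono) (auto simp: abs_le_iff)
      then have "\<bar>d i * tanh (m \<sigma> i)\<bar> \<le> D" by (simp add: abs_mult)
      then show ?thesis using om_upper[OF that, of \<sigma>] by linarith
    qed
    ultimately show ?thesis using avg_abs_le[of n _ "D + om \<sigma>"] n0 by simp
  qed
  also have "\<bar>avg n (\<lambda>i. tgap (m \<sigma> i) - tgap (mb \<sigma>))\<bar> \<le> (om \<sigma> + 2 * D) / (2 * rate)"
  proof -
    define g where "g = (\<lambda>i. tgap (m \<sigma> i) - tgap (mb \<sigma>))"
    \<comment> \<open>The average goes through the Euclidean norm of \<open>y\<close>: the supremum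
      bound would bring in a logarithm, and \<open>s0\<close> would have to depend on
      \<open>n\<close>.\<close>
    have "nrm n g \<le> nrm n (y \<sigma>)"
      unfolding nrm_def ip_def
    proof (intro real_sqrt_le_mono sum_mono)
      fix i
      have "\<bar>g i\<bar> \<le> \<bar>y \<sigma> i\<bar>" using tgap_Lipschitz[of "m \<sigma> i" "mb \<sigma>"] by (simp add: g_def m_eq_y)
      then have "\<bar>g i\<bar> * \<bar>g i\<bar> \<le> \<bar>y \<sigma> i\<bar> * \<bar>y \<sigma> i\<bar>" by (intro mult_mono) auto
      then show "g i * g i \<le> y \<sigma> i * y \<sigma> i" by simp
    qed
    moreover have "sqrt n * \<bar>avg n g\<bar> \<le> nrm n g"
      using real_sqrt_le_mono[OF avg_sq_le[OF n0, of g]] by (simp add: nrm_def real_sqrt_mult)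
    moreover have "2 * rate * nrm n (y \<sigma>) \<le> sqrt n * (om \<sigma> + 2 * D)"
    proof -
      have "nrm n (an \<sigma>) \<le> sqrt n * om \<sigma>" by (intro nrm_le_sup om_upper om_nonneg)
      moreover have nd: "nrm n d \<le> sqrt n * D" by (intro nrm_le_sup d_le D0)
      moreover have "\<bar>mb \<sigma>\<bar> * nrm n d \<le> 2 * (sqrt n * D)"
        using mb_bound[OF \<sigma>] D1 by (intro mult_mono nd nrm_nonneg) auto
      ultimately show ?thesis using y_nrm[of \<sigma>] by (simp add: distrib_left)
    qed
    ultimately have "2 * rate * (sqrt n * \<bar>avg n g\<bar>) \<le> sqrt n * (om \<sigma> + 2 * D)"
      using rate_pos by (meson mult_left_mono order_trans less_imp_le mult_pos_pos zero_less_numeral)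
    then have "sqrt n * (2 * rate * \<bar>avg n g\<bar>) \<le> sqrt n * (om \<sigma> + 2 * D)" by (simp only: mult_ac)
    then have "2 * rate * \<bar>avg n g\<bar> \<le> om \<sigma> + 2 * D" using n0 by simp
    then show ?thesis using rate_pos by (simp add: g_def field_simps)
  qed
  also have "D + om \<sigma> + (om \<sigma> + 2 * D) / (2 * rate) \<le> (1 + 1 / rate) * (D + om \<sigma>)"
    using om_nonneg[of \<sigma>] rate_pos by (simp add: field_simps)
  also have "\<dots> < (1 + 1 / rate) * (2 * s0)"
    using D om rate_pos by (intro mult_strict_left_mono) (auto intro: add_pos_pos)
  also have "\<dots> = tgap (1 / H)"
  proof -
    have "0 < 1 + 1 / rate" using rate_pos by (intro add_pos_pos) auto
    moreover have "x * (2 * (g / (2 * x))) = g" if "0 < x" for x g :: real using that by simp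
    ultimately show ?thesis unfolding s0_def by blast
  qed
  finally show False by simp
qed

text \<open>The first entry belongs to noise of size \<open>t * sqrt (al * ln n) / H\<close>, the
  second to noise of size \<open>s0\<close>; there
  \<open>al \<le> 9 / (t\<^sup>2 * ln n ^ 3)\<close> may be assumed, and
  \<open>180 = 20 * 9\<close>.\<close>

definition c0 :: real where "c0 = min (1 / (20 * H\<^sup>2)) (s0\<^sup>2 / 180)"

lemma c0_pos: "0 < c0" using H_pos s0_pos by (simp add: c0_def)

text \<open>Since \<open>Ym\<close> is at most 3, only \<open>t\<close> with
  \<open>t\<^sup>2 * ln n ^ 3 \<le> 9 / al\<close> matter, and for these noise above
  \<open>s0\<close> is unlikely enough. Below \<open>s0\<close> the mean field is at most
  \<open>1 / H\<close>, the row term of \<open>Ym_log\<close> stays under \<open>ln n * D\<close>,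
  and the noise has to produce the rest.\<close>

lemma large_deviation:
  assumes n3: "3 \<le> n" and D: "3 * ln n / rate * D \<le> 1" "D \<le> s0" and t: "0 \<le> t" "6 / c0 \<le> t\<^sup>2"
  shows "pr (\<lambda>\<sigma>. t * sqrt (al * ln n ^ 3) + ln n * D \<le> Ym \<sigma>) \<le> exp (- (c0 / 2 * t\<^sup>2))"
proof -
  define L where "L = ln (real n)"
  have L: "1 \<le> L" unfolding L_def by (rule ln_n_ge_1[OF n3])
  let ?Q = "\<lambda>\<sigma>. t * sqrt (al * ln n ^ 3) + ln n * D \<le> Ym \<sigma>"
  have sq: "sqrt (al * L ^ 3) = L * sqrt (al * L)"
    using L by (simp add: power3_eq_cube real_sqrt_mult mult_ac)
  define x where "x = t * sqrt (al * L) / H"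
  have x0: "0 \<le> x" using t H_pos L al_pos by (simp add: x_def)
  have bound: "pr ?Q \<le> 4 * n * exp (- (c0 * t\<^sup>2 * L))"
  proof (cases "t * sqrt (al * L ^ 3) \<le> 3")
    case False
    have LD: "0 \<le> L * D" using L D0 by simp
    have "pr ?Q \<le> pr (\<lambda>_. False)"
    proof (rule pr_mono)
      fix \<sigma> assume \<sigma>: "\<sigma> \<in> conf n" and "?Q \<sigma>"
      then show False using Ym_le_3[OF \<sigma>] False LD by (simp add: L_def)
    qed
    also have "\<dots> = 0" by (simp add: pr_def)
    finally show ?thesis by (rule order_trans) simp
  next
    case True
    have "pr ?Q \<le> pr (\<lambda>\<sigma>. x \<le> om \<sigma> \<or> s0 \<le> om \<sigma>)"
    proof (rule pr_mono)
      fix \<sigma> assume \<sigma>: "\<sigma> \<in> conf n" and Q: "?Q \<sigma>"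
      show "x \<le> om \<sigma> \<or> s0 \<le> om \<sigma>"
      proof (cases "om \<sigma> < s0")
        case True
        then have "H * \<bar>mb \<sigma>\<bar> \<le> 1" using mb_small[OF \<sigma> D(2)] H_pos by (simp add: field_simps)
        then have "(H * \<bar>mb \<sigma>\<bar>) * (L * D) \<le> 1 * (L * D)" using L D0 by (intro mult_right_mono) auto
        moreover have "Ym \<sigma> \<le> H * L * om \<sigma> + (H * \<bar>mb \<sigma>\<bar>) * (L * D)"
          using Ym_log[OF n3 D(1), of \<sigma>] by (simp add: L_def algebra_simps)
        ultimately have "t * (L * sqrt (al * L)) \<le> H * L * om \<sigma>"
          using Q by (simp add: sq flip: L_def)
        then have "L * (t * sqrt (al * L)) \<le> L * (H * om \<sigma>)" by (simp only: mult_ac)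
        then have "t * sqrt (al * L) \<le> H * om \<sigma>" using L by simp
        then show ?thesis using H_pos by (simp add: x_def field_simps)
      qed simp
    qed
    also have "\<dots> \<le> pr (\<lambda>\<sigma>. x \<le> om \<sigma>) + pr (\<lambda>\<sigma>. s0 \<le> om \<sigma>)" by (rule pr_disj)
    also have "\<dots> \<le> 2 * n * exp (- (x\<^sup>2 / (20 * al))) + 2 * n * exp (- (s0\<^sup>2 / (20 * al)))"
      using x0 s0_pos by (intro add_mono om_tail) auto
    also have "\<dots> \<le> 2 * n * exp (- (c0 * t\<^sup>2 * L)) + 2 * n * exp (- (c0 * t\<^sup>2 * L))"
    proof -
      have "x\<^sup>2 / (20 * al) = 1 / (20 * H\<^sup>2) * (t\<^sup>2 * L)"
        using L al_pos by (simp add: x_def power_divide power_mult_distrib)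
      also have "\<dots> \<ge> c0 * (t\<^sup>2 * L)" using L by (intro mult_right_mono) (auto simp: c0_def)
      finally have 1: "c0 * t\<^sup>2 * L \<le> x\<^sup>2 / (20 * al)" by (simp add: mult.assoc)
      have "(t * sqrt (al * L ^ 3))\<^sup>2 \<le> 3\<^sup>2" using True t L al_pos by (intro power_mono) auto
      then have "t\<^sup>2 * L ^ 3 * al \<le> 9" using L al_pos by (simp add: power_mult_distrib mult_ac)
      then have le: "t\<^sup>2 * L ^ 3 \<le> 9 / al" using al_pos by (simp add: field_simps)
      have "c0 * t\<^sup>2 * L \<le> s0\<^sup>2 / 180 * (t\<^sup>2 * L ^ 3)"
      proof -
        have "c0 * (t\<^sup>2 * L) \<le> s0\<^sup>2 / 180 * (t\<^sup>2 * L ^ 3)"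
          using L power_increasing[of 1 3 L] c0_pos by (intro mult_mono) (auto simp: c0_def)
        then show ?thesis by (simp add: mult.assoc)
      qed
      also have "\<dots> \<le> s0\<^sup>2 / 180 * (9 / al)" by (intro mult_left_mono le) auto
      also have "\<dots> = s0\<^sup>2 / (20 * al)" by simp
      finally have 2: "c0 * t\<^sup>2 * L \<le> s0\<^sup>2 / (20 * al)" .
      show ?thesis using 1 2 by (intro add_mono mult_left_mono) auto
    qed
    finally show ?thesis by simp
  qed
  also have "4 * n * exp (- (c0 * t\<^sup>2 * L)) \<le> exp (- (c0 / 2 * t\<^sup>2))"
  proof -
    have "(4 :: real) \<le> exp 2"
    proof -
      have "(2 :: real) * 2 \<le> exp 1 * exp 1" using exp_ge_add_one_self[of 1] by (intro mult_mono) auto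
      then show ?thesis by (simp flip: exp_add)
    qed
    then have "4 * n * exp (- (c0 * t\<^sup>2 * L)) \<le> exp 2 * exp L * exp (- (c0 * t\<^sup>2 * L))"
      using n0 by (intro mult_right_mono mult_mono) (auto simp: L_def)
    also have "\<dots> = exp (2 + L - c0 * t\<^sup>2 * L)" by (simp add: exp_add exp_diff exp_minus field_simps)
    \<comment> \<open>As \<open>c0 * t\<^sup>2 \<ge> 6\<close>, at most half of the exponent is
      spent on the factor \<open>4 * n\<close>.\<close>
    also have "\<dots> \<le> exp (- (c0 / 2 * t\<^sup>2))"
    proof -
      have "6 \<le> c0 * t\<^sup>2" using t(2) c0_pos by (simp add: field_simps)
      then have "(c0 * t\<^sup>2 - 3) * 1 \<le> (c0 * t\<^sup>2 - 3) * L" using L by (intro mult_left_mono) auto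
      then have "2 + L - c0 * t\<^sup>2 * L \<le> 3 - c0 * t\<^sup>2" using L by (simp add: left_diff_distrib)
      then show ?thesis using \<open>6 \<le> c0 * t\<^sup>2\<close> by simp
    qed
    finally show ?thesis .
  qed
  finally show ?thesis .
qed

subsection \<open>The linearized fixed point equation\<close>

lemma resolvent_nrm:
  assumes h: "(\<Sum>i<n. h i) = 0" "\<And>i. i < n \<Longrightarrow> h i - ctr n (m h) i = v i"
  shows "\<delta> * nrm n h \<le> nrm n v"
proof -
  have "\<delta> * ip n h h \<le> ip n h h - ip n h (m h)"
    using gap[of h] h(1) by (simp add: ip_one algebra_simps)
  also have "\<dots> = ip n h (\<lambda>i. h i - ctr n (m h) i)"
    by (simp add: ip_diff_right ctr_def ip_const h(1))
  also have "\<dots> = ip n h v" using h(2) by (intro ip_cong) auto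
  also have "\<dots> \<le> nrm n h * nrm n v" using Cauchy_Schwarz_ip[of n h v] by simp
  finally have "nrm n h * (\<delta> * nrm n h) \<le> nrm n h * nrm n v"
    by (simp add: power2_eq_square mult_ac flip: nrm_sq)
  then show ?thesis using nrm_nonneg[of n h] nrm_nonneg[of n v] by (cases "nrm n h = 0") auto
qed

text \<open>Centring and \<open>m\<close> are symmetric for \<open>ip\<close>, hence so is the
  solution operator on centred vectors.\<close>

lemma resolvent_sym:
  assumes h: "(\<Sum>i<n. h i) = 0" "\<And>i. i < n \<Longrightarrow> h i - ctr n (m h) i = v i"
    and w: "(\<Sum>i<n. w i) = 0" "\<And>i. i < n \<Longrightarrow> w i - ctr n (m w) i = z i"
  shows "ip n w v = ip n z h"
proof -
  have "ip n w v = ip n w (\<lambda>i. h i - ctr n (m h) i)" using h(2) by (intro ip_cong) auto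
  also have "\<dots> = ip n w h - ip n w (m h)" by (simp add: ip_diff_right ctr_def ip_const w(1))
  also have "\<dots> = ip n w h - ip n (m w) h" by (simp add: ip_m_sym)
  also have "\<dots> = ip n (\<lambda>i. w i - ctr n (m w) i) h" by (simp add: ip_diff_left ctr_def ip_const h(1))
  also have "\<dots> = ip n z h" using w(2) by (intro ip_cong) auto
  finally show ?thesis .
qed

lemma ip_delta: "i < n \<Longrightarrow> ip n (\<lambda>j. of_bool (j = i)) x = x i"
proof -
  assume "i < n"
  then have "(\<Sum>j<n. of_bool (j = i) * x j) = (\<Sum>j<n. if j = i then x j else 0)"
    by (intro sum.cong) auto
  then show ?thesis using \<open>i < n\<close> by (simp add: ip_def sum.delta)
qed

text \<open>\<open>sup_bound\<close> with the identity for \<open>\<phi>\<close>: for centred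
  \<open>h\<close> the defect under \<open>Psi\<close> is half of \<open>v\<close> minus the average
  of \<open>m h\<close>. That average is at most \<open>D\<close> times the largest entry of
  \<open>h\<close> and is absorbed because \<open>H * ln n * D \<le> 1 / 2\<close>.\<close>

lemma resolvent_sup:
  assumes n3: "3 \<le> n" and D: "H * ln n * D \<le> 1 / 2"
    and h: "(\<Sum>i<n. h i) = 0" "\<And>i. i < n \<Longrightarrow> h i - ctr n (m h) i = v i"
    and v: "\<And>i. i < n \<Longrightarrow> \<bar>v i\<bar> \<le> V" and i: "i < n"
  shows "\<bar>h i\<bar> \<le> 2 * H * ln n * V"
proof -
  have L: "1 \<le> ln (real n)" by (rule ln_n_ge_1[OF n3])
  have V: "0 \<le> V" using v[OF i] by linarith
  define X where "X = (MAX i\<in>{..<n}. \<bar>h i\<bar>)"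
  have hX: "\<bar>h j\<bar> \<le> X" if "j < n" for j unfolding X_def using Max_upper[OF that, of "\<lambda>i. \<bar>h i\<bar>"] .
  obtain i0 where i0: "i0 < n" "X = \<bar>h i0\<bar>" unfolding X_def using Max_attained[of "\<lambda>i. \<bar>h i\<bar>"] by auto
  have avgh: "avg n h = 0" by (simp add: avg_def h(1))
  have mean: "\<bar>avg n (m h)\<bar> \<le> D * X"
  proof -
    have "avg n (m h) = avg n (\<lambda>i. d i * h i)"
      using sum_m[of h] h(1) by (simp add: avg_def ip_def)
    also have "\<bar>\<dots>\<bar> \<le> D * X"
      by (rule avg_abs_le[OF _ n0]) (use d_le hX D0 in \<open>auto simp: abs_mult intro!: mult_mono\<close>)
    finally show ?thesis .
  qed
  have "3 * ln n / rate * D \<le> 1" using D L D0 rate_pos by (simp add: H_def field_simps)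
  from sup_steps[OF n3 this] obtain k where k: "real k \<le> 3 * ln n / rate" and kk: "real k * D \<le> 1" "(1 - rate) ^ k * sqrt n \<le> 1 / 2" .
  have "\<bar>ctr n h i0\<bar> \<le> 12 * real k * ((V + D * X) / 2)"
  proof (rule sup_bound[of "\<lambda>x. x", OF _ _ kk i0(1)])
    fix j assume j: "j < n"
    have e: "h j - Psi (\<lambda>x. x) h j = (v j - avg n (m h)) / 2"
      using h(2)[OF j] by (simp add: Psi_def avgh ctr_def field_simps)
    have "\<bar>v j - avg n (m h)\<bar> \<le> V + D * X" using v[OF j] mean by linarith
    then show "\<bar>h j - Psi (\<lambda>x. x) h j\<bar> \<le> (V + D * X) / 2" unfolding e by simp
  qed auto
  then have "X \<le> 6 * real k * (V + D * X)" by (simp add: ctr_def avgh i0)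
  also have "\<dots> \<le> H * ln n * (V + D * X)"
    using k V D0 i0 by (intro mult_right_mono add_nonneg_nonneg mult_nonneg_nonneg) (auto simp: H_def)
  also have "\<dots> = H * ln n * V + (H * ln n * D) * X" by (simp add: algebra_simps)
  also have "\<dots> \<le> H * ln n * V + 1 / 2 * X" using D i0 by (intro add_left_mono mult_right_mono) auto
  finally have "X \<le> 2 * H * ln n * V" by simp
  then show ?thesis using hX[OF i] by linarith
qed

text \<open>A discrete Green function, namely row \<open>i\<close> of the resolvent on centred
  vectors. The choice is legitimate by \<open>resolvent_exists\<close>.\<close>

definition rsv :: "nat \<Rightarrow> nat \<Rightarrow> real" where
  "rsv i = (SOME w. (\<Sum>j<n. w j) = 0 \<and> (\<forall>j<n. w j - ctr n (m w) j = ctr n (\<lambda>j. of_bool (j = i)) j))"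

lemma rsv: "(\<Sum>j<n. rsv i j) = 0" "j < n \<Longrightarrow> rsv i j - ctr n (m (rsv i)) j = ctr n (\<lambda>j. of_bool (j = i)) j"
proof -
  have "\<exists>w. (\<Sum>j<n. w j) = 0 \<and> (\<forall>j<n. w j - ctr n (m w) j = ctr n (\<lambda>j. of_bool (j = i)) j)"
    using resolvent_exists[OF sum_ctr[OF n0]] by metis
  from someI_ex[OF this] show "(\<Sum>j<n. rsv i j) = 0" "j < n \<Longrightarrow> rsv i j - ctr n (m (rsv i)) j = ctr n (\<lambda>j. of_bool (j = i)) j"
    unfolding rsv_def by blast+
qed

lemma rsv_ip:
  assumes h: "(\<Sum>i<n. h i) = 0" "\<And>i. i < n \<Longrightarrow> h i - ctr n (m h) i = v i" and i: "i < n"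
  shows "ip n (rsv i) v = h i"
proof -
  have "ip n (rsv i) v = ip n (ctr n (\<lambda>j. of_bool (j = i))) h"
    by (rule resolvent_sym[OF h rsv]) 
  also have "\<dots> = h i"
    by (simp add: ctr_def ip_diff_left ip_const h(1) ip_delta i)
  finally show ?thesis .
qed

text \<open>By symmetry, pairing the row with \<open>g\<close> evaluates at \<open>i\<close> the
  solution with right-hand side \<open>g\<close> centred, so \<open>resolvent_sup\<close> applies;
  centring costs a factor 2.\<close>

lemma rsv_bound:
  assumes n3: "3 \<le> n" and D: "H * ln n * D \<le> 1 / 2" and i: "i < n" and g: "\<And>j. j < n \<Longrightarrow> \<bar>g j\<bar> \<le> G"
  shows "\<bar>ip n (rsv i) g\<bar> \<le> 4 * H * ln n * G"
proof -
  obtain h where h: "(\<Sum>i<n. h i) = 0" "\<And>i. i < n \<Longrightarrow> h i - ctr n (m h) i = ctr n g i"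
    using resolvent_exists[OF sum_ctr[OF n0]] by metis
  have "ip n (rsv i) g = ip n (rsv i) (ctr n g)"
    by (simp add: ctr_def ip_diff_right ip_const rsv)
  also have "\<dots> = h i" by (rule rsv_ip[OF h i])
  also have "\<bar>h i\<bar> \<le> 2 * H * ln n * (2 * G)"
  proof (rule resolvent_sup[OF n3 D h _ i])
    fix j assume "j < n"
    then show "\<bar>ctr n g j\<bar> \<le> 2 * G"
      using g[of j] avg_abs_le[OF g n0, of "\<lambda>j. j"] unfolding ctr_def by linarith
  qed
  finally show ?thesis by simp
qed

definition mr :: "nat \<Rightarrow> nat \<Rightarrow> real" where "mr i = m (rsv i)"

text \<open>This vector carries the noise in the linearized equation, and the point is a bound free
  of logarithms. Its centred part solves a resolvent equation whose right-hand side is row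
  \<open>i\<close> of \<open>a\<close> up to an error of order \<open>1 / sqrt n\<close>, so the
  Euclidean bound \<open>1 / \<delta>\<close> suffices. Only the mean goes through a supremum bound,
  where \<open>H * ln n * D \<le> 1 / 2\<close> removes the logarithm.\<close>

lemma nrm_mr:
  assumes n3: "3 \<le> n" and D: "H * ln n * D \<le> 1 / 2" and i: "i < n"
  shows "ip n (mr i) (mr i) \<le> 81 / \<delta>\<^sup>2 * al"
proof -
  define s where "s = sqrt al"
  have s: "0 \<le> s" using al_nonneg by (simp add: s_def)
  have ns: "1 / sqrt n \<le> 3 / 2 * s"
  proof (rule power2_le_imp_le)
    have "1 / real n \<le> 2 * al" using al_lower n0 by (simp add: field_simps)
    then show "(1 / sqrt n)\<^sup>2 \<le> (3 / 2 * s)\<^sup>2"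
      using al_nonneg by (simp add: power_divide power_mult_distrib s_def)
  qed (use s in simp)
  let ?e = "\<lambda>j. of_bool (j = i)"
  \<comment> \<open>This is \<open>rsv i\<close> minus the centred unit vector, whose norm of order
    one would spoil a bound by \<open>al\<close>.\<close>
  define x where "x = ctr n (mr i)"
  have x_eq: "x j = rsv i j - ctr n ?e j" if "j < n" for j
    using rsv(2)[OF that, of i] by (simp add: x_def mr_def)
  have nx: "\<delta> * nrm n x \<le> 4 * s"
  proof -
    have "\<delta> * nrm n x \<le> nrm n (ctr n (m (ctr n ?e)))"
    proof (rule resolvent_nrm)
      show "(\<Sum>i<n. x i) = 0" by (simp add: x_def sum_ctr n0)
      fix j assume j: "j < n"
      have "ctr n (m x) j = ctr n (m (\<lambda>j. rsv i j - ctr n ?e j)) j"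
        unfolding ctr_def[of n "m _"] using x_eq by (intro arg_cong2[of _ _ _ _ "(-)"] mv_cong avg_cong) auto
      also have "\<dots> = x j - ctr n (m (ctr n ?e)) j"
        by (simp add: mv_diff ctr_diff x_def mr_def)
      finally show "x j - ctr n (m x) j = ctr n (m (ctr n ?e)) j" by simp
    qed
    also have "\<dots> \<le> nrm n (m (ctr n ?e))" by (rule nrm_ctr_le[OF n0])
    also have "\<dots> = nrm n (\<lambda>j. a i j - (1 / real n) * (1 + d j))"
    proof (rule nrm_cong)
      fix j assume j: "j < n"
      have 1: "avg n ?e = 1 / n" using ip_delta[OF i, of "\<lambda>_. 1"] by (simp add: avg_def ip_def)
      have "m ?e j = ip n ?e (a j)" by (simp add: mv_def ip_def mult.commute)
      also have "\<dots> = a i j" using sym[OF i j] by (simp add: ip_delta[OF i])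
      finally have 2: "m ?e j = a i j" .
      show "m (ctr n ?e) j = a i j - (1 / real n) * (1 + d j)"
        unfolding ctr_def by (simp only: mv_diff 1 2 m_const)
    qed
    also have "\<dots> \<le> nrm n (a i) + nrm n (\<lambda>j. (1 / real n) * (1 + d j))" by (rule nrm_triangle_diff)
    also have "\<dots> \<le> s + 5 / 2 * s"
    proof (rule add_mono)
      show "nrm n (a i) \<le> s" unfolding s_def nrm_def by (intro real_sqrt_le_mono al_upper i)
      have "nrm n (\<lambda>j. (1 / real n) * (1 + d j)) \<le> sqrt n * ((1 / real n) * (81 / 80))"
      proof (rule nrm_le_sup)
        fix j assume "j < n"
        from d_le[OF this] D1 have "\<bar>1 + d j\<bar> \<le> 81 / 80" by linarith
        then show "\<bar>1 / real n * (1 + d j)\<bar> \<le> (1 / real n) * (81 / 80)"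
          unfolding abs_mult by (intro mult_mono) auto
      qed simp
      also have "\<dots> = 81 / 80 * (1 / sqrt n)" using n0 by (simp add: field_simps)
      also have "\<dots> \<le> 5 / 2 * s" using ns s by linarith
      finally show "nrm n (\<lambda>j. (1 / real n) * (1 + d j)) \<le> 5 / 2 * s" .
    qed
    finally show ?thesis using s by linarith
  qed
  have mean: "real n * (avg n (mr i))\<^sup>2 \<le> (4 * s)\<^sup>2"
  proof -
    have "real n * avg n (mr i) = ip n (rsv i) d"
      using sum_m[of "rsv i"] rsv(1)[of i] n0 by (simp add: avg_def mr_def ip_commute)
    also have "\<bar>\<dots>\<bar> \<le> 4 * H * ln n * D" by (rule rsv_bound[OF n3 D i d_le])
    also have "4 * H * ln n * D = 4 * (H * ln n * D)" by simp
    also have "\<dots> \<le> 2" using D by linarith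
    finally have "real n * \<bar>avg n (mr i)\<bar> \<le> 2" by (simp add: abs_mult)
    then have "sqrt n * (sqrt n * \<bar>avg n (mr i)\<bar>) \<le> 2" by (simp flip: mult.assoc)
    then have "sqrt n * \<bar>avg n (mr i)\<bar> \<le> 2 * (1 / sqrt n)" using n0 by (simp add: field_simps)
    also have "\<dots> \<le> 4 * s" using ns s by linarith
    finally have "(sqrt n * \<bar>avg n (mr i)\<bar>)\<^sup>2 \<le> (4 * s)\<^sup>2" by (intro power_mono) auto
    then show ?thesis by (simp add: power_mult_distrib)
  qed
  have "ip n (mr i) (mr i) = (nrm n x)\<^sup>2 + real n * (avg n (mr i))\<^sup>2"
    using ip_split[OF n0, of "mr i" "mr i"] by (simp add: nrm_sq x_def power2_eq_square[of "avg n _"])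
  also have "(nrm n x)\<^sup>2 \<le> (4 * s / \<delta>)\<^sup>2"
    using nx \<delta>0 nrm_nonneg by (intro power_mono) (auto simp: field_simps)
  also have "(4 * s / \<delta>)\<^sup>2 = 16 * (al / \<delta>\<^sup>2)" using al_nonneg by (simp add: power_divide power_mult_distrib s_def)
  also have "real n * (avg n (mr i))\<^sup>2 \<le> 16 * (al / \<delta>\<^sup>2)"
  proof -
    have "\<delta>\<^sup>2 \<le> 1" using \<delta>0 \<delta>1 by (simp add: power_le_one)
    then have "al * \<delta>\<^sup>2 \<le> al * 1" using al_nonneg by (intro mult_left_mono)
    then have "al \<le> al / \<delta>\<^sup>2" using \<delta>0 by (simp add: field_simps)
    moreover have "(4 * s)\<^sup>2 = 16 * al" using al_nonneg by (simp add: power_mult_distrib s_def)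
    ultimately show ?thesis using mean by linarith
  qed
  also have "16 * (al / \<delta>\<^sup>2) + 16 * (al / \<delta>\<^sup>2) \<le> 81 / \<delta>\<^sup>2 * al" using al_nonneg by (simp add: divide_right_mono)
  finally show ?thesis by simp
qed

definition om' :: "(nat \<Rightarrow> real) \<Rightarrow> real" where "om' \<sigma> = (MAX i\<in>{..<n}. \<bar>ip n (mr i) (nz \<sigma>)\<bar>)"

lemma om'_tail:
  assumes "3 \<le> n" "H * ln n * D \<le> 1 / 2" "0 \<le> x"
  shows "pr (\<lambda>\<sigma>. x \<le> om' \<sigma>) \<le> 2 * n * exp (- (x\<^sup>2 * \<delta>\<^sup>2 / (1620 * al)))"
proof -
  have "pr (\<lambda>\<sigma>. x \<le> om' \<sigma>) \<le> 2 * n * exp (- (x\<^sup>2 / (4 * (5 * (81 / \<delta>\<^sup>2 * al)))))"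
  proof (rule pr_Chernoff[OF _ assms(3)])
    show "0 < 5 * (81 / \<delta>\<^sup>2 * al)" using \<delta>0 al_pos by simp
    fix \<theta> :: real assume "0 \<le> \<theta>"
    from max_nz_exp[OF this nrm_mr[OF assms(1,2)]]
    show "E (\<lambda>\<sigma>. exp (\<theta> * om' \<sigma>)) \<le> 2 * n * exp (\<theta>\<^sup>2 * (5 * (81 / \<delta>\<^sup>2 * al)))"
      unfolding om'_def by (simp add: mult_ac)
  qed
  then show ?thesis using \<delta>0 by (simp add: mult_ac)
qed

lemma tgap_diff_le:
  assumes "\<bar>x\<bar> \<le> b" "\<bar>x'\<bar> \<le> b"
  shows "\<bar>tgap x - tgap x'\<bar> \<le> b\<^sup>2 * \<bar>x - x'\<bar>"
proof -
  have *: "tgap x - tgap x' \<le> b\<^sup>2 * (x - x')" if "x' \<le> x" "\<bar>x\<bar> \<le> b" "\<bar>x'\<bar> \<le> b" for x x'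
  proof -
    have "tgap x - b\<^sup>2 * x \<le> tgap x' - b\<^sup>2 * x'"
    proof (rule DERIV_nonpos_imp_nonincreasing[OF that(1), where f = "\<lambda>x. tgap x - b\<^sup>2 * x"])
      fix s assume s: "x' \<le> s" "s \<le> x"
      have "\<bar>tanh s\<bar> \<le> b" using tanh_abs_le[of s] s that by linarith
      then have "(tanh s)\<^sup>2 \<le> b\<^sup>2" by (metis abs_ge_zero power2_abs power_mono)
      moreover have "((\<lambda>x. tgap x - b\<^sup>2 * x) has_real_derivative (tanh s)\<^sup>2 - b\<^sup>2) (at s)"
        by (auto intro!: derivative_eq_intros tgap_deriv)
      ultimately show "\<exists>y. ((\<lambda>x. tgap x - b\<^sup>2 * x) has_real_derivative y) (at s) \<and> y \<le> 0" by force
    qed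
    then show ?thesis by (simp add: right_diff_distrib)
  qed
  show ?thesis
    using *[of x' x] *[of x x'] tgap_mono[of x x'] tgap_mono[of x' x] assms by (cases "x' \<le> x") auto
qed

text \<open>Linearization of the fixed point equation around the constant vector \<open>mb\<close>: in contrast to
  \<open>Ym_log\<close>, the noise enters through single linear forms, so that no logarithm is lost.\<close>

lemma y_linear:
  assumes i: "i < n"
  shows "y \<sigma> i = tanh (mb \<sigma>) * ip n (rsv i) d + ip n (mr i) (nz \<sigma>)
    - ip n (rsv i) (m (\<lambda>j. tgap (m \<sigma> j) - tgap (mb \<sigma>)))"
proof -
  define g where "g = (\<lambda>j. tgap (m \<sigma> j) - tgap (mb \<sigma>))"
  define R where "R = (\<lambda>j. tanh (mb \<sigma>) * d j + an \<sigma> j - m g j)"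
  have R: "m \<sigma> j - m (y \<sigma>) j = R j + mb \<sigma> - tgap (mb \<sigma>)" for j
  proof -
    have my: "m (m \<sigma>) j = mb \<sigma> * (1 + d j) + m (y \<sigma>) j"
    proof -
      have "m (m \<sigma>) j = m (\<lambda>j. mb \<sigma> + y \<sigma> j) j" by (rule mv_cong) (rule m_eq_y)
      then show ?thesis by (simp add: mv_add m_const)
    qed
    have "m (\<lambda>j. tanh (m \<sigma> j)) j = m (\<lambda>j. m \<sigma> j - (tgap (mb \<sigma>) + g j)) j"
      by (rule mv_cong) (simp add: g_def tgap_def)
    also have "\<dots> = m (m \<sigma>) j - tgap (mb \<sigma>) * (1 + d j) - m g j"
      by (simp add: mv_diff mv_add m_const)
    finally have "m \<sigma> j = mb \<sigma> * (1 + d j) + m (y \<sigma>) j - tgap (mb \<sigma>) * (1 + d j) - m g j + an \<sigma> j"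
      using m_fixed_point[of \<sigma> j] my by simp
    moreover have t: "tanh (mb \<sigma>) = mb \<sigma> - tgap (mb \<sigma>)" by (simp add: tgap_def)
    ultimately show ?thesis by (simp add: R_def t algebra_simps)
  qed
  have Ry: "y \<sigma> j - ctr n (m (y \<sigma>)) j = ctr n R j" for j
  proof -
    have "y \<sigma> j - ctr n (m (y \<sigma>)) j = ctr n (\<lambda>j. m \<sigma> j - m (y \<sigma>) j) j" by (simp add: ctr_diff y_def)
    also have "\<dots> = ctr n (\<lambda>j. R j + (mb \<sigma> - tgap (mb \<sigma>))) j" by (simp add: R add_diff_eq)
    also have "\<dots> = ctr n R j" by (simp add: ctr_add ctr_const[OF n0])
    finally show ?thesis .
  qed
  have "y \<sigma> i = ip n (rsv i) (ctr n R)"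
    by (rule rsv_ip[symmetric, OF _ Ry i]) (simp add: sum_ctr n0 y_def)
  also have "\<dots> = ip n (rsv i) R" by (simp add: ctr_def ip_diff_right ip_const rsv)
  also have "\<dots> = tanh (mb \<sigma>) * ip n (rsv i) d + ip n (rsv i) (an \<sigma>) - ip n (rsv i) (m g)"
    by (simp add: R_def ip_diff_right ip_add_right ip_scale_right)
  also have "ip n (rsv i) (an \<sigma>) = ip n (mr i) (nz \<sigma>)" by (simp add: an_def mr_def ip_m_sym)
  finally show ?thesis by (simp add: g_def)
qed

text \<open>The derivative of \<open>tgap\<close> is the square of \<open>tanh\<close>, so the
  remainder is at most \<open>(\<bar>mb \<sigma>\<bar> + Ym \<sigma>)\<^sup>2 * Ym \<sigma>\<close>.
  After the logarithm of \<open>rsv_bound\<close>, \<open>mu\<close> makes it at most half of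
  \<open>Ym\<close>, which is absorbed; \<open>mb\<close> halves the row term.\<close>

lemma Ym_le_om':
  assumes n3: "3 \<le> n" and D: "H * ln n * D \<le> 1 / 2"
    and mu: "16 * H * ln n * (\<bar>mb \<sigma>\<bar> + Ym \<sigma>)\<^sup>2 \<le> 1" and mb: "8 * H * \<bar>mb \<sigma>\<bar> \<le> 1"
  shows "Ym \<sigma> \<le> 2 * om' \<sigma> + ln n * D"
proof -
  have L: "1 \<le> ln (real n)" by (rule ln_n_ge_1[OF n3])
  obtain i where i: "i < n" "Ym \<sigma> = \<bar>y \<sigma> i\<bar>"
    unfolding Ym_def using Max_attained[of "\<lambda>i. \<bar>y \<sigma> i\<bar>"] by auto
  define \<mu> where "\<mu> = \<bar>mb \<sigma>\<bar> + Ym \<sigma>"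
  define g where "g = (\<lambda>j. tgap (m \<sigma> j) - tgap (mb \<sigma>))"
  have g: "\<bar>g j\<bar> \<le> \<mu>\<^sup>2 * Ym \<sigma>" if "j < n" for j
  proof -
    have b: "\<bar>m \<sigma> j\<bar> \<le> \<mu>" "\<bar>mb \<sigma>\<bar> \<le> \<mu>"
      using Ym_upper[OF that, of \<sigma>] Ym_nonneg[of \<sigma>] by (auto simp: \<mu>_def m_eq_y[of \<sigma> j])
    have "\<bar>g j\<bar> \<le> \<mu>\<^sup>2 * \<bar>m \<sigma> j - mb \<sigma>\<bar>" unfolding g_def by (rule tgap_diff_le[OF b])
    also have "\<dots> \<le> \<mu>\<^sup>2 * Ym \<sigma>" using Ym_upper[OF that, of \<sigma>] by (intro mult_left_mono) (auto simp: m_eq_y[of \<sigma> j])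
    finally show ?thesis .
  qed
  have mg: "\<bar>m g j\<bar> \<le> 2 * (\<mu>\<^sup>2 * Ym \<sigma>)" if "j < n" for j
  proof -
    have "\<bar>m g j\<bar> \<le> (1 + D) * (\<mu>\<^sup>2 * Ym \<sigma>)" by (rule m_sup[OF g that])
    also have "\<dots> \<le> 2 * (\<mu>\<^sup>2 * Ym \<sigma>)" using D1 Ym_nonneg by (intro mult_right_mono) auto
    finally show ?thesis .
  qed
  have 1: "\<bar>tanh (mb \<sigma>) * ip n (rsv i) d\<bar> \<le> \<bar>mb \<sigma>\<bar> * (4 * H * ln n * D)"
    unfolding abs_mult by (intro mult_mono tanh_abs_le rsv_bound[OF n3 D i(1) d_le]) auto
  have 2: "\<bar>ip n (mr i) (nz \<sigma>)\<bar> \<le> om' \<sigma>"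
    unfolding om'_def by (rule Max_upper[OF i(1), of "\<lambda>i. \<bar>ip n (mr i) (nz \<sigma>)\<bar>"])
  have 3: "\<bar>ip n (rsv i) (m g)\<bar> \<le> 4 * H * ln n * (2 * (\<mu>\<^sup>2 * Ym \<sigma>))"
    by (rule rsv_bound[OF n3 D i(1) mg])
  have 4: "\<bar>mb \<sigma>\<bar> * (4 * H * ln n * D) \<le> 1 / 2 * (ln n * D)"
  proof -
    have "(8 * H * \<bar>mb \<sigma>\<bar>) * (ln n * D) \<le> 1 * (ln n * D)" using mb L D0 by (intro mult_right_mono) auto
    then show ?thesis by (simp add: mult_ac)
  qed
  have 5: "4 * H * ln n * (2 * (\<mu>\<^sup>2 * Ym \<sigma>)) \<le> 1 / 2 * Ym \<sigma>"
  proof -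
    have "(16 * H * ln n * \<mu>\<^sup>2) * Ym \<sigma> \<le> 1 * Ym \<sigma>" using mu Ym_nonneg by (intro mult_right_mono) (auto simp: \<mu>_def)
    then show ?thesis by (simp add: mult_ac)
  qed
  have "y \<sigma> i = tanh (mb \<sigma>) * ip n (rsv i) d + ip n (mr i) (nz \<sigma>) - ip n (rsv i) (m g)"
    unfolding g_def by (rule y_linear[OF i(1)])
  then have "\<bar>y \<sigma> i\<bar> \<le> \<bar>tanh (mb \<sigma>) * ip n (rsv i) d\<bar> + \<bar>ip n (mr i) (nz \<sigma>)\<bar> + \<bar>ip n (rsv i) (m g)\<bar>" by linarith
  then show ?thesis using 1 2 3 4 5 i(2) by linarith
qed

subsection \<open>Small deviations\<close>

lemma H_ge_1: "1 \<le> H"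
  using rate_le rate_pos by (simp add: H_def field_simps)

lemma small_al_tail:
  assumes n3: "3 \<le> n" and D: "H * ln n * D \<le> 1 / 2" and t: "0 \<le> t"
  shows "pr (\<lambda>\<sigma>. t * sqrt (al * ln n ^ 3) + ln n * D \<le> Ym \<sigma>)
    \<le> 2 * n * exp (- (\<delta>\<^sup>2 / 6480 * t\<^sup>2 * ln n ^ 3)) + 96 * H\<^sup>2 * (ln n * (E (\<lambda>\<sigma>. (mb \<sigma>)\<^sup>2) + E (\<lambda>\<sigma>. (Ym \<sigma>)\<^sup>2)))"
proof -
  define L where "L = ln (real n)"
  have L: "1 \<le> L" unfolding L_def by (rule ln_n_ge_1[OF n3])
  define x where "x = t * sqrt (al * L ^ 3)"
  have x0: "0 \<le> x" using t L al_pos by (simp add: x_def)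
  \<comment> \<open>The two conditions of \<open>Ym_le_om'\<close> need the factors 32 and 64 here;
    96 covers both.\<close>
  define f where "f = (\<lambda>\<sigma>. 96 * H\<^sup>2 * L * ((mb \<sigma>)\<^sup>2 + (Ym \<sigma>)\<^sup>2))"
  have "pr (\<lambda>\<sigma>. x + L * D \<le> Ym \<sigma>) \<le> pr (\<lambda>\<sigma>. x / 2 \<le> om' \<sigma> \<or> 1 \<le> f \<sigma>)"
  proof (rule pr_mono)
    fix \<sigma> assume Q: "x + L * D \<le> Ym \<sigma>"
    show "x / 2 \<le> om' \<sigma> \<or> 1 \<le> f \<sigma>"
    proof (rule disjCI)
      assume nf: "\<not> 1 \<le> f \<sigma>"
      define M where "M = (mb \<sigma>)\<^sup>2 + (Ym \<sigma>)\<^sup>2"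
      have M0: "0 \<le> M" by (simp add: M_def)
      have HL: "1 \<le> H\<^sup>2 * L" "H * L \<le> H\<^sup>2 * L" "H\<^sup>2 \<le> H\<^sup>2 * L"
      proof -
        show 2: "H * L \<le> H\<^sup>2 * L" using H_ge_1 L by (simp add: power2_eq_square)
        show "H\<^sup>2 \<le> H\<^sup>2 * L" using H_ge_1 L by simp
        have "1 * 1 \<le> H * L" using H_ge_1 L by (intro mult_mono) auto
        then show "1 \<le> H\<^sup>2 * L" using 2 by linarith
      qed
      have fM: "96 * (H\<^sup>2 * L * M) < 1" using nf by (simp add: f_def M_def)
      have "(\<bar>mb \<sigma>\<bar> + Ym \<sigma>)\<^sup>2 \<le> 2 * M"
        using sum_squares_bound[of "\<bar>mb \<sigma>\<bar>" "Ym \<sigma>"] by (simp add: M_def power2_sum)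
      then have "H * L * (\<bar>mb \<sigma>\<bar> + Ym \<sigma>)\<^sup>2 \<le> H\<^sup>2 * L * (2 * M)"
        using HL(1) L by (intro mult_mono[OF HL(2)]) auto
      moreover have "0 \<le> H\<^sup>2 * L * M" using L M0 by (intro mult_nonneg_nonneg) auto
      ultimately have 1: "16 * H * L * (\<bar>mb \<sigma>\<bar> + Ym \<sigma>)\<^sup>2 \<le> 1" using fM by (simp add: mult.assoc)
      have "H\<^sup>2 * (mb \<sigma>)\<^sup>2 \<le> H\<^sup>2 * L * M" using HL by (intro mult_mono) (auto simp: M_def)
      then have "(8 * H * \<bar>mb \<sigma>\<bar>)\<^sup>2 \<le> 1\<^sup>2" using fM by (simp add: power_mult_distrib)
      then have "8 * H * \<bar>mb \<sigma>\<bar> \<le> 1" by (rule power2_le_imp_le) simp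
      from Ym_le_om'[OF n3 D 1[unfolded L_def] this] Q show "x / 2 \<le> om' \<sigma>" by (simp add: L_def)
    qed
  qed
  also have "\<dots> \<le> pr (\<lambda>\<sigma>. x / 2 \<le> om' \<sigma>) + pr (\<lambda>\<sigma>. 1 \<le> f \<sigma>)" by (rule pr_disj)
  also have "\<dots> \<le> 2 * n * exp (- ((x / 2)\<^sup>2 * \<delta>\<^sup>2 / (1620 * al))) + E f"
    using x0 L by (intro add_mono om'_tail n3 D pr_Markov) (auto simp: f_def)
  also have "E f = 96 * H\<^sup>2 * (L * (E (\<lambda>\<sigma>. (mb \<sigma>)\<^sup>2) + E (\<lambda>\<sigma>. (Ym \<sigma>)\<^sup>2)))"
    unfolding f_def E_cmult E_add by simp
  also have "(x / 2)\<^sup>2 * \<delta>\<^sup>2 / (1620 * al) = \<delta>\<^sup>2 / 6480 * t\<^sup>2 * L ^ 3"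
    using L al_pos by (simp add: x_def power_divide power_mult_distrib)
  finally show ?thesis by (simp add: x_def L_def)
qed

text \<open>When the variances \<open>p i\<close> are of order \<open>al\<close>, GHS makes each
  field sub-Gaussian on that scale, and \<open>Ym\<close> is at most twice the largest
  field.\<close>

lemma large_al_tail:
  assumes P: "0 < P" "\<And>i. i < n \<Longrightarrow> p i \<le> P * al" and n3: "3 \<le> n" and t: "0 \<le> t"
  shows "pr (\<lambda>\<sigma>. t * sqrt (al * ln n ^ 3) + ln n * D \<le> Ym \<sigma>) \<le> 2 * n * exp (- (1 / (8 * P) * t\<^sup>2 * ln n ^ 3))"
proof -
  define L where "L = ln (real n)"
  have L: "1 \<le> L" unfolding L_def by (rule ln_n_ge_1[OF n3])
  define x where "x = t * sqrt (al * L ^ 3)"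
  have x0: "0 \<le> x" using t L al_pos by (simp add: x_def)
  define Mm where "Mm = (\<lambda>\<sigma>. MAX i\<in>{..<n}. \<bar>m \<sigma> i\<bar>)"
  have Mm: "\<bar>m \<sigma> i\<bar> \<le> Mm \<sigma>" if "i < n" for \<sigma> i
    unfolding Mm_def by (rule Max_upper[OF that, of "\<lambda>i. \<bar>m \<sigma> i\<bar>"])
  have "pr (\<lambda>\<sigma>. x + L * D \<le> Ym \<sigma>) \<le> pr (\<lambda>\<sigma>. x / 2 \<le> Mm \<sigma>)"
  proof (rule pr_mono)
    fix \<sigma> assume "x + L * D \<le> Ym \<sigma>"
    moreover have "0 \<le> L * D" using L D0 by simp
    moreover obtain i where i: "i < n" "Ym \<sigma> = \<bar>y \<sigma> i\<bar>"
      unfolding Ym_def using Max_attained[of "\<lambda>i. \<bar>y \<sigma> i\<bar>"] by auto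
    moreover have "\<bar>mb \<sigma>\<bar> \<le> Mm \<sigma>" unfolding mb_def by (rule avg_abs_le[OF Mm n0])
    ultimately show "x / 2 \<le> Mm \<sigma>" using Mm[OF i(1), of \<sigma>] m_eq_y[of \<sigma> i] by linarith
  qed
  also have "\<dots> \<le> 2 * n * exp (- ((x / 2)\<^sup>2 / (4 * (P * al / 2))))"
  proof (rule pr_Chernoff)
    fix \<theta> :: real assume \<theta>: "0 \<le> \<theta>"
    have "E (\<lambda>\<sigma>. exp (\<theta> * Mm \<sigma>)) \<le> E (\<lambda>\<sigma>. \<Sum>i<n. exp (\<theta> * \<bar>m \<sigma> i\<bar>))"
    proof (rule E_mono)
      fix \<sigma>
      obtain i where i: "i < n" "Mm \<sigma> = \<bar>m \<sigma> i\<bar>"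
        unfolding Mm_def using Max_attained[of "\<lambda>i. \<bar>m \<sigma> i\<bar>"] by auto
      show "exp (\<theta> * Mm \<sigma>) \<le> (\<Sum>i<n. exp (\<theta> * \<bar>m \<sigma> i\<bar>))"
        unfolding i(2) by (rule member_le_sum[of i]) (use i in auto)
    qed
    also have "\<dots> \<le> (\<Sum>i<n. 2 * exp (\<theta>\<^sup>2 * (P * al / 2)))"
      unfolding E_sum
    proof (rule sum_mono)
      fix i assume "i \<in> {..<n}"
      then have i: "i < n" by simp
      have one: "E (\<lambda>\<sigma>. exp (\<theta> * m \<sigma> i)) \<le> exp (\<theta>\<^sup>2 * (P * al / 2))"
      proof -
        have "E (\<lambda>\<sigma>. exp (\<theta> * m \<sigma> i)) \<le> exp (\<theta>\<^sup>2 / 2 * p i)"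
          unfolding p_def m_eq_ip by (rule sub_Gaussian) (use nonneg i \<theta> in auto)
        also have "\<dots> \<le> exp (\<theta>\<^sup>2 / 2 * (P * al))"
          using mult_left_mono[OF P(2)[OF i], of "\<theta>\<^sup>2 / 2"] by simp
        finally show ?thesis by simp
      qed
      have "E (\<lambda>\<sigma>. exp (- (\<theta> * m \<sigma> i)) - exp (\<theta> * m \<sigma> i)) = 0"
        by (rule E_odd) (simp add: m_flip_all)
      then have neg: "E (\<lambda>\<sigma>. exp (- (\<theta> * m \<sigma> i))) = E (\<lambda>\<sigma>. exp (\<theta> * m \<sigma> i))"
        by (simp add: E_diff)
      have "E (\<lambda>\<sigma>. exp (\<theta> * \<bar>m \<sigma> i\<bar>)) \<le> E (\<lambda>\<sigma>. exp (\<theta> * m \<sigma> i) + exp (- (\<theta> * m \<sigma> i)))"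
        by (rule E_mono) (use exp_abs_le \<theta> in \<open>metis abs_mult abs_of_nonneg\<close>)
      also have "\<dots> \<le> 2 * exp (\<theta>\<^sup>2 * (P * al / 2))" using one by (simp add: E_add neg)
      finally show "E (\<lambda>\<sigma>. exp (\<theta> * \<bar>m \<sigma> i\<bar>)) \<le> 2 * exp (\<theta>\<^sup>2 * (P * al / 2))" .
    qed
    finally show "E (\<lambda>\<sigma>. exp (\<theta> * Mm \<sigma>)) \<le> 2 * n * exp (\<theta>\<^sup>2 * (P * al / 2))" by simp
  qed (use x0 P al_pos in auto)
  also have "(x / 2)\<^sup>2 / (4 * (P * al / 2)) = 1 / (8 * P) * t\<^sup>2 * L ^ 3"
    using L al_pos P(1) by (simp add: x_def power_divide power_mult_distrib)
  finally show ?thesis by (simp add: x_def L_def)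
qed

definition Ub :: "real \<Rightarrow> real" where
  "Ub K = Ubound (\<kappa>0 K) * (1 + tbound K + (tbound K)\<^sup>2)"

text \<open>The factor in \<open>p i \<le> Pb K * al\<close>, valid when
  \<open>al \<ge> 1 / q\<^sup>2\<close>, so that \<open>\<tau>\<close> is of order at most
  \<open>al\<close>.\<close>

definition Pb :: "real \<Rightarrow> real" where
  "Pb K = 17 * (1 + tbound K * (K\<^sup>2 + K)) / \<delta>\<^sup>2 + 16 * tbound K"

definition c1 :: "real \<Rightarrow> real" where "c1 K = min (\<delta>\<^sup>2 / 6480) (1 / (8 * Pb K))"

definition c2 :: "real \<Rightarrow> real" where
  "c2 K = 96 * H\<^sup>2 * (2 * tbound K + 2 * K\<^sup>2 * Ub K + 2 * Ymom 2 * (1 + K\<^sup>2))"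

text \<open>The cases split at \<open>al = 1 / q\<^sup>2\<close>, the order of the bound on
  \<open>\<tau>\<close>. Above, the magnetization adds at most order \<open>al\<close> to the
  variance of a field. Below, \<open>rr\<^sup>2\<close> is of order at most
  \<open>ln n ^ 3 / q\<^sup>2\<close>, so the Markov term of \<open>small_al_tail\<close> is of
  order \<open>ln n ^ 4 / q\<^sup>2\<close>.\<close>

lemma small_deviation:
  assumes n3: "3 \<le> n" and D: "H * ln n * D \<le> 1 / 2" "q * D \<le> K"
    and q: "0 < q" "q ^ 4 = real n" and K: "1 \<le> K"
    and e: "fr \<le> e" "ln n \<le> e" "e \<le> K * q\<^sup>2" "e * rr \<le> K * q"
    and r: "ip n d d \<le> r" "sd\<^sup>2 \<le> r * q\<^sup>2" "(ln n)\<^sup>2 * sqrt r \<le> K * q" and t: "0 \<le> t"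
  shows "pr (\<lambda>\<sigma>. t * sqrt (al * ln n ^ 3) + ln n * D \<le> Ym \<sigma>)
    \<le> 2 * n * exp (- (c1 K * t\<^sup>2 * ln n ^ 3)) + c2 K * (ln n ^ 4 / q\<^sup>2)"
    and "0 < c1 K"
proof -
  define L where "L = ln (real n)"
  have L: "1 \<le> L" unfolding L_def by (rule ln_n_ge_1[OF n3])
  have D3: "3 * ln n / rate * D \<le> 1" using D L D0 rate_pos by (simp add: H_def L_def field_simps)
  note mom = moment_bounds[OF n3 D3 q K e r]
  define tb where "tb = tbound K"
  have \<tau>: "\<tau> \<le> tb / q\<^sup>2" using mom(2) q by (simp add: tb_def field_simps)
  have "0 \<le> q\<^sup>2 * \<tau>" using \<tau>_nonneg by simp
  then have tb0: "0 \<le> tb" using mom(2) unfolding tb_def by linarith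
  have q1: "1 \<le> q"
  proof (rule ccontr)
    assume "\<not> 1 \<le> q"
    then have "q ^ 4 \<le> 1" using q by (intro power_le_one) auto
    then show False using q n3 by simp
  qed
  have r0: "0 \<le> r" using r(1) ip_nonneg[of n d] by linarith
  have rq: "r \<le> K\<^sup>2 * q\<^sup>2"
  proof -
    have "1 * sqrt r \<le> (ln n)\<^sup>2 * sqrt r" using L r0 by (intro mult_right_mono) (auto simp: one_le_power L_def)
    then have "sqrt r \<le> K * q" using r by linarith
    then have "(sqrt r)\<^sup>2 \<le> (K * q)\<^sup>2" using r0 by (intro power_mono) auto
    then show ?thesis using r0 by (simp add: power_mult_distrib)
  qed
  have \<Theta>: "\<Theta> \<le> 1 + tb * (K\<^sup>2 + K)"
  proof -
    have "sd\<^sup>2 \<le> (K\<^sup>2 * q\<^sup>2) * q\<^sup>2" using r(2) mult_right_mono[OF rq, of "q\<^sup>2"] by simp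
    then have "\<bar>sd\<bar>\<^sup>2 \<le> (K * q\<^sup>2)\<^sup>2" by (simp add: power_mult_distrib power2_eq_square mult_ac)
    then have "\<bar>sd\<bar> \<le> K * q\<^sup>2" by (rule power2_le_imp_le) (use K in auto)
    then have "ip n d d + \<bar>sd\<bar> \<le> (K\<^sup>2 + K) * q\<^sup>2" using r(1) rq by (simp add: distrib_right)
    then have "\<tau> * (ip n d d + \<bar>sd\<bar>) \<le> tb / q\<^sup>2 * ((K\<^sup>2 + K) * q\<^sup>2)"
      using \<tau> \<tau>_nonneg ip_nonneg[of n d] tb0 by (intro mult_mono) auto
    then show ?thesis using q by (simp add: \<Theta>_def)
  qed
  have Pb: "Pb K = 17 * (1 + tb * (K\<^sup>2 + K)) / \<delta>\<^sup>2 + 16 * tb" by (simp add: Pb_def tb_def)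
  have Pb0: "0 < Pb K"
  proof -
    have "0 < 17 * (1 + tb * (K\<^sup>2 + K)) / \<delta>\<^sup>2" using tb0 K \<delta>0 by (intro divide_pos_pos mult_pos_pos add_pos_nonneg mult_nonneg_nonneg) auto
    then show ?thesis using tb0 by (simp add: Pb)
  qed
  then show "0 < c1 K" using \<delta>0 by (simp add: c1_def)
  have Ub0: "0 \<le> Ub K"
  proof -
    have "0 \<le> Ymom 6 * K ^ 6" "0 \<le> sqrt (Ymom 4 * Kmom 8) * K\<^sup>2" "0 \<le> K\<^sup>2"
      using Ymom_nonneg Kmom_nonneg K by simp_all
    then have "1 \<le> \<kappa>0 K" using K unfolding \<kappa>0_def by linarith
    from Ubound_nonneg[OF this] tb0 show ?thesis by (simp add: Ub_def tb_def)
  qed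
  have c20: "0 \<le> c2 K" unfolding c2_def
    using tb0 Ub0 Ymom_nonneg[of 2] by (intro mult_nonneg_nonneg add_nonneg_nonneg) (auto simp: tb_def)
  have ex: "2 * n * exp (- (c * t\<^sup>2 * ln n ^ 3)) \<le> 2 * n * exp (- (c1 K * t\<^sup>2 * ln n ^ 3))" if "c1 K \<le> c" for c
  proof -
    have "c1 K * (t\<^sup>2 * ln n ^ 3) \<le> c * (t\<^sup>2 * ln n ^ 3)" using that L by (intro mult_right_mono) (auto simp: L_def)
    then show ?thesis by (intro mult_left_mono) (auto simp: mult.assoc)
  qed
  let ?Q = "\<lambda>\<sigma>. t * sqrt (al * ln n ^ 3) + ln n * D \<le> Ym \<sigma>"
  show "pr ?Q \<le> 2 * n * exp (- (c1 K * t\<^sup>2 * ln n ^ 3)) + c2 K * (ln n ^ 4 / q\<^sup>2)"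
  proof (cases "1 / q\<^sup>2 \<le> al")
    case True
    have "p i \<le> Pb K * al" if i: "i < n" for i
    proof -
      have "p i \<le> 17 * \<Theta> / \<delta>\<^sup>2 * al + 16 * \<tau>" by (rule p_le[OF i])
      also have "\<dots> \<le> 17 * (1 + tb * (K\<^sup>2 + K)) / \<delta>\<^sup>2 * al + 16 * (tb * al)"
      proof (intro add_mono mult_left_mono mult_right_mono divide_right_mono \<Theta> al_nonneg)
        have "tb * (1 / q\<^sup>2) \<le> tb * al" by (intro mult_left_mono True tb0)
        then show "\<tau> \<le> tb * al" using \<tau> by simp
      qed auto
      finally show ?thesis by (simp add: Pb distrib_right)
    qed
    from large_al_tail[OF Pb0 this n3 t]
    have "pr ?Q \<le> 2 * n * exp (- (1 / (8 * Pb K) * t\<^sup>2 * ln n ^ 3))" .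
    also have "\<dots> \<le> 2 * n * exp (- (c1 K * t\<^sup>2 * ln n ^ 3))" by (rule ex) (simp add: c1_def)
    also have "\<dots> \<le> \<dots> + c2 K * (ln n ^ 4 / q\<^sup>2)"
      using c20 L by (simp add: L_def)
    finally show ?thesis .
  next
    case False
    have mb2: "E (\<lambda>\<sigma>. (mb \<sigma>)\<^sup>2) \<le> (2 * tb + 2 * K\<^sup>2 * Ub K) / q\<^sup>2"
    proof -
      have nn: "0 < real n" using n0 by simp
      have "real n * (mb \<sigma>)\<^sup>2 \<le> real n * (2 * (sb \<sigma>)\<^sup>2 + 2 / (real n)\<^sup>2 * (u \<sigma>)\<^sup>2)" for \<sigma>
      proof -
        have "real n * (2 * (sb \<sigma>)\<^sup>2 + 2 / (real n)\<^sup>2 * (u \<sigma>)\<^sup>2) = 2 * real n * (sb \<sigma>)\<^sup>2 + 2 * (u \<sigma>)\<^sup>2 / real n"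
          using nn by (simp add: field_simps power2_eq_square)
        then show ?thesis using mb_sq_le[of \<sigma>] by simp
      qed
      then have "(mb \<sigma>)\<^sup>2 \<le> 2 * (sb \<sigma>)\<^sup>2 + 2 / (real n)\<^sup>2 * (u \<sigma>)\<^sup>2" for \<sigma>
        using nn by (simp only: mult_le_cancel_left_pos)
      then have "E (\<lambda>\<sigma>. (mb \<sigma>)\<^sup>2) \<le> E (\<lambda>\<sigma>. 2 * (sb \<sigma>)\<^sup>2 + 2 / (real n)\<^sup>2 * (u \<sigma>)\<^sup>2)"
        by (intro E_mono)
      also have "\<dots> = 2 * \<tau> + 2 / (real n)\<^sup>2 * E (\<lambda>\<sigma>. (u \<sigma>)\<^sup>2)"
        unfolding E_add E_cmult \<tau>_def ..
      also have "\<dots> \<le> 2 * (tb / q\<^sup>2) + 2 / (real n)\<^sup>2 * (K\<^sup>2 * q\<^sup>2 * Ub K)"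
      proof (intro add_mono mult_left_mono \<tau>)
        have "E (\<lambda>\<sigma>. (u \<sigma>)\<^sup>2) \<le> r * Ub K" using mom(3) by (simp add: Ub_def)
        also have "\<dots> \<le> K\<^sup>2 * q\<^sup>2 * Ub K" by (intro mult_right_mono rq Ub0)
        finally show "E (\<lambda>\<sigma>. (u \<sigma>)\<^sup>2) \<le> K\<^sup>2 * q\<^sup>2 * Ub K" .
      qed auto
      also have "2 / (real n)\<^sup>2 * (K\<^sup>2 * q\<^sup>2 * Ub K) \<le> 2 / (q\<^sup>2 * q\<^sup>2) * (K\<^sup>2 * q\<^sup>2 * Ub K)"
      proof (intro mult_right_mono divide_left_mono)
        have "q\<^sup>2 * q\<^sup>2 = q ^ 4 * 1" by (simp flip: power_add)
        also have "\<dots> \<le> q ^ 4 * q ^ 4" using q1 by (intro mult_left_mono one_le_power) auto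
        finally show "q\<^sup>2 * q\<^sup>2 \<le> (real n)\<^sup>2" by (simp add: q(2)[symmetric] power2_eq_square[of "q ^ 4"])
      qed (use Ub0 q nn in auto)
      also have "2 / (q\<^sup>2 * q\<^sup>2) * (K\<^sup>2 * q\<^sup>2 * Ub K) = 2 * K\<^sup>2 * Ub K / q\<^sup>2"
        using q(1) by (simp add: field_simps)
      finally show ?thesis by (simp add: add_divide_distrib)
    qed
    have Ym2: "E (\<lambda>\<sigma>. (Ym \<sigma>)\<^sup>2) \<le> 2 * Ymom 2 * (1 + K\<^sup>2) * L ^ 3 / q\<^sup>2"
    proof -
      have Y: "E (\<lambda>\<sigma>. (Ym \<sigma>)\<^sup>2) \<le> Ymom 2 * rr\<^sup>2" by (rule Ym_moment[OF n3 D3])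
      have "rr\<^sup>2 \<le> 2 * (L ^ 3 * al) + 2 * (L * D)\<^sup>2"
      proof -
        have "(x + z)\<^sup>2 \<le> 2 * x\<^sup>2 + 2 * z\<^sup>2" for x z :: real
          using sum_squares_bound[of x z] by (simp add: power2_sum)
        moreover have "(sqrt (L ^ 3 * al))\<^sup>2 = L ^ 3 * al" using L al_pos by simp
        ultimately show ?thesis unfolding rr_def L_def[symmetric] by metis
      qed
      also have "\<dots> \<le> 2 * (L ^ 3 * (1 / q\<^sup>2)) + 2 * (L ^ 3 * (K\<^sup>2 * (1 / q\<^sup>2)))"
      proof (intro add_mono mult_left_mono)
        show "al \<le> 1 / q\<^sup>2" using False by simp
        have "D \<le> K / q" using D(2) q by (simp add: field_simps)
        then have "(L * D)\<^sup>2 \<le> (L * (K / q))\<^sup>2" using L D0 by (intro power_mono mult_left_mono) auto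
        also have "\<dots> = L\<^sup>2 * (K\<^sup>2 * (1 / q\<^sup>2))" by (simp add: power_mult_distrib power_divide)
        also have "\<dots> \<le> L ^ 3 * (K\<^sup>2 * (1 / q\<^sup>2))" using L by (intro mult_right_mono power_increasing) auto
        finally show "(L * D)\<^sup>2 \<le> L ^ 3 * (K\<^sup>2 * (1 / q\<^sup>2))" .
      qed (use L in auto)
      also have "\<dots> = 2 * (1 + K\<^sup>2) * L ^ 3 / q\<^sup>2" by (simp add: algebra_simps add_divide_distrib)
      finally have "rr\<^sup>2 \<le> 2 * (1 + K\<^sup>2) * L ^ 3 / q\<^sup>2" .
      then have "Ymom 2 * rr\<^sup>2 \<le> Ymom 2 * (2 * (1 + K\<^sup>2) * L ^ 3 / q\<^sup>2)"
        by (intro mult_left_mono Ymom_nonneg)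
      also have "\<dots> = 2 * Ymom 2 * (1 + K\<^sup>2) * L ^ 3 / q\<^sup>2" by simp
      finally show ?thesis using Y by linarith
    qed
    have "96 * H\<^sup>2 * (L * (E (\<lambda>\<sigma>. (mb \<sigma>)\<^sup>2) + E (\<lambda>\<sigma>. (Ym \<sigma>)\<^sup>2)))
      \<le> 96 * H\<^sup>2 * (L * (L ^ 3 * ((2 * tb + 2 * K\<^sup>2 * Ub K) / q\<^sup>2) + 2 * Ymom 2 * (1 + K\<^sup>2) * L ^ 3 / q\<^sup>2))"
    proof (intro mult_left_mono add_mono Ym2)
      have "1 * ((2 * tb + 2 * K\<^sup>2 * Ub K) / q\<^sup>2) \<le> L ^ 3 * ((2 * tb + 2 * K\<^sup>2 * Ub K) / q\<^sup>2)"
        using L tb0 Ub0 by (intro mult_right_mono one_le_power) auto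
      with mb2 show "E (\<lambda>\<sigma>. (mb \<sigma>)\<^sup>2) \<le> L ^ 3 * ((2 * tb + 2 * K\<^sup>2 * Ub K) / q\<^sup>2)" by linarith
    qed (use L in auto)
    also have "\<dots> = c2 K * (L ^ 4 / q\<^sup>2)"
      by (simp add: c2_def tb_def[symmetric] eval_nat_numeral algebra_simps add_divide_distrib)
    finally have "96 * H\<^sup>2 * (ln n * (E (\<lambda>\<sigma>. (mb \<sigma>)\<^sup>2) + E (\<lambda>\<sigma>. (Ym \<sigma>)\<^sup>2))) \<le> c2 K * (ln n ^ 4 / q\<^sup>2)"
      by (simp only: L_def)
    moreover have "2 * n * exp (- (\<delta>\<^sup>2 / 6480 * t\<^sup>2 * ln n ^ 3)) \<le> 2 * n * exp (- (c1 K * t\<^sup>2 * ln n ^ 3))"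
      by (rule ex) (simp add: c1_def)
    ultimately show ?thesis using small_al_tail[OF n3 D(1) t] by linarith
  qed
qed

end

subsection \<open>Coupling matrices as Ising models\<close>

definition couplings :: "real mat \<Rightarrow> nat \<Rightarrow> nat \<Rightarrow> real" where "couplings A i j = A $$ (i, j)"

definition conf_of :: "nat \<Rightarrow> real vec \<Rightarrow> nat \<Rightarrow> real" where
  "conf_of N \<sigma> = restrict (\<lambda>i. \<sigma> $ i) {..<N}"

lemma conf_of_apply: "i < N \<Longrightarrow> conf_of N \<sigma> i = \<sigma> $ i"
  by (simp add: conf_of_def)

lemma bij_conf_of: "bij_betw (conf_of N) (spins N) (conf N)"
proof (rule bij_betw_byWitness[where f' = "vec N"])
  show "\<forall>\<sigma>\<in>spins N. vec N (conf_of N \<sigma>) = \<sigma>"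
    by (auto simp: spins_def conf_of_def)
  show "\<forall>\<sigma>\<in>conf N. conf_of N (vec N \<sigma>) = \<sigma>"
    by (auto simp: conf_def conf_of_def fun_eq_iff PiE_def extensional_def)
  show "conf_of N ` spins N \<subseteq> conf N" 
    unfolding conf_of_def conf_def by (intro image_subsetI) (subst restrict_PiE_iff, auto simp: spins_def)
  show "vec N ` conf N \<subseteq> spins N"
  proof (rule image_subsetI)
    fix \<sigma> assume "\<sigma> \<in> conf N"
    then have "\<sigma> i \<in> {-1, 1}" if "i < N" for i using that unfolding conf_def by (auto dest: PiE_mem)
    then show "vec N \<sigma> \<in> spins N" by (simp add: spins_def)
  qed
qed

lemma couplings_model: "coupling_matrix N A \<Longrightarrow> ising_model N (couplings A)"
proof
  fix i j assume A: "coupling_matrix N A" and i: "i < N" and j: "j < N"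
  then have "A \<in> carrier_mat N N" "A\<^sup>T = A" by (auto simp: coupling_matrix_def)
  then show "couplings A i j = couplings A j i"
    using i j unfolding couplings_def by (metis carrier_matD index_transpose_mat(1))
qed (auto simp: coupling_matrix_def couplings_def)

context
  fixes N :: nat and A :: "real mat"
  assumes A: "coupling_matrix N A"
begin

interpretation ising_model N "couplings A"
  by (rule couplings_model[OF A])

lemma dim_A: "dim_row A = N" "dim_col A = N" "A \<in> carrier_mat N N"
  using A by (auto simp: coupling_matrix_def)

lemma local_field_conf: "i < N \<Longrightarrow> local_field A \<sigma> i = mv N (couplings A) (conf_of N \<sigma>) i"
  by (auto simp: local_field_def dim_A mv_def couplings_def conf_of_apply intro!: sum.cong)

lemma ising_weight_conf:
  assumes "\<sigma> \<in> spins N"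
  shows "ising_weight A 1 0 \<sigma> = W (conf_of N \<sigma>)"
proof -
  have \<sigma>: "dim_vec \<sigma> = N" using assms by (simp add: spins_def)
  have "\<sigma> \<bullet> (A *\<^sub>v \<sigma>) = (\<Sum>i<N. \<sigma> $ i * local_field A \<sigma> i)"
    using dim_A \<sigma> by (auto simp: scalar_prod_def local_field_def lessThan_atLeast0 intro!: sum.cong)
  also have "\<dots> = ip N (conf_of N \<sigma>) (mv N (couplings A) (conf_of N \<sigma>))"
    unfolding ip_def by (intro sum.cong) (auto simp: local_field_conf conf_of_apply)
  finally show ?thesis by (simp add: ising_weight_def W_def)
qed

lemma expectation_conf:
  assumes f: "\<And>\<sigma>. \<sigma> \<in> spins N \<Longrightarrow> f \<sigma> = g (conf_of N \<sigma>)"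
  shows "measure_pmf.expectation (ising A 1 0) f = E g"
proof -
  have "ising_Z A 1 0 = (\<Sum>\<sigma>\<in>spins N. W (conf_of N \<sigma>))"
    unfolding ising_Z_def dim_A by (intro sum.cong refl ising_weight_conf)
  also have "\<dots> = Z" unfolding Z_def by (rule sum.reindex_bij_betw[OF bij_conf_of])
  finally have Z: "ising_Z A 1 0 = Z" .
  have "measure_pmf.expectation (ising A 1 0) f = (\<Sum>\<sigma>\<in>spins N. f \<sigma> * pmf (ising A 1 0) \<sigma>)"
    by (rule integral_measure_pmf_real) (auto simp: finite_spins set_pmf_iff pmf_ising dim_A split: if_splits)
  also have "\<dots> = (\<Sum>\<sigma>\<in>spins N. W (conf_of N \<sigma>) / Z * g (conf_of N \<sigma>))"
    by (intro sum.cong refl) (simp add: pmf_ising dim_A Z ising_weight_conf f)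
  also have "\<dots> = E g" unfolding E_def by (rule sum.reindex_bij_betw[OF bij_conf_of])
  finally show ?thesis .
qed

lemma prob_conf:
  assumes "\<And>\<sigma>. \<sigma> \<in> spins N \<Longrightarrow> \<sigma> \<in> S \<longleftrightarrow> Q (conf_of N \<sigma>)"
  shows "measure_pmf.prob (ising A 1 0) S = pr Q"
proof -
  have "measure_pmf.prob (ising A 1 0) S = measure_pmf.expectation (ising A 1 0) (indicator S)" by simp
  also have "\<dots> = pr Q"
    unfolding pr_def by (rule expectation_conf) (simp add: assms indicator_def)
  finally show ?thesis .
qed

lemma row_total_conf: "row_total A i = (\<Sum>j<N. couplings A i j)"
  by (simp add: row_total_def dim_A couplings_def)

lemma spin_mean_conf: "spin_mean N \<sigma> = avg N (conf_of N \<sigma>)"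
  by (simp add: spin_mean_def avg_def conf_of_apply)

lemma spin_form_conf: "(\<Sum>i<N. (row_total A i - 1) * \<sigma> $ i) = ip N (\<lambda>i. row_total A i - 1) (conf_of N \<sigma>)"
  by (simp add: ip_def conf_of_apply)

text \<open>Cauchy-Schwarz, with a factor that grows with \<open>N\<close>: it serves the finitely
  many \<open>N\<close> before the asymptotic regime.\<close>

lemma second_moment_trivial:
  "measure_pmf.expectation (ising A 1 0) (\<lambda>\<sigma>. (\<Sum>i<N. (row_total A i - 1) * \<sigma> $ i)\<^sup>2) \<le> N * row_irregularity A"
proof -
  define b where "b = (\<lambda>i. row_total A i - 1)"
  have "measure_pmf.expectation (ising A 1 0) (\<lambda>\<sigma>. (\<Sum>i<N. (row_total A i - 1) * \<sigma> $ i)\<^sup>2) = E (\<lambda>\<sigma>. (ip N b \<sigma>)\<^sup>2)"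
    by (rule expectation_conf) (simp add: spin_form_conf b_def)
  also have "\<dots> \<le> E (\<lambda>_. N * ip N b b)"
  proof (rule E_mono)
    fix \<sigma> assume \<sigma>: "\<sigma> \<in> conf N"
    have "(ip N b \<sigma>)\<^sup>2 \<le> (nrm N b * nrm N \<sigma>)\<^sup>2"
      using Cauchy_Schwarz_ip[of N b \<sigma>] by (metis abs_ge_zero power2_abs power_mono)
    also have "\<dots> = N * ip N b b"
      using conf_sq[OF \<sigma>] by (simp add: power_mult_distrib nrm_sq ip_def)
    finally show "(ip N b \<sigma>)\<^sup>2 \<le> N * ip N b b" .
  qed
  also have "\<dots> = N * ip N b b" by simp
  also have "\<dots> \<le> N * row_irregularity A"
    by (intro mult_left_mono) (simp_all add: row_irregularity_def ip_def b_def dim_A power2_eq_square)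
  finally show ?thesis .
qed

lemma sixth_moment_trivial:
  assumes "0 < N"
  shows "measure_pmf.expectation (ising A 1 0) (\<lambda>\<sigma>. spin_mean N \<sigma> ^ 6) \<le> 1"
proof -
  have "measure_pmf.expectation (ising A 1 0) (\<lambda>\<sigma>. spin_mean N \<sigma> ^ 6) = E (\<lambda>\<sigma>. avg N \<sigma> ^ 6)"
    by (rule expectation_conf) (simp add: spin_mean_conf)
  also have "\<dots> \<le> E (\<lambda>_. 1)"
  proof (rule E_mono)
    fix \<sigma> assume "\<sigma> \<in> conf N"
    then have "\<bar>avg N \<sigma>\<bar> \<le> 1" using assms conf_abs[of \<sigma> N] by (intro avg_abs_le) auto
    then have "\<bar>avg N \<sigma>\<bar> ^ 6 \<le> 1" by (intro power_le_one) auto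
    then show "avg N \<sigma> ^ 6 \<le> 1" by (simp add: power_even_abs)
  qed
  finally show ?thesis by simp
qed

lemma alpha_nonneg: "0 < N \<Longrightarrow> 0 \<le> alpha A"
  unfolding alpha_def dim_A by (subst Max_ge_iff) (auto intro!: sum_nonneg exI[of _ 0])

lemma max_row_dev_ge: "i < N \<Longrightarrow> \<bar>row_total A i - 1\<bar> \<le> max_row_dev A"
  unfolding max_row_dev_def dim_A by (rule Max_ge) auto

lemma max_row_dev_nonneg: "0 < N \<Longrightarrow> 0 \<le> max_row_dev A"
  using max_row_dev_ge[of 0] by linarith

text \<open>Half of the gap \<open>1 - \<rho>\<close> is given away: one \<open>D\<close> is lost
  because the top eigenvalue is only near 1, and two more in \<open>coupling_gap\<close>.\<close>

lemma near_regular_couplings: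
  assumes n: "2 \<le> N" and \<rho>: "0 \<le> \<rho>" "\<rho> < 1" and gap: "eigval_desc A 2 / eigval_desc A 1 \<le> \<rho>"
    and D: "max_row_dev A \<le> ((1 - \<rho>) / 2)\<^sup>2 / 80"
  shows "near_regular N (couplings A) (max_row_dev A) ((1 - \<rho>) / 2)"
proof
  define \<delta> where "\<delta> = (1 - \<rho>) / 2"
  have \<delta>: "0 < \<delta>" "\<delta> \<le> 1" using \<rho> by (auto simp: \<delta>_def)
  define D where "D = max_row_dev A"
  have "\<delta>\<^sup>2 \<le> \<delta>" using \<delta> by (simp add: power2_eq_square mult_left_le)
  then have D\<delta>: "D \<le> \<delta> / 80" using D by (simp add: D_def \<delta>_def)
  have D0: "0 \<le> D" using max_row_dev_nonneg n by (simp add: D_def)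
  note gap' = coupling_gap[OF A n max_row_dev_ge, folded D_def]
  fix x :: "nat \<Rightarrow> real" assume x: "ip N x (\<lambda>_. 1) = 0"
  have "eigval_desc A 2 \<le> \<rho> * eigval_desc A 1"
    using gap gap'(1) D\<delta> \<delta> by (simp add: divide_le_eq split: if_splits)
  also have "\<dots> \<le> \<rho> * (1 + D)" by (intro mult_left_mono gap'(2) \<rho>)
  also have "\<dots> \<le> \<rho> + D" using \<rho> D0 by (simp add: distrib_left mult_left_le_one_le)
  finally have "eigval_desc A 2 \<le> \<rho> + D" .
  moreover have "160 * D \<le> 1 - \<rho>" using D\<delta> by (simp add: \<delta>_def)
  moreover have "1 - \<delta> = 1 / 2 + \<rho> / 2" by (simp add: \<delta>_def field_simps)
  ultimately have "eigval_desc A 2 + 2 * D \<le> 1 - \<delta>" using \<rho> by linarith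
  then have "(eigval_desc A 2 + 2 * D) * ip N x x \<le> (1 - \<delta>) * ip N x x" by (intro mult_right_mono ip_nonneg)
  then show "ip N x (mv N (couplings A) x) \<le> (1 - (1 - \<rho>) / 2) * ip N x x"
    using gap'(3)[OF _ x] by (simp add: \<delta>_def couplings_def[abs_def])
qed (use A D n \<rho> max_row_dev_ge max_row_dev_nonneg row_total_conf couplings_model[OF A] in \<open>auto simp: ising_model_def\<close>)

end

subsection \<open>Asymptotics\<close>

context
  fixes N :: nat and A :: "real mat" and \<delta> :: real
  assumes A: "coupling_matrix N A" and NR: "near_regular N (couplings A) (max_row_dev A) \<delta>"
begin

interpretation near_regular N "couplings A" "max_row_dev A" \<delta>
  by (rule NR)

lemma d_couplings: "d = (\<lambda>i. row_total A i - 1)"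
  by (rule ext) (simp add: d_def row_total_conf[OF A])

lemma al_couplings: "al = alpha A"
  by (simp add: al_def alpha_def dim_A[OF A] ip_def couplings_def power2_eq_square)

lemma fr_couplings: "fr = (frobenius_norm A)\<^sup>2"
proof -
  have "0 \<le> (\<Sum>i<N. \<Sum>j<N. (A $$ (i, j))\<^sup>2)" by (intro sum_nonneg) auto
  then show ?thesis
    by (simp add: fr_def frobenius_norm_def dim_A[OF A] ip_def couplings_def power2_eq_square)
qed

lemma rr_couplings: "rr = r_rate A"
  by (simp add: rr_def r_rate_def dim_A[OF A] al_couplings)

lemma Ym_couplings:
  "(MAX i\<in>{..<N}. \<bar>local_field A \<sigma> i - local_field_mean A \<sigma>\<bar>) = Ym (conf_of N \<sigma>)"
proof -
  have "local_field_mean A \<sigma> = mb (conf_of N \<sigma>)"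
    by (simp add: local_field_mean_def mb_def avg_def dim_A[OF A] local_field_conf[OF A])
  then have "\<bar>local_field A \<sigma> i - local_field_mean A \<sigma>\<bar> = \<bar>y (conf_of N \<sigma>) i\<bar>" if "i < N" for i
    using m_eq_y[of "conf_of N \<sigma>" i] local_field_conf[OF A that, of \<sigma>] by simp
  then show ?thesis unfolding Ym_def by (intro arg_cong[where f = Max] image_cong) auto
qed

abbreviation deviation :: "real \<Rightarrow> real vec set" where
  "deviation t \<equiv> {\<sigma>. (MAX i\<in>{..<N}. \<bar>local_field A \<sigma> i - local_field_mean A \<sigma>\<bar>)
                 \<ge> t * sqrt (alpha A * ln (real N) ^ 3) + ln (real N) * max_row_dev A}"

lemma prob_deviation:
  "measure_pmf.prob (ising A 1 0) (deviation t) = pr (\<lambda>\<sigma>. t * sqrt (al * ln N ^ 3) + ln N * max_row_dev A \<le> Ym \<sigma>)"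
  by (rule prob_conf[OF A]) (simp only: mem_Collect_eq Ym_couplings al_couplings)

context
  fixes q K :: real
  assumes n3: "3 \<le> N" and q: "0 < q" "q ^ 4 = real N" and K: "1 \<le> K"
    and HD: "H * ln N * max_row_dev A \<le> 1 / 2" and Ds: "max_row_dev A \<le> s0" and qD: "q * max_row_dev A \<le> K"
    and e: "eps_rate A \<le> K * q\<^sup>2" "eps_rate A * r_rate A \<le> K * q"
    and irr: "(ln N)\<^sup>2 * sqrt (row_irregularity A) \<le> K * q"
begin

lemma ln_N_ge_1: "1 \<le> ln (real N)" by (rule ln_n_ge_1[OF n3])

lemma max_row_dev_ln_le: "3 * ln N / rate * max_row_dev A \<le> 1"
  using HD ln_N_ge_1 D0 rate_pos by (simp add: H_def field_simps)

lemma eps_rate_ge: "fr \<le> eps_rate A" "ln N \<le> eps_rate A"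
proof -
  have "0 \<le> (\<Sum>i<N. row_total A i - 1)\<^sup>2 / real N" "0 \<le> (\<Sum>i<N. (row_total A i - 1)\<^sup>2) / real N"
    by (auto intro!: divide_nonneg_nonneg sum_nonneg)
  then show "fr \<le> eps_rate A" "ln N \<le> eps_rate A"
    using ln_N_ge_1 by (auto simp: eps_rate_def dim_A[OF A] fr_couplings)
qed

lemma powr_q: "real N powr (- 1 / 2) = 1 / q\<^sup>2" "real N powr (3 / 2) = q ^ 6"
proof -
  have N: "real N = q powr 4" using q by simp
  have "real N powr (- 1 / 2) = q powr (- 2)" unfolding N powr_powr by simp
  then show "real N powr (- 1 / 2) = 1 / q\<^sup>2" using q(1) by (simp add: powr_minus_divide)
  have "real N powr (3 / 2) = q powr 6" unfolding N powr_powr by simp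
  then show "real N powr (3 / 2) = q ^ 6" using q(1) by simp
qed

lemma irregularity_ge: "ip N d d \<le> row_irregularity A" "sd\<^sup>2 \<le> row_irregularity A * q\<^sup>2"
proof -
  define R1 R2 where "R1 = (\<Sum>i<N. (row_total A i - 1)\<^sup>2)" and "R2 = (\<Sum>i<N. row_total A i - 1)\<^sup>2"
  have R: "row_irregularity A = R1 + 1 / q\<^sup>2 * R2"
    unfolding row_irregularity_def dim_A(1)[OF A] R1_def R2_def powr_q ..
  have R0: "0 \<le> R1" "0 \<le> R2" by (auto simp: R1_def R2_def sum_nonneg)
  have "ip N d d = R1" by (simp add: ip_def d_couplings R1_def power2_eq_square)
  moreover have "0 \<le> 1 / q\<^sup>2 * R2" using R0 by simp
  ultimately show "ip N d d \<le> row_irregularity A" using R by linarith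
  have "sd\<^sup>2 = R2" by (simp add: sd_def d_couplings R2_def)
  also have "\<dots> \<le> R1 * q\<^sup>2 + R2" using R0 by simp
  also have "\<dots> = row_irregularity A * q\<^sup>2" using q(1) by (simp add: R distrib_right)
  finally show "sd\<^sup>2 \<le> row_irregularity A * q\<^sup>2" .
qed

lemmas bounds = moment_bounds[OF n3 max_row_dev_ln_le q K eps_rate_ge e[folded rr_couplings] irregularity_ge irr]

lemma sixth_moment_couplings:
  "N powr (3 / 2) * measure_pmf.expectation (ising A 1 0) (\<lambda>\<sigma>. spin_mean N \<sigma> ^ 6) \<le> tbound K"
proof -
  have "measure_pmf.expectation (ising A 1 0) (\<lambda>\<sigma>. spin_mean N \<sigma> ^ 6) = E (\<lambda>\<sigma>. sb \<sigma> ^ 6)"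
    by (rule expectation_conf[OF A]) (simp add: spin_mean_conf[OF A] sb_def)
  then show ?thesis using bounds(1) by (simp add: powr_q)
qed

lemma second_moment_couplings:
  "measure_pmf.expectation (ising A 1 0) (\<lambda>\<sigma>. (\<Sum>i<N. (row_total A i - 1) * \<sigma> $ i)\<^sup>2) \<le> Ub K * row_irregularity A"
proof -
  have "measure_pmf.expectation (ising A 1 0) (\<lambda>\<sigma>. (\<Sum>i<N. (row_total A i - 1) * \<sigma> $ i)\<^sup>2) = E (\<lambda>\<sigma>. (u \<sigma>)\<^sup>2)"
    by (rule expectation_conf[OF A]) (simp add: spin_form_conf[OF A] u_def d_couplings)
  then show ?thesis using bounds(3) by (simp add: Ub_def mult.commute)
qed

lemma small_deviation_couplings:
  assumes "0 \<le> t"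
  shows "measure_pmf.prob (ising A 1 0) (deviation t) \<le> 2 * N * exp (- (c1 K * t\<^sup>2 * ln N ^ 3)) + c2 K * (ln N ^ 4 / q\<^sup>2)"
  and "0 < c1 K"
  using small_deviation[OF n3 HD qD q K eps_rate_ge e[folded rr_couplings] irregularity_ge irr assms]
  unfolding prob_deviation by simp_all

lemma large_deviation_couplings:
  assumes "0 \<le> t" "6 / c0 \<le> t\<^sup>2"
  shows "measure_pmf.prob (ising A 1 0) (deviation t) \<le> exp (- (c0 / 2 * t\<^sup>2))"
  unfolding prob_deviation by (rule large_deviation[OF n3 max_row_dev_ln_le Ds assms])

text \<open>Large \<open>t\<close> have their own bound. For the others
  \<open>c0 / 2 * t\<^sup>2\<close> is below 3, so by monotonicity in \<open>t\<close> it is enough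
  that the bound at \<open>t0\<close> falls below \<open>exp (- 3)\<close>; one constant then serves
  all \<open>t \<ge> t0\<close>.\<close>

lemma deviation_bound:
  assumes t: "0 < t0" "t0 \<le> t" and small: "2 * N * exp (- (c1 K * t0\<^sup>2 * ln N ^ 3)) + c2 K * (ln N ^ 4 / q\<^sup>2) \<le> exp (- 3)"
  shows "elog (measure_pmf.prob (ising A 1 0) (deviation t)) \<le> ereal (- (c0 / 2) * t\<^sup>2)"
proof -
  let ?P = "measure_pmf.prob (ising A 1 0) (deviation t)"
  have "?P \<le> exp (- (c0 / 2 * t\<^sup>2))"
  proof (cases "6 / c0 \<le> t\<^sup>2")
    case True
    then show ?thesis using t by (intro large_deviation_couplings) auto
  next
    case False
    have "alpha A * ln N ^ 3 \<ge> 0" using alpha_nonneg[OF A] ln_N_ge_1 n3 by simp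
    then have "t0 * sqrt (alpha A * ln N ^ 3) \<le> t * sqrt (alpha A * ln N ^ 3)" using t by (intro mult_right_mono) auto
    then have "deviation t \<subseteq> deviation t0" by auto
    then have "?P \<le> measure_pmf.prob (ising A 1 0) (deviation t0)"
      by (intro measure_pmf.finite_measure_mono) auto
    also have "\<dots> \<le> exp (- 3)" using small_deviation_couplings(1)[of t0] small t by linarith
    also have "\<dots> \<le> exp (- (c0 / 2 * t\<^sup>2))" using False c0_pos by (simp add: field_simps)
    finally show ?thesis .
  qed
  then have "ln ?P \<le> - (c0 / 2) * t\<^sup>2" if "0 < ?P"
    using ln_le_cancel_iff[OF that, of "exp (- (c0 / 2 * t\<^sup>2))"] by simp
  then show ?thesis by (auto simp: elog_def not_le)
qed

end

end

text \<open>The finitely many exceptional \<open>N\<close> enter the constant through the sum of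
  their factors \<open>F N\<close>; non-negative \<open>y\<close> permits enlarging the
  constant.\<close>

lemma lesssimI:
  fixes x y :: "nat \<Rightarrow> real"
  assumes ev: "\<forall>\<^sub>F N in sequentially. x N \<le> C * y N" and small: "\<And>N. 2 \<le> N \<Longrightarrow> x N \<le> F N * y N"
    and y: "\<And>N. 2 \<le> N \<Longrightarrow> 0 \<le> y N"
  shows "x \<lesssim> y"
proof -
  from ev obtain N0 where N0: "\<And>N. N0 \<le> N \<Longrightarrow> x N \<le> C * y N" by (auto simp: eventually_sequentially)
  define C' where "C' = 1 + \<bar>C\<bar> + (\<Sum>N<N0. \<bar>F N\<bar>)"
  have S: "0 \<le> (\<Sum>N<N0. \<bar>F N\<bar>)" by (rule sum_nonneg) auto
  have "x N \<le> C' * y N" if N: "2 \<le> N" for N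
  proof (cases "N0 \<le> N")
    case True
    have "C * y N \<le> C' * y N" using S by (intro mult_right_mono y N) (unfold C'_def, use S in linarith)
    then show ?thesis using N0[OF True] by linarith
  next
    case False
    then have "\<bar>F N\<bar> \<le> (\<Sum>N<N0. \<bar>F N\<bar>)" by (intro member_le_sum) auto
    then have "F N * y N \<le> C' * y N" by (intro mult_right_mono y N) (unfold C'_def, linarith)
    then show ?thesis using small[OF N] by linarith
  qed
  moreover have "0 < C'" unfolding C'_def using S by linarith
  ultimately show ?thesis unfolding lesssim_def by blast
qed

lemma limsup_lessD:
  assumes "limsup (\<lambda>N. ereal (f N)) < ereal c"
  shows "\<forall>\<^sub>F N in sequentially. f N < c"
  using Limsup_lessD[OF assms] by simp

lemma row_irregularity_nonneg: "0 \<le> row_irregularity A"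
  unfolding row_irregularity_def by (intro add_nonneg_nonneg sum_nonneg mult_nonneg_nonneg) auto

theorem lemma2p3:
  fixes A :: "nat \<Rightarrow> real mat"
  assumes coupling: "\<And>N. coupling_matrix N (A N)"
    and row_dev: "limsup (\<lambda>N. ereal (real N powr (1/4) * max_row_dev (A N))) < \<infinity>"
    and gap: "limsup (\<lambda>N. ereal (eigval_desc (A N) 2 / eigval_desc (A N) 1)) < 1"
    and bounded: "Bseq (\<lambda>N. eps_rate (A N) / sqrt (real N)
           + eps_rate (A N) * r_rate (A N) / real N powr (1/4)
           + (ln (real N))\<^sup>2 / real N powr (1/4) * sqrt (row_irregularity (A N)))"
  shows "log_tail_lesssim (\<lambda>N t. measure_pmf.prob (ising (A N) 1 0)
           {\<sigma>. (MAX i\<in>{..<N}. \<bar>local_field (A N) \<sigma> i - local_field_mean (A N) \<sigma>\<bar>)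
                 \<ge> t * sqrt (alpha (A N) * ln (real N) ^ 3) + ln (real N) * max_row_dev (A N)})
       \<and> (\<lambda>N. measure_pmf.expectation (ising (A N) 1 0)
              (\<lambda>\<sigma>. (\<Sum>i<N. (row_total (A N) i - 1) * \<sigma> $ i)\<^sup>2))
           \<lesssim> (\<lambda>N. row_irregularity (A N) * ln (real N) ^ 4)
       \<and> (\<lambda>N. real N powr (3/2)
              * measure_pmf.expectation (ising (A N) 1 0) (\<lambda>\<sigma>. spin_mean N \<sigma> ^ 6))
           \<lesssim> (\<lambda>N. 1)"
proof -
  define q where "q = (\<lambda>N. real N powr (1/4))"
  define D where "D = (\<lambda>N. max_row_dev (A N))"
  obtain K0 :: real where K0: "limsup (\<lambda>N. ereal (q N * D N)) < ereal K0"
    using row_dev ereal_dense2[of _ \<infinity>] unfolding q_def D_def by (metis ereal_dense2 less_ereal.simps(4) less_PInf_Ex_of_nat)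
  obtain \<rho>0 :: real where \<rho>0: "limsup (\<lambda>N. ereal (eigval_desc (A N) 2 / eigval_desc (A N) 1)) < ereal \<rho>0" "\<rho>0 < 1"
    using ereal_dense2[OF gap] by (metis less_ereal.simps(1) one_ereal_def)
  obtain K1 where K1: "\<And>N. \<bar>eps_rate (A N) / sqrt (real N) + eps_rate (A N) * r_rate (A N) / q N
           + (ln (real N))\<^sup>2 / q N * sqrt (row_irregularity (A N))\<bar> \<le> K1"
    using bounded unfolding Bseq_def q_def by (auto simp: real_norm_def)
  \<comment> \<open>The bound \<open>\<rho>0\<close> may be negative, whereas the transfer of the
    gap multiplies the bound on the top eigenvalue by \<open>\<rho>\<close>.\<close>
  define \<rho> where "\<rho> = max \<rho>0 0"
  define \<delta> where "\<delta> = (1 - \<rho>) / 2"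
  have \<rho>: "0 \<le> \<rho>" "\<rho> < 1" using \<rho>0 by (auto simp: \<rho>_def)
  have \<delta>: "0 < \<delta>" using \<rho> by (simp add: \<delta>_def)
  define K where "K = max 1 (max K0 K1)"
  have K: "1 \<le> K" by (simp add: K_def)
  define H where "H = near_regular.H \<delta>"
  define s0 where "s0 = near_regular.s0 \<delta>"
  define good where "good = (\<lambda>N. 3 \<le> N \<and> near_regular N (couplings (A N)) (D N) \<delta> \<and> H * ln N * D N \<le> 1 / 2
    \<and> D N \<le> s0 \<and> q N * D N \<le> K \<and> eps_rate (A N) \<le> K * (q N)\<^sup>2 \<and> eps_rate (A N) * r_rate (A N) \<le> K * q N
    \<and> (ln N)\<^sup>2 * sqrt (row_irregularity (A N)) \<le> K * q N)"
  have q: "0 < q N" "q N ^ 4 = real N" if "2 \<le> N" for N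
    using that by (simp_all add: q_def powr_powr flip: powr_realpow)
  have scale: "eps_rate (A N) \<le> K * (q N)\<^sup>2" "eps_rate (A N) * r_rate (A N) \<le> K * q N"
    "(ln N)\<^sup>2 * sqrt (row_irregularity (A N)) \<le> K * q N" if N: "3 \<le> N" for N
  proof -
    have e0: "0 \<le> eps_rate (A N)"
      unfolding eps_rate_def using N by (auto simp: dim_A[OF coupling] intro!: add_nonneg_nonneg divide_nonneg_nonneg sum_nonneg)
    have r0: "0 \<le> r_rate (A N)"
      unfolding r_rate_def using N alpha_nonneg[OF coupling, of N] max_row_dev_nonneg[OF coupling, of N]
      by (auto simp: dim_A[OF coupling])
    define x1 x2 x3 where "x1 = eps_rate (A N) / sqrt (real N)" and "x2 = eps_rate (A N) * r_rate (A N) / q N"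
      and "x3 = (ln N)\<^sup>2 / q N * sqrt (row_irregularity (A N))"
    have x0: "0 \<le> x1" "0 \<le> x2" "0 \<le> x3"
      using e0 r0 q[of N] N row_irregularity_nonneg by (auto simp: x1_def x2_def x3_def)
    have "x1 + x2 + x3 \<le> K" using K1[of N] unfolding x1_def[symmetric] x2_def[symmetric] x3_def[symmetric] K_def by linarith
    then have x: "x1 \<le> K" "x2 \<le> K" "x3 \<le> K" using x0 by linarith+
    have "((q N)\<^sup>2)\<^sup>2 = real N" using q(2)[of N] N by (simp flip: power_mult)
    then have "sqrt N = (q N)\<^sup>2" by (rule real_sqrt_unique) simp
    then show "eps_rate (A N) \<le> K * (q N)\<^sup>2" "eps_rate (A N) * r_rate (A N) \<le> K * q N"
      "(ln N)\<^sup>2 * sqrt (row_irregularity (A N)) \<le> K * q N"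
      using x q(1)[of N] N by (simp_all add: x1_def x2_def x3_def field_simps)
  qed
  have lim_D: "\<forall>\<^sub>F N in sequentially. D N \<le> c" if "0 < c" for c
  proof -
    have "\<forall>\<^sub>F N in sequentially. K / q N < c"
      unfolding q_def using that by real_asymp
    moreover have "\<forall>\<^sub>F N in sequentially. q N * D N < K0" by (rule limsup_lessD[OF K0])
    ultimately show ?thesis using eventually_ge_at_top[of 2]
    proof eventually_elim
      case (elim N)
      have "D N \<le> K / q N" using elim q[of N] K by (simp add: field_simps K_def)
      then show ?case using elim by linarith
    qed
  qed
  have lim_LD: "\<forall>\<^sub>F N in sequentially. H * ln N * D N \<le> 1 / 2"
  proof -
    have "(\<lambda>N. \<bar>H\<bar> * ln N * (K / q N)) \<longlonglongrightarrow> 0"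
      unfolding q_def by real_asymp
    then have "\<forall>\<^sub>F N in sequentially. \<bar>H\<bar> * ln N * (K / q N) < 1 / 2" by (rule order_tendstoD) simp
    moreover have "\<forall>\<^sub>F N in sequentially. q N * D N < K0" by (rule limsup_lessD[OF K0])
    ultimately show ?thesis using eventually_ge_at_top[of 2]
    proof eventually_elim
      case (elim N)
      have D: "D N \<le> K / q N" using elim q[of N] K by (simp add: field_simps K_def)
      have D0: "0 \<le> D N" using max_row_dev_nonneg[OF coupling, of N] elim by (simp add: D_def)
      have "H * ln N * D N \<le> \<bar>H\<bar> * ln N * (K / q N)"
        using D D0 elim by (intro mult_mono) auto
      then show ?case using elim by linarith
    qed
  qed
  have "0 < \<delta>\<^sup>2 / 80" using \<delta> by simp
  have NR: "\<forall>\<^sub>F N in sequentially. near_regular N (couplings (A N)) (D N) \<delta>"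
    using limsup_lessD[OF \<rho>0(1)] lim_D[OF \<open>0 < \<delta>\<^sup>2 / 80\<close>] eventually_ge_at_top[of 2]
  proof eventually_elim
    case (elim N)
    then show ?case
      using near_regular_couplings[OF coupling, of N \<rho>] \<rho> \<delta> by (simp add: D_def \<delta>_def \<rho>_def)
  qed
  \<comment> \<open>\<open>s0\<close> and \<open>c0\<close> depend on \<open>\<delta>\<close> alone,
    so a single instance of the locale shows that they are positive.\<close>
  then obtain N1 where N1: "near_regular N1 (couplings (A N1)) (D N1) \<delta>" by (auto simp: eventually_sequentially)
  have s0: "0 < s0" unfolding s0_def by (rule near_regular.s0_pos[OF N1])
  have c0: "0 < near_regular.c0 \<delta>" by (rule near_regular.c0_pos[OF N1])
  have good: "\<forall>\<^sub>F N in sequentially. good N"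
    using NR lim_LD lim_D[OF s0] limsup_lessD[OF K0] eventually_ge_at_top[of 3]
  proof eventually_elim
    case (elim N)
    then show ?case using scale[of N] by (simp add: good_def K_def)
  qed
  have goodD: "near_regular N (couplings (A N)) (max_row_dev (A N)) \<delta>" "3 \<le> N" "0 < q N" "q N ^ 4 = real N" "1 \<le> K"
    "near_regular.H \<delta> * ln N * max_row_dev (A N) \<le> 1 / 2" "max_row_dev (A N) \<le> near_regular.s0 \<delta>" "q N * max_row_dev (A N) \<le> K"
    "eps_rate (A N) \<le> K * (q N)\<^sup>2" "eps_rate (A N) * r_rate (A N) \<le> K * q N"
    "(ln N)\<^sup>2 * sqrt (row_irregularity (A N)) \<le> K * q N" if "good N" for N
    using that q[of N] K by (auto simp: good_def D_def H_def s0_def)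
  show ?thesis
  proof (intro conjI)
    show "log_tail_lesssim (\<lambda>N t. measure_pmf.prob (ising (A N) 1 0)
           {\<sigma>. (MAX i\<in>{..<N}. \<bar>local_field (A N) \<sigma> i - local_field_mean (A N) \<sigma>\<bar>)
                 \<ge> t * sqrt (alpha (A N) * ln (real N) ^ 3) + ln (real N) * max_row_dev (A N)})"
      unfolding log_tail_lesssim_def
    proof (intro exI[of _ "near_regular.c0 \<delta> / 2"] conjI allI impI)
      show "0 < near_regular.c0 \<delta> / 2" using c0 by simp
      fix t0 :: real assume t0: "0 < t0"
      from good obtain N2 where N2: "good N2" by (auto simp: eventually_sequentially)
      define c where "c = near_regular.c1 \<delta> K * t0\<^sup>2"
      have c: "0 < c"
        using small_deviation_couplings(2)[OF coupling goodD[OF N2], of 0] t0 by (simp add: c_def)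
      define c' where "c' = near_regular.c2 \<delta> K"
      \<comment> \<open>For every fixed \<open>t0\<close> the exponent of order
        \<open>ln N ^ 3\<close> beats the factor \<open>N\<close> of the union bound; this is the
        gain of the linearized estimate.\<close>
      have "(\<lambda>N. 2 * real N * exp (- (c * ln N ^ 3)) + c' * (ln N ^ 4 / (q N)\<^sup>2)) \<longlonglongrightarrow> 0"
        unfolding q_def using c by real_asymp
      then have "\<forall>\<^sub>F N in sequentially. 2 * real N * exp (- (c * ln N ^ 3)) + c' * (ln N ^ 4 / (q N)\<^sup>2) < exp (- 3)"
        by (rule order_tendstoD) simp
      with good show "\<forall>\<^sub>F N in sequentially. \<forall>t\<ge>t0. elog (measure_pmf.prob (ising (A N) 1 0)
           {\<sigma>. (MAX i\<in>{..<N}. \<bar>local_field (A N) \<sigma> i - local_field_mean (A N) \<sigma>\<bar>)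
                 \<ge> t * sqrt (alpha (A N) * ln (real N) ^ 3) + ln (real N) * max_row_dev (A N)}) \<le> ereal (- (near_regular.c0 \<delta> / 2) * t\<^sup>2)"
      proof eventually_elim
        case (elim N)
        show ?case
        proof (intro allI impI)
          fix t assume "t0 \<le> t"
          from deviation_bound[OF coupling goodD[OF elim(1)] t0 this]
          show "elog (measure_pmf.prob (ising (A N) 1 0)
           {\<sigma>. (MAX i\<in>{..<N}. \<bar>local_field (A N) \<sigma> i - local_field_mean (A N) \<sigma>\<bar>)
                 \<ge> t * sqrt (alpha (A N) * ln (real N) ^ 3) + ln (real N) * max_row_dev (A N)}) \<le> ereal (- (near_regular.c0 \<delta> / 2) * t\<^sup>2)"
            using elim(2) by (simp add: c_def c'_def)
        qed
      qed
    qed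
    show "(\<lambda>N. measure_pmf.expectation (ising (A N) 1 0) (\<lambda>\<sigma>. (\<Sum>i<N. (row_total (A N) i - 1) * \<sigma> $ i)\<^sup>2))
           \<lesssim> (\<lambda>N. row_irregularity (A N) * ln (real N) ^ 4)"
    proof (rule lesssimI)
      show "\<forall>\<^sub>F N in sequentially. measure_pmf.expectation (ising (A N) 1 0) (\<lambda>\<sigma>. (\<Sum>i<N. (row_total (A N) i - 1) * \<sigma> $ i)\<^sup>2)
        \<le> \<bar>near_regular.Ub \<delta> K\<bar> * (row_irregularity (A N) * ln (real N) ^ 4)"
        using good
      proof eventually_elim
        case (elim N)
        have L: "1 \<le> ln (real N)" using near_regular.ln_n_ge_1[OF goodD(1,2)[OF elim]] .
        note second_moment_couplings[OF coupling goodD[OF elim]]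
        also have "near_regular.Ub \<delta> K * row_irregularity (A N) \<le> \<bar>near_regular.Ub \<delta> K\<bar> * (row_irregularity (A N) * ln (real N) ^ 4)"
        proof (intro mult_mono)
          show "row_irregularity (A N) \<le> row_irregularity (A N) * ln (real N) ^ 4"
            using L row_irregularity_nonneg mult_left_mono[of 1 "ln (real N) ^ 4" "row_irregularity (A N)"] by (simp add: one_le_power)
        qed (auto simp: row_irregularity_nonneg)
        finally show ?case .
      qed
      fix N :: nat assume N: "2 \<le> N"
      have L: "0 < ln (real N) ^ 4" using N by simp
      show "measure_pmf.expectation (ising (A N) 1 0) (\<lambda>\<sigma>. (\<Sum>i<N. (row_total (A N) i - 1) * \<sigma> $ i)\<^sup>2)
        \<le> N / ln (real N) ^ 4 * (row_irregularity (A N) * ln (real N) ^ 4)"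
        using second_moment_trivial[OF coupling, of N] L by simp
      show "0 \<le> row_irregularity (A N) * ln (real N) ^ 4" using row_irregularity_nonneg L by simp
    qed
    show "(\<lambda>N. real N powr (3/2) * measure_pmf.expectation (ising (A N) 1 0) (\<lambda>\<sigma>. spin_mean N \<sigma> ^ 6)) \<lesssim> (\<lambda>N. 1)"
    proof (rule lesssimI)
      show "\<forall>\<^sub>F N in sequentially. real N powr (3/2) * measure_pmf.expectation (ising (A N) 1 0) (\<lambda>\<sigma>. spin_mean N \<sigma> ^ 6)
        \<le> near_regular.tbound \<delta> K * 1"
        using good
      proof eventually_elim
        case (elim N)
        show ?case using sixth_moment_couplings[OF coupling goodD[OF elim]] by simp
      qed
      fix N :: nat assume N: "2 \<le> N"
      show "real N powr (3/2) * measure_pmf.expectation (ising (A N) 1 0) (\<lambda>\<sigma>. spin_mean N \<sigma> ^ 6) \<le> real N powr (3/2) * 1"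
        using sixth_moment_trivial[OF coupling, of N] N by (intro mult_left_mono) auto
    qed simp
  qed
qed

end
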